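(* Let $k$ and $n$ be positive integers and $\epsilon>0$. Let $\mathbb{T}^n=H/L$ with $H\approx\mathbb{R}^n$ and $L\subset H$ a lattice, let $M=\mathbb{T}^n\times(-\epsilon,\epsilon)$, and let $D=\mathbb{R}^n$. Let $A:(-\epsilon,\epsilon)\to\mathbb{R}^{n\times n}$, $A(z)=(a_{ij}(z))$, be a smooth function such that $A(z)$ is invertible for all $z$, regarded as a family of linear maps $A(z):D\to H$. Let $\theta$ be the locally free homogeneous horizontal action of $D$ on $M$ defined by the commuting vector fields $X_j(y_1,\dots,y_n,z)=\sum_{1\le i\le n}a_{ij}(z)\,Y_i$, $1\le j\le n$. Then the following conditions are equivalent: 1. There exists a linear subspace $D'\subset D$ of codimension $1$ such that, for all $w\in D'$ and all $j$ with $1\le j\le k$, we have $A^{(j)}(0)\,w=0$. 2. For all $\delta>0$ there exist a $\delta$-$C^k$-close family $\tilde\theta=(\tilde X_1,\dots,\tilde X_n)$ of commuting vector fields on $M$ and a point of the base torus $\mathbb{T}^n\times\{0\}$ which belongs to a noncompact orbit of $\tilde\theta$. 3. For all $\delta\in(0,\epsilon/2)$ there exists a homogeneous $\delta$-$C^k$-close family $\tilde\theta=(\tilde X_1,\dots,\tilde X_n)$ of commuting vector fields on $M$ which coincides with $\theta$ on $M\smallsetminus(\mathbb{T}^n\times(-\delta,\delta))$ (that is, $\tilde X_j=X_j$ there for all $j$) and for which every point of the base torus $\mathbb{T}^n\times\{0\}$ belongs to a noncompact orbit of $\tilde\theta$.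
   Context: Coordinates on $M=\mathbb{T}^n\times(-\epsilon,\epsilon)$ are $(y_1,\dots,y_n,z)$, where $y_1,\dots,y_n$ are (induced by) linear coordinates on $H$ and $z\in(-\epsilon,\epsilon)$; $Y_1,\dots,Y_n,Z$ denote the corresponding coordinate vector fields on $M$. $A^{(j)}$ is the $j$-th derivative of $A$ with respect to $z$. The torus $z=0$ is the base torus. Given $\theta$ defined by $X_1,\dots,X_n$ and given $\delta>0$, a $\delta$-$C^k$-close family of commuting vector fields is a family $(\tilde X_1,\dots,\tilde X_n)$ of smooth tangent vector fields on $M$ with $[\tilde X_{j_0},\tilde X_{j_1}]=0$ for all $j_0,j_1$ and $\|\tilde X_j-X_j\|_{C^k}<\delta$ for all $j$. Here the $C^k$ norm of a vector field on $M$ is the supremum over $M$ of the absolute values of the partial derivatives of order at most $k$ (including order $0$), in the coordinates $(y,z)$, of its coefficients in the frame $Y_1,\dots,Y_n,Z$. Such a family defines a local action of $D$ on $M$ (the flows need not be complete). The orbit of a point $p\in M$ is the set of all points of $M$ that can be reached from $p$ by finitely many successive integral curves (inside $M$, in positive or negative time) of the vector fields $\tilde X_1,\dots,\tilde X_n$; it is noncompact if it is not a compact subset of $M$. The family is called homogeneous if each $\tilde X_j$ can be written as $\tilde X_j=\tilde a_{Z,j}(z)\,Z+\sum_{1\le i\le n}\tilde a_{ij}(z)\,Y_i$ with coefficients $\tilde a_{Z,j},\tilde a_{ij}$ that are functions of $z$ only. *)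

theory Defs
  imports "HOL-Analysis.Analysis"
begin

definition partial_deriv ::
    "'a::euclidean_space \<Rightarrow> ('a \<Rightarrow> 'b::real_normed_vector) \<Rightarrow> 'a \<Rightarrow> 'b" where
  "partial_deriv b f = (\<lambda>x. frechet_derivative f (at x) b)"

text \<open>The derivatives are full ones, so \<open>S\<close> is meant to be open in \<open>Ck_on\<close> and \<open>smooth_on\<close>.\<close>

primrec Ck_on ::
    "nat \<Rightarrow> ('a::euclidean_space \<Rightarrow> 'b::real_normed_vector) \<Rightarrow> 'a set \<Rightarrow> bool" where
  "Ck_on 0 f S \<longleftrightarrow> continuous_on S f"
| "Ck_on (Suc m) f S \<longleftrightarrow>
     (\<forall>x\<in>S. f differentiable (at x)) \<and> (\<forall>b\<in>Basis. Ck_on m (partial_deriv b f) S)"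

definition smooth_on ::
    "('a::euclidean_space \<Rightarrow> 'b::real_normed_vector) \<Rightarrow> 'a set \<Rightarrow> bool" where
  "smooth_on f S \<longleftrightarrow> (\<forall>m. Ck_on m f S)"

fun iter_partial ::
    "'a::euclidean_space list \<Rightarrow> ('a \<Rightarrow> 'b::real_normed_vector) \<Rightarrow> 'a \<Rightarrow> 'b" where
  "iter_partial [] f = f"
| "iter_partial (b # bs) f = partial_deriv b (iter_partial bs f)"

definition nth_vector_derivative ::
    "nat \<Rightarrow> (real \<Rightarrow> 'b::real_normed_vector) \<Rightarrow> real \<Rightarrow> 'b" where
  "nth_vector_derivative j f = ((\<lambda>g t. vector_derivative g (at t)) ^^ j) f"

text \<open>A lattice is the group of integer combinations of a basis (the columns of \<open>B\<close>).\<close>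

definition lattice_in :: "(real^'n) set \<Rightarrow> bool" where
  "lattice_in L \<longleftrightarrow>
     (\<exists>B :: real^'n^'n. invertible B \<and> L = (\<lambda>m. B *v m) ` {m. \<forall>i. m $ i \<in> \<int>})"

definition lattice_rel :: "(real^'n) set \<Rightarrow> ((real^'n) \<times> (real^'n)) set" where
  "lattice_rel L = {(x, y). y - x \<in> L}"

definition torus :: "(real^'n) set \<Rightarrow> (real^'n) set set" where
  "torus L = UNIV // lattice_rel L"

definition torus_proj :: "(real^'n) set \<Rightarrow> real^'n \<Rightarrow> (real^'n) set" where
  "torus_proj L y = lattice_rel L `` {y}"

definition torus_topology :: "(real^'n) set \<Rightarrow> (real^'n) set topology" where
  "torus_topology L = topology (\<lambda>U. U \<subseteq> torus L \<and> open (torus_proj L -` U))"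

lemma openin_torus_topology:
  "openin (torus_topology L) U \<longleftrightarrow> U \<subseteq> torus L \<and> open (torus_proj L -` U)"
proof -
  have "istopology (\<lambda>U. U \<subseteq> torus L \<and> open (torus_proj L -` U))"
    unfolding istopology_def by (auto simp: vimage_Union)
  then show ?thesis
    by (simp add: torus_topology_def topology_inverse')
qed

lemma torus_proj_image: "range (torus_proj L) = torus L"
  by (auto simp: torus_def torus_proj_def quotient_def)

lemma topspace_torus_topology: "topspace (torus_topology L) = torus L"
proof
  show "topspace (torus_topology L) \<subseteq> torus L"
    unfolding topspace_def by (auto simp: openin_torus_topology)
  have "torus_proj L -` torus L = UNIV"
    using torus_proj_image by blast
  then have "openin (torus_topology L) (torus L)"
    by (simp add: openin_torus_topology)
  then show "torus L \<subseteq> topspace (torus_topology L)"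
    by (rule openin_subset)
qed

lemma quotient_map_torus_proj: "quotient_map euclidean (torus_topology L) (torus_proj L)"
  by (simp add: quotient_map_def topspace_torus_topology torus_proj_image
      openin_torus_topology vimage_def)

definition M_set :: "(real^'n) set \<Rightarrow> real \<Rightarrow> ((real^'n) set \<times> real) set" where
  "M_set L \<epsilon> = torus L \<times> {-\<epsilon><..<\<epsilon>}"

definition M_topology :: "(real^'n) set \<Rightarrow> real \<Rightarrow> ((real^'n) set \<times> real) topology" where
  "M_topology L \<epsilon> = prod_topology (torus_topology L) (top_of_set {-\<epsilon><..<\<epsilon>})"

text \<open>The universal cover of \<open>M\<close>, on which \<open>(y, z)\<close> are global coordinates.\<close>

definition M_cover :: "real \<Rightarrow> ((real^'n) \<times> real) set" where
  "M_cover \<epsilon> = UNIV \<times> {-\<epsilon><..<\<epsilon>}"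

definition M_proj :: "(real^'n) set \<Rightarrow> (real^'n) \<times> real \<Rightarrow> (real^'n) set \<times> real" where
  "M_proj L = (\<lambda>(y, z). (torus_proj L y, z))"

text \<open>
  A vector field is given by its coefficients in the frame \<open>Y\<^sub>1, \<dots>, Y\<^sub>n, Z\<close>: the value \<open>(v, c)\<close>
  stands for \<open>(\<Sum>i. v $ i Y\<^sub>i) + c Z\<close>.  The frame is global, so any function on \<open>M\<close> with values in
  \<open>(real^'n) \<times> real\<close> is a vector field.  Smoothness, brackets and norms are computed in the
  coordinates \<open>(y, z)\<close>, that is, after composition with the covering map \<open>M_proj L\<close>.
  Values outside \<open>M_set L \<epsilon>\<close> are irrelevant.
\<close>

type_synonym 'n vfield = "(real^'n) set \<times> real \<Rightarrow> (real^'n) \<times> real"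

definition smooth_vfield :: "(real^'n) set \<Rightarrow> real \<Rightarrow> 'n vfield \<Rightarrow> bool" where
  "smooth_vfield L \<epsilon> X \<longleftrightarrow> smooth_on (X \<circ> M_proj L) (M_cover \<epsilon>)"

definition lie_bracket ::
    "('a::real_normed_vector \<Rightarrow> 'a) \<Rightarrow> ('a \<Rightarrow> 'a) \<Rightarrow> 'a \<Rightarrow> 'a" where
  "lie_bracket X Y =
     (\<lambda>p. frechet_derivative Y (at p) (X p) - frechet_derivative X (at p) (Y p))"

definition vfields_commute :: "(real^'n) set \<Rightarrow> real \<Rightarrow> 'n vfield \<Rightarrow> 'n vfield \<Rightarrow> bool" where
  "vfields_commute L \<epsilon> X Y \<longleftrightarrow>
     (\<forall>p\<in>M_cover \<epsilon>. lie_bracket (X \<circ> M_proj L) (Y \<circ> M_proj L) p = 0)"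

text \<open>The \<open>C\<^sup>k\<close> norm may be infinite since \<open>M\<close> is not compact, hence the extended reals.\<close>

definition Ck_norm :: "(real^'n) set \<Rightarrow> real \<Rightarrow> nat \<Rightarrow> 'n vfield \<Rightarrow> ereal" where
  "Ck_norm L \<epsilon> k X =
     Sup {ereal \<bar>iter_partial bs (\<lambda>q. X (M_proj L q) \<bullet> c) p\<bar> | bs c p.
            length bs \<le> k \<and> set bs \<subseteq> Basis \<and> c \<in> Basis \<and> p \<in> M_cover \<epsilon>}"

definition close_commuting_family ::
    "(real^'n) set \<Rightarrow> real \<Rightarrow> nat \<Rightarrow> ('n \<Rightarrow> 'n vfield) \<Rightarrow> real \<Rightarrow> ('n \<Rightarrow> 'n vfield) \<Rightarrow> bool"
  where
  "close_commuting_family L \<epsilon> k X \<delta> X' \<longleftrightarrow>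
     (\<forall>j. smooth_vfield L \<epsilon> (X' j)) \<and>
     (\<forall>j\<^sub>0 j\<^sub>1. vfields_commute L \<epsilon> (X' j\<^sub>0) (X' j\<^sub>1)) \<and>
     (\<forall>j. Ck_norm L \<epsilon> k (\<lambda>p. X' j p - X j p) < ereal \<delta>)"

definition homogeneous_family :: "(real^'n) set \<Rightarrow> real \<Rightarrow> ('n \<Rightarrow> 'n vfield) \<Rightarrow> bool" where
  "homogeneous_family L \<epsilon> X \<longleftrightarrow>
     (\<forall>j. \<exists>a :: real \<Rightarrow> (real^'n) \<times> real. \<forall>(u, z)\<in>M_set L \<epsilon>. X j (u, z) = a z)"

definition horizontal_family :: "(real \<Rightarrow> real^'n^'n) \<Rightarrow> 'n \<Rightarrow> 'n vfield" where
  "horizontal_family A j = (\<lambda>(u, z). (\<chi> i. A z $ i $ j, 0))"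

text \<open>
  \<open>r\<close> is the end point of an integral curve of \<open>X\<close> in \<open>M\<close> that starts at \<open>q\<close> and runs for the time
  \<open>T\<close>, which may be negative.  Every curve in \<open>M\<close> on an interval lifts to the universal cover, so
  integral curves are described by their lifts \<open>c\<close>; the curve in \<open>M\<close> is \<open>M_proj L \<circ> c\<close>.
\<close>

definition integral_curve_step ::
    "(real^'n) set \<Rightarrow> real \<Rightarrow> 'n vfield \<Rightarrow> (real^'n) set \<times> real \<Rightarrow> (real^'n) set \<times> real \<Rightarrow> bool"
  where
  "integral_curve_step L \<epsilon> X q r \<longleftrightarrow>
     (\<exists>T c. (\<forall>t\<in>closed_segment 0 T.
               c t \<in> M_cover \<epsilon> \<and>
               (c has_vector_derivative X (M_proj L (c t))) (at t within closed_segment 0 T)) \<and>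
            M_proj L (c 0) = q \<and> M_proj L (c T) = r)"

definition orbit ::
    "(real^'n) set \<Rightarrow> real \<Rightarrow> ('n \<Rightarrow> 'n vfield) \<Rightarrow> (real^'n) set \<times> real \<Rightarrow> ((real^'n) set \<times> real) set"
  where
  "orbit L \<epsilon> X p = {q. (\<lambda>r s. \<exists>j. integral_curve_step L \<epsilon> (X j) r s)\<^sup>*\<^sup>* p q}"

end

theory Submission
  imports Defs "HOL-Analysis.Analysis"
begin

text \<open>
  (1) implies (3). Let \<open>u\<close> be a unit normal of \<open>D'\<close> and \<open>P\<close> the orthogonal projection to \<open>D'\<close>. By (1)
  the matrix \<open>B(z) = (A(z) - A(0)) P\<close> vanishes to order \<open>k\<close> at \<open>0\<close>, so subtracting its product with a
  cutoff at scale \<open>r\<close> is a \<open>C\<^sup>k\<close>-small perturbation for small \<open>r\<close>. Near \<open>z = 0\<close> the new fields are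
  constant fields plus \<open>u\<^sub>j\<close> times one common field. Hence they still commute after adding
  \<open>\<eta> u\<^sub>j h(z) Z\<close> with a bump function \<open>h\<close> supported in \<open>[-r/2, r/2]\<close>, and now every orbit that
  starts at \<open>z = 0\<close> comes arbitrarily close to the height \<open>r/2\<close> without reaching it.

  (2) implies (1). A family close to \<open>\<theta>\<close> spans hyperplanes \<open>dz = \<omega>(y, z) dy\<close>, and the leaf through a
  point of the base torus is the graph of a function \<open>F\<close> on a large ball, on which the rows \<open>w\<close> of the
  inverse frame matrix restrict to closed forms \<open>d\<Phi>\<close>. If \<open>F\<close> vanishes at the lattice basis, it extends
  to a periodic function and the orbit is compact. So take families \<open>X\<^sub>n\<close> tending to \<open>\<theta>\<close> with noncompact
  orbits and, after passing to a subsequence, a basis vector \<open>l\<close> with \<open>F\<^sub>n(l) \<noteq> 0\<close> and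
  \<open>F\<^sub>n(m) / F\<^sub>n(l) \<longlonglongrightarrow> r(m)\<close> for all basis vectors \<open>m\<close>. Put
  \<open>Q x(y) = (x(y + l) - x(y)) / (F\<^sub>n(y + l) - F\<^sub>n(y))\<close>. The iterates of \<open>Q\<close> turn \<open>\<psi>(F\<^sub>n(y))\<close> into
  approximations of the derivatives \<open>\<psi>\<^sup>(\<^sup>j\<^sup>)(0)\<close> that use only differences along the lattice. The second
  difference of \<open>\<Phi>\<close> in the directions \<open>l\<close> and \<open>m\<close> is symmetric; applying \<open>Q\<close> to it \<open>j - 1\<close> times
  and letting \<open>n\<close> tend to infinity gives \<open>w\<^sup>(\<^sup>j\<^sup>)(0) m = r(m) w\<^sup>(\<^sup>j\<^sup>)(0) l\<close> for the rows \<open>w\<close> of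
  \<open>A\<^sup>-\<^sup>1\<close> and \<open>1 \<le> j \<le> k\<close>, so all these derivatives of \<open>A\<^sup>-\<^sup>1\<close>, and then those of \<open>A\<close>, vanish on a common
  hyperplane.
\<close>

section \<open>Functions of class \<open>C\<^sup>m\<close>\<close>

text \<open>The coframes of the approximating families differ from their limit by o(1) together with
  k derivatives, but at no rate relative to powers of F_n. A Taylor expansion along the leaf
  therefore cannot isolate a jet: already the error of order 0 may exceed F_n^k. Difference
  quotients along the lattice avoid this. By periodicity a translation by l leaves
  \<open>\<omega>\<close> and \<open>w\<close> unchanged and moves only the height at which they are
  evaluated, so each Q costs one z-derivative, and k derivatives suffice. The price is a calculus
  twisted by translations; the main labour is to show that neither the cocycle nor the ratios r(m)
  vary with y to the orders needed. The inverse matrix enters because leaves are graphs over y: the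
  fields restrict to a frame on each leaf, and commutation makes the dual coframe closed. The
  noncompact orbits may start anywhere on the base torus, so all estimates are uniform in y and each
  leaf is translated to start over the origin.\<close>

lemma partial_deriv_eq: "(f has_derivative D) (at x) \<Longrightarrow> partial_deriv b f x = D b"
  unfolding partial_deriv_def by (simp add: frechet_derivative_at[symmetric])

lemma has_derivative_frechet: "f differentiable (at x) \<Longrightarrow> (f has_derivative (\<lambda>h. partial_deriv h f x)) (at x)"
  by (simp add: partial_deriv_def frechet_derivative_works[symmetric])

lemma partial_deriv_cong:
  assumes "open S" "x \<in> S" "\<And>x. x \<in> S \<Longrightarrow> f x = g x" "f differentiable (at x)"
  shows "partial_deriv b f x = partial_deriv b g x"
  unfolding partial_deriv_def using frechet_derivative_transform_within_open[OF assms(4,1,2,3)] by simp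

lemma differentiable_cong_open:
  assumes "open S" "x \<in> S" "\<And>x. x \<in> S \<Longrightarrow> f x = g x" "f differentiable (at x)"
  shows "g differentiable (at x)"
  using assms has_derivative_transform_within_open unfolding differentiable_def by blast

lemma Ck_on_cong:
  assumes "open S" "\<And>x. x \<in> S \<Longrightarrow> f x = g x" "Ck_on m f S"
  shows "Ck_on m g S"
  using assms(2,3)
proof (induction m arbitrary: f g)
  case 0 then show ?case using continuous_on_cong by force
next
  case (Suc m)
  have "Ck_on m (partial_deriv b g) S" if "b \<in> Basis" for b
  proof (rule Suc.IH[of "partial_deriv b f"])
    show "partial_deriv b f x = partial_deriv b g x" if "x \<in> S" for x
      by (rule partial_deriv_cong[OF assms(1) that]) (use Suc.prems that in auto)
  qed (use Suc.prems that in auto)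
  then show ?case using Suc.prems differentiable_cong_open[OF assms(1)] by (metis Ck_on.simps(2))
qed

lemma Ck_on_SucD: "Ck_on (Suc m) f S \<Longrightarrow> Ck_on m f S"
proof (induction m arbitrary: f)
  case 0 then show ?case by (auto intro!: continuous_at_imp_continuous_on differentiable_imp_continuous_within)
next
  case (Suc m) then show ?case by (metis Ck_on.simps(2))
qed

lemma Ck_on_mono: "Ck_on m f S \<Longrightarrow> i \<le> m \<Longrightarrow> Ck_on i f S"
  by (induction m) (auto simp: le_Suc_eq dest: Ck_on_SucD simp del: Ck_on.simps(2))

lemma Ck_on_subset: "Ck_on m f S \<Longrightarrow> T \<subseteq> S \<Longrightarrow> Ck_on m f T"
  by (induction m arbitrary: f) (auto intro: continuous_on_subset)

text \<open>Working form of the recursion: any explicit derivative may stand for the one chosen by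
  \<open>frechet_derivative\<close>, so closure under an operation reduces to its derivative rule
  and an induction.\<close>

lemma Ck_on_SucI:
  assumes "open S" "\<And>x. x \<in> S \<Longrightarrow> (f has_derivative D x) (at x)" "\<And>b. b \<in> Basis \<Longrightarrow> Ck_on m (\<lambda>x. D x b) S"
  shows "Ck_on (Suc m) f S"
proof -
  have "Ck_on m (partial_deriv b f) S" if "b \<in> Basis" for b
    by (rule Ck_on_cong[OF assms(1) _ assms(3)[OF that]]) (simp add: partial_deriv_eq[OF assms(2)])
  then show ?thesis using assms(2) by (auto simp: differentiable_def)
qed

lemma Ck_on_const: "open S \<Longrightarrow> Ck_on m (\<lambda>x. c) S"
proof (induction m arbitrary: c)
  case (Suc m) show ?case by (rule Ck_on_SucI[where D="\<lambda>x h. 0"]) (use Suc in auto)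
qed simp

lemma Ck_on_linear: "open S \<Longrightarrow> bounded_linear L \<Longrightarrow> Ck_on m L S"
proof (cases m)
  case 0 then show "bounded_linear L \<Longrightarrow> Ck_on m L S" by (simp add: linear_continuous_on)
next
  case (Suc i)
  assume "open S" "bounded_linear L"
  then show ?thesis unfolding Suc
    by (intro Ck_on_SucI[where D="\<lambda>x. L"]) (auto intro: bounded_linear_imp_has_derivative Ck_on_const)
qed

lemma Ck_on_derivD:
  assumes "Ck_on (Suc m) f S" "x \<in> S" shows "(f has_derivative (\<lambda>h. partial_deriv h f x)) (at x)"
  using assms by (intro has_derivative_frechet) auto

lemma Ck_on_linear_compose:
  assumes "open S" "bounded_linear L" "Ck_on m f S" shows "Ck_on m (\<lambda>x. L (f x)) S"
  using assms(3)
proof (induction m arbitrary: f)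
  case 0 then show ?case using assms(2) by (auto intro: bounded_linear.continuous_on)
next
  case (Suc m)
  show ?case
  proof (rule Ck_on_SucI[OF assms(1)])
    show "((\<lambda>x. L (f x)) has_derivative (\<lambda>h. L (partial_deriv h f x))) (at x)" if "x \<in> S" for x
      by (rule bounded_linear.has_derivative[OF assms(2) Ck_on_derivD[OF Suc.prems that]])
    show "Ck_on m (\<lambda>x. L (partial_deriv b f x)) S" if "b \<in> Basis" for b
      using Suc that by auto
  qed
qed

lemma Ck_on_add:
  assumes "open S" "Ck_on m f S" "Ck_on m g S" shows "Ck_on m (\<lambda>x. f x + g x) S"
  using assms(2,3)
proof (induction m arbitrary: f g)
  case 0 then show ?case by (auto intro: continuous_on_add)
next
  case (Suc m)
  show ?case
  proof (rule Ck_on_SucI[OF assms(1)])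
    show "((\<lambda>x. f x + g x) has_derivative (\<lambda>h. partial_deriv h f x + partial_deriv h g x)) (at x)" if "x \<in> S" for x
      by (rule has_derivative_add[OF Ck_on_derivD[OF Suc.prems(1) that] Ck_on_derivD[OF Suc.prems(2) that]])
    show "Ck_on m (\<lambda>x. partial_deriv b f x + partial_deriv b g x) S" if "b \<in> Basis" for b
      using Suc that by auto
  qed
qed

lemma Ck_on_scaleR:
  fixes f :: "'a::euclidean_space \<Rightarrow> real"
  assumes "open S" "Ck_on m f S" "Ck_on m g S" shows "Ck_on m (\<lambda>x. f x *\<^sub>R g x) S"
  using assms(2,3)
proof (induction m arbitrary: f g)
  case 0 then show ?case by (auto intro: continuous_on_scaleR)
next
  case (Suc m)
  show ?case
  proof (rule Ck_on_SucI[OF assms(1)])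
    show "((\<lambda>x. f x *\<^sub>R g x) has_derivative (\<lambda>h. f x *\<^sub>R partial_deriv h g x + partial_deriv h f x *\<^sub>R g x)) (at x)" if "x \<in> S" for x
      by (rule has_derivative_scaleR[OF Ck_on_derivD[OF Suc.prems(1) that] Ck_on_derivD[OF Suc.prems(2) that]])
    show "Ck_on m (\<lambda>x. f x *\<^sub>R partial_deriv b g x + partial_deriv b f x *\<^sub>R g x) S" if "b \<in> Basis" for b
    proof (rule Ck_on_add[OF assms(1)])
      show "Ck_on m (\<lambda>x. f x *\<^sub>R partial_deriv b g x) S"
        by (rule Suc.IH[OF Ck_on_SucD[OF Suc.prems(1)]]) (use Suc.prems that in auto)
      show "Ck_on m (\<lambda>x. partial_deriv b f x *\<^sub>R g x) S"
        by (rule Suc.IH[OF _ Ck_on_SucD[OF Suc.prems(2)]]) (use Suc.prems that in auto)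
    qed
  qed
qed

lemma Ck_on_mult:
  fixes f g :: "'a::euclidean_space \<Rightarrow> real"
  assumes "open S" "Ck_on m f S" "Ck_on m g S" shows "Ck_on m (\<lambda>x. f x * g x) S"
  using Ck_on_scaleR[OF assms] by simp

lemma Ck_on_uminus: "open S \<Longrightarrow> Ck_on m f S \<Longrightarrow> Ck_on m (\<lambda>x. - f x) S"
  using Ck_on_linear_compose[OF _ bounded_linear_minus[OF bounded_linear_ident]] by auto

lemma Ck_on_diff: "open S \<Longrightarrow> Ck_on m f S \<Longrightarrow> Ck_on m g S \<Longrightarrow> Ck_on m (\<lambda>x. f x - g x) S"
  using Ck_on_add[of S m f "\<lambda>x. - g x"] Ck_on_uminus[of S m g] by simp

lemma Ck_on_sum: "open S \<Longrightarrow> (\<And>i. i \<in> A \<Longrightarrow> Ck_on m (f i) S) \<Longrightarrow> Ck_on m (\<lambda>x. \<Sum>i\<in>A. f i x) S"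
  by (induction A rule: infinite_finite_induct) (auto intro: Ck_on_const Ck_on_add)

lemma Ck_on_prod:
  fixes f :: "'i \<Rightarrow> 'a::euclidean_space \<Rightarrow> real"
  shows "open S \<Longrightarrow> (\<And>i. i \<in> A \<Longrightarrow> Ck_on m (f i) S) \<Longrightarrow> Ck_on m (\<lambda>x. \<Prod>i\<in>A. f i x) S"
  by (induction A rule: infinite_finite_induct) (auto intro: Ck_on_const Ck_on_mult)

lemma Ck_on_inverse:
  fixes f :: "'a::euclidean_space \<Rightarrow> real"
  assumes "open S" "\<And>x. x \<in> S \<Longrightarrow> f x \<noteq> 0" "Ck_on m f S" shows "Ck_on m (\<lambda>x. inverse (f x)) S"
  using assms(3)
proof (induction m)
  case 0 then show ?case using assms(2) by (auto intro: continuous_on_inverse)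
next
  case (Suc m)
  have i: "Ck_on m (\<lambda>x. inverse (f x)) S" using Suc Ck_on_SucD by blast
  show ?case
  proof (rule Ck_on_SucI[OF assms(1)])
    show "((\<lambda>x. inverse (f x)) has_derivative (\<lambda>h. - (inverse (f x) * partial_deriv h f x * inverse (f x)))) (at x)" if "x \<in> S" for x
      by (rule Deriv.has_derivative_inverse[OF assms(2)[OF that] Ck_on_derivD[OF Suc.prems that]])
    show "Ck_on m (\<lambda>x. - (inverse (f x) * partial_deriv b f x * inverse (f x))) S" if "b \<in> Basis" for b
      by (intro Ck_on_uminus Ck_on_mult assms(1) i) (use Suc.prems that in auto)
  qed
qed

lemma linear_real_scale:
  fixes L :: "real \<Rightarrow> 'b::real_vector" assumes "linear L" shows "L = (\<lambda>t. t *\<^sub>R L 1)"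
proof
  fix t show "L t = t *\<^sub>R L 1" using linear_scale[OF assms, of t 1] by simp
qed

text \<open>The inner functions that occur are real (heights, rescalings, quadratic expressions).
  The chain rule is then a scalar multiple, and the induction closes with
  \<open>Ck_on_scaleR\<close>.\<close>

lemma Ck_on_compose:
  fixes q :: "'a::euclidean_space \<Rightarrow> real" and \<phi> :: "real \<Rightarrow> 'b::real_normed_vector"
  assumes "open S" "q ` S \<subseteq> T" "Ck_on m \<phi> T" "Ck_on m q S"
  shows "Ck_on m (\<lambda>x. \<phi> (q x)) S"
  using assms(3,4)
proof (induction m arbitrary: \<phi>)
  case 0 then show ?case using assms(2) by (auto intro: continuous_on_compose2)
next
  case (Suc m)
  show ?case
  proof (rule Ck_on_SucI[OF assms(1)])
    show "((\<lambda>x. \<phi> (q x)) has_derivative (\<lambda>h. partial_deriv h q x *\<^sub>R partial_deriv 1 \<phi> (q x))) (at x)" if "x \<in> S" for x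
    proof -
      have d: "\<phi> differentiable (at (q x))" using Suc.prems(1) assms(2) that by auto
      then have "linear (\<lambda>h. partial_deriv h \<phi> (q x))" using has_derivative_linear has_derivative_frechet by blast
      then have "(\<lambda>t. partial_deriv t \<phi> (q x)) = (\<lambda>t. t *\<^sub>R partial_deriv 1 \<phi> (q x))"
        by (rule linear_real_scale)
      from has_derivative_frechet[OF d, unfolded this] show ?thesis
        using diff_chain_at[OF Ck_on_derivD[OF Suc.prems(2) that]] unfolding comp_def by blast
    qed
    show "Ck_on m (\<lambda>x. partial_deriv b q x *\<^sub>R partial_deriv 1 \<phi> (q x)) S" if "b \<in> Basis" for b
      by (intro Ck_on_scaleR assms(1) Suc.IH) (use Suc.prems that Ck_on_SucD[OF Suc.prems(2)] in auto)
  qed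
qed

lemma Ck_on_components:
  fixes f :: "'a::euclidean_space \<Rightarrow> 'b::euclidean_space"
  assumes "open S" "\<And>b. b \<in> Basis \<Longrightarrow> Ck_on m (\<lambda>x. f x \<bullet> b) S" shows "Ck_on m f S"
proof -
  have "Ck_on m (\<lambda>x. \<Sum>b\<in>Basis. (f x \<bullet> b) *\<^sub>R b) S"
    by (intro Ck_on_sum Ck_on_scaleR Ck_on_const assms)
  then show ?thesis by (simp add: euclidean_representation)
qed

lemma Ck_on_inner: "open S \<Longrightarrow> Ck_on m f S \<Longrightarrow> Ck_on m (\<lambda>x. f x \<bullet> b) S"
  by (rule Ck_on_linear_compose[OF _ bounded_linear_inner_left])

lemma Ck_on_real_deriv:
  fixes f :: "real \<Rightarrow> 'b::real_normed_vector"
  assumes "Ck_on (Suc m) f S" "open S" "x \<in> S"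
  shows "(f has_vector_derivative partial_deriv 1 f x) (at x)" "vector_derivative f (at x) = partial_deriv 1 f x"
proof -
  have d: "(f has_derivative (\<lambda>h. partial_deriv h f x)) (at x)" by (rule Ck_on_derivD[OF assms(1,3)])
  then have "linear (\<lambda>h. partial_deriv h f x)" by (rule has_derivative_linear)
  then have e: "(\<lambda>t. partial_deriv t f x) = (\<lambda>t. t *\<^sub>R partial_deriv 1 f x)"
    by (rule linear_real_scale)
  show "(f has_vector_derivative partial_deriv 1 f x) (at x)" using d unfolding e has_vector_derivative_def .
  then show "vector_derivative f (at x) = partial_deriv 1 f x" by (rule vector_derivative_at)
qed

lemma Ck_on_realI:
  fixes f :: "real \<Rightarrow> 'b::real_normed_vector"
  assumes "open S" "\<And>x. x \<in> S \<Longrightarrow> (f has_vector_derivative D x) (at x)" "Ck_on m D S"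
  shows "Ck_on (Suc m) f S"
  by (rule Ck_on_SucI[OF assms(1) assms(2)[unfolded has_vector_derivative_def]]) (use assms(3) in auto)

section \<open>Integral manifolds of hyperplane fields\<close>

text \<open>Leaves and primitives are obtained by differentiating integrals along one line at a
  time. Continuity of the candidate gradient and the mean value theorem on short segments upgrade
  this to a total derivative.\<close>

lemma gradient_of_directional:
  fixes F :: "'a::euclidean_space \<Rightarrow> real"
  assumes "open B" "y \<in> B" and d: "\<And>z u. z \<in> B \<Longrightarrow> ((\<lambda>s. F (z + s *\<^sub>R u)) has_real_derivative G z \<bullet> u) (at 0)"
    and G: "continuous_on B G"
  shows "(F has_derivative (\<lambda>h. G y \<bullet> h)) (at y)"
  unfolding has_derivative_at_alt
proof (intro conjI allI impI)
  show "bounded_linear (\<lambda>h. G y \<bullet> h)" by (rule bounded_linear_inner_right)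
  fix e :: real assume e: "e > 0"
  have "isCont G y" using G assms(1,2) by (simp add: continuous_on_eq_continuous_at)
  then obtain d1 where d1: "d1 > 0" "\<And>z. dist z y < d1 \<Longrightarrow> dist (G z) (G y) < e"
    using e unfolding continuous_at_eps_delta by blast
  obtain d2 where d2: "d2 > 0" "ball y d2 \<subseteq> B" using assms(1,2) openE by blast
  show "\<exists>r>0. \<forall>z. norm (z - y) < r \<longrightarrow> norm (F z - F y - G y \<bullet> (z - y)) \<le> e * norm (z - y)"
  proof (intro exI[of _ "min d1 d2"] conjI allI impI)
    show "min d1 d2 > 0" using d1 d2 by simp
    fix z assume z: "norm (z - y) < min d1 d2"
    define h where "h = z - y"
    have m: "dist (y + s *\<^sub>R h) y < min d1 d2" if "0 \<le> s" "s \<le> 1" for s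
    proof -
      have "norm (s *\<^sub>R h) \<le> norm h" using that by (auto intro: mult_left_le_one_le)
      then show ?thesis using z by (simp add: dist_norm h_def)
    qed
    have "((\<lambda>s. F (y + s *\<^sub>R h)) has_real_derivative G (y + s *\<^sub>R h) \<bullet> h) (at s)" if "0 \<le> s" "s \<le> 1" for s
    proof -
      have "y + s *\<^sub>R h \<in> B" using m[OF that] d2 by (auto simp: dist_commute subset_iff)
      from d[OF this, of h] have "((\<lambda>r. F (y + s *\<^sub>R h + r *\<^sub>R h)) has_real_derivative G (y + s *\<^sub>R h) \<bullet> h) (at (s - s))" by simp
      then have "((\<lambda>r. F (y + s *\<^sub>R h + (r - s) *\<^sub>R h)) has_real_derivative G (y + s *\<^sub>R h) \<bullet> h) (at s)"
        using DERIV_shift[of "\<lambda>r. F (y + s *\<^sub>R h + r *\<^sub>R h)" _ s "- s"] by simp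
      then show ?thesis by (simp add: algebra_simps)
    qed
    from MVT2[of 0 1, OF _ this] obtain s where s: "0 < s" "s < 1" "F (y + h) - F y = G (y + s *\<^sub>R h) \<bullet> h" by auto
    have "norm ((G (y + s *\<^sub>R h) - G y) \<bullet> h) \<le> norm (G (y + s *\<^sub>R h) - G y) * norm h" by (simp add: Cauchy_Schwarz_ineq2)
    also have "\<dots> \<le> e * norm h" using d1(2)[of "y + s *\<^sub>R h"] m[of s] s by (intro mult_right_mono) (auto simp: dist_norm)
    finally show "norm (F z - F y - G y \<bullet> (z - y)) \<le> e * norm (z - y)" using s(3) by (simp add: h_def inner_diff_left)
  qed
qed

section \<open>Leaves by Picard iteration along rays\<close>

lemma continuous_on_ray_compose:
  fixes \<phi> :: "'a::euclidean_space \<Rightarrow> real \<Rightarrow> 'b::topological_space"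
  assumes "continuous_on (UNIV \<times> I) (\<lambda>(y, s). \<phi> y s)" "continuous_on B f" "\<And>y. y \<in> B \<Longrightarrow> f y \<in> I"
    "\<And>y t. y \<in> B \<Longrightarrow> t \<in> {0..1} \<Longrightarrow> t *\<^sub>R y \<in> B"
  shows "continuous_on (B \<times> {0..1}) (\<lambda>z. \<phi> (snd z *\<^sub>R fst z) (f (snd z *\<^sub>R fst z)))"
proof -
  have "continuous_on (B \<times> {0..1}) (\<lambda>z. f (snd z *\<^sub>R fst z))"
    by (rule continuous_on_compose2[OF assms(2)]) (auto intro!: continuous_intros assms(4))
  then have "continuous_on (B \<times> {0..1}) (\<lambda>z. (\<lambda>(y, s). \<phi> y s) (snd z *\<^sub>R fst z, f (snd z *\<^sub>R fst z)))"
    by (intro continuous_on_compose2[OF assms(1)]) (auto intro!: continuous_intros assms(3,4))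
  then show ?thesis by simp
qed

text \<open>An error with b' <= e_n + b / 2 and e_n -> 0 tends to 0. Premise \<open>M\<close> is the
  recursion with a fixed defect; it keeps each iterate bounded until the sharper premise
  \<open>N\<close> takes over.\<close>

lemma halving_converges:
  fixes q :: "nat \<Rightarrow> 'a \<Rightarrow> real"
  assumes b0: "\<And>y. y \<in> B \<Longrightarrow> \<bar>q 0 y\<bar> \<le> C"
    and M: "\<And>n b. (\<And>y. y \<in> B \<Longrightarrow> \<bar>q n y\<bar> \<le> b) \<Longrightarrow> (\<And>y. y \<in> B \<Longrightarrow> \<bar>q (Suc n) y\<bar> \<le> M + b / 2)"
    and N: "\<And>e. e > 0 \<Longrightarrow> \<exists>N. \<forall>n\<ge>N. \<forall>b. (\<forall>y\<in>B. \<bar>q n y\<bar> \<le> b) \<longrightarrow> (\<forall>y\<in>B. \<bar>q (Suc n) y\<bar> \<le> e + b / 2)"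
    and e: "e > 0"
  shows "\<exists>N. \<forall>n\<ge>N. \<forall>y\<in>B. \<bar>q n y\<bar> \<le> e"
proof -
  have "\<exists>b. \<forall>y\<in>B. \<bar>q n y\<bar> \<le> b" for n
  proof (induction n)
    case 0 then show ?case using b0 by blast
  next
    case (Suc n) then show ?case using M by blast
  qed
  moreover obtain N where N': "\<And>n b. n \<ge> N \<Longrightarrow> (\<forall>y\<in>B. \<bar>q n y\<bar> \<le> b) \<Longrightarrow> (\<forall>y\<in>B. \<bar>q (Suc n) y\<bar> \<le> e / 4 + b / 2)"
    using N[of "e / 4"] e by fastforce
  ultimately obtain b where b: "\<forall>y\<in>B. \<bar>q N y\<bar> \<le> b" by blast
  \<comment> \<open>e / 2 is the fixed point of b -> e / 4 + b / 2 and is approached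
    geometrically.\<close>
  have *: "\<forall>y\<in>B. \<bar>q (N + k) y\<bar> \<le> e / 2 + (1/2) ^ k * \<bar>b\<bar>" for k
  proof (induction k)
    case 0 then show ?case using b e by fastforce
  next
    case (Suc k)
    have "e / 4 + (e / 2 + (1/2) ^ k * \<bar>b\<bar>) / 2 = e / 2 + (1/2) ^ Suc k * \<bar>b\<bar>" by (simp add: field_simps)
    then show ?case using N'[OF _ Suc.IH] by (simp only: add_Suc_right) simp
  qed
  have "(\<lambda>k. (1/2) ^ k * \<bar>b\<bar>) \<longlonglongrightarrow> 0 * \<bar>b\<bar>" by (intro tendsto_mult LIMSEQ_power_zero tendsto_const) auto
  then have "\<forall>\<^sub>F k in sequentially. (1/2) ^ k * \<bar>b\<bar> < e / 2" using e order_tendstoD(2)[of _ "0 * \<bar>b\<bar>" sequentially "e / 2"] by simp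
  then obtain K where K: "\<And>k. k \<ge> K \<Longrightarrow> (1/2) ^ k * \<bar>b\<bar> < e / 2" by (auto simp: eventually_sequentially)
  show ?thesis
  proof (intro exI[of _ "N + K"] allI impI ballI)
    fix n y assume "n \<ge> N + K" "y \<in> B"
    then show "\<bar>q n y\<bar> \<le> e" using *[of "n - N"] K[of "n - N"] by force
  qed
qed

lemma ftc01:
  assumes "\<And>t. t \<in> {0..1} \<Longrightarrow> (g has_real_derivative g' t) (at t within {0..1})"
  shows "g 1 - g 0 = integral {0..1} g'"
proof -
  have "(g' has_integral g 1 - g 0) {0..1}"
    by (rule fundamental_theorem_of_calculus) (use assms in \<open>auto simp: has_real_derivative_iff_has_vector_derivative\<close>)
  then show ?thesis by (simp add: integral_unique)
qed

text \<open>Data of the equation dF = \<open>\<omega>\<close>(y, F) dy on the ball of radius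
  \<open>R\<close>. Premise \<open>sym\<close> is the Frobenius condition: the derivative of
  \<open>\<omega>\<close> along the lifted vector (v, \<open>\<omega>\<close> . v), paired with u,
  is symmetric in u and v. The two bounds \<open>dR\<close> serve different ends: the first keeps
  the iterates in the middle half of the height interval, the second makes the iteration contract by
  1/2.\<close>

locale leaf_form =
  fixes \<omega> :: "'a::euclidean_space \<Rightarrow> real \<Rightarrow> 'a" and \<omega>' :: "'a \<Rightarrow> real \<Rightarrow> 'a \<times> real \<Rightarrow> 'a" and c d R :: real
  assumes c: "c > 0" and R: "R > 0"
    and der: "s \<in> {-c<..<c} \<Longrightarrow> ((\<lambda>p. \<omega> (fst p) (snd p)) has_derivative \<omega>' y s) (at (y, s))"
    and cont': "continuous_on (UNIV \<times> {-c<..<c}) (\<lambda>(y, s). \<omega>' y s h)"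
    and bd: "s \<in> {-c<..<c} \<Longrightarrow> norm (\<omega> y s) \<le> d" and bd': "s \<in> {-c<..<c} \<Longrightarrow> norm (\<omega>' y s (0, 1)) \<le> d"
    and sym: "s \<in> {-c<..<c} \<Longrightarrow> \<omega>' y s (v, \<omega> y s \<bullet> v) \<bullet> u = \<omega>' y s (u, \<omega> y s \<bullet> u) \<bullet> v"
    and dR: "d * R \<le> c / 2" "d * R \<le> 1 / 2"
begin

abbreviation "I \<equiv> {-c<..<c}"
abbreviation "B \<equiv> ball (0::'a) R"

lemma d: "d \<ge> 0" using bd[of 0 0] c norm_ge_zero[of "\<omega> 0 0"] by (simp del: norm_ge_zero)

lemma cont: "continuous_on (UNIV \<times> I) (\<lambda>(y, s). \<omega> y s)"
proof -
  have "continuous_on (UNIV \<times> I) (\<lambda>p. \<omega> (fst p) (snd p))"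
    by (rule continuous_at_imp_continuous_on) (auto intro!: has_derivative_continuous[OF der])
  then show ?thesis by (simp add: case_prod_unfold)
qed

lemma lin: "s \<in> I \<Longrightarrow> \<omega>' y s (u, q) = \<omega>' y s (u, 0) + q *\<^sub>R \<omega>' y s (0, 1)"
proof -
  assume "s \<in> I"
  then have "linear (\<omega>' y s)" using der has_derivative_linear by blast
  then have "\<omega>' y s ((u, 0) + q *\<^sub>R (0, 1)) = \<omega>' y s (u, 0) + q *\<^sub>R \<omega>' y s (0, 1)"
    by (simp only: linear_add linear_scale)
  then show ?thesis by simp
qed

lemma lin': "s \<in> I \<Longrightarrow> \<omega>' y s (t *\<^sub>R u, t * q) = t *\<^sub>R \<omega>' y s (u, q)"
proof -
  assume "s \<in> I"
  then have "linear (\<omega>' y s)" using der has_derivative_linear by blast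
  then have "\<omega>' y s (t *\<^sub>R (u, q)) = t *\<^sub>R \<omega>' y s (u, q)" by (rule linear_scale)
  then show ?thesis by simp
qed

lemma lip: "s \<in> I \<Longrightarrow> s' \<in> I \<Longrightarrow> norm (\<omega> y s - \<omega> y s') \<le> d * \<bar>s - s'\<bar>"
proof -
  assume s: "s \<in> I" "s' \<in> I"
  have "norm (\<omega> y s - \<omega> y s') \<le> d * norm (s - s')"
  proof (rule differentiable_bound[where S=I and f'="\<lambda>s q. q *\<^sub>R \<omega>' y s (0,1)"])
    fix x assume x: "x \<in> I"
    have "((\<lambda>s. (y, s)) has_derivative (\<lambda>q. (0, q))) (at x)" by (auto intro!: derivative_eq_intros)
    from diff_chain_at[OF this der[OF x]] have "((\<lambda>s. \<omega> y s) has_derivative (\<lambda>q. \<omega>' y x (0, q))) (at x)"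
      by (simp add: comp_def)
    moreover have "(\<lambda>q. \<omega>' y x (0, q)) = (\<lambda>q. q *\<^sub>R \<omega>' y x (0, 1))"
    proof
      fix q show "\<omega>' y x (0, q) = q *\<^sub>R \<omega>' y x (0, 1)" using lin'[OF x, where u=0 and q=1 and y=y and t=q] by simp
    qed
    ultimately show "(\<omega> y has_derivative (\<lambda>q. q *\<^sub>R \<omega>' y x (0,1))) (at x within I)"
      by (simp add: has_derivative_at_withinI)
    show "onorm (\<lambda>q. q *\<^sub>R \<omega>' y x (0, 1)) \<le> d"
    proof (rule onorm_le)
      fix q :: real show "norm (q *\<^sub>R \<omega>' y x (0, 1)) \<le> d * norm q"
        using mult_left_mono[OF bd'[OF x, of y], of "\<bar>q\<bar>"] by (simp add: mult.commute)
    qed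
  qed (use s in auto)
  then show ?thesis by simp
qed

text \<open>
  Picard iteration along rays. \<open>Ps n u\<close> is the derivative of \<open>Fs n\<close> in the direction \<open>u\<close>; it obeys an
  affine recursion with contraction factor \<open>1/2\<close>, and integrability makes \<open>\<omega>(y, F y) \<bullet> u\<close> its fixed point.
\<close>

primrec Fs :: "nat \<Rightarrow> 'a \<Rightarrow> real" where
  "Fs 0 y = 0"
| "Fs (Suc n) y = integral {0..1} (\<lambda>t. \<omega> (t *\<^sub>R y) (Fs n (t *\<^sub>R y)) \<bullet> y)"

primrec Ps :: "nat \<Rightarrow> 'a \<Rightarrow> 'a \<Rightarrow> real" where
  "Ps 0 u y = 0"
| "Ps (Suc n) u y = integral {0..1} (\<lambda>t. \<omega> (t *\<^sub>R y) (Fs n (t *\<^sub>R y)) \<bullet> u +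
      t * (\<omega>' (t *\<^sub>R y) (Fs n (t *\<^sub>R y)) (u, Ps n u (t *\<^sub>R y)) \<bullet> y))"

lemma star: "y \<in> B \<Longrightarrow> t \<in> {0..1} \<Longrightarrow> t *\<^sub>R y \<in> B"
  using mult_left_le_one_le[of "norm y" t] by (simp add: le_less_trans)

lemma half_c_I: "\<bar>s\<bar> \<le> c / 2 \<Longrightarrow> s \<in> I" using c by auto

lemma dy_c: "y \<in> B \<Longrightarrow> d * norm y \<le> c / 2"
  using dR(1) mult_left_mono[of "norm y" R d] d by auto

lemma Fs_props: "continuous_on B (Fs n) \<and> (\<forall>y\<in>B. \<bar>Fs n y\<bar> \<le> d * norm y)"
proof (induction n)
  case 0 then show ?case using d by auto
next
  case (Suc n)
  have inI: "Fs n y \<in> I" if "y \<in> B" for y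
    using Suc dy_c[OF that] that by (intro half_c_I) fastforce
  have c1: "continuous_on (B \<times> {0..1}) (\<lambda>z. \<omega> (snd z *\<^sub>R fst z) (Fs n (snd z *\<^sub>R fst z)) \<bullet> fst z)"
    using Suc by (intro continuous_intros continuous_on_ray_compose[OF cont]) (auto simp: inI star simp del: mem_ball mem_ball_0 greaterThanLessThan_iff)
  then have "continuous_on B (\<lambda>y. integral (cbox 0 1) (\<lambda>t. \<omega> (t *\<^sub>R y) (Fs n (t *\<^sub>R y)) \<bullet> y))"
    by (intro integral_continuous_on_param) (simp add: case_prod_unfold)
  then have "continuous_on B (Fs (Suc n))" by simp
  moreover have "\<bar>Fs (Suc n) y\<bar> \<le> d * norm y" if y: "y \<in> B" for y
  proof -
    have "norm (integral {0..1} (\<lambda>t. \<omega> (t *\<^sub>R y) (Fs n (t *\<^sub>R y)) \<bullet> y)) \<le> (d * norm y) * (1 - 0)"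
    proof (rule integral_bound)
      show "continuous_on {0..1} (\<lambda>t. \<omega> (t *\<^sub>R y) (Fs n (t *\<^sub>R y)) \<bullet> y)"
        by (rule continuous_on_compose2[OF c1, of _ "\<lambda>t. (y, t)", simplified]) (use y in \<open>auto intro!: continuous_intros\<close>)
      fix t :: real assume t: "t \<in> {0..1}"
      have "norm (\<omega> (t *\<^sub>R y) (Fs n (t *\<^sub>R y)) \<bullet> y) \<le> norm (\<omega> (t *\<^sub>R y) (Fs n (t *\<^sub>R y))) * norm y" by (simp add: Cauchy_Schwarz_ineq2)
      also have "\<dots> \<le> d * norm y" using bd[OF inI[OF star[OF y t]]] by (intro mult_right_mono) auto
      finally show "norm (\<omega> (t *\<^sub>R y) (Fs n (t *\<^sub>R y)) \<bullet> y) \<le> d * norm y" .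
    qed simp
    then show ?thesis by simp
  qed
  ultimately show ?case by blast
qed

lemma Fs_cont: "continuous_on B (Fs n)" and Fs_bd: "y \<in> B \<Longrightarrow> \<bar>Fs n y\<bar> \<le> d * norm y"
  using Fs_props by auto

lemma Fs_I: "y \<in> B \<Longrightarrow> Fs n y \<in> I"
  using Fs_bd[of y n] dy_c[of y] by (intro half_c_I) linarith

text \<open>\<open>cont'\<close> speaks of one fixed direction at a time, while here the direction
  (u, p) varies with the point; by \<open>lin\<close> the fixed directions (u, 0) and (0, 1)
  suffice.\<close>

lemma form_cont:
  assumes "continuous_on B f" "\<And>y. y \<in> B \<Longrightarrow> f y \<in> I" "continuous_on B p"
  shows "continuous_on (B \<times> {0..1}) (\<lambda>z. \<omega> (snd z *\<^sub>R fst z) (f (snd z *\<^sub>R fst z)) \<bullet> u +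
      snd z * (\<omega>' (snd z *\<^sub>R fst z) (f (snd z *\<^sub>R fst z)) (u, p (snd z *\<^sub>R fst z)) \<bullet> fst z))"
proof -
  have "continuous_on (B \<times> {0..1}) (\<lambda>z. \<omega> (snd z *\<^sub>R fst z) (f (snd z *\<^sub>R fst z)) \<bullet> u +
      snd z * ((\<omega>' (snd z *\<^sub>R fst z) (f (snd z *\<^sub>R fst z)) (u, 0) + p (snd z *\<^sub>R fst z) *\<^sub>R \<omega>' (snd z *\<^sub>R fst z) (f (snd z *\<^sub>R fst z)) (0, 1)) \<bullet> fst z))"
    using assms
    by (intro continuous_intros continuous_on_ray_compose[OF cont] continuous_on_ray_compose[OF cont'] continuous_on_compose2[OF assms(3)])
      (auto simp: star simp del: mem_ball mem_ball_0 greaterThanLessThan_iff)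
  then show ?thesis
    by (rule continuous_on_eq) (use assms(2) star in \<open>auto simp: lin[symmetric] simp del: mem_ball mem_ball_0 greaterThanLessThan_iff\<close>)
qed

lemma Ps_cont: "continuous_on B (Ps n u)"
proof (induction n)
  case (Suc n)
  have "continuous_on B (\<lambda>y. integral (cbox 0 1) (\<lambda>t. \<omega> (t *\<^sub>R y) (Fs n (t *\<^sub>R y)) \<bullet> u +
      t * (\<omega>' (t *\<^sub>R y) (Fs n (t *\<^sub>R y)) (u, Ps n u (t *\<^sub>R y)) \<bullet> y)))"
    using form_cont[OF Fs_cont Fs_I Suc, where u=u]
    by (intro integral_continuous_on_param) (simp add: case_prod_unfold)
  then show ?case by simp
qed simp

lemma line_open: "open {s. y + s *\<^sub>R u \<in> B}" "convex {s. y + s *\<^sub>R u \<in> B}"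
proof -
  have "{s. y + s *\<^sub>R u \<in> B} = (\<lambda>s. y + s *\<^sub>R u) -` B" by auto
  moreover have "open ((\<lambda>s. y + s *\<^sub>R u) -` B)" by (intro continuous_open_vimage) (auto intro!: continuous_intros)
  ultimately show "open {s. y + s *\<^sub>R u \<in> B}" by simp
  show "convex {s. y + s *\<^sub>R u \<in> B}"
  proof (rule convexI)
    fix a b p q :: real assume h: "a \<in> {s. y + s *\<^sub>R u \<in> B}" "b \<in> {s. y + s *\<^sub>R u \<in> B}" "0 \<le> p" "0 \<le> q" "p + q = 1"
    have "p *\<^sub>R (y + a *\<^sub>R u) + q *\<^sub>R (y + b *\<^sub>R u) \<in> B"
      using convexD[OF convex_ball, of "y + a *\<^sub>R u" 0 R "y + b *\<^sub>R u" p q] h by auto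
    moreover have "p *\<^sub>R (y + a *\<^sub>R u) + q *\<^sub>R (y + b *\<^sub>R u) = (p + q) *\<^sub>R y + (p * a + q * b) *\<^sub>R u" by (simp add: algebra_simps)
    ultimately show "p *\<^sub>R a + q *\<^sub>R b \<in> {s. y + s *\<^sub>R u \<in> B}" using h(5) by simp
  qed
qed

lemma form_derivative:
  assumes f: "((\<lambda>\<sigma>. f (t *\<^sub>R y + \<sigma> *\<^sub>R u)) has_real_derivative p) (at (s * t))" and I: "f (t *\<^sub>R (y + s *\<^sub>R u)) \<in> I"
  shows "((\<lambda>s. \<omega> (t *\<^sub>R (y + s *\<^sub>R u)) (f (t *\<^sub>R (y + s *\<^sub>R u))) \<bullet> (y + s *\<^sub>R u)) has_real_derivative
     \<omega> (t *\<^sub>R (y + s *\<^sub>R u)) (f (t *\<^sub>R (y + s *\<^sub>R u))) \<bullet> u +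
      t * (\<omega>' (t *\<^sub>R (y + s *\<^sub>R u)) (f (t *\<^sub>R (y + s *\<^sub>R u))) (u, p) \<bullet> (y + s *\<^sub>R u))) (at s)"
proof -
  have "((\<lambda>s. f (t *\<^sub>R y + (s * t) *\<^sub>R u)) has_real_derivative p * t) (at s)"
    by (rule DERIV_chain2[where f="\<lambda>\<sigma>. f (t *\<^sub>R y + \<sigma> *\<^sub>R u)" and g="\<lambda>s. s * t", OF f]) (auto intro!: derivative_eq_intros)
  moreover have "t *\<^sub>R (y + s *\<^sub>R u) = t *\<^sub>R y + (s * t) *\<^sub>R u" for s by (simp add: algebra_simps)
  ultimately have "((\<lambda>s. f (t *\<^sub>R (y + s *\<^sub>R u))) has_derivative (\<lambda>h. p * t * h)) (at s)"
    by (simp only: has_field_derivative_def)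
  then have 1: "((\<lambda>s. f (t *\<^sub>R (y + s *\<^sub>R u))) has_derivative (\<lambda>h. h * (t * p))) (at s)"
    by (rule has_derivative_eq_rhs) auto
  have 2: "((\<lambda>s. t *\<^sub>R (y + s *\<^sub>R u)) has_derivative (\<lambda>h. h *\<^sub>R (t *\<^sub>R u))) (at s)"
    by (auto intro!: derivative_eq_intros simp: algebra_simps)
  have "((\<lambda>s. \<omega> (t *\<^sub>R (y + s *\<^sub>R u)) (f (t *\<^sub>R (y + s *\<^sub>R u)))) has_derivative
     (\<lambda>h. \<omega>' (t *\<^sub>R (y + s *\<^sub>R u)) (f (t *\<^sub>R (y + s *\<^sub>R u))) (h *\<^sub>R (t *\<^sub>R u), h * (t * p)))) (at s)"
    using diff_chain_at[OF has_derivative_Pair[OF 2 1] der[OF I]] by (simp add: comp_def)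
  then have 3: "((\<lambda>s. \<omega> (t *\<^sub>R (y + s *\<^sub>R u)) (f (t *\<^sub>R (y + s *\<^sub>R u)))) has_derivative
     (\<lambda>h. h *\<^sub>R t *\<^sub>R \<omega>' (t *\<^sub>R (y + s *\<^sub>R u)) (f (t *\<^sub>R (y + s *\<^sub>R u))) (u, p))) (at s)"
    by (simp only: lin'[OF I])
  have 4: "((\<lambda>s. y + s *\<^sub>R u) has_derivative (\<lambda>h. h *\<^sub>R u)) (at s)" by (auto intro!: derivative_eq_intros)
  show ?thesis unfolding has_field_derivative_def
    by (rule has_derivative_eq_rhs[OF has_derivative_inner[OF 3 4]]) (auto simp: algebra_simps inner_commute)
qed

text \<open>Induction over the Picard steps, differentiating under the integral sign on the open
  convex set of parameters that keep the line inside \<open>B\<close>.\<close>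

lemma Fs_deriv:
  assumes "y + s *\<^sub>R u \<in> B"
  shows "((\<lambda>s. Fs n (y + s *\<^sub>R u)) has_real_derivative Ps n u (y + s *\<^sub>R u)) (at s)"
  using assms
proof (induction n arbitrary: y s)
  case (Suc n)
  let ?U = "{s. y + s *\<^sub>R u \<in> B}"
  let ?K = "\<lambda>z t. \<omega> (t *\<^sub>R z) (Fs n (t *\<^sub>R z)) \<bullet> u + t * (\<omega>' (t *\<^sub>R z) (Fs n (t *\<^sub>R z)) (u, Ps n u (t *\<^sub>R z)) \<bullet> z)"
  have s: "s \<in> ?U" using Suc.prems by simp
  have "((\<lambda>s. integral (cbox 0 1) (\<lambda>t. \<omega> (t *\<^sub>R (y + s *\<^sub>R u)) (Fs n (t *\<^sub>R (y + s *\<^sub>R u))) \<bullet> (y + s *\<^sub>R u))) has_real_derivative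
      integral (cbox 0 1) (?K (y + s *\<^sub>R u))) (at s within ?U)"
  proof (rule leibniz_rule_field_derivative[where U="?U" and fx="\<lambda>s t. ?K (y + s *\<^sub>R u) t", OF _ _ _ s line_open(2)])
    fix x t :: real assume x: "x \<in> ?U" and t: "t \<in> cbox 0 1"
    have z: "t *\<^sub>R (y + x *\<^sub>R u) \<in> B" using star[of "y + x *\<^sub>R u" t] x t by simp
    have "t *\<^sub>R y + (x * t) *\<^sub>R u \<in> B" using z by (simp add: algebra_simps)
    from Suc.IH[OF this] have f: "((\<lambda>\<sigma>. Fs n (t *\<^sub>R y + \<sigma> *\<^sub>R u)) has_real_derivative Ps n u (t *\<^sub>R (y + x *\<^sub>R u))) (at (x * t))"
      by (simp add: algebra_simps)
    show "((\<lambda>s. \<omega> (t *\<^sub>R (y + s *\<^sub>R u)) (Fs n (t *\<^sub>R (y + s *\<^sub>R u))) \<bullet> (y + s *\<^sub>R u)) has_real_derivative ?K (y + x *\<^sub>R u) t) (at x within ?U)"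
      using form_derivative[OF f Fs_I[OF z]] by (rule has_field_derivative_at_within)
  next
    fix x assume x: "x \<in> ?U"
    have c1: "continuous_on (B \<times> {0..1}) (\<lambda>z. \<omega> (snd z *\<^sub>R fst z) (Fs n (snd z *\<^sub>R fst z)) \<bullet> fst z)"
      using Fs_cont by (intro continuous_intros continuous_on_ray_compose[OF cont]) (auto simp: Fs_I star simp del: mem_ball mem_ball_0 greaterThanLessThan_iff)
    have "continuous_on {0..1} (\<lambda>t. \<omega> (t *\<^sub>R (y + x *\<^sub>R u)) (Fs n (t *\<^sub>R (y + x *\<^sub>R u))) \<bullet> (y + x *\<^sub>R u))"
      by (rule continuous_on_compose2[OF c1, of _ "\<lambda>t. (y + x *\<^sub>R u, t)", simplified]) (use x in \<open>auto intro!: continuous_intros\<close>)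
    then show "(\<lambda>t. \<omega> (t *\<^sub>R (y + x *\<^sub>R u)) (Fs n (t *\<^sub>R (y + x *\<^sub>R u))) \<bullet> (y + x *\<^sub>R u)) integrable_on cbox 0 1"
      by (simp add: integrable_continuous_interval)
  next
    have "continuous_on (?U \<times> {0..1}) (\<lambda>z. (\<lambda>z. ?K (fst z) (snd z)) (y + fst z *\<^sub>R u, snd z))"
      by (rule continuous_on_compose2[OF form_cont[OF Fs_cont Fs_I Ps_cont]]) (auto intro!: continuous_intros)
    then show "continuous_on (?U \<times> cbox 0 1) (\<lambda>(s, t). ?K (y + s *\<^sub>R u) t)"
      by (simp add: case_prod_unfold)
  qed
  then show ?case using at_within_open[OF s line_open(1)] by simp
qed simp


lemma int_bd: "continuous_on {0..1} (g :: real \<Rightarrow> real) \<Longrightarrow> (\<And>t. t \<in> {0..1} \<Longrightarrow> \<bar>g t\<bar> \<le> C) \<Longrightarrow> \<bar>integral {0..1} g\<bar> \<le> (C :: real)"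
  using integral_bound[of 0 1 g C] by simp

lemma ray_cont:
  assumes "continuous_on B f" "\<And>y. y \<in> B \<Longrightarrow> f y \<in> I" "y \<in> B"
  shows "continuous_on {0..1} (\<lambda>t. \<omega> (t *\<^sub>R y) (f (t *\<^sub>R y)) \<bullet> u)"
proof -
  have c1: "continuous_on (B \<times> {0..1}) (\<lambda>z. \<omega> (snd z *\<^sub>R fst z) (f (snd z *\<^sub>R fst z)) \<bullet> u)"
    using assms by (intro continuous_intros continuous_on_ray_compose[OF cont]) (auto simp: star simp del: mem_ball mem_ball_0 greaterThanLessThan_iff)
  show ?thesis
    by (rule continuous_on_compose2[OF c1, of _ "\<lambda>t. (y, t)", simplified]) (use assms(3) in \<open>auto intro!: continuous_intros\<close>)
qed

lemma ray_cont':
  assumes "continuous_on B f" "\<And>y. y \<in> B \<Longrightarrow> f y \<in> I" "y \<in> B" "continuous_on B p"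
  shows "continuous_on {0..1} (\<lambda>t. \<omega> (t *\<^sub>R y) (f (t *\<^sub>R y)) \<bullet> u + t * (\<omega>' (t *\<^sub>R y) (f (t *\<^sub>R y)) (u, p (t *\<^sub>R y)) \<bullet> y))"
  by (rule continuous_on_compose2[OF form_cont[OF assms(1,2,4)], of _ "\<lambda>t. (y, t)", simplified])
    (use assms(3) in \<open>auto intro!: continuous_intros\<close>)

text \<open>Contraction of the Picard map in the supremum norm: the Lipschitz constant
  \<open>d\<close> in the height times the length of a ray is at most 1/2.\<close>

lemma form_diff:
  assumes f: "continuous_on B f" "\<And>y. y \<in> B \<Longrightarrow> f y \<in> I" and g: "continuous_on B g" "\<And>y. y \<in> B \<Longrightarrow> g y \<in> I"
    and e: "\<And>y. y \<in> B \<Longrightarrow> \<bar>f y - g y\<bar> \<le> e" and y: "y \<in> B"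
  shows "\<bar>integral {0..1} (\<lambda>t. \<omega> (t *\<^sub>R y) (f (t *\<^sub>R y)) \<bullet> y) - integral {0..1} (\<lambda>t. \<omega> (t *\<^sub>R y) (g (t *\<^sub>R y)) \<bullet> y)\<bar> \<le> e / 2"
proof -
  have "integral {0..1} (\<lambda>t. \<omega> (t *\<^sub>R y) (f (t *\<^sub>R y)) \<bullet> y) - integral {0..1} (\<lambda>t. \<omega> (t *\<^sub>R y) (g (t *\<^sub>R y)) \<bullet> y)
    = integral {0..1} (\<lambda>t. \<omega> (t *\<^sub>R y) (f (t *\<^sub>R y)) \<bullet> y - \<omega> (t *\<^sub>R y) (g (t *\<^sub>R y)) \<bullet> y)"
    by (intro integral_diff[symmetric] integrable_continuous_interval ray_cont f g y)
  also have "\<bar>\<dots>\<bar> \<le> e / 2"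
  proof (rule int_bd)
    show "continuous_on {0..1} (\<lambda>t. \<omega> (t *\<^sub>R y) (f (t *\<^sub>R y)) \<bullet> y - \<omega> (t *\<^sub>R y) (g (t *\<^sub>R y)) \<bullet> y)"
      by (intro continuous_on_diff ray_cont f g y)
    fix t :: real assume t: "t \<in> {0..1}"
    note z = star[OF y t]
    have e0: "e \<ge> 0" using e[OF z] by linarith
    have "\<bar>(\<omega> (t *\<^sub>R y) (f (t *\<^sub>R y)) - \<omega> (t *\<^sub>R y) (g (t *\<^sub>R y))) \<bullet> y\<bar> \<le> norm (\<omega> (t *\<^sub>R y) (f (t *\<^sub>R y)) - \<omega> (t *\<^sub>R y) (g (t *\<^sub>R y))) * norm y"
      by (rule Cauchy_Schwarz_ineq2)
    also have "\<dots> \<le> (d * e) * R"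
      using lip[OF f(2)[OF z] g(2)[OF z], of "t *\<^sub>R y"] mult_left_mono[OF e[OF z] d] y d e0
      by (intro mult_mono) auto
    also have "\<dots> = (d * R) * e" by simp
    also have "\<dots> \<le> (1 / 2) * e" using dR(2) e0 by (rule mult_right_mono)
    finally show "\<bar>\<omega> (t *\<^sub>R y) (f (t *\<^sub>R y)) \<bullet> y - \<omega> (t *\<^sub>R y) (g (t *\<^sub>R y)) \<bullet> y\<bar> \<le> e / 2" by (simp add: inner_diff_left)
  qed
  finally show ?thesis .
qed

lemma Fs_step: "y \<in> B \<Longrightarrow> \<bar>Fs (Suc n) y - Fs n y\<bar> \<le> (c / 2) * (1/2) ^ n"
proof (induction n arbitrary: y)
  case 0
  have "\<bar>Fs (Suc 0) y\<bar> \<le> c / 2" by (rule order_trans[OF Fs_bd[OF 0] dy_c[OF 0]])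
  then show ?case by (simp only: Fs.simps(1) diff_0_right power_0 mult_1_right)
next
  case (Suc n)
  have "\<bar>Fs (Suc (Suc n)) y - Fs (Suc n) y\<bar> \<le> ((c / 2) * (1/2) ^ n) / 2"
    unfolding Fs.simps(2)[of "Suc n"] Fs.simps(2)[of n y]
    by (rule form_diff[OF Fs_cont Fs_I Fs_cont Fs_I Suc.IH Suc.prems])
  then show ?case by simp
qed

text \<open>Written as a telescoping series so that the Weierstrass test applies with the geometric
  bounds of \<open>Fs_step\<close>.\<close>

definition F :: "'a \<Rightarrow> real" where "F y = suminf (\<lambda>i. Fs (Suc i) y - Fs i y)"

lemma F_unif: "uniform_limit B Fs F sequentially"
proof -
  have "uniform_limit B (\<lambda>n y. \<Sum>i<n. Fs (Suc i) y - Fs i y) F sequentially"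
    unfolding F_def[abs_def]
    by (rule Weierstrass_m_test[where M="\<lambda>n. (c / 2) * (1/2) ^ n"]) (use Fs_step in \<open>auto intro: summable_mult simp del: Fs.simps\<close>)
  moreover have "(\<lambda>n y. \<Sum>i<n. Fs (Suc i) y - Fs i y) = Fs"
  proof (intro ext)
    fix n y show "(\<Sum>i<n. Fs (Suc i) y - Fs i y) = Fs n y"
      using sum_lessThan_telescope[of "\<lambda>i. Fs i y" n] by (simp del: Fs.simps(2))
  qed
  ultimately show ?thesis by simp
qed

lemma F_lim: "y \<in> B \<Longrightarrow> (\<lambda>n. Fs n y) \<longlonglongrightarrow> F y"
  using F_unif by (rule tendsto_uniform_limitI)

lemma F_bd: "y \<in> B \<Longrightarrow> \<bar>F y\<bar> \<le> d * norm y"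
  by (rule LIMSEQ_le_const2[OF tendsto_rabs[OF F_lim]]) (use Fs_bd in blast)+

lemma F_I: "y \<in> B \<Longrightarrow> F y \<in> I"
  using F_bd[of y] dy_c[of y] by (intro half_c_I) linarith

lemma F_cont: "continuous_on B F"
  by (rule uniform_limit_theorem[OF _ F_unif]) (simp_all add: Fs_cont)

lemma F_close: "e > 0 \<Longrightarrow> \<exists>N. \<forall>n\<ge>N. \<forall>y\<in>B. \<bar>Fs n y - F y\<bar> < e"
  using F_unif by (auto simp: uniform_limit_sequentially_iff dist_real_def)

lemma F_eq: assumes y: "y \<in> B" shows "F y = integral {0..1} (\<lambda>t. \<omega> (t *\<^sub>R y) (F (t *\<^sub>R y)) \<bullet> y)"
proof (rule LIMSEQ_unique[OF LIMSEQ_Suc[OF F_lim[OF y]]], rule LIMSEQ_I)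
  fix e :: real assume e: "e > 0"
  obtain N where N: "\<forall>n\<ge>N. \<forall>y\<in>B. \<bar>Fs n y - F y\<bar> < e" using F_close[OF e] by blast
  have "norm (Fs (Suc n) y - integral {0..1} (\<lambda>t. \<omega> (t *\<^sub>R y) (F (t *\<^sub>R y)) \<bullet> y)) < e" if "n \<ge> N" for n
  proof -
    have "\<bar>Fs (Suc n) y - integral {0..1} (\<lambda>t. \<omega> (t *\<^sub>R y) (F (t *\<^sub>R y)) \<bullet> y)\<bar> \<le> e / 2"
      unfolding Fs.simps(2) by (rule form_diff[OF Fs_cont Fs_I F_cont F_I _ y]) (use N that in \<open>auto intro: less_imp_le simp del: mem_ball mem_ball_0\<close>)
    then show ?thesis using e by simp
  qed
  then show "\<exists>N. \<forall>n\<ge>N. norm (Fs (Suc n) y - integral {0..1} (\<lambda>t. \<omega> (t *\<^sub>R y) (F (t *\<^sub>R y)) \<bullet> y)) < e" by blast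
qed

text \<open>At the point s y the substitution t = \<tau> s turns the integral equation into an
  integral from 0 to s; the fundamental theorem of calculus then yields the equation along the
  ray.\<close>

lemma F_ray:
  assumes y: "y \<in> B" and t: "t \<in> {0..1}"
  shows "((\<lambda>t. F (t *\<^sub>R y)) has_real_derivative \<omega> (t *\<^sub>R y) (F (t *\<^sub>R y)) \<bullet> y) (at t within {0..1})"
proof -
  let ?h = "\<lambda>t. \<omega> (t *\<^sub>R y) (F (t *\<^sub>R y)) \<bullet> y"
  have hc: "continuous_on {0..1} ?h" by (rule ray_cont[OF F_cont F_I y])
  define H where "H t = integral {0..t} ?h" for t
  have H: "(H has_real_derivative ?h s) (at s within {0..1})" if "s \<in> {0..1}" for s
    using integral_has_real_derivative[OF hc that] by (simp add: H_def[abs_def])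
  have "F (s *\<^sub>R y) = H s" if s: "s \<in> {0..1}" for s
  proof -
    have "H (1 * s) - H (0 * s) = integral {0..1} (\<lambda>\<tau>. ?h (\<tau> * s) * s)"
    proof (rule ftc01[of "\<lambda>\<tau>. H (\<tau> * s)"])
      fix \<tau> :: real assume \<tau>: "\<tau> \<in> {0..1}"
      have 1: "\<tau> * s \<in> {0..1}" using \<tau> s by (auto simp: mult_le_one)
      have im: "(\<lambda>\<tau>. \<tau> * s) ` {0..1} \<subseteq> {0..1}" using s by (auto simp: mult_le_one)
      have 2: "((\<lambda>\<tau>. \<tau> * s) has_derivative (\<lambda>h. h * s)) (at \<tau> within {0..1})" by (auto intro!: derivative_eq_intros)
      have 3: "(H has_derivative (\<lambda>h. h * ?h (\<tau> * s))) (at (\<tau> * s) within (\<lambda>\<tau>. \<tau> * s) ` {0..1})"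
        using has_derivative_subset[OF _ im] H[OF 1] by (simp add: has_field_derivative_def mult_commute_abs)
      show "((\<lambda>\<tau>. H (\<tau> * s)) has_real_derivative ?h (\<tau> * s) * s) (at \<tau> within {0..1})"
        unfolding has_field_derivative_def
        by (rule has_derivative_eq_rhs[OF diff_chain_within[OF 2 3, unfolded comp_def]]) auto
    qed
    moreover have "F (s *\<^sub>R y) = integral {0..1} (\<lambda>\<tau>. ?h (\<tau> * s) * s)"
      using F_eq[OF star[OF y s]] by (simp add: mult.commute)
    ultimately show ?thesis by (simp add: H_def)
  qed
  then show ?thesis
    unfolding has_field_derivative_def
    by (intro has_derivative_transform[OF t _ H[OF t, unfolded has_field_derivative_def]]) simp
qed

text \<open>The candidate gradient p is the increment of t p(t y) from t = 0 to t = 1.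
  Differentiating in t produces \<open>\<omega>'\<close> along the lift of y, paired with u;
  \<open>sym\<close> exchanges y and u, and the result is the equation whose iteration defines
  \<open>Ps\<close>. This is where integrability enters the construction of the leaf.\<close>

lemma p_fix:
  assumes y: "y \<in> B"
  shows "\<omega> y (F y) \<bullet> u = integral {0..1} (\<lambda>t. \<omega> (t *\<^sub>R y) (F (t *\<^sub>R y)) \<bullet> u +
    t * (\<omega>' (t *\<^sub>R y) (F (t *\<^sub>R y)) (u, \<omega> (t *\<^sub>R y) (F (t *\<^sub>R y)) \<bullet> u) \<bullet> y))"
proof -
  let ?g = "\<lambda>t. t * (\<omega> (t *\<^sub>R y) (F (t *\<^sub>R y)) \<bullet> u)"
  have "?g 1 - ?g 0 = integral {0..1} (\<lambda>t. \<omega> (t *\<^sub>R y) (F (t *\<^sub>R y)) \<bullet> u +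
    t * (\<omega>' (t *\<^sub>R y) (F (t *\<^sub>R y)) (u, \<omega> (t *\<^sub>R y) (F (t *\<^sub>R y)) \<bullet> u) \<bullet> y))"
  proof (rule ftc01)
    fix t :: real assume t: "t \<in> {0..1}"
    let ?z = "t *\<^sub>R y"
    note I = F_I[OF star[OF y t]]
    have 1: "((\<lambda>t. t *\<^sub>R y) has_derivative (\<lambda>h. h *\<^sub>R y)) (at t within {0..1})" by (auto intro!: derivative_eq_intros)
    have 2: "((\<lambda>t. F (t *\<^sub>R y)) has_derivative (\<lambda>h. h * (\<omega> ?z (F ?z) \<bullet> y))) (at t within {0..1})"
      using F_ray[OF y t] by (simp add: has_field_derivative_def mult_commute_abs)
    have "((\<lambda>p. \<omega> (fst p) (snd p)) has_derivative \<omega>' ?z (F ?z)) (at (?z, F ?z) within (\<lambda>t. (t *\<^sub>R y, F (t *\<^sub>R y))) ` {0..1})"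
      using der[OF I] by (rule has_derivative_at_withinI)
    from diff_chain_within[OF has_derivative_Pair[OF 1 2] this]
    have 3: "((\<lambda>t. \<omega> (t *\<^sub>R y) (F (t *\<^sub>R y))) has_derivative (\<lambda>h. h *\<^sub>R \<omega>' ?z (F ?z) (y, \<omega> ?z (F ?z) \<bullet> y))) (at t within {0..1})"
      by (simp add: comp_def lin'[OF I])
    have 4: "((\<lambda>t. t * (\<omega> (t *\<^sub>R y) (F (t *\<^sub>R y)) \<bullet> u)) has_derivative
       (\<lambda>h. h * (\<omega> ?z (F ?z) \<bullet> u + t * (\<omega>' ?z (F ?z) (y, \<omega> ?z (F ?z) \<bullet> y) \<bullet> u)))) (at t within {0..1})"
      by (rule has_derivative_eq_rhs[OF has_derivative_mult[OF has_derivative_ident has_derivative_inner_left[OF 3]]]) (auto simp: algebra_simps)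
    show "(?g has_real_derivative \<omega> ?z (F ?z) \<bullet> u + t * (\<omega>' ?z (F ?z) (u, \<omega> ?z (F ?z) \<bullet> u) \<bullet> y)) (at t within {0..1})"
      using 4 unfolding sym[OF I, of ?z y u] by (simp add: has_field_derivative_def mult_commute_abs)
  qed
  then show ?thesis by simp
qed

lemma p_cont: "continuous_on B (\<lambda>y. \<omega> y (F y))"
proof -
  have "continuous_on B (\<lambda>y. (\<lambda>(y, s). \<omega> y s) (y, F y))"
    by (rule continuous_on_compose2[OF cont]) (auto intro!: continuous_intros F_cont simp: F_I simp del: mem_ball mem_ball_0 greaterThanLessThan_iff)
  then show ?thesis by simp
qed

text \<open>The error splits into the change of the coefficients between \<open>Fs n\<close> and
  \<open>F\<close>, which is O(e), and a term linear in the previous error, whose coefficient is at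
  most \<open>d * R\<close> <= 1/2.\<close>

lemma Ps_step:
  assumes b: "\<And>z. z \<in> B \<Longrightarrow> \<bar>Ps n u z - \<omega> z (F z) \<bullet> u\<bar> \<le> b"
    and e: "\<And>z. z \<in> B \<Longrightarrow> \<bar>Fs n z - F z\<bar> \<le> e"
      "\<And>z. z \<in> B \<Longrightarrow> norm (\<omega>' z (Fs n z) (u, 0) - \<omega>' z (F z) (u, 0)) \<le> e"
      "\<And>z. z \<in> B \<Longrightarrow> norm (\<omega>' z (Fs n z) (0, 1) - \<omega>' z (F z) (0, 1)) \<le> e"
    and y: "y \<in> B"
  shows "\<bar>Ps (Suc n) u y - \<omega> y (F y) \<bullet> u\<bar> \<le> e * (d * norm u + R * (1 + d * norm u)) + b / 2"
proof -
  let ?p = "\<lambda>y. \<omega> y (F y) \<bullet> u"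
  have pc: "continuous_on B ?p" by (intro continuous_intros p_cont)
  let ?A = "\<lambda>t. \<omega> (t *\<^sub>R y) (Fs n (t *\<^sub>R y)) \<bullet> u + t * (\<omega>' (t *\<^sub>R y) (Fs n (t *\<^sub>R y)) (u, Ps n u (t *\<^sub>R y)) \<bullet> y)"
  let ?C = "\<lambda>t. \<omega> (t *\<^sub>R y) (F (t *\<^sub>R y)) \<bullet> u + t * (\<omega>' (t *\<^sub>R y) (F (t *\<^sub>R y)) (u, ?p (t *\<^sub>R y)) \<bullet> y)"
  have cA: "continuous_on {0..1} ?A" by (rule ray_cont'[OF Fs_cont Fs_I y Ps_cont])
  have cC: "continuous_on {0..1} ?C" by (rule ray_cont'[OF F_cont F_I y pc])
  have "Ps (Suc n) u y - ?p y = integral {0..1} (\<lambda>t. ?A t - ?C t)"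
    unfolding p_fix[OF y, of u] Ps.simps(2)
    by (intro integral_diff[symmetric] integrable_continuous_interval cA cC)
  also have "\<bar>\<dots>\<bar> \<le> e * (d * norm u + R * (1 + d * norm u)) + b / 2"
  proof (rule int_bd)
    show "continuous_on {0..1} (\<lambda>t. ?A t - ?C t)" by (intro continuous_on_diff cA cC)
    fix t :: real assume t: "t \<in> {0..1}"
    let ?z = "t *\<^sub>R y"
    note z = star[OF y t]
    note I = Fs_I[OF z, of n] F_I[OF z]
    have e0: "e \<ge> 0" using e(1)[OF z] by linarith
    have b0: "b \<ge> 0" using b[OF z] by linarith
    have y': "norm y \<le> R" using y by simp
    have 1: "\<bar>(\<omega> ?z (Fs n ?z) - \<omega> ?z (F ?z)) \<bullet> u\<bar> \<le> (d * e) * norm u"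
      using order_trans[OF lip[OF I, of ?z] mult_left_mono[OF e(1)[OF z] d]]
      by (intro order_trans[OF Cauchy_Schwarz_ineq2] mult_right_mono) auto
    let ?v = "\<omega>' ?z (Fs n ?z) (u, Ps n u ?z) - \<omega>' ?z (F ?z) (u, ?p ?z)"
    have "?v = (\<omega>' ?z (Fs n ?z) (u, 0) - \<omega>' ?z (F ?z) (u, 0)) + ?p ?z *\<^sub>R (\<omega>' ?z (Fs n ?z) (0, 1) - \<omega>' ?z (F ?z) (0, 1))
       + (Ps n u ?z - ?p ?z) *\<^sub>R \<omega>' ?z (Fs n ?z) (0, 1)"
      unfolding lin[OF I(1), of ?z u "Ps n u ?z"] lin[OF I(2), of ?z u "?p ?z"] by (simp add: algebra_simps)
    also have "norm \<dots> \<le> e + (d * norm u) * e + b * d"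
    proof (intro norm_triangle_le add_mono e(2)[OF z])
      have "\<bar>?p ?z\<bar> \<le> d * norm u"
        using bd[OF I(2), of ?z] by (intro order_trans[OF Cauchy_Schwarz_ineq2] mult_right_mono) auto
      then show "norm (?p ?z *\<^sub>R (\<omega>' ?z (Fs n ?z) (0, 1) - \<omega>' ?z (F ?z) (0, 1))) \<le> (d * norm u) * e"
        unfolding norm_scaleR using e(3)[OF z] d by (intro mult_mono) auto
      show "norm ((Ps n u ?z - ?p ?z) *\<^sub>R \<omega>' ?z (Fs n ?z) (0, 1)) \<le> b * d"
        unfolding norm_scaleR using b[OF z] bd'[OF I(1), of ?z] b0 by (intro mult_mono) auto
    qed
    finally have "\<bar>?v \<bullet> y\<bar> \<le> (e + (d * norm u) * e + b * d) * R"
      using y' d e0 b0 by (intro order_trans[OF Cauchy_Schwarz_ineq2] mult_mono) auto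
    then have "\<bar>t * (?v \<bullet> y)\<bar> \<le> 1 * ((e + (d * norm u) * e + b * d) * R)"
      unfolding abs_mult using t by (intro mult_mono) auto
    moreover have "b * d * R \<le> b / 2" using mult_left_mono[OF dR(2) b0] by (simp add: mult.assoc)
    moreover have "?A t - ?C t = (\<omega> ?z (Fs n ?z) - \<omega> ?z (F ?z)) \<bullet> u + t * (?v \<bullet> y)"
      by (simp add: inner_diff_left algebra_simps)
    ultimately have "\<bar>?A t - ?C t\<bar> \<le> (d * e) * norm u + (e + (d * norm u) * e) * R + b / 2"
      using 1 by (simp add: algebra_simps abs_le_iff)
    then show "\<bar>?A t - ?C t\<bar> \<le> e * (d * norm u + R * (1 + d * norm u)) + b / 2"
      by (simp add: algebra_simps)
  qed
  finally show ?thesis .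
qed

text \<open>A compact set that contains the graphs of all iterates: there \<open>\<omega>'\<close>
  in a fixed direction is bounded and uniformly continuous, which the hypotheses do not provide on
  the open cylinder.\<close>

abbreviation "KK \<equiv> cball (0::'a) R \<times> {-(c/2)..c/2}"

lemma KK: "compact KK" "KK \<subseteq> UNIV \<times> I" "y \<in> B \<Longrightarrow> (y, Fs n y) \<in> KK" "y \<in> B \<Longrightarrow> (y, F y) \<in> KK"
proof -
  show "compact KK" by (intro compact_Times compact_cball compact_Icc)
  show "KK \<subseteq> UNIV \<times> I" using c by auto
  show "(y, Fs n y) \<in> KK" if "y \<in> B" using that Fs_bd[OF that, of n] dy_c[OF that] by (auto simp: abs_le_iff)
  show "(y, F y) \<in> KK" if "y \<in> B" using that F_bd[OF that] dy_c[OF that] by (auto simp: abs_le_iff)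
qed

lemma Ps_conv: assumes "e > 0" shows "\<exists>N. \<forall>n\<ge>N. \<forall>y\<in>B. \<bar>Ps n u y - \<omega> y (F y) \<bullet> u\<bar> \<le> e"
proof -
  let ?D = "\<lambda>h p. (\<lambda>(y, s). \<omega>' y s h) p"
  let ?K = "d * norm u + R * (1 + d * norm u)"
  have K0: "?K > 0"
  proof -
    have "1 + d * norm u > 0" by (intro add_pos_nonneg mult_nonneg_nonneg d) auto
    then have "R * (1 + d * norm u) > 0" using R by simp
    then show ?thesis using mult_nonneg_nonneg[OF d norm_ge_zero[of u]] by linarith
  qed
  have cD: "continuous_on KK (?D h)" for h by (rule continuous_on_subset[OF cont' KK(2)])
  have uc: "uniformly_continuous_on KK (?D h)" for h by (rule compact_uniformly_continuous[OF cD KK(1)])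
  have "bounded (?D h ` KK)" for h by (intro compact_imp_bounded compact_continuous_image cD KK(1))
  then have "\<exists>M. \<forall>p\<in>KK. norm (?D h p) \<le> M" for h by (auto simp: bounded_iff)
  then obtain M1 M2 where M: "\<forall>p\<in>KK. norm (?D (u, 0) p) \<le> M1" "\<forall>p\<in>KK. norm (?D (0, 1) p) \<le> M2" by metis
  show ?thesis
  proof (rule halving_converges[OF _ _ _ assms, where C="d * norm u" and M="Max {c, 2 * M1, 2 * M2} * ?K"])
  show "\<bar>Ps 0 u y - \<omega> y (F y) \<bullet> u\<bar> \<le> d * norm u" if "y \<in> B" for y
    using bd[OF F_I[OF that], of y] by (auto intro!: order_trans[OF Cauchy_Schwarz_ineq2] mult_right_mono)
  show "\<bar>Ps (Suc n) u y - \<omega> y (F y) \<bullet> u\<bar> \<le> (Max {c, 2 * M1, 2 * M2} * ?K) + b / 2"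
    if b: "\<And>y. y \<in> B \<Longrightarrow> \<bar>Ps n u y - \<omega> y (F y) \<bullet> u\<bar> \<le> b" and y: "y \<in> B" for n b y
  proof (rule Ps_step[OF b _ _ _ y])
    fix z :: 'a assume z: "z \<in> B"
    have "\<bar>Fs n z - F z\<bar> \<le> c" using KK(3)[OF z, of n] KK(4)[OF z] by auto
    then show "\<bar>Fs n z - F z\<bar> \<le> Max {c, 2 * M1, 2 * M2}" by (rule order_trans) simp
    have "norm (?D (u, 0) (z, Fs n z) - ?D (u, 0) (z, F z)) \<le> M1 + M1"
      using M(1) KK(3)[OF z, of n] KK(4)[OF z] by (intro order_trans[OF norm_triangle_ineq4] add_mono) blast+
    then show "norm (\<omega>' z (Fs n z) (u, 0) - \<omega>' z (F z) (u, 0)) \<le> Max {c, 2 * M1, 2 * M2}"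
      by (simp add: le_max_iff_disj)
    have "norm (?D (0, 1) (z, Fs n z) - ?D (0, 1) (z, F z)) \<le> M2 + M2"
      using M(2) KK(3)[OF z, of n] KK(4)[OF z] by (intro order_trans[OF norm_triangle_ineq4] add_mono) blast+
    then show "norm (\<omega>' z (Fs n z) (0, 1) - \<omega>' z (F z) (0, 1)) \<le> Max {c, 2 * M1, 2 * M2}"
      by (simp add: le_max_iff_disj)
  qed
  show "\<exists>N. \<forall>n\<ge>N. \<forall>b. (\<forall>y\<in>B. \<bar>Ps n u y - \<omega> y (F y) \<bullet> u\<bar> \<le> b) \<longrightarrow> (\<forall>y\<in>B. \<bar>Ps (Suc n) u y - \<omega> y (F y) \<bullet> u\<bar> \<le> \<epsilon> + b / 2)"
    if \<epsilon>: "\<epsilon> > 0" for \<epsilon>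
  proof -
    define e' where "e' = \<epsilon> / ?K"
    have e': "e' > 0" using \<epsilon> K0 by (simp add: e'_def)
    obtain d1 where d1: "d1 > 0" "\<forall>p\<in>KK. \<forall>q\<in>KK. dist q p < d1 \<longrightarrow> dist (?D (u, 0) q) (?D (u, 0) p) < e'"
      using uc[of "(u, 0)"] e' unfolding uniformly_continuous_on_def by meson
    obtain d2 where d2: "d2 > 0" "\<forall>p\<in>KK. \<forall>q\<in>KK. dist q p < d2 \<longrightarrow> dist (?D (0, 1) q) (?D (0, 1) p) < e'"
      using uc[of "(0, 1)"] e' unfolding uniformly_continuous_on_def by meson
    obtain N where N: "\<forall>n\<ge>N. \<forall>y\<in>B. \<bar>Fs n y - F y\<bar> < min e' (min d1 d2)" using F_close[of "min e' (min d1 d2)"] e' d1 d2 by auto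
    show ?thesis
    proof (intro exI[of _ N] allI impI ballI)
      fix n b y assume n: "n \<ge> N" and b: "\<forall>y\<in>B. \<bar>Ps n u y - \<omega> y (F y) \<bullet> u\<bar> \<le> b" and y: "y \<in> B"
      have "\<bar>Ps (Suc n) u y - \<omega> y (F y) \<bullet> u\<bar> \<le> e' * ?K + b / 2"
      proof (rule Ps_step[OF _ _ _ _ y])
        fix z :: 'a assume z: "z \<in> B"
        show "\<bar>Ps n u z - \<omega> z (F z) \<bullet> u\<bar> \<le> b" using b z by blast
        have m: "\<bar>Fs n z - F z\<bar> < min e' (min d1 d2)" using N n z by blast
        then show "\<bar>Fs n z - F z\<bar> \<le> e'" by simp
        have "dist (z, Fs n z) (z, F z) < min d1 d2" using m by (simp add: dist_Pair_Pair dist_real_def)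
        then have "dist (?D (u, 0) (z, Fs n z)) (?D (u, 0) (z, F z)) < e'" "dist (?D (0, 1) (z, Fs n z)) (?D (0, 1) (z, F z)) < e'"
          using d1(2) d2(2) KK(3)[OF z, of n] KK(4)[OF z] by (meson min_less_iff_conj)+
        then show "norm (\<omega>' z (Fs n z) (u, 0) - \<omega>' z (F z) (u, 0)) \<le> e'" "norm (\<omega>' z (Fs n z) (0, 1) - \<omega>' z (F z) (0, 1)) \<le> e'"
          by (simp_all add: dist_norm)
      qed
      also have "e' * ?K = \<epsilon>" using K0 by (simp add: e'_def)
      finally show "\<bar>Ps (Suc n) u y - \<omega> y (F y) \<bullet> u\<bar> \<le> \<epsilon> + b / 2" .
    qed
  qed
  qed
qed

lemma F_line:
  assumes "y + s *\<^sub>R u \<in> B"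
  shows "((\<lambda>s. F (y + s *\<^sub>R u)) has_real_derivative \<omega> (y + s *\<^sub>R u) (F (y + s *\<^sub>R u)) \<bullet> u) (at s)"
proof -
  let ?U = "{s. y + s *\<^sub>R u \<in> B}"
  have s: "s \<in> ?U" using assms by simp
  have "\<exists>g. \<forall>x\<in>?U. (\<lambda>n. Fs n (y + x *\<^sub>R u)) \<longlonglongrightarrow> g x \<and>
     (g has_derivative (\<lambda>h. (\<omega> (y + x *\<^sub>R u) (F (y + x *\<^sub>R u)) \<bullet> u) * h)) (at x within ?U)"
  proof (rule has_derivative_sequence[OF line_open(2) _ _ s F_lim])
    fix n x assume "x \<in> ?U"
    then show "((\<lambda>s. Fs n (y + s *\<^sub>R u)) has_derivative (\<lambda>h. Ps n u (y + x *\<^sub>R u) * h)) (at x within ?U)"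
      using Fs_deriv[of y x u n] by (simp add: has_field_derivative_def has_derivative_at_withinI)
  next
    fix e :: real assume e: "e > 0"
    obtain N where N: "\<forall>n\<ge>N. \<forall>y\<in>B. \<bar>Ps n u y - \<omega> y (F y) \<bullet> u\<bar> \<le> e" using Ps_conv[OF e] by blast
    have "norm (Ps n u (y + x *\<^sub>R u) * h - \<omega> (y + x *\<^sub>R u) (F (y + x *\<^sub>R u)) \<bullet> u * h) \<le> e * norm h"
      if "n \<ge> N" "x \<in> ?U" for n x h
    proof -
      have "\<bar>Ps n u (y + x *\<^sub>R u) - \<omega> (y + x *\<^sub>R u) (F (y + x *\<^sub>R u)) \<bullet> u\<bar> * \<bar>h\<bar> \<le> e * \<bar>h\<bar>"
        using N[rule_format, OF that(1), of "y + x *\<^sub>R u"] that(2) by (intro mult_right_mono) auto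
      then show ?thesis by (simp add: left_diff_distrib[symmetric] abs_mult)
    qed
    then show "\<forall>\<^sub>F n in sequentially. \<forall>x\<in>?U. \<forall>h. norm (Ps n u (y + x *\<^sub>R u) * h - \<omega> (y + x *\<^sub>R u) (F (y + x *\<^sub>R u)) \<bullet> u * h) \<le> e * norm h"
      unfolding eventually_sequentially by blast
  qed (use assms in simp)
  then obtain g where g: "\<And>x. x \<in> ?U \<Longrightarrow> (\<lambda>n. Fs n (y + x *\<^sub>R u)) \<longlonglongrightarrow> g x"
     "(g has_derivative (\<lambda>h. (\<omega> (y + s *\<^sub>R u) (F (y + s *\<^sub>R u)) \<bullet> u) * h)) (at s within ?U)" using s by blast
  have "g x = F (y + x *\<^sub>R u)" if "x \<in> ?U" for x
    using LIMSEQ_unique[OF g(1)[OF that] F_lim] that by simp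
  then have "((\<lambda>s. F (y + s *\<^sub>R u)) has_derivative (\<lambda>h. (\<omega> (y + s *\<^sub>R u) (F (y + s *\<^sub>R u)) \<bullet> u) * h)) (at s within ?U)"
    using has_derivative_transform[OF s _ g(2)] by simp
  then show ?thesis using at_within_open[OF s line_open(1)] by (simp add: has_field_derivative_def)
qed

lemma F_deriv: "y \<in> B \<Longrightarrow> (F has_derivative (\<lambda>h. \<omega> y (F y) \<bullet> h)) (at y)"
  by (rule gradient_of_directional[OF open_ball _ _ p_cont]) (use F_line[where s=0] in auto)

lemma F_0: "F 0 = 0" using F_bd[of 0] R by simp

end

text \<open>Radial primitive of a closed form. Its derivative in direction u is an integral over a
  ray whose integrand is, by \<open>sym\<close>, the t-derivative of t (\<open>\<beta>\<close>(t y)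
  . u).\<close>

lemma poincare:
  fixes \<beta> :: "'a::euclidean_space \<Rightarrow> 'a"
  assumes B: "open B" "convex B" "0 \<in> B"
    and der: "\<And>y. y \<in> B \<Longrightarrow> (\<beta> has_derivative \<beta>' y) (at y)"
    and cont': "\<And>h. continuous_on B (\<lambda>y. \<beta>' y h)"
    and sym: "\<And>y u v. y \<in> B \<Longrightarrow> \<beta>' y v \<bullet> u = \<beta>' y u \<bullet> v"
  shows "\<exists>\<Phi>. \<Phi> 0 = 0 \<and> (\<forall>y\<in>B. (\<Phi> has_derivative (\<lambda>h. \<beta> y \<bullet> h)) (at y))"
proof -
  define \<Phi> where "\<Phi> y = integral (cbox 0 1) (\<lambda>t. \<beta> (t *\<^sub>R y) \<bullet> y)" for y
  have cont: "continuous_on B \<beta>" by (rule continuous_at_imp_continuous_on) (use der has_derivative_continuous in blast)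
  have star: "t *\<^sub>R y \<in> B" if "y \<in> B" "t \<in> {0..1}" for t y
    using convexD_alt[OF B(2,3) that(1), of t] that(2) by simp
  have sc: "\<beta>' y (t *\<^sub>R u) = t *\<^sub>R \<beta>' y u" if "y \<in> B" for y t u
    using der[OF that] has_derivative_linear linear_scale by blast
  have "(\<Phi> has_derivative (\<lambda>h. \<beta> y \<bullet> h)) (at y)" if "y \<in> B" for y
  proof (rule gradient_of_directional[OF B(1) that _ cont])
    fix z u assume z: "z \<in> B"
    let ?U = "{s. z + s *\<^sub>R u \<in> B}"
    let ?K = "\<lambda>y t. \<beta> (t *\<^sub>R y) \<bullet> u + t * (\<beta>' (t *\<^sub>R y) u \<bullet> y)"
    have s: "(0::real) \<in> ?U" using z by simp
    have "?U = (\<lambda>s. z + s *\<^sub>R u) -` B" by auto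
    moreover have "open ((\<lambda>s. z + s *\<^sub>R u) -` B)" by (intro continuous_open_vimage B) (auto intro!: continuous_intros)
    ultimately have oU: "open ?U" by simp
    have cU: "convex ?U"
    proof (rule convexI)
      fix a b p q :: real assume h: "a \<in> ?U" "b \<in> ?U" "0 \<le> p" "0 \<le> q" "p + q = 1"
      have "p *\<^sub>R (z + a *\<^sub>R u) + q *\<^sub>R (z + b *\<^sub>R u) \<in> B" using convexD[OF B(2)] h by auto
      moreover have "p *\<^sub>R (z + a *\<^sub>R u) + q *\<^sub>R (z + b *\<^sub>R u) = (p + q) *\<^sub>R z + (p * a + q * b) *\<^sub>R u" by (simp add: algebra_simps)
      ultimately show "p *\<^sub>R a + q *\<^sub>R b \<in> ?U" using h(5) by simp
    qed
    have c0: "continuous_on (B \<times> {0..1}) (\<lambda>p. \<beta> (snd p *\<^sub>R fst p))"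
      by (rule continuous_on_compose2[OF cont]) (auto intro!: continuous_intros star)
    have c1: "continuous_on (B \<times> {0..1}) (\<lambda>p. \<beta>' (snd p *\<^sub>R fst p) u)"
      by (rule continuous_on_compose2[OF cont']) (auto intro!: continuous_intros star)
    have "((\<lambda>s. integral (cbox 0 1) (\<lambda>t. \<beta> (t *\<^sub>R (z + s *\<^sub>R u)) \<bullet> (z + s *\<^sub>R u))) has_real_derivative
        integral (cbox 0 1) (?K (z + 0 *\<^sub>R u))) (at 0 within ?U)"
    proof (rule leibniz_rule_field_derivative[where U="?U" and fx="\<lambda>s t. ?K (z + s *\<^sub>R u) t", OF _ _ _ s cU])
      fix x t :: real assume x: "x \<in> ?U" and t: "t \<in> cbox 0 1"
      have zB: "t *\<^sub>R (z + x *\<^sub>R u) \<in> B" using star x t by simp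
      have 2: "((\<lambda>s. t *\<^sub>R (z + s *\<^sub>R u)) has_derivative (\<lambda>h. h *\<^sub>R (t *\<^sub>R u))) (at x)"
        by (auto intro!: derivative_eq_intros simp: algebra_simps)
      have 3: "((\<lambda>s. \<beta> (t *\<^sub>R (z + s *\<^sub>R u))) has_derivative (\<lambda>h. h *\<^sub>R t *\<^sub>R \<beta>' (t *\<^sub>R (z + x *\<^sub>R u)) u)) (at x)"
        using diff_chain_at[OF 2 der[OF zB]] by (simp add: comp_def sc[OF zB] del: scaleR_scaleR)
      have 4: "((\<lambda>s. z + s *\<^sub>R u) has_derivative (\<lambda>h. h *\<^sub>R u)) (at x)" by (auto intro!: derivative_eq_intros)
      have "((\<lambda>s. \<beta> (t *\<^sub>R (z + s *\<^sub>R u)) \<bullet> (z + s *\<^sub>R u)) has_real_derivative ?K (z + x *\<^sub>R u) t) (at x)"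
        unfolding has_field_derivative_def
        by (rule has_derivative_eq_rhs[OF has_derivative_inner[OF 3 4]]) (auto simp: algebra_simps)
      then show "((\<lambda>s. \<beta> (t *\<^sub>R (z + s *\<^sub>R u)) \<bullet> (z + s *\<^sub>R u)) has_real_derivative ?K (z + x *\<^sub>R u) t) (at x within ?U)"
        by (rule has_field_derivative_at_within)
    next
      fix x assume x: "x \<in> ?U"
      have "continuous_on {0..1} (\<lambda>t. \<beta> (t *\<^sub>R (z + x *\<^sub>R u)))"
        by (rule continuous_on_compose2[OF cont]) (use x star in \<open>auto intro!: continuous_intros\<close>)
      then show "(\<lambda>t. \<beta> (t *\<^sub>R (z + x *\<^sub>R u)) \<bullet> (z + x *\<^sub>R u)) integrable_on cbox 0 1"
        by (simp add: integrable_continuous_interval continuous_on_inner)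
    next
      have c2: "continuous_on (B \<times> {0..1}) (\<lambda>p. \<beta> (snd p *\<^sub>R fst p) \<bullet> u + snd p * (\<beta>' (snd p *\<^sub>R fst p) u \<bullet> fst p))"
        by (intro continuous_intros c0 c1)
      have "continuous_on (?U \<times> {0..1}) (\<lambda>p. (\<lambda>p. ?K (fst p) (snd p)) (z + fst p *\<^sub>R u, snd p))"
        by (rule continuous_on_compose2[OF c2]) (auto intro!: continuous_intros)
      then show "continuous_on (?U \<times> cbox 0 1) (\<lambda>(s, t). ?K (z + s *\<^sub>R u) t)"
        by (simp add: case_prod_unfold)
    qed
    then have D: "((\<lambda>s. \<Phi> (z + s *\<^sub>R u)) has_real_derivative integral {0..1} (?K z)) (at 0)"
      using at_within_open[OF s oU] by (simp add: \<Phi>_def)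
    have "(\<lambda>t. t * (\<beta> (t *\<^sub>R z) \<bullet> u)) 1 - (\<lambda>t. t * (\<beta> (t *\<^sub>R z) \<bullet> u)) 0 = integral {0..1} (?K z)"
    proof (rule ftc01)
      fix t :: real assume t: "t \<in> {0..1}"
      have 1: "((\<lambda>t. t *\<^sub>R z) has_derivative (\<lambda>h. h *\<^sub>R z)) (at t)" by (auto intro!: derivative_eq_intros)
      have 3: "((\<lambda>t. \<beta> (t *\<^sub>R z)) has_derivative (\<lambda>h. h *\<^sub>R \<beta>' (t *\<^sub>R z) z)) (at t)"
        using diff_chain_at[OF 1 der[OF star[OF z t]]] by (simp add: comp_def sc[OF star[OF z t]])
      have "((\<lambda>t. t * (\<beta> (t *\<^sub>R z) \<bullet> u)) has_derivative (\<lambda>h. h * (\<beta> (t *\<^sub>R z) \<bullet> u + t * (\<beta>' (t *\<^sub>R z) z \<bullet> u)))) (at t)"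
        by (rule has_derivative_eq_rhs[OF has_derivative_mult[OF has_derivative_ident has_derivative_inner_left[OF 3]]]) (auto simp: algebra_simps)
      then show "((\<lambda>t. t * (\<beta> (t *\<^sub>R z) \<bullet> u)) has_real_derivative ?K z t) (at t within {0..1})"
        unfolding sym[OF star[OF z t], of z u] by (simp add: has_field_derivative_def mult_commute_abs has_derivative_at_withinI)
    qed
    then have "integral {0..1} (?K z) = \<beta> z \<bullet> u" by simp
    then show "((\<lambda>s. \<Phi> (z + s *\<^sub>R u)) has_real_derivative \<beta> z \<bullet> u) (at 0)" using D by simp
  qed
  moreover have "\<Phi> 0 = 0" by (simp add: \<Phi>_def)
  ultimately show ?thesis by blast
qed

section \<open>Difference quotients along a lattice vector\<close>

text \<open>
  The flag \<open>z\<close> selects between the estimates \<open>o(1)\<close> (true) and \<open>O(1)\<close> (false), so that sums and products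
  need be treated only once.
\<close>

definition seq_class :: "bool \<Rightarrow> (nat \<Rightarrow> real) \<Rightarrow> bool" where
  "seq_class z s \<longleftrightarrow> (if z then s \<longlonglongrightarrow> 0 else Bseq s)"

lemma seq_class_le:
  assumes "seq_class z s" "\<forall>\<^sub>F n in sequentially. \<bar>t n\<bar> \<le> \<bar>s n\<bar>"
  shows "seq_class z t"
proof (cases z)
  case True
  then have "(\<lambda>n. \<bar>s n\<bar>) \<longlonglongrightarrow> 0" using assms(1) by (simp add: seq_class_def tendsto_rabs_zero)
  then have "t \<longlonglongrightarrow> 0" by (rule Lim_null_comparison[rotated]) (use assms(2) in simp)
  then show ?thesis using True by (simp add: seq_class_def)
next
  case False
  then obtain K where K: "K > 0" "\<forall>\<^sub>F n in sequentially. norm (s n) \<le> K"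
    using assms(1) by (auto simp: seq_class_def Bfun_def)
  have "\<forall>\<^sub>F n in sequentially. norm (t n) \<le> K"
    using K(2) assms(2) by eventually_elim auto
  then have "Bseq t" using K(1) unfolding Bfun_def by blast
  then show ?thesis using False by (simp add: seq_class_def)
qed

lemma seq_class_cong_ev:
  assumes "seq_class z s" "\<forall>\<^sub>F n in sequentially. t n = s n" shows "seq_class z t"
  by (rule seq_class_le[OF assms(1)]) (use assms(2) in \<open>auto elim: eventually_mono\<close>)

lemma seq_class_weaken: "seq_class z s \<Longrightarrow> seq_class False s"
  using convergent_imp_Bseq[OF convergentI] by (cases z) (auto simp: seq_class_def)

lemma Bseq_plus2:
  fixes s t :: "nat \<Rightarrow> 'b::real_normed_vector"
  assumes "Bseq s" "Bseq t" shows "Bseq (\<lambda>n. s n + t n)"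
  using bounded_plus_comp[of s UNIV t] assms by (simp add: Bseq_eq_bounded)

lemma seq_class_add: "seq_class z s \<Longrightarrow> seq_class z t \<Longrightarrow> seq_class z (\<lambda>n. s n + t n)"
  by (cases z) (auto simp: seq_class_def Bseq_plus2 intro: tendsto_add_zero)

text \<open>The disjunction of the flags encodes that o(1) times O(1) is o(1).\<close>

lemma seq_class_mult:
  assumes "seq_class a s" "seq_class b t" shows "seq_class (a \<or> b) (\<lambda>n. s n * t n)"
proof -
  have 1: "seq_class True (\<lambda>n. s n * t n)" if "seq_class True s" "seq_class False t" for s t
  proof -
    have "Zfun s sequentially" "Bfun t sequentially"
      using that by (auto simp: seq_class_def tendsto_Zfun_iff)
    then have "Zfun (\<lambda>n. s n * t n) sequentially"
      by (rule bounded_bilinear.Zfun_prod_Bfun[OF bounded_bilinear_mult])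
    then show ?thesis by (simp add: seq_class_def tendsto_Zfun_iff)
  qed
  show ?thesis
  proof (cases a)
    case True then show ?thesis using 1[of s t] assms seq_class_weaken by auto
  next
    case False
    show ?thesis
    proof (cases b)
      case True then show ?thesis using 1[of t s] assms seq_class_weaken by (auto simp: mult.commute)
    next
      case False then show ?thesis using \<open>\<not> a\<close> assms Bseq_mult[of s t] by (auto simp: seq_class_def)
    qed
  qed
qed

lemma seq_class_const0[simp]: "seq_class z (\<lambda>n. 0)" by (simp add: seq_class_def)

lemma Bseq_scale01:
  fixes v :: "nat \<Rightarrow> 'b::real_normed_vector"
  assumes "Bseq v" "\<And>n. t n \<in> {0..1::real}" shows "Bseq (\<lambda>n. t n *\<^sub>R v n)"
proof -
  obtain K where K: "K > 0" "\<And>n. norm (v n) \<le> K" using assms(1) by (auto simp: Bseq_def)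
  have "norm (t n *\<^sub>R v n) \<le> 1 * K" for n
    unfolding norm_scaleR using assms(2)[of n] K by (intro mult_mono) auto
  then show ?thesis using K(1) by (auto simp: Bseq_def)
qed

text \<open>Replaces an integral by a single value of the integrand, so that estimates of integrals
  reduce to estimates along a sequence of parameters.\<close>

lemma integral_bound_attained:
  fixes f :: "real \<Rightarrow> real"
  assumes "continuous_on {0..1} f"
  shows "\<exists>s\<in>{0..1}. \<bar>integral {0..1} f\<bar> \<le> \<bar>f s\<bar>"
proof -
  obtain s where s: "s \<in> {0..1}" "\<forall>t\<in>{0..1}. \<bar>f t\<bar> \<le> \<bar>f s\<bar>"
    using continuous_attains_sup[of "{0..1::real}" "\<lambda>t. \<bar>f t\<bar>"] continuous_on_rabs[OF assms] by auto
  have "norm (integral {0..1} f) \<le> \<bar>f s\<bar> * (1 - 0)"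
    by (rule integral_bound) (use s assms in auto)
  then show ?thesis using s by auto
qed

text \<open>
  Uniformity in \<open>y\<close> and \<open>s\<close> is expressed by arbitrary sequences of arguments.
\<close>

primrec param_class :: "real \<Rightarrow> bool \<Rightarrow> nat \<Rightarrow> (nat \<Rightarrow> 'a::topological_space \<Rightarrow> real \<Rightarrow> real) \<Rightarrow> bool" where
  "param_class c z 0 \<phi> \<longleftrightarrow> (\<forall>n. continuous_on (UNIV \<times> {-c<..<c}) (\<lambda>(y, s). \<phi> n y s)) \<and>
     (\<forall>y s. (\<forall>n. s n \<in> {-c<..<c}) \<longrightarrow> seq_class z (\<lambda>n. \<phi> n (y n) (s n)))"
| "param_class c z (Suc j) \<phi> \<longleftrightarrow> (\<forall>n. continuous_on (UNIV \<times> {-c<..<c}) (\<lambda>(y, s). \<phi> n y s)) \<and>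
     (\<forall>y s. (\<forall>n. s n \<in> {-c<..<c}) \<longrightarrow> seq_class z (\<lambda>n. \<phi> n (y n) (s n))) \<and>
     (\<forall>n y. \<forall>s\<in>{-c<..<c}. \<phi> n y differentiable (at s)) \<and> param_class c z j (\<lambda>n y. deriv (\<phi> n y))"

lemma param_class_0: "param_class c z j \<phi> \<Longrightarrow> param_class c z 0 \<phi>" by (cases j) auto

lemma param_class_mono: "param_class c z j \<phi> \<Longrightarrow> i \<le> j \<Longrightarrow> param_class c z i \<phi>"
proof (induction j arbitrary: i \<phi>)
  case (Suc j) then show ?case by (cases i) auto
qed auto

lemma param_class_cont2:
  assumes "param_class c z j \<phi>" shows "continuous_on (UNIV \<times> {-c<..<c}) (\<lambda>(y, s). \<phi> n y s)"
  using param_class_0[OF assms] by auto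

lemma param_class_cont:
  assumes "param_class c z j \<phi>" shows "continuous_on {-c<..<c} (\<phi> n y)"
proof -
  have "continuous_on {-c<..<c} ((\<lambda>(y, s). \<phi> n y s) \<circ> (\<lambda>s. (y, s)))"
    by (rule continuous_on_compose[OF _ continuous_on_subset[OF param_class_cont2[OF assms]]]) (auto intro!: continuous_intros)
  then show ?thesis by (simp add: comp_def)
qed

lemma param_class_weaken: "param_class c z j \<phi> \<Longrightarrow> param_class c False j \<phi>"
  by (induction j arbitrary: \<phi>) (auto intro!: seq_class_weaken[of z])

text \<open>Periodicity in the first argument alone: translating y by \<open>p\<close> then affects
  \<open>\<phi> n y (x n y)\<close> only through the height \<open>x n y\<close>.\<close>

definition periodic :: "real \<Rightarrow> 'a::ab_group_add \<Rightarrow> (nat \<Rightarrow> 'a \<Rightarrow> real \<Rightarrow> real) \<Rightarrow> bool" where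
  "periodic c p \<phi> \<longleftrightarrow> (\<forall>n y. \<forall>s\<in>{-c<..<c}. \<phi> n (y + p) s = \<phi> n y s)"

lemma periodic_deriv: "periodic c p \<phi> \<Longrightarrow> periodic c p (\<lambda>n y. deriv (\<phi> n y))"
  unfolding periodic_def
proof (intro allI ballI)
  fix n y s assume h: "\<forall>n y. \<forall>s\<in>{-c<..<c}. \<phi> n (y + p) s = \<phi> n y s" and s: "s \<in> {-c<..<c}"
  have "\<forall>\<^sub>F t in nhds s. \<phi> n (y + p) t = \<phi> n y t"
    using eventually_nhds_in_open[OF open_greaterThanLessThan s] by (rule eventually_mono) (use h in blast)
  then show "deriv (\<phi> n (y + p)) s = deriv (\<phi> n y) s" by (rule deriv_cong_ev) simp
qed

text \<open>Hadamard's form of an increment. The remaining factor is again a composition, now with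
  \<open>deriv f\<close>, and so is open to the same estimates one order lower.\<close>

lemma increment_integral:
  fixes f :: "real \<Rightarrow> real"
  assumes "convex I" "open I" "\<And>s. s \<in> I \<Longrightarrow> f differentiable (at s)" "continuous_on I (deriv f)" "a \<in> I" "b \<in> I"
  shows "f b - f a = (b - a) * integral {0..1} (\<lambda>t. deriv f (a + t * (b - a)))"
    and "continuous_on {0..1} (\<lambda>t. deriv f (a + t * (b - a)))"
proof -
  have m: "a + t * (b - a) \<in> I" if "t \<in> {0..1}" for t
  proof -
    have "(1 - t) *\<^sub>R a + t *\<^sub>R b \<in> I" using assms(1,5,6) that by (auto simp: convex_alt)
    then show ?thesis by (simp add: algebra_simps)
  qed
  show c: "continuous_on {0..1} (\<lambda>t. deriv f (a + t * (b - a)))"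
    by (rule continuous_on_compose2[OF assms(4)]) (auto intro!: continuous_intros m)
  have "((\<lambda>t. deriv f (a + t * (b - a)) * (b - a)) has_integral f (a + 1 * (b - a)) - f (a + 0 * (b - a))) {0..1}"
  proof (rule fundamental_theorem_of_calculus)
    fix t :: real assume t: "t \<in> {0..1}"
    have "(f has_real_derivative deriv f (a + t * (b - a))) (at (a + t * (b - a)))"
      using assms(3)[OF m[OF t]] by (simp add: DERIV_deriv_iff_real_differentiable)
    then have "((\<lambda>t. f (a + t * (b - a))) has_real_derivative deriv f (a + t * (b - a)) * (b - a)) (at t within {0..1})"
      by (rule DERIV_chain2) (auto intro!: derivative_eq_intros)
    then show "((\<lambda>t. f (a + t * (b - a))) has_vector_derivative deriv f (a + t * (b - a)) * (b - a)) (at t within {0..1})"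
      by (simp add: has_real_derivative_iff_has_vector_derivative)
  qed simp
  from integral_unique[OF this] have "integral {0..1} (\<lambda>t. deriv f (a + t * (b - a))) * (b - a) = f b - f a"
    by simp
  then show "f b - f a = (b - a) * integral {0..1} (\<lambda>t. deriv f (a + t * (b - a)))"
    by (simp add: mult.commute)
qed

text \<open>
  For \<open>\<alpha> n y = F n (y + l) - F n y\<close> the operator \<open>Q\<close> is a difference quotient in the variable \<open>F n y\<close>
  transverse to the leaves. It does not commute with translations: the factor is the ratio \<open>cocycle\<close>,
  and \<open>cocycle_trivial j\<close> says that this factor is negligible in computations with fewer than \<open>j\<close> further
  applications of \<open>Q\<close>.
\<close>

locale diff_quot =
  fixes l :: "'a::euclidean_space" and \<alpha> :: "nat \<Rightarrow> 'a \<Rightarrow> real"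
  assumes alpha_nz: "Bseq y \<Longrightarrow> \<forall>\<^sub>F n in sequentially. \<alpha> n (y n) \<noteq> 0"
begin

definition Q :: "(nat \<Rightarrow> 'a \<Rightarrow> real) \<Rightarrow> nat \<Rightarrow> 'a \<Rightarrow> real" where
  "Q x n y = (x n (y + l) - x n y) / \<alpha> n y"

text \<open>The arguments are bounded sequences because the functions are meaningful only on balls
  that grow with n.\<close>

primrec quot_class :: "bool \<Rightarrow> nat \<Rightarrow> (nat \<Rightarrow> 'a \<Rightarrow> real) \<Rightarrow> bool" where
  "quot_class z 0 x \<longleftrightarrow> (\<forall>y. Bseq y \<longrightarrow> seq_class z (\<lambda>n. x n (y n)))"
| "quot_class z (Suc j) x \<longleftrightarrow> (\<forall>y. Bseq y \<longrightarrow> seq_class z (\<lambda>n. x n (y n))) \<and> quot_class z j (Q x)"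

text \<open>Division by \<open>\<alpha>\<close> and the leaf equation are legitimate only for large
  n, with a threshold depending on the bounded sequence, so identities are stated up to this
  relation.\<close>

definition eqv :: "(nat \<Rightarrow> 'a \<Rightarrow> real) \<Rightarrow> (nat \<Rightarrow> 'a \<Rightarrow> real) \<Rightarrow> bool" where
  "eqv x x' \<longleftrightarrow> (\<forall>y. Bseq y \<longrightarrow> (\<forall>\<^sub>F n in sequentially. x n (y n) = x' n (y n)))"

definition lim :: "nat \<Rightarrow> (nat \<Rightarrow> 'a \<Rightarrow> real) \<Rightarrow> real \<Rightarrow> bool" where
  "lim j x c \<longleftrightarrow> (\<forall>y. Bseq y \<longrightarrow> (\<lambda>n. (Q ^^ j) x n (y n)) \<longlonglongrightarrow> c)"

definition translate :: "(nat \<Rightarrow> 'a) \<Rightarrow> (nat \<Rightarrow> 'a \<Rightarrow> real) \<Rightarrow> nat \<Rightarrow> 'a \<Rightarrow> real" where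
  "translate v x n y = x n (y + v n)"

definition cocycle :: "(nat \<Rightarrow> 'a) \<Rightarrow> nat \<Rightarrow> 'a \<Rightarrow> real" where
  "cocycle v n y = \<alpha> n (y + v n) / \<alpha> n y"

abbreviation cocycle_trivial :: "nat \<Rightarrow> bool" where
  "cocycle_trivial j \<equiv> (\<forall>i<j. \<forall>v. Bseq v \<longrightarrow> quot_class True i (\<lambda>n y. cocycle v n y - 1))"

lemma quot_class_0: "quot_class z j x \<Longrightarrow> Bseq y \<Longrightarrow> seq_class z (\<lambda>n. x n (y n))"
  by (cases j) auto

lemma quot_class_mono: "quot_class z j x \<Longrightarrow> i \<le> j \<Longrightarrow> quot_class z i x"
proof (induction j arbitrary: i x)
  case (Suc j) then show ?case by (cases i) auto
qed auto

lemma eqv_Q: "eqv x x' \<Longrightarrow> eqv (Q x) (Q x')"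
  unfolding eqv_def Q_def
proof (intro allI impI)
  fix y :: "nat \<Rightarrow> 'a"
  assume h: "\<forall>y. Bseq y \<longrightarrow> (\<forall>\<^sub>F n in sequentially. x n (y n) = x' n (y n))" and y: "Bseq y"
  have "\<forall>\<^sub>F n in sequentially. x n (y n) = x' n (y n)" using h y by blast
  moreover have "\<forall>\<^sub>F n in sequentially. x n (y n + l) = x' n (y n + l)"
    using h Bseq_add[OF y, of l] by blast
  ultimately show "\<forall>\<^sub>F n in sequentially. (x n (y n + l) - x n (y n)) / \<alpha> n (y n)
      = (x' n (y n + l) - x' n (y n)) / \<alpha> n (y n)"
    by eventually_elim simp
qed

lemma eqv_Qn: "eqv x x' \<Longrightarrow> eqv ((Q ^^ j) x) ((Q ^^ j) x')"
  by (induction j) (auto intro: eqv_Q)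

lemma quot_class_cong: "quot_class z j x \<Longrightarrow> eqv x' x \<Longrightarrow> quot_class z j x'"
proof (induction j arbitrary: x x')
  case 0 then show ?case by (auto simp: eqv_def intro: seq_class_cong_ev)
next
  case (Suc j)
  then show ?case by (auto simp: eqv_def intro: seq_class_cong_ev dest: eqv_Q[unfolded eqv_def])
qed

lemma lim_cong: "lim j x c \<Longrightarrow> eqv x' x \<Longrightarrow> lim j x' c"
  unfolding lim_def using eqv_Qn[of x' x j]
  by (auto simp: eqv_def intro: Lim_transform_eventually[OF _ eventually_mono])

lemma quot_class_weaken: "quot_class z j x \<Longrightarrow> quot_class False j x"
  by (induction j arbitrary: x) (auto intro: seq_class_weaken)

lemma Q_add: "Q (\<lambda>n y. x n y + w n y) = (\<lambda>n y. Q x n y + Q w n y)"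
  by (auto simp: Q_def fun_eq_iff add_divide_distrib diff_divide_distrib)

lemma Q_const: "Q (\<lambda>n y. c n) = (\<lambda>n y. 0)"
  by (auto simp: Q_def fun_eq_iff)

lemma Q_cmult: "Q (\<lambda>n y. c n * x n y) = (\<lambda>n y. c n * Q x n y)"
  by (auto simp: Q_def fun_eq_iff algebra_simps)

lemma Qn_add: "(Q ^^ j) (\<lambda>n y. x n y + w n y) = (\<lambda>n y. (Q ^^ j) x n y + (Q ^^ j) w n y)"
  by (induction j) (auto simp: Q_add)

lemma Qn_cmult: "(Q ^^ j) (\<lambda>n y. c n * x n y) = (\<lambda>n y. c n * (Q ^^ j) x n y)"
  by (induction j) (auto simp: Q_cmult)

lemma quot_class_add: "quot_class z j x \<Longrightarrow> quot_class z j w \<Longrightarrow> quot_class z j (\<lambda>n y. x n y + w n y)"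
  by (induction j arbitrary: x w) (auto intro: seq_class_add simp: Q_add)

lemma quot_class_zero: "quot_class z j (\<lambda>n y. 0)"
  by (induction j) (auto simp: Q_const)

lemma quot_class_const: "seq_class z c \<Longrightarrow> quot_class z j (\<lambda>n y. c n)"
  by (cases j) (auto simp: Q_const quot_class_zero)

lemma quot_class_cmult: "seq_class False c \<Longrightarrow> quot_class z j x \<Longrightarrow> quot_class z j (\<lambda>n y. c n * x n y)"
proof (induction j arbitrary: x)
  case 0 then show ?case using seq_class_mult[of False c z] by auto
next
  case (Suc j) then show ?case using seq_class_mult[of False c z] by (auto simp: Q_cmult)
qed

lemma quot_class_lim: "quot_class True j x \<Longrightarrow> lim j x 0"
proof (induction j arbitrary: x)
  case 0 then show ?case by (auto simp: lim_def seq_class_def)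
next
  case (Suc j)
  have "lim j (Q x) 0" using Suc by simp
  then show ?case by (auto simp: lim_def funpow_Suc_right simp del: funpow.simps)
qed

lemma lim_add: "lim j x a \<Longrightarrow> lim j w b \<Longrightarrow> lim j (\<lambda>n y. x n y + w n y) (a + b)"
  by (auto simp: lim_def Qn_add intro!: tendsto_add)

text \<open>Leibniz rule of a difference quotient. One factor sits at the translated point, which is
  why stability under \<open>translate\<close> must accompany stability under products.\<close>

lemma Q_mult: "Q (\<lambda>n y. x n y * w n y) = (\<lambda>n y. Q x n y * w n y + translate (\<lambda>n. l) x n y * Q w n y)"
proof -
  have "(a' * b' - a * b) / d = (a' - a) / d * b + a' * ((b' - b) / d)" for a a' b b' d :: real
    by (cases "d = 0") (auto simp: field_simps)
  then show ?thesis by (simp add: Q_def translate_def fun_eq_iff)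
qed

lemma Q_tr:
  assumes "Bseq v" shows "eqv (Q (translate v x)) (\<lambda>n y. cocycle v n y * translate v (Q x) n y)"
  unfolding eqv_def
proof (intro allI impI)
  fix y :: "nat \<Rightarrow> 'a" assume "Bseq y"
  then have "\<forall>\<^sub>F n in sequentially. \<alpha> n (y n + v n) \<noteq> 0"
    using alpha_nz[of "\<lambda>n. y n + v n"] Bseq_plus2 assms by blast
  then show "\<forall>\<^sub>F n in sequentially. Q (translate v x) n (y n) = cocycle v n (y n) * translate v (Q x) n (y n)"
    by eventually_elim (simp add: Q_def translate_def cocycle_def add.assoc add.commute[of l])
qed

lemma cocycle_False: "cocycle_trivial j \<Longrightarrow> i < j \<Longrightarrow> Bseq v \<Longrightarrow> quot_class False i (cocycle v)"
proof -
  assume a: "cocycle_trivial j" "i < j" "Bseq v"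
  then have "quot_class False i (\<lambda>n y. (cocycle v n y - 1) + 1)"
    by (intro quot_class_add quot_class_const quot_class_weaken[of True]) (auto simp: seq_class_def)
  then show ?thesis by simp
qed

text \<open>A joint induction: products at order j + 1 need translates at order j, and translates at
  order j + 1 need the product of the cocycle with a translate at order j.\<close>

lemma quot_class_mult_tr:
  assumes "cocycle_trivial j"
  shows "(\<forall>a b x w. quot_class a j x \<longrightarrow> quot_class b j w \<longrightarrow> quot_class (a \<or> b) j (\<lambda>n y. x n y * w n y)) \<and>
    (\<forall>a x v. Bseq v \<longrightarrow> quot_class a j x \<longrightarrow> quot_class a j (translate v x))"
  using assms
proof (induction j)
  case 0
  then show ?case by (auto simp: translate_def intro!: seq_class_mult Bseq_plus2)
next
  case (Suc j)
  then have m: "\<And>a b x w. quot_class a j x \<Longrightarrow> quot_class b j w \<Longrightarrow> quot_class (a \<or> b) j (\<lambda>n y. x n y * w n y)"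
    and t: "\<And>a x v. Bseq v \<Longrightarrow> quot_class a j x \<Longrightarrow> quot_class a j (translate v x)" by auto
  have "quot_class (a \<or> b) (Suc j) (\<lambda>n y. x n y * w n y)" if "quot_class a (Suc j) x" "quot_class b (Suc j) w" for a b x w
  proof -
    have "quot_class (a \<or> b) j (\<lambda>n y. Q x n y * w n y)" "quot_class (a \<or> b) j (\<lambda>n y. translate (\<lambda>n. l) x n y * Q w n y)"
      using that quot_class_mono[OF that(1), of j] quot_class_mono[OF that(2), of j] by (auto intro!: m t)
    then show ?thesis using that by (auto simp: Q_mult intro!: seq_class_mult quot_class_add)
  qed
  moreover have "quot_class a (Suc j) (translate v x)" if "Bseq v" "quot_class a (Suc j) x" for a x v
  proof -
    have "quot_class (False \<or> a) j (\<lambda>n y. cocycle v n y * translate v (Q x) n y)"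
      by (intro m t cocycle_False[OF Suc.prems]) (use that in auto)
    then have "quot_class a j (Q (translate v x))" using quot_class_cong[OF _ Q_tr] that by auto
    then show ?thesis using that by (auto simp: translate_def Bseq_plus2)
  qed
  ultimately show ?case by auto
qed

lemma quot_class_mult: "cocycle_trivial j \<Longrightarrow> quot_class a j x \<Longrightarrow> quot_class b j w \<Longrightarrow> quot_class (a \<or> b) j (\<lambda>n y. x n y * w n y)"
  using quot_class_mult_tr by blast

lemma quot_class_tr: "cocycle_trivial j \<Longrightarrow> Bseq v \<Longrightarrow> quot_class a j x \<Longrightarrow> quot_class a j (translate v x)"
  using quot_class_mult_tr by blast

definition cont :: "(nat \<Rightarrow> real \<Rightarrow> 'a \<Rightarrow> real) \<Rightarrow> bool" where
  "cont x \<longleftrightarrow> (\<forall>y. Bseq y \<longrightarrow> (\<forall>\<^sub>F n in sequentially. continuous_on {0..1} (\<lambda>s. x n s (y n))))"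

lemma Q_integral:
  assumes "cont x"
  shows "eqv (Q (\<lambda>n y. integral {0..1} (\<lambda>s. x n s y)))
      (\<lambda>n y. integral {0..1} (\<lambda>s. Q (\<lambda>n. x n s) n y))"
    and "cont (\<lambda>n s. Q (\<lambda>n. x n s) n)"
proof -
  have c: "\<forall>\<^sub>F n in sequentially. continuous_on {0..1} (\<lambda>s. x n s (y n)) \<and> continuous_on {0..1} (\<lambda>s. x n s (y n + l))"
    if "Bseq y" for y
    using assms that Bseq_add[OF that, of l] unfolding cont_def by (auto intro: eventually_conj)
  have "\<forall>\<^sub>F n in sequentially. Q (\<lambda>n y. integral {0..1} (\<lambda>s. x n s y)) n (y n) = integral {0..1} (\<lambda>s. Q (\<lambda>n. x n s) n (y n))"
    if "Bseq y" for y
    using c[OF that]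
    by eventually_elim (auto simp: Q_def integrable_continuous_interval integral_divide integral_diff)
  then show "eqv (Q (\<lambda>n y. integral {0..1} (\<lambda>s. x n s y)))
      (\<lambda>n y. integral {0..1} (\<lambda>s. Q (\<lambda>n. x n s) n y))" by (auto simp: eqv_def)
  have "\<forall>\<^sub>F n in sequentially. continuous_on {0..1} (\<lambda>s. Q (\<lambda>n. x n s) n (y n))" if "Bseq y" for y
    using c[OF that]
    by eventually_elim (auto simp: Q_def divide_inverse intro!: continuous_intros)
  then show "cont (\<lambda>n s. Q (\<lambda>n. x n s) n)" by (auto simp: cont_def)
qed

lemma integral_pick:
  assumes "cont x" "Bseq y"
  shows "\<exists>s. (\<forall>n. s n \<in> {0..1}) \<and> (\<forall>\<^sub>F n in sequentially.
     \<bar>integral {0..1} (\<lambda>s. x n s (y n))\<bar> \<le> \<bar>x n (s n) (y n)\<bar>)"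
proof -
  have "\<forall>n. \<exists>s\<in>{0..1::real}. continuous_on {0..1} (\<lambda>s. x n s (y n)) \<longrightarrow>
     \<bar>integral {0..1} (\<lambda>s. x n s (y n))\<bar> \<le> \<bar>x n s (y n)\<bar>"
    using integral_bound_attained by (metis atLeastAtMost_iff order_refl zero_le_one)
  then obtain s where "\<forall>n. s n \<in> {0..1::real} \<and> (continuous_on {0..1} (\<lambda>s. x n s (y n)) \<longrightarrow>
     \<bar>integral {0..1} (\<lambda>s. x n s (y n))\<bar> \<le> \<bar>x n (s n) (y n)\<bar>)" by metis
  then show ?thesis using assms unfolding cont_def
    by (intro exI[of _ s]) (auto elim!: allE[of _ y] eventually_mono)
qed

text \<open>By \<open>integral_pick\<close> the integral is dominated by the integrand at a
  parameter depending on n; the premise admits arbitrary sequences of parameters for this purpose.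
  For higher orders Q passes under the integral.\<close>

lemma quot_class_integral:
  assumes "\<And>s. (\<And>n. s n \<in> {0..1}) \<Longrightarrow> quot_class z j (\<lambda>n y. x n (s n) y)" "cont x"
  shows "quot_class z j (\<lambda>n y. integral {0..1} (\<lambda>s. x n s y))"
  using assms
proof (induction j arbitrary: x)
  case 0
  show ?case unfolding quot_class.simps
  proof (intro allI impI)
    fix y :: "nat \<Rightarrow> 'a" assume y: "Bseq y"
    obtain s where s: "\<forall>n. s n \<in> {0..1}" "\<forall>\<^sub>F n in sequentially.
     \<bar>integral {0..1} (\<lambda>s. x n s (y n))\<bar> \<le> \<bar>x n (s n) (y n)\<bar>" using integral_pick[OF 0(2) y] by blast
    show "seq_class z (\<lambda>n. integral {0..1} (\<lambda>s. x n s (y n)))"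
      using seq_class_le[OF _ s(2)] 0(1)[of s] s(1) y by auto
  qed
next
  case (Suc j)
  have "quot_class z 0 (\<lambda>n y. integral {0..1} (\<lambda>s. x n s y))"
  proof -
    have "seq_class z (\<lambda>n. integral {0..1} (\<lambda>s. x n s (y n)))" if y: "Bseq y" for y
    proof -
      obtain s where s: "\<forall>n. s n \<in> {0..1}" "\<forall>\<^sub>F n in sequentially.
        \<bar>integral {0..1} (\<lambda>s. x n s (y n))\<bar> \<le> \<bar>x n (s n) (y n)\<bar>" using integral_pick[OF Suc.prems(2) y] by blast
      show ?thesis using seq_class_le[OF _ s(2)] Suc(2)[of s] s(1) y by auto
    qed
    then show ?thesis by simp
  qed
  moreover have "quot_class z j (Q (\<lambda>n y. integral {0..1} (\<lambda>s. x n s y)))"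
  proof (rule quot_class_cong[OF _ Q_integral(1)[OF Suc.prems(2)]], rule Suc.IH)
    fix s :: "nat \<Rightarrow> real" assume "\<And>n. s n \<in> {0..1}"
    then have "quot_class z j (Q (\<lambda>n y. x n (s n) y))" using Suc.prems(1)[of s] by auto
    then show "quot_class z j (\<lambda>n y. Q (\<lambda>n'. x n' (s n)) n y)" by (simp add: Q_def[abs_def])
  qed (use Q_integral(2)[OF Suc.prems(2)] in auto)
  ultimately show ?case by simp
qed


lemma quot_class_segment:
  assumes "quot_class z j x" "quot_class z j w" "\<And>n. t n \<in> {0..1}"
  shows "quot_class z j (\<lambda>n y. x n y + t n * (w n y - x n y))"
proof -
  have "Bseq t" using assms(3) by (auto intro!: BseqI'[of _ 1])
  then have "seq_class False t" by (simp add: seq_class_def)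
  moreover have "seq_class False (\<lambda>n. -1)" by (simp add: seq_class_def)
  ultimately have "quot_class z j (\<lambda>n y. x n y + t n * (w n y + -1 * x n y))"
    using assms by (intro quot_class_add quot_class_cmult)
  then show ?thesis by simp
qed

text \<open>Chain rule for Q. By periodicity a translation by \<open>l\<close> moves only the
  height, from x(y) to x(y + l), and the increment factors as in \<open>increment_integral\<close>.
  Both heights lie in the interval only for large n, hence \<open>eqv\<close>.\<close>

lemma comp_Q:
  assumes "c > 0" "param_class c z (Suc j) \<phi>" "periodic c l \<phi>" "quot_class True 0 x"
  shows "eqv (Q (\<lambda>n y. \<phi> n y (x n y)))
     (\<lambda>n y. Q x n y * integral {0..1} (\<lambda>t. deriv (\<phi> n y) (x n y + t * (translate (\<lambda>n. l) x n y - x n y))))"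
    and "cont (\<lambda>n t y. deriv (\<phi> n y) (x n y + t * (translate (\<lambda>n. l) x n y - x n y)))"
proof -
  have x: "\<forall>\<^sub>F n in sequentially. x n (y n) \<in> {-c<..<c} \<and> x n (y n + l) \<in> {-c<..<c}" if "Bseq y" for y
  proof -
    have "(\<lambda>n. x n (y n)) \<longlonglongrightarrow> 0" "(\<lambda>n. x n (y n + l)) \<longlonglongrightarrow> 0"
      using assms(4) that Bseq_add[OF that, of l] by (auto simp: seq_class_def)
    then have "\<forall>\<^sub>F n in sequentially. dist (x n (y n)) 0 < c" "\<forall>\<^sub>F n in sequentially. dist (x n (y n + l)) 0 < c"
      using assms(1) by (auto simp: tendsto_iff)
    then show ?thesis by eventually_elim auto
  qed
  have d: "\<And>n y s. s \<in> {-c<..<c} \<Longrightarrow> \<phi> n y differentiable (at s)" using assms(2) by auto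
  have cd: "continuous_on {-c<..<c} (deriv (\<phi> n y))" for n y
    using param_class_cont[of c z j "\<lambda>n y. deriv (\<phi> n y)"] assms(2) by auto
  note inc = increment_integral[OF convex_real_interval(8) open_greaterThanLessThan d cd]
  have "\<forall>\<^sub>F n in sequentially. Q (\<lambda>n y. \<phi> n y (x n y)) n (y n) =
     Q x n (y n) * integral {0..1} (\<lambda>t. deriv (\<phi> n (y n)) (x n (y n) + t * (translate (\<lambda>n. l) x n (y n) - x n (y n))))"
    if "Bseq y" for y
    using x[OF that]
  proof eventually_elim
    case (elim n)
    have "\<phi> n (y n + l) (x n (y n + l)) = \<phi> n (y n) (x n (y n + l))" using assms(3) elim by (auto simp: periodic_def)
    then show ?case using inc(1)[of "x n (y n)" "x n (y n + l)" n "y n"] elim by (simp add: Q_def translate_def)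
  qed
  then show "eqv (Q (\<lambda>n y. \<phi> n y (x n y)))
     (\<lambda>n y. Q x n y * integral {0..1} (\<lambda>t. deriv (\<phi> n y) (x n y + t * (translate (\<lambda>n. l) x n y - x n y))))"
    by (simp add: eqv_def)
  have "\<forall>\<^sub>F n in sequentially. continuous_on {0..1} (\<lambda>t. deriv (\<phi> n (y n)) (x n (y n) + t * (translate (\<lambda>n. l) x n (y n) - x n (y n))))"
    if "Bseq y" for y
    using x[OF that]
  proof eventually_elim
    case (elim n)
    then show ?case using inc(2)[of "x n (y n)" "x n (y n + l)" n "y n"] elim by (simp add: translate_def)
  qed
  then show "cont (\<lambda>n t y. deriv (\<phi> n y) (x n y + t * (translate (\<lambda>n. l) x n y - x n y)))" by (simp add: cont_def)
qed

lemma quot_class_comp_0: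
  assumes "c > 0" "param_class c z 0 \<phi>" "quot_class True 0 x"
  shows "quot_class z 0 (\<lambda>n y. \<phi> n y (x n y))"
proof -
  have "seq_class z (\<lambda>n. \<phi> n (y n) (x n (y n)))" if "Bseq y" for y
  proof -
    have "(\<lambda>n. x n (y n)) \<longlonglongrightarrow> 0" using assms(3) that by (auto simp: seq_class_def)
    then have e: "\<forall>\<^sub>F n in sequentially. dist (x n (y n)) 0 < c" using assms(1) by (auto simp: tendsto_iff)
    \<comment> \<open>The value 0 is a dummy for the at most finitely many n whose height lies
      outside the interval, where \<open>\<phi>\<close> is not controlled.\<close>
    define s where "s n = (if \<bar>x n (y n)\<bar> < c then x n (y n) else 0)" for n
    have "\<forall>n. s n \<in> {-c<..<c}" using assms(1) by (auto simp: s_def)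
    then have "seq_class z (\<lambda>n. \<phi> n (y n) (s n))" using assms(2) unfolding param_class.simps by blast
    moreover have "\<forall>\<^sub>F n in sequentially. \<phi> n (y n) (x n (y n)) = \<phi> n (y n) (s n)"
      using e by eventually_elim (auto simp: s_def)
    ultimately show ?thesis by (rule seq_class_cong_ev)
  qed
  then show ?thesis by simp
qed

text \<open>Induction with the chain rule: \<open>Q x\<close> is bounded by hypothesis, and the mean
  value factor composes the derivative of \<open>\<phi>\<close> with points of the segment from x(y)
  to x(y + l), one order lower.\<close>

lemma quot_class_comp:
  assumes "c > 0" "cocycle_trivial j" "param_class c z j \<phi>" "periodic c l \<phi>" "quot_class False j x" "quot_class True 0 x"
  shows "quot_class z j (\<lambda>n y. \<phi> n y (x n y))"
  using assms(2-)
proof (induction j arbitrary: \<phi> x)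
  case 0
  show ?case by (rule quot_class_comp_0[OF assms(1) 0(2) 0(5)])
next
  case (Suc j)
  have "quot_class z 0 (\<lambda>n y. \<phi> n y (x n y))"
    by (rule quot_class_comp_0[OF assms(1) param_class_0[OF Suc.prems(2)] Suc.prems(5)])
  moreover have "quot_class z j (Q (\<lambda>n y. \<phi> n y (x n y)))"
  proof (rule quot_class_cong[OF _ comp_Q(1)[OF assms(1) Suc.prems(2,3,5)]])
    have KBj: "cocycle_trivial j" using Suc.prems(1) by auto
    have "quot_class z j (\<lambda>n y. integral {0..1} (\<lambda>t. deriv (\<phi> n y) (x n y + t * (translate (\<lambda>n. l) x n y - x n y))))"
    proof (rule quot_class_integral[OF _ comp_Q(2)[OF assms(1) Suc.prems(2,3,5)]])
      fix t :: "nat \<Rightarrow> real" assume t: "\<And>n. t n \<in> {0..1}"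
      have 1: "quot_class False j x" using quot_class_mono[OF Suc.prems(4)] by auto
      have b: "Bseq (\<lambda>n. l)" by simp
      have 2: "quot_class False j (translate (\<lambda>n. l) x)" by (rule quot_class_tr[OF KBj b 1])
      have 3: "quot_class True 0 (translate (\<lambda>n. l) x)" by (rule quot_class_tr[OF _ b Suc.prems(5)]) simp
      show "quot_class z j (\<lambda>n y. deriv (\<phi> n y) (x n y + t n * (translate (\<lambda>n. l) x n y - x n y)))"
        by (rule Suc.IH[OF KBj _ periodic_deriv[OF Suc.prems(3)] quot_class_segment[OF 1 2 t] quot_class_segment[OF Suc.prems(5) 3 t]])
          (use Suc.prems(2) in auto)
    qed
    then have "quot_class (False \<or> z) j (\<lambda>n y. Q x n y * integral {0..1} (\<lambda>t. deriv (\<phi> n y) (x n y + t * (translate (\<lambda>n. l) x n y - x n y))))"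
      by (intro quot_class_mult[OF KBj]) (use Suc.prems(4) in auto)
    then show "quot_class z j (\<lambda>n y. Q x n y * integral {0..1} (\<lambda>t. deriv (\<phi> n y) (x n y + t * (translate (\<lambda>n. l) x n y - x n y))))" by simp
  qed
  ultimately show ?case by simp
qed

lemma quot_class_comp_integral:
  assumes "c > 0" "cocycle_trivial j" "param_class c z (Suc i) \<phi>" "j \<le> i" "periodic c l \<phi>" "quot_class False j x" "quot_class True 0 x"
  shows "quot_class z j (\<lambda>n y. integral {0..1} (\<lambda>t. deriv (\<phi> n y) (x n y + t * (translate (\<lambda>n. l) x n y - x n y))))"
proof (rule quot_class_integral[OF _ comp_Q(2)[OF assms(1,3,5,7)]])
  fix t :: "nat \<Rightarrow> real" assume t: "\<And>n. t n \<in> {0..1}"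
  have b: "Bseq (\<lambda>n. l)" by simp
  have 2: "quot_class False j (translate (\<lambda>n. l) x)" by (rule quot_class_tr[OF assms(2) b assms(6)])
  have 3: "quot_class True 0 (translate (\<lambda>n. l) x)" by (rule quot_class_tr[OF _ b assms(7)]) simp
  have "param_class c z i (\<lambda>n y. deriv (\<phi> n y))" using assms(3) by auto
  then have "param_class c z j (\<lambda>n y. deriv (\<phi> n y))" by (rule param_class_mono) (rule assms(4))
  then show "quot_class z j (\<lambda>n y. deriv (\<phi> n y) (x n y + t n * (translate (\<lambda>n. l) x n y - x n y)))"
    by (rule quot_class_comp[OF assms(1,2) _ periodic_deriv[OF assms(5)] quot_class_segment[OF assms(6) 2 t] quot_class_segment[OF assms(7) 3 t]])
qed

lemma param_class_exp: "param_class c False j (\<lambda>n (y::'a). exp)"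
proof -
  have "seq_class False (\<lambda>n. exp (s n))" if "\<forall>n. s n \<in> {-c<..<c}" for s :: "nat \<Rightarrow> real"
    unfolding seq_class_def using that by (auto intro!: BseqI'[of _ "exp c"] simp: less_imp_le)
  moreover have "continuous_on (UNIV \<times> {-c<..<c}) (\<lambda>(y::'a, s). exp s)"
    by (auto simp: case_prod_unfold intro!: continuous_intros)
  moreover have "deriv exp = (exp :: real \<Rightarrow> real)" by (rule ext, rule DERIV_imp_deriv, rule DERIV_exp)
  moreover have "exp differentiable (at s)" for s :: real using DERIV_exp real_differentiable_def by blast
  ultimately show ?thesis by (induction j) auto
qed

text \<open>Passes from the exponent in the growth law to the cocycle. Order 0 is continuity of exp;
  at higher orders the smallness comes from the factor \<open>Q E\<close>.\<close>

lemma quot_class_exp: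
  assumes "cocycle_trivial j" "quot_class True j E" shows "quot_class True j (\<lambda>n y. exp (E n y) - 1)"
proof -
  have 0: "quot_class True 0 (\<lambda>n y. exp (E n y) - 1)"
  proof -
    have "(\<lambda>n. exp (E n (y n)) - 1) \<longlonglongrightarrow> 0" if "Bseq y" for y
    proof -
      have "(\<lambda>n. E n (y n)) \<longlonglongrightarrow> 0" using quot_class_0[OF assms(2) that] by (simp add: seq_class_def)
      then have "(\<lambda>n. exp (E n (y n))) \<longlonglongrightarrow> exp 0" by (rule tendsto_exp)
      then show ?thesis using LIM_zero by fastforce
    qed
    then show ?thesis by (simp add: seq_class_def)
  qed
  show ?thesis
  proof (cases j)
    case (Suc i)
    have KBi: "cocycle_trivial i" using assms(1) Suc by auto
    have E0: "quot_class True 0 E" by (rule quot_class_mono[OF assms(2)]) simp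
    have "eqv (Q (\<lambda>n y. exp (E n y))) (\<lambda>n y. Q E n y * integral {0..1} (\<lambda>t. deriv exp (E n y + t * (translate (\<lambda>n. l) E n y - E n y))))"
      using comp_Q(1)[of 1, OF _ param_class_exp[of 1 "Suc i"] _ E0] by (simp add: periodic_def)
    moreover have "quot_class (True \<or> False) i (\<lambda>n y. Q E n y * integral {0..1} (\<lambda>t. deriv exp (E n y + t * (translate (\<lambda>n. l) E n y - E n y))))"
      using quot_class_comp_integral[of 1, OF _ KBi param_class_exp[of 1 "Suc i"] _ _ _ E0]
        quot_class_mono[OF quot_class_weaken[OF assms(2)], of i] assms(2) Suc
      by (intro quot_class_mult[OF KBi]) (auto simp: periodic_def)
    ultimately have "quot_class True i (Q (\<lambda>n y. exp (E n y)))" using quot_class_cong by auto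
    moreover have "Q (\<lambda>n y. exp (E n y) - 1) = Q (\<lambda>n y. exp (E n y))" by (simp add: Q_def fun_eq_iff)
    ultimately show ?thesis using 0 Suc by auto
  qed (use 0 in auto)
qed

lemma lim_0: "lim 0 x c \<longleftrightarrow> quot_class True 0 (\<lambda>n y. x n y - c)"
  by (auto simp: lim_def seq_class_def LIM_zero_iff)

lemma lim_Suc: "lim (Suc j) x c \<longleftrightarrow> lim j (Q x) c"
  by (simp add: lim_def funpow_Suc_right del: funpow.simps)

lemma lim_integral:
  assumes "\<And>s. (\<And>n. s n \<in> {0..1}) \<Longrightarrow> lim j (\<lambda>n y. x n (s n) y) c" "cont x"
  shows "lim j (\<lambda>n y. integral {0..1} (\<lambda>s. x n s y)) c"
  using assms
proof (induction j arbitrary: x)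
  case 0
  have "quot_class True 0 (\<lambda>n y. integral {0..1} (\<lambda>s. x n s y - c))"
    using 0 by (intro quot_class_integral) (auto simp: lim_0 cont_def elim!: eventually_mono intro!: continuous_intros)
  moreover have "eqv (\<lambda>n y. integral {0..1} (\<lambda>s. x n s y) - c) (\<lambda>n y. integral {0..1} (\<lambda>s. x n s y - c))"
    unfolding eqv_def
  proof (intro allI impI)
    fix y :: "nat \<Rightarrow> 'a" assume "Bseq y"
    then have "\<forall>\<^sub>F n in sequentially. continuous_on {0..1} (\<lambda>s. x n s (y n))" using 0(2) by (simp add: cont_def)
    then show "\<forall>\<^sub>F n in sequentially. integral {0..1} (\<lambda>s. x n s (y n)) - c = integral {0..1} (\<lambda>s. x n s (y n) - c)"
      by eventually_elim (simp add: integral_diff integrable_continuous_interval)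
  qed
  ultimately show ?case unfolding lim_0 by (rule quot_class_cong)
next
  case (Suc j)
  show ?case unfolding lim_Suc
  proof (rule lim_cong[OF _ Q_integral(1)[OF Suc.prems(2)]], rule Suc.IH)
    fix s :: "nat \<Rightarrow> real" assume "\<And>n. s n \<in> {0..1}"
    then have "lim j (Q (\<lambda>n y. x n (s n) y)) c" using Suc.prems(1)[of s] by (auto simp: lim_Suc)
    then show "lim j (\<lambda>n y. Q (\<lambda>n'. x n' (s n)) n y) c" by (simp add: Q_def[abs_def])
  qed (use Q_integral(2)[OF Suc.prems(2)] in auto)
qed

text \<open>Says that x may replace the transverse coordinate with respect to which Q
  differentiates.\<close>

definition Q1 :: "nat \<Rightarrow> (nat \<Rightarrow> 'a \<Rightarrow> real) \<Rightarrow> bool" where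
  "Q1 j x \<longleftrightarrow> quot_class True j (\<lambda>n y. Q x n y - 1)"

lemma Q1_mono: "Q1 j x \<Longrightarrow> i \<le> j \<Longrightarrow> Q1 i x" unfolding Q1_def by (rule quot_class_mono)

lemma Q1_cls: "Q1 j x \<Longrightarrow> quot_class True 0 x \<Longrightarrow> quot_class False (Suc j) x"
proof -
  assume a: "Q1 j x" "quot_class True 0 x"
  have "quot_class False j (\<lambda>n y. (Q x n y - 1) + 1)"
    using quot_class_weaken[OF a(1)[unfolded Q1_def]] by (intro quot_class_add quot_class_const) (auto simp: seq_class_def)
  then show ?thesis using a(2) by (auto intro: seq_class_weaken)
qed

text \<open>Q of a translate is the cocycle times the translate of \<open>Q x\<close>, and both
  factors are 1 + o(1).\<close>

lemma Q1_tr: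
  assumes "cocycle_trivial (Suc j)" "Bseq v" "Q1 j x" shows "Q1 j (translate v x)"
proof -
  have KBj: "cocycle_trivial j" using assms(1) by auto
  have k: "quot_class True j (\<lambda>n y. cocycle v n y - 1)" using assms by auto
  have k': "quot_class False j (cocycle v)" by (rule cocycle_False[OF assms(1)]) (use assms in auto)
  have "quot_class (False \<or> True) j (\<lambda>n y. cocycle v n y * translate v (\<lambda>n y. Q x n y - 1) n y)"
    using assms(3) by (intro quot_class_mult[OF KBj] k' quot_class_tr[OF KBj assms(2)]) (simp add: Q1_def)
  then have "quot_class True j (\<lambda>n y. cocycle v n y * translate v (\<lambda>n y. Q x n y - 1) n y + (cocycle v n y - 1))"
    using k by (intro quot_class_add) auto
  then have "quot_class True j (\<lambda>n y. cocycle v n y * translate v (Q x) n y - 1)" by (simp add: translate_def algebra_simps)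
  then show ?thesis unfolding Q1_def
    by (rule quot_class_cong) (use Q_tr[OF assms(2), of x] in \<open>auto simp: eqv_def elim!: allE eventually_mono\<close>)
qed

lemma Q1_segment:
  assumes "Q1 j x" "Q1 j w" "\<And>n. t n \<in> {0..1}"
  shows "Q1 j (\<lambda>n y. x n y + t n * (w n y - x n y))"
proof -
  have "quot_class True j (\<lambda>n y. (Q x n y - 1) + t n * ((Q w n y - 1) - (Q x n y - 1)))"
    using assms unfolding Q1_def by (intro quot_class_segment)
  moreover have *: "Q (\<lambda>n y. x n y + t n * (w n y - x n y)) n y - 1 = (Q x n y - 1) + t n * ((Q w n y - 1) - (Q x n y - 1))" for n y
  proof -
    have "Q (\<lambda>n y. x n y + t n * (w n y - x n y)) n y = Q x n y + t n * (Q w n y - Q x n y)"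
      by (simp add: Q_def algebra_simps add_divide_distrib diff_divide_distrib)
    then show ?thesis by (simp add: algebra_simps)
  qed
  ultimately show ?thesis unfolding Q1_def by (simp only: *)
qed

text \<open>When \<open>Q x\<close> is close to 1, Q acts on functions of x like differentiation. So
  j quotients recover the j-th derivative at 0, without a factorial and without any derivative of
  order j + 1: each quotient trades an increment for the mean of one derivative.\<close>

lemma lim_comp:
  assumes "c > 0" "cocycle_trivial j" "param_class c False j (\<lambda>n (y::'a). \<psi>)" "quot_class True 0 x" "\<And>i. j = Suc i \<Longrightarrow> Q1 i x"
  shows "lim j (\<lambda>n y. \<psi> (x n y)) ((deriv ^^ j) \<psi> 0)"
  using assms(2-)
proof (induction j arbitrary: \<psi> x)
  case 0
  have "continuous_on {-c<..<c} \<psi>" using param_class_cont[OF 0(2)] .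
  then have "isCont \<psi> 0" using assms(1) by (simp add: continuous_on_eq_continuous_at)
  then show ?case using 0(3) by (auto simp: lim_def seq_class_def intro: isCont_tendsto_compose)
next
  case (Suc j)
  have KBj: "cocycle_trivial j" using Suc.prems(1) by auto
  have p: "periodic c l (\<lambda>n (y::'a). \<psi>)" by (simp add: periodic_def)
  have Q1x: "Q1 j x" using Suc.prems(4) by auto
  have xj: "quot_class False j x" using quot_class_mono[OF Q1_cls[OF Q1x Suc.prems(3)]] by auto
  have b: "Bseq (\<lambda>n. l)" by simp
  let ?I = "\<lambda>n y. integral {0..1} (\<lambda>t. deriv \<psi> (x n y + t * (translate (\<lambda>n. l) x n y - x n y)))"
  have I: "quot_class False j ?I"
    by (rule quot_class_comp_integral[OF assms(1) KBj Suc.prems(2) _ p xj Suc.prems(3)]) simp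
  have "quot_class (True \<or> False) j (\<lambda>n y. (Q x n y - 1) * ?I n y)"
    by (intro quot_class_mult[OF KBj] I) (use Q1x in \<open>simp add: Q1_def\<close>)
  then have 1: "lim j (\<lambda>n y. (Q x n y - 1) * ?I n y) 0" by (intro quot_class_lim) simp
  have 2: "lim j ?I ((deriv ^^ j) (deriv \<psi>) 0)"
  proof (rule lim_integral[OF _ comp_Q(2)[OF assms(1) Suc.prems(2) p Suc.prems(3)]])
    fix t :: "nat \<Rightarrow> real" assume t: "\<And>n. t n \<in> {0..1}"
    have 3: "quot_class True 0 (translate (\<lambda>n. l) x)" by (rule quot_class_tr[OF _ b Suc.prems(3)]) simp
    show "lim j (\<lambda>n y. deriv \<psi> (x n y + t n * (translate (\<lambda>n. l) x n y - x n y))) ((deriv ^^ j) (deriv \<psi>) 0)"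
    proof (rule Suc.IH[OF KBj _ quot_class_segment[OF Suc.prems(3) 3 t]])
      show "param_class c False j (\<lambda>n (y::'a). deriv \<psi>)" using Suc.prems(2) by auto
      fix i assume i: "j = Suc i"
      show "Q1 i (\<lambda>n y. x n y + t n * (translate (\<lambda>n. l) x n y - x n y))"
        using i KBj Q1_mono[OF Q1x, of i] by (intro Q1_segment t Q1_tr[OF _ b]) auto
    qed
  qed
  have "lim j (\<lambda>n y. (Q x n y - 1) * ?I n y + ?I n y) (0 + (deriv ^^ j) (deriv \<psi>) 0)"
    by (rule lim_add[OF 1 2])
  then have "lim j (\<lambda>n y. Q x n y * ?I n y) ((deriv ^^ Suc j) \<psi> 0)"
    by (simp add: algebra_simps funpow_Suc_right del: funpow.simps)
  then show ?case unfolding lim_Suc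
    by (rule lim_cong[OF _ comp_Q(1)[OF assms(1) Suc.prems(2) p Suc.prems(3)]])
qed

end

section \<open>Growth of the increments of a leaf under lattice translations\<close>

lemma linear_ode:
  fixes h \<theta> :: "real \<Rightarrow> real"
  assumes "\<And>t. t \<in> {0..1} \<Longrightarrow> (h has_real_derivative h t * \<theta> t) (at t within {0..1})"
    and "continuous_on {0..1} \<theta>"
  shows "h 1 = h 0 * exp (integral {0..1} \<theta>)"
proof -
  define g where "g t = integral {0..t} \<theta>" for t
  have g: "(g has_real_derivative \<theta> t) (at t within {0..1})" if "t \<in> {0..1}" for t
    using integral_has_real_derivative[OF assms(2) that] by (simp add: g_def[abs_def])
  have "((\<lambda>t. h t * exp (- g t)) has_real_derivative 0) (at t within {0..1})" if "t \<in> {0..1}" for t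
    by (rule derivative_eq_intros assms(1) g that refl | simp add: algebra_simps)+
  then have "\<exists>K. \<forall>t\<in>{0..1}. h t * exp (- g t) = K"
    by (intro has_field_derivative_zero_constant) auto
  then have "h 1 * exp (- g 1) = h 0 * exp (- g 0)" by force
  moreover have "g 0 = 0" by (simp add: g_def)
  ultimately have "h 1 * exp (- g 1) * exp (g 1) = h 0 * exp (g 1)" by simp
  then show ?thesis by (simp add: g_def mult.assoc flip: exp_add)
qed

lemma param_integral_cont:
  fixes c :: real and f g :: "'b::topological_space \<Rightarrow> real"
  assumes "continuous_on (UNIV \<times> {-c<..<c}) (\<lambda>(y, s). \<phi> y s)" "continuous_on U f" "continuous_on U g"
    "\<And>y. y \<in> U \<Longrightarrow> f y \<in> {-c<..<c}" "\<And>y. y \<in> U \<Longrightarrow> g y \<in> {-c<..<c}"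
  shows "continuous_on (U :: 'b::topological_space set) (\<lambda>y. integral {0..1} (\<lambda>t. \<phi> y (f y + t * (g y - f y)) :: real))"
    "continuous_on (U \<times> {0..1}) (\<lambda>(y, t). \<phi> y (f y + t * (g y - f y)))"
proof -
  have m: "f y + t * (g y - f y) \<in> {-c<..<c}" if "t \<in> {0..1}" "y \<in> U" for t :: real and y
  proof -
    have "(1 - t) *\<^sub>R f y + t *\<^sub>R g y \<in> {-c<..<c}"
      using convex_real_interval(8)[of "-c" c] assms(4,5)[OF that(2)] that(1) by (auto simp: convex_alt)
    then show ?thesis by (simp add: algebra_simps)
  qed
  have f: "continuous_on (U \<times> {0..1::real}) (\<lambda>z. f (fst z))" "continuous_on (U \<times> {0..1::real}) (\<lambda>z. g (fst z))"
    by (rule continuous_on_compose2[OF assms(2)] continuous_on_compose2[OF assms(3)], auto intro!: continuous_intros)+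
  have "continuous_on (U \<times> {0..1}) (\<lambda>z. (\<lambda>(y, s). \<phi> y s) (fst z, f (fst z) + snd z * (g (fst z) - f (fst z))))"
    by (rule continuous_on_compose2[OF assms(1)]) (use m in \<open>auto intro!: continuous_intros f\<close>)
  then show c: "continuous_on (U \<times> {0..1}) (\<lambda>(y, t). \<phi> y (f y + t * (g y - f y)))"
    by (simp add: case_prod_unfold)
  show "continuous_on U (\<lambda>y. integral {0..1} (\<lambda>t. \<phi> y (f y + t * (g y - f y))))"
    using integral_continuous_on_param[of U 0 1 "\<lambda>y t. \<phi> y (f y + t * (g y - f y))"] c by simp
qed

context diff_quot begin

lemma cont_seg:
  assumes "c > 0" and FDh: "param_class c z i \<phi>" and a: "quot_class True 0 a" and b: "quot_class True 0 b"
  shows "cont (\<lambda>n t y. \<phi> n y (a n y + t * (b n y - a n y)))"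
  unfolding cont_def
proof (intro allI impI)
  fix y :: "nat \<Rightarrow> 'a" assume y: "Bseq y"
  have "\<forall>\<^sub>F n in sequentially. \<bar>w n (y n)\<bar> < c" if "quot_class True 0 w" for w
  proof -
    have "(\<lambda>n. w n (y n)) \<longlonglongrightarrow> 0" using that y by (auto simp: seq_class_def)
    then show ?thesis using assms(1) by (auto simp: tendsto_iff)
  qed
  from this[OF a] this[OF b] show "\<forall>\<^sub>F n in sequentially. continuous_on {0..1}
      (\<lambda>t. \<phi> n (y n) (a n (y n) + t * (b n (y n) - a n (y n))))"
  proof eventually_elim
    case (elim n)
    have "continuous_on {0..1} (\<lambda>t. \<phi> n (y n) (a n (y n) + t * (b n (y n) - a n (y n))))"
    proof (rule continuous_on_compose2[OF param_class_cont[OF FDh]])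
      have "a n (y n) + t * (b n (y n) - a n (y n)) \<in> {-c<..<c}" if "t \<in> {0..1}" for t
      proof -
        have "(1 - t) *\<^sub>R a n (y n) + t *\<^sub>R b n (y n) \<in> {-c<..<c}"
          using convex_real_interval(8)[of "-c" c] elim that by (auto simp: convex_alt abs_less_iff)
        then show ?thesis by (simp add: algebra_simps)
      qed
      then show "(\<lambda>t. a n (y n) + t * (b n (y n) - a n (y n))) ` {0..1} \<subseteq> {-c<..<c}" by auto
    qed (auto intro!: continuous_intros)
    then show ?case .
  qed
qed

end

text \<open>
  Along a segment of direction \<open>v\<close> the increment \<open>\<beta> p\<close> of \<open>F\<close> under a period \<open>p\<close> solves a linear
  differential equation with coefficient \<open>\<Theta> p v\<close> and so grows by the factor \<open>exp (E p v)\<close>. As \<open>E\<close> is small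
  with its \<open>Q\<close>-derivatives, \<open>cocycle_trivial\<close> propagates by induction up to \<open>k\<close>.
\<close>

locale leaf_seq =
  fixes l m :: "'a::euclidean_space" and c :: real and k :: nat
    and F :: "nat \<Rightarrow> 'a \<Rightarrow> real" and \<omega> :: "nat \<Rightarrow> 'a \<Rightarrow> real \<Rightarrow> 'a"
  assumes c_pos: "c > 0" and k_pos: "k \<ge> 1"
    and F_deriv: "\<forall>\<^sub>F n in sequentially. \<forall>y\<in>ball 0 \<rho>. (F n has_derivative (\<lambda>h. \<omega> n y (F n y) \<bullet> h)) (at y)"
    and F_small: "e > 0 \<Longrightarrow> \<forall>\<^sub>F n in sequentially. \<forall>y\<in>ball 0 \<rho>. \<bar>F n y\<bar> < e"
    and F_0: "F n 0 = 0" and F_l: "F n l \<noteq> 0"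
    and om_FD: "Bseq v \<Longrightarrow> param_class c True k (\<lambda>n y s. \<omega> n y s \<bullet> v n)"
    and om_per: "s \<in> {-c<..<c} \<Longrightarrow> \<omega> n (y + l) s = \<omega> n y s" "s \<in> {-c<..<c} \<Longrightarrow> \<omega> n (y + m) s = \<omega> n y s"
begin

definition \<beta> :: "'a \<Rightarrow> nat \<Rightarrow> 'a \<Rightarrow> real" where "\<beta> p n y = F n (y + p) - F n y"

definition \<Theta> :: "'a \<Rightarrow> (nat \<Rightarrow> 'a) \<Rightarrow> nat \<Rightarrow> 'a \<Rightarrow> real" where
  "\<Theta> p v n y = integral {0..1} (\<lambda>t. deriv (\<lambda>s. \<omega> n y s \<bullet> v n) (F n y + t * (F n (y + p) - F n y)))"

definition E :: "'a \<Rightarrow> (nat \<Rightarrow> 'a) \<Rightarrow> nat \<Rightarrow> 'a \<Rightarrow> real" where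
  "E p v n y = integral {0..1} (\<lambda>t. \<Theta> p v n (y + t *\<^sub>R v n))"

definition good :: "nat \<Rightarrow> real \<Rightarrow> bool" where
  "good n \<rho> \<longleftrightarrow> (\<forall>y\<in>ball 0 \<rho>. (F n has_derivative (\<lambda>h. \<omega> n y (F n y) \<bullet> h)) (at y) \<and> F n y \<in> {-c<..<c})"

lemma ev_good: "\<forall>\<^sub>F n in sequentially. good n \<rho>"
  using F_deriv[of \<rho>] F_small[of c \<rho>, OF c_pos] by eventually_elim (auto simp: good_def abs_less_iff)

lemma F_cont: "good n \<rho> \<Longrightarrow> continuous_on (ball 0 \<rho>) (F n)"
  by (auto simp: good_def intro!: continuous_at_imp_continuous_on has_derivative_continuous)

lemma F_line:
  assumes "good n \<rho>" "a + t *\<^sub>R v \<in> ball 0 \<rho>"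
  shows "((\<lambda>t. F n (a + t *\<^sub>R v)) has_real_derivative \<omega> n (a + t *\<^sub>R v) (F n (a + t *\<^sub>R v)) \<bullet> v) (at t)"
proof -
  have 1: "(F n has_derivative (\<lambda>h. \<omega> n (a + t *\<^sub>R v) (F n (a + t *\<^sub>R v)) \<bullet> h)) (at (a + t *\<^sub>R v))"
    using assms by (auto simp: good_def)
  have 2: "((\<lambda>t. a + t *\<^sub>R v) has_derivative (\<lambda>d. d *\<^sub>R v)) (at t)"
    by (auto intro!: derivative_eq_intros)
  show ?thesis using diff_chain_at[OF 2 1] by (simp add: has_field_derivative_def comp_def mult.commute[of _ "_ \<bullet> _"] fun_eq_iff)
qed

lemma om_FD': "Bseq v \<Longrightarrow> \<exists>k'. k = Suc k' \<and> param_class c True (Suc k') (\<lambda>n y s. \<omega> n y s \<bullet> v n)"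
  using om_FD k_pos by (cases k) auto

lemma om_d:
  assumes "Bseq v"
  shows "continuous_on (UNIV \<times> {-c<..<c}) (\<lambda>(y, s). deriv (\<lambda>s. \<omega> n y s \<bullet> v n) s)"
    and "continuous_on {-c<..<c} (deriv (\<lambda>s. \<omega> n y s \<bullet> v n))"
    and "s \<in> {-c<..<c} \<Longrightarrow> (\<lambda>s. \<omega> n y s \<bullet> v n) differentiable (at s)"
proof -
  obtain k' where k: "param_class c True (Suc k') (\<lambda>n y s. \<omega> n y s \<bullet> v n)" using om_FD'[OF assms] by blast
  then have 1: "param_class c True k' (\<lambda>n y. deriv (\<lambda>s. \<omega> n y s \<bullet> v n))" by auto
  show "continuous_on (UNIV \<times> {-c<..<c}) (\<lambda>(y, s). deriv (\<lambda>s. \<omega> n y s \<bullet> v n) s)" using param_class_cont2[OF 1] .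
  show "continuous_on {-c<..<c} (deriv (\<lambda>s. \<omega> n y s \<bullet> v n))" using param_class_cont[OF 1] .
  show "s \<in> {-c<..<c} \<Longrightarrow> (\<lambda>s. \<omega> n y s \<bullet> v n) differentiable (at s)" using k by auto
qed

lemma shift_ball: "norm p + \<rho>' \<le> \<rho> \<Longrightarrow> y \<in> ball 0 \<rho>' \<Longrightarrow> y + p \<in> ball 0 \<rho> \<and> y \<in> ball 0 \<rho>"
  using norm_triangle_ineq[of y p] norm_ge_zero[of p] unfolding mem_ball_0 by linarith

lemma F_shift_cont: "good n \<rho> \<Longrightarrow> norm p + \<rho>' \<le> \<rho> \<Longrightarrow> continuous_on (ball 0 \<rho>') (\<lambda>y. F n (y + p))"
  by (rule continuous_on_compose2[OF F_cont]) (use shift_ball[of p \<rho>' \<rho>] in \<open>auto intro!: continuous_intros simp del: mem_ball mem_ball_0\<close>)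

lemma good_mono: "good n \<rho> \<Longrightarrow> \<rho>' \<le> \<rho> \<Longrightarrow> good n \<rho>'" by (auto simp: good_def)

lemma Theta_cont:
  assumes "good n \<rho>" "norm p + \<rho>' \<le> \<rho>" "Bseq v"
  shows "continuous_on (ball 0 \<rho>') (\<Theta> p v n)"
  unfolding \<Theta>_def[abs_def]
proof (rule param_integral_cont(1)[OF om_d(1)[OF assms(3)]])
  have "\<rho>' \<le> \<rho>" using assms(2) norm_ge_zero[of p] by linarith
  then show "continuous_on (ball 0 \<rho>') (F n)" using F_cont good_mono assms(1) by blast
  show "continuous_on (ball 0 \<rho>') (\<lambda>y. F n (y + p))" by (rule F_shift_cont[OF assms(1,2)])
  show "F n y \<in> {-c<..<c}" "F n (y + p) \<in> {-c<..<c}" if "y \<in> ball 0 \<rho>'" for y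
    using assms(1) shift_ball[OF assms(2) that] unfolding good_def by blast+
qed

lemma Theta_line_cont:
  assumes "good n \<rho>" "norm y + norm w + norm p < \<rho>" "Bseq v"
  shows "continuous_on {0..1} (\<lambda>t. \<Theta> p v n (y + t *\<^sub>R w))"
proof (rule continuous_on_compose2[OF Theta_cont[OF assms(1) _ assms(3)]])
  show "norm p + (\<rho> - norm p) \<le> \<rho>" by simp
  have "norm (y + t *\<^sub>R w) < \<rho> - norm p" if "t \<in> {0..1}" for t
  proof -
    have "norm (y + t *\<^sub>R w) \<le> norm y + 1 * norm w"
      using that by (intro order_trans[OF norm_triangle_ineq] add_mono) (auto intro: mult_left_le_one_le)
    then show ?thesis using assms(2) by simp
  qed
  then show "(\<lambda>t. y + t *\<^sub>R w) ` {0..1} \<subseteq> ball 0 (\<rho> - norm p)" by auto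
qed (auto intro!: continuous_intros)

text \<open>By periodicity the heights F(y) and F(y + p) obey the equation with the same first
  argument y, so the derivative of their difference is a height increment of
  \<open>\<omega>\<close>, that is, \<open>\<beta>\<close> times a mean derivative.\<close>

lemma beta_line:
  assumes "good n \<rho>" "a + t *\<^sub>R v n \<in> ball 0 \<rho>" "a + t *\<^sub>R v n + p \<in> ball 0 \<rho>" "p = l \<or> p = m" "Bseq v"
  shows "((\<lambda>t. \<beta> p n (a + t *\<^sub>R v n)) has_real_derivative \<beta> p n (a + t *\<^sub>R v n) * \<Theta> p v n (a + t *\<^sub>R v n)) (at t)"
proof -
  let ?y = "a + t *\<^sub>R v n"
  have I: "F n ?y \<in> {-c<..<c}" "F n (?y + p) \<in> {-c<..<c}" using assms(1-3) by (auto simp: good_def simp del: mem_ball)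
  have 1: "((\<lambda>t. F n (a + t *\<^sub>R v n)) has_real_derivative \<omega> n ?y (F n ?y) \<bullet> v n) (at t)"
    by (rule F_line[OF assms(1,2)])
  have eq: "a + t *\<^sub>R v n + p = (a + p) + t *\<^sub>R v n" for t by (simp add: algebra_simps)
  have "((\<lambda>t. F n (a + t *\<^sub>R v n + p)) has_real_derivative \<omega> n (?y + p) (F n (?y + p)) \<bullet> v n) (at t)"
    using F_line[OF assms(1) assms(3)[unfolded eq]] by (simp only: eq)
  moreover have "\<omega> n (?y + p) (F n (?y + p)) = \<omega> n ?y (F n (?y + p))" using assms(4) om_per I by blast
  ultimately have 2: "((\<lambda>t. F n (a + t *\<^sub>R v n + p)) has_real_derivative \<omega> n ?y (F n (?y + p)) \<bullet> v n) (at t)" by simp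
  have 3: "\<omega> n ?y (F n (?y + p)) \<bullet> v n - \<omega> n ?y (F n ?y) \<bullet> v n = \<beta> p n ?y * \<Theta> p v n ?y"
    using increment_integral(1)[OF convex_real_interval(8) open_greaterThanLessThan om_d(3)[OF assms(5)] om_d(2)[OF assms(5)] I]
    by (simp add: \<beta>_def \<Theta>_def)
  show ?thesis using DERIV_diff[OF 2 1] 3 by (simp add: \<beta>_def)
qed

lemma growth:
  assumes "good n \<rho>" "norm y + norm (v n) + norm p < \<rho>" "p = l \<or> p = m" "Bseq v"
  shows "\<beta> p n (y + v n) = \<beta> p n y * exp (E p v n y)"
proof -
  have b: "y + t *\<^sub>R v n \<in> ball 0 \<rho>" "y + t *\<^sub>R v n + p \<in> ball 0 \<rho>" if "t \<in> {0..1}" for t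
  proof -
    have "norm (y + t *\<^sub>R v n) \<le> norm y + 1 * norm (v n)"
      using that by (intro order_trans[OF norm_triangle_ineq] add_mono) (auto intro: mult_left_le_one_le)
    moreover have "norm (y + t *\<^sub>R v n + p) \<le> norm (y + t *\<^sub>R v n) + norm p" by (rule norm_triangle_ineq)
    ultimately show "y + t *\<^sub>R v n \<in> ball 0 \<rho>" "y + t *\<^sub>R v n + p \<in> ball 0 \<rho>"
      using assms(2) norm_ge_zero[of p] unfolding mem_ball_0 by linarith+
  qed
  have "((\<lambda>t. \<beta> p n (y + t *\<^sub>R v n)) has_real_derivative \<beta> p n (y + t *\<^sub>R v n) * \<Theta> p v n (y + t *\<^sub>R v n)) (at t within {0..1})"
    if "t \<in> {0..1}" for t
    using beta_line[OF assms(1) b[OF that] assms(3,4)] by (rule has_field_derivative_at_within)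
  from linear_ode[OF this Theta_line_cont[OF assms(1,2,4)]] show ?thesis by (simp add: E_def)
qed

lemma ev_bound:
  fixes y v :: "nat \<Rightarrow> 'a" assumes "Bseq y" "Bseq v"
  shows "\<exists>\<rho>. \<forall>n. norm (y n) + norm (v n) + norm p < \<rho>"
proof -
  obtain K1 where K1: "\<And>n. norm (y n) \<le> K1" using assms(1) by (auto simp: Bseq_def)
  obtain K2 where K2: "\<And>n. norm (v n) \<le> K2" using assms(2) by (auto simp: Bseq_def)
  from K1 K2 have "norm (y n) + norm (v n) + norm p < K1 + K2 + norm p + 1" for n by (smt (verit))
  then show ?thesis by blast
qed

lemma ev_growth:
  assumes "Bseq y" "Bseq v" "p = l \<or> p = m"
  shows "\<forall>\<^sub>F n in sequentially. \<beta> p n (y n + v n) = \<beta> p n (y n) * exp (E p v n (y n))"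
proof -
  obtain \<rho> where \<rho>: "\<forall>n. norm (y n) + norm (v n) + norm p < \<rho>" using ev_bound[OF assms(1,2)] by blast
  show ?thesis using ev_good[of \<rho>] by eventually_elim (use growth \<rho> assms in blast)
qed

text \<open>The denominators of Q are the increments of F under \<open>l\<close>. They do not vanish
  at bounded points for large n, since they arise from \<open>F n l\<close> by exponential growth
  starting at the origin.\<close>

sublocale diff_quot l "\<beta> l"
proof
  fix y :: "nat \<Rightarrow> 'a" assume y: "Bseq y"
  have "Bseq (\<lambda>n. 0::'a)" by simp
  from ev_growth[OF this y, of l] show "\<forall>\<^sub>F n in sequentially. \<beta> l n (y n) \<noteq> 0"
    by (auto elim!: eventually_mono simp: \<beta>_def F_0 F_l)
qed

lemma F_cls0: "quot_class True 0 F"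
proof -
  have "(\<lambda>n. F n (y n)) \<longlonglongrightarrow> 0" if y: "Bseq y" for y
  proof (rule tendstoI)
    fix e :: real assume "e > 0"
    obtain K where K: "\<And>n. norm (y n) \<le> K" using y by (auto simp: Bseq_def)
    have "y n \<in> ball 0 (K + 1)" for n using K[of n] by simp
    then show "\<forall>\<^sub>F n in sequentially. dist (F n (y n)) 0 < e"
      using F_small[OF \<open>e > 0\<close>, of "K + 1"] by (auto elim!: eventually_mono simp del: mem_ball)
  qed
  then show ?thesis by (simp add: seq_class_def)
qed

text \<open>\<open>Q F\<close> equals 1 wherever the denominator is nonzero: F is the transverse
  coordinate itself.\<close>

lemma F_Q1: "Q1 j F"
proof -
  have "eqv (\<lambda>n y. Q F n y - 1) (\<lambda>n y. 0)"
    using alpha_nz by (auto simp: eqv_def Q_def \<beta>_def elim!: eventually_mono)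
  then show ?thesis unfolding Q1_def using quot_class_cong[OF quot_class_zero] by blast
qed

lemma F_cls: "quot_class False j F"
  using quot_class_mono[OF Q1_cls[OF F_Q1[of j] F_cls0]] by auto

lemma translate_F_cls: "cocycle_trivial j \<Longrightarrow> Bseq v \<Longrightarrow> quot_class False j (translate v F)" "Bseq v \<Longrightarrow> quot_class True 0 (translate v F)"
  using quot_class_tr[OF _ _ F_cls] quot_class_tr[OF _ _ F_cls0] by blast+

lemma om_perl: "periodic c l (\<lambda>n y s. \<omega> n y s \<bullet> v n)" using om_per by (simp add: periodic_def)

text \<open>\<open>\<Theta>\<close> consumes one height derivative of \<open>\<omega>\<close>, hence
  the strict bound j < k.\<close>

lemma Theta_cls:
  assumes "cocycle_trivial j" "j < k" "Bseq v" shows "quot_class True j (\<Theta> p v)"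
proof -
  obtain k' where k': "k = Suc k'" "param_class c True (Suc k') (\<lambda>n y s. \<omega> n y s \<bullet> v n)" using om_FD'[OF assms(3)] by blast
  have FDj: "param_class c True j (\<lambda>n y. deriv (\<lambda>s. \<omega> n y s \<bullet> v n))" using param_class_mono[of c True k' _ j] k' assms(2) by auto
  have bp: "Bseq (\<lambda>n. p)" "Bseq (\<lambda>n. 0::'a)" by simp_all
  show ?thesis unfolding \<Theta>_def[abs_def]
  proof (rule quot_class_integral)
    show "cont (\<lambda>n t y. deriv (\<lambda>s. \<omega> n y s \<bullet> v n) (F n y + t * (F n (y + p) - F n y)))"
      using cont_seg[OF c_pos FDj F_cls0 translate_F_cls(2)[OF bp(1)]] by (simp add: translate_def)
    fix t :: "nat \<Rightarrow> real" assume t: "\<And>n. t n \<in> {0..1}"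
    have "quot_class True j (\<lambda>n y. deriv (\<lambda>s. \<omega> n y s \<bullet> v n) (F n y + t n * (translate (\<lambda>n. p) F n y - F n y)))"
      by (rule quot_class_comp[OF c_pos assms(1) FDj periodic_deriv[OF om_perl] quot_class_segment[OF F_cls translate_F_cls(1)[OF assms(1) bp(1)] t]
          quot_class_segment[OF F_cls0 translate_F_cls(2)[OF bp(1)] t]])
    then show "quot_class True j (\<lambda>n y. deriv (\<lambda>s. \<omega> n y s \<bullet> v n) (F n y + t n * (F n (y + p) - F n y)))"
      by (simp add: translate_def)
  qed
qed

lemma E_cls:
  assumes "cocycle_trivial j" "j < k" "Bseq v" shows "quot_class True j (E p v)"
  unfolding E_def[abs_def]
proof (rule quot_class_integral)
  show "cont (\<lambda>n t y. \<Theta> p v n (y + t *\<^sub>R v n))"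
    unfolding cont_def
  proof (intro allI impI)
    fix y :: "nat \<Rightarrow> 'a" assume y: "Bseq y"
    obtain \<rho> where \<rho>: "\<forall>n. norm (y n) + norm (v n) + norm p < \<rho>" using ev_bound[OF y assms(3)] by blast
    show "\<forall>\<^sub>F n in sequentially. continuous_on {0..1} (\<lambda>t. \<Theta> p v n (y n + t *\<^sub>R v n))"
      using ev_good[of \<rho>] by eventually_elim (use Theta_line_cont \<rho> assms(3) in blast)
  qed
  fix t :: "nat \<Rightarrow> real" assume t: "\<And>n. t n \<in> {0..1}"
  have "quot_class True j (translate (\<lambda>n. t n *\<^sub>R v n) (\<Theta> p v))"
    by (rule quot_class_tr[OF assms(1) Bseq_scale01[OF assms(3) t] Theta_cls[OF assms]])
  then show "quot_class True j (\<lambda>n y. \<Theta> p v n (y + t n *\<^sub>R v n))" by (simp add: translate_def[abs_def])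
qed

text \<open>There is no circularity: estimating the exponent \<open>E l v\<close> to order j uses
  the cocycle at orders below j only, and the growth law then gives the cocycle at order j.\<close>

lemma cocycle_trivial_step:
  assumes "cocycle_trivial j" "j < k" "Bseq v" shows "quot_class True j (\<lambda>n y. cocycle v n y - 1)"
proof (rule quot_class_cong[OF quot_class_exp[OF assms(1) E_cls[OF assms, of l]]])
  show "eqv (\<lambda>n y. cocycle v n y - 1) (\<lambda>n y. exp (E l v n y) - 1)"
    unfolding eqv_def
  proof (intro allI impI)
    fix y :: "nat \<Rightarrow> 'a" assume y: "Bseq y"
    show "\<forall>\<^sub>F n in sequentially. cocycle v n (y n) - 1 = exp (E l v n (y n)) - 1"
      using ev_growth[OF y assms(3), of l, simplified] alpha_nz[OF y] by eventually_elim (auto simp: cocycle_def)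
  qed
qed

lemma cocycle_trivial_k: "j \<le> k \<Longrightarrow> cocycle_trivial j"
proof (induction j)
  case (Suc j)
  then have "cocycle_trivial j" by simp
  then have "\<And>v. Bseq v \<Longrightarrow> quot_class True j (\<lambda>n y. cocycle v n y - 1)" using cocycle_trivial_step Suc.prems by auto
  then show ?case using \<open>cocycle_trivial j\<close> by (auto simp: less_Suc_eq)
qed simp


end

section \<open>The ratio of the increments in two lattice directions\<close>

locale leaf_seq_ratio = leaf_seq +
  fixes r\<^sub>0 :: real
  assumes ratio: "(\<lambda>n. F n m / F n l) \<longlonglongrightarrow> r\<^sub>0"
begin

definition r :: "nat \<Rightarrow> 'a \<Rightarrow> real" where "r n y = \<beta> m n y / \<beta> l n y"

text \<open>The limit is prescribed at the origin only. Both increments are carried from there to y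
  n by exponentials of exponents o(1), so the ratio has the same limit at all bounded
  points.\<close>

lemma r_lim: "quot_class True 0 (\<lambda>n y. r n y - r\<^sub>0)"
proof -
  have "(\<lambda>n. r n (y n)) \<longlonglongrightarrow> r\<^sub>0" if y: "Bseq y" for y
  proof -
    have z: "Bseq (\<lambda>n. 0::'a)" by simp
    have "(\<lambda>n. E p y n 0) \<longlonglongrightarrow> 0" for p
      using quot_class_0[OF E_cls[of 0 y p] z] y k_pos by (auto simp: seq_class_def)
    then have "(\<lambda>n. F n m / F n l * (exp (E m y n 0) / exp (E l y n 0))) \<longlonglongrightarrow> r\<^sub>0 * (exp 0 / exp 0)"
      by (intro tendsto_mult[OF ratio] tendsto_divide tendsto_exp) auto
    moreover have "\<forall>\<^sub>F n in sequentially. r n (y n) = F n m / F n l * (exp (E m y n 0) / exp (E l y n 0))"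
      using ev_growth[OF z y, of m, simplified] ev_growth[OF z y, of l, simplified]
      by eventually_elim (simp add: r_def \<beta>_def F_0)
    ultimately show ?thesis using tendsto_cong by fastforce
  qed
  then show ?thesis by (auto simp: seq_class_def intro: LIM_zero)
qed

lemma r_0: "quot_class False 0 r"
proof -
  have "quot_class False 0 (\<lambda>n y. (r n y - r\<^sub>0) + r\<^sub>0)"
    by (intro quot_class_add quot_class_weaken[OF r_lim] quot_class_const) (simp add: seq_class_def)
  then show ?thesis by simp
qed

text \<open>Hadamard factor of second order: \<open>\<Theta> m\<close> and \<open>\<Theta> l\<close>
  average the same function over two segments whose points at parameter t differ by t
  (\<open>\<beta> m - \<beta> l\<close>).\<close>

definition \<Lambda> :: "nat \<Rightarrow> 'a \<Rightarrow> real" where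
  "\<Lambda> n y = integral {0..1} (\<lambda>t. t * integral {0..1} (\<lambda>u. deriv (deriv (\<lambda>s. \<omega> n y s \<bullet> l))
     ((F n y + t * \<beta> l n y) + u * ((F n y + t * \<beta> m n y) - (F n y + t * \<beta> l n y)))))"

lemma Theta_diff:
  assumes k: "k = Suc (Suc k')" and I: "F n y \<in> {-c<..<c}" "F n (y + l) \<in> {-c<..<c}" "F n (y + m) \<in> {-c<..<c}"
  shows "\<Theta> m (\<lambda>n. l) n y - \<Theta> l (\<lambda>n. l) n y = (\<beta> m n y - \<beta> l n y) * \<Lambda> n y"
    and "continuous_on {0..1} (\<lambda>t. t * integral {0..1} (\<lambda>u. deriv (deriv (\<lambda>s. \<omega> n y s \<bullet> l))
     ((F n y + t * \<beta> l n y) + u * ((F n y + t * \<beta> m n y) - (F n y + t * \<beta> l n y)))))"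
proof -
  let ?\<phi> = "\<lambda>s. \<omega> n y s \<bullet> l"
  have b: "Bseq (\<lambda>n. l)" by simp
  have FD2: "param_class c True (Suc (Suc k')) (\<lambda>n y s. \<omega> n y s \<bullet> l)" using om_FD[OF b] k by simp
  then have FD1: "param_class c True (Suc k') (\<lambda>n y. deriv (\<lambda>s. \<omega> n y s \<bullet> l))" by auto
  then have FD0: "param_class c True k' (\<lambda>n y. deriv (deriv (\<lambda>s. \<omega> n y s \<bullet> l)))" by auto
  have d: "\<And>s. s \<in> {-c<..<c} \<Longrightarrow> deriv ?\<phi> differentiable (at s)" using FD1 by auto
  have cc: "continuous_on {-c<..<c} (deriv (deriv ?\<phi>))" using param_class_cont[OF FD0] .
  have m: "F n y + t * \<beta> p n y \<in> {-c<..<c}" if "t \<in> {0..1}" "p = l \<or> p = m" for t p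
  proof -
    have "(1 - t) *\<^sub>R F n y + t *\<^sub>R F n (y + p) \<in> {-c<..<c}"
      using convex_real_interval(8)[of "-c" c] I that by (auto simp: convex_alt)
    then show ?thesis by (simp add: algebra_simps \<beta>_def)
  qed
  have inc: "deriv ?\<phi> (F n y + t * \<beta> m n y) - deriv ?\<phi> (F n y + t * \<beta> l n y) =
      (\<beta> m n y - \<beta> l n y) * (t * integral {0..1} (\<lambda>u. deriv (deriv ?\<phi>)
     ((F n y + t * \<beta> l n y) + u * ((F n y + t * \<beta> m n y) - (F n y + t * \<beta> l n y)))))" if "t \<in> {0..1}" for t
    using increment_integral(1)[OF convex_real_interval(8) open_greaterThanLessThan d cc m[OF that, of l] m[OF that, of m]]
    by (simp add: algebra_simps)
  have ci: "continuous_on {0..1} (\<lambda>t. deriv ?\<phi> (F n y + t * \<beta> p n y))" if "p = l \<or> p = m" for p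
    by (rule continuous_on_compose2[OF param_class_cont[OF FD1]]) (use m[OF _ that] in \<open>auto intro!: continuous_intros simp del: greaterThanLessThan_iff\<close>)
  have "\<Theta> m (\<lambda>n. l) n y - \<Theta> l (\<lambda>n. l) n y = integral {0..1} (\<lambda>t. deriv ?\<phi> (F n y + t * \<beta> m n y) - deriv ?\<phi> (F n y + t * \<beta> l n y))"
    using integral_diff[OF integrable_continuous_interval[OF ci[of m]] integrable_continuous_interval[OF ci[of l]]]
    by (simp add: \<Theta>_def \<beta>_def)
  also have "\<dots> = integral {0..1} (\<lambda>t. (\<beta> m n y - \<beta> l n y) * (t * integral {0..1} (\<lambda>u. deriv (deriv ?\<phi>)
     ((F n y + t * \<beta> l n y) + u * ((F n y + t * \<beta> m n y) - (F n y + t * \<beta> l n y))))))"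
    by (rule integral_cong) (rule inc)
  finally show "\<Theta> m (\<lambda>n. l) n y - \<Theta> l (\<lambda>n. l) n y = (\<beta> m n y - \<beta> l n y) * \<Lambda> n y"
    by (simp add: \<Lambda>_def)
  have "continuous_on (UNIV \<times> {-c<..<c}) (\<lambda>z. deriv (deriv ?\<phi>) (snd (z :: real \<times> real)))"
    by (rule continuous_on_compose2[OF cc]) (auto intro!: continuous_intros)
  then have c2: "continuous_on (UNIV \<times> {-c<..<c}) (\<lambda>(t::real, s). deriv (deriv ?\<phi>) s)"
    by (simp add: case_prod_unfold)
  show "continuous_on {0..1} (\<lambda>t. t * integral {0..1} (\<lambda>u. deriv (deriv ?\<phi>)
     ((F n y + t * \<beta> l n y) + u * ((F n y + t * \<beta> m n y) - (F n y + t * \<beta> l n y)))))"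
    by (intro continuous_on_mult continuous_on_id param_integral_cont(1)[OF c2])
      (use m in \<open>auto intro!: continuous_intros simp del: greaterThanLessThan_iff\<close>)
qed

lemma ev_I:
  assumes "Bseq y" "Bseq v"
  shows "\<forall>\<^sub>F n in sequentially. F n (y n + v n) \<in> {-c<..<c}"
proof -
  have "(\<lambda>n. F n (y n + v n)) \<longlonglongrightarrow> 0" using translate_F_cls(2)[OF assms(2)] assms(1) by (auto simp: seq_class_def translate_def)
  then have "\<forall>\<^sub>F n in sequentially. dist (F n (y n + v n)) 0 < c" using c_pos by (auto simp: tendsto_iff)
  then show ?thesis by eventually_elim auto
qed

lemma Lambda_cls:
  assumes k: "k = Suc (Suc k')" and j: "j \<le> k'" shows "quot_class True j \<Lambda>"
proof -
  have KBj: "cocycle_trivial j" by (rule cocycle_trivial_k) (use j k in simp)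
  have b: "Bseq (\<lambda>n. l)" "Bseq (\<lambda>n. m)" "Bseq (\<lambda>n. 0::'a)" by simp_all
  have FD2: "param_class c True (Suc (Suc k')) (\<lambda>n y s. \<omega> n y s \<bullet> l)" using om_FD[OF b(1)] k by simp
  then have "param_class c True k' (\<lambda>n y. deriv (deriv (\<lambda>s. \<omega> n y s \<bullet> l)))" by auto
  then have FD0: "param_class c True j (\<lambda>n y. deriv (deriv (\<lambda>s. \<omega> n y s \<bullet> l)))" using param_class_mono j by blast
  have p: "periodic c l (\<lambda>n y. deriv (deriv (\<lambda>s. \<omega> n y s \<bullet> l)))" by (intro periodic_deriv om_perl)
  have seg: "quot_class z i (\<lambda>n y. F n y + t n * \<beta> p n y)" if "\<And>n. t n \<in> {0..1}" "quot_class z i F" "quot_class z i (translate (\<lambda>n. p) F)" for t p z i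
    using quot_class_segment[OF that(2,3,1)] by (simp add: \<beta>_def translate_def)
  show ?thesis unfolding \<Lambda>_def[abs_def]
  proof (rule quot_class_integral)
    fix t :: "nat \<Rightarrow> real" assume t: "\<And>n. t n \<in> {0..1}"
    have "Bseq t" using t by (auto intro!: BseqI'[of _ 1])
    then have okt: "seq_class False t" by (simp add: seq_class_def)
    let ?A = "\<lambda>p n y. F n y + t n * \<beta> p n y"
    have A: "quot_class False j (?A p)" "quot_class True 0 (?A p)" for p
      by (intro seg t F_cls F_cls0 translate_F_cls KBj, simp)+
    show "quot_class True j (\<lambda>n y. t n * integral {0..1} (\<lambda>u. deriv (deriv (\<lambda>s. \<omega> n y s \<bullet> l)) (?A l n y + u * (?A m n y - ?A l n y))))"
    proof (rule quot_class_cmult[OF okt quot_class_integral[OF _ cont_seg[OF c_pos FD0 A(2)[of l] A(2)[of m]]]])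
      fix u :: "nat \<Rightarrow> real" assume u: "\<And>n. u n \<in> {0..1}"
      show "quot_class True j (\<lambda>n y. deriv (deriv (\<lambda>s. \<omega> n y s \<bullet> l)) (?A l n y + u n * (?A m n y - ?A l n y)))"
        by (rule quot_class_comp[OF c_pos KBj FD0 p quot_class_segment[OF A(1) A(1) u] quot_class_segment[OF A(2) A(2) u]])
    qed
  next
    show "cont (\<lambda>n t y. t * integral {0..1} (\<lambda>u. deriv (deriv (\<lambda>s. \<omega> n y s \<bullet> l))
      ((F n y + t * \<beta> l n y) + u * ((F n y + t * \<beta> m n y) - (F n y + t * \<beta> l n y)))))"
      unfolding cont_def
    proof (intro allI impI)
      fix y :: "nat \<Rightarrow> 'a" assume y: "Bseq y"
      show "\<forall>\<^sub>F n in sequentially. continuous_on {0..1} (\<lambda>t. t * integral {0..1} (\<lambda>u. deriv (deriv (\<lambda>s. \<omega> n (y n) s \<bullet> l))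
      ((F n (y n) + t * \<beta> l n (y n)) + u * ((F n (y n) + t * \<beta> m n (y n)) - (F n (y n) + t * \<beta> l n (y n))))))"
        using ev_I[OF y b(1)] ev_I[OF y b(2)] ev_I[OF y b(3)]
        by eventually_elim (rule Theta_diff(2)[OF k], auto)
    qed
  qed
qed

text \<open>Along l one has r' = r (\<open>\<Theta> m - \<Theta> l\<close>) = r
  (\<open>\<beta> m - \<beta> l\<close>) \<open>\<Lambda>\<close>, and
  \<open>\<beta> m - \<beta> l\<close> = \<open>\<beta> l\<close> (r - 1). Division by the increment
  at y turns the factor \<open>\<beta> l\<close> into a cocycle. The smallness comes from
  \<open>\<Lambda>\<close>, which costs two height derivatives of \<open>\<omega>\<close>.\<close>

lemma Q_r_cls:
  assumes k: "k = Suc (Suc k')" and j: "j \<le> k'" and rj: "quot_class False j r" shows "quot_class True j (Q r)"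
proof -
  have KBk: "cocycle_trivial (Suc j)" "cocycle_trivial j" by (rule cocycle_trivial_k, use j k in simp)+
  have b: "Bseq (\<lambda>n. l)" "Bseq (\<lambda>n. m)" "Bseq (\<lambda>n. 0::'a)" by simp_all
  let ?D = "\<lambda>n y. r n y * (\<Theta> m (\<lambda>n. l) n y - \<Theta> l (\<lambda>n. l) n y)"
  have line: "\<forall>\<^sub>F n in sequentially. (\<forall>s\<in>{0..1}. ((\<lambda>s. r n (y n + s *\<^sub>R l)) has_real_derivative ?D n (y n + s *\<^sub>R l)) (at s within {0..1}))
      \<and> continuous_on {0..1} (\<lambda>s. ?D n (y n + s *\<^sub>R l))" if y: "Bseq y" for y
  proof -
    \<comment> \<open>An auxiliary vector of norm |l| + |m| in place of a period gives one radius
      that suits both periods.\<close>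
    obtain \<rho> where \<rho>: "\<forall>n. norm (y n) + norm l + (norm l + norm m) < \<rho>"
      using ev_bound[OF y b(1), of "(norm l + norm m) *\<^sub>R (SOME b. b \<in> Basis)"] by (auto simp: some_in_eq)
    show ?thesis using ev_good[of \<rho>]
    proof eventually_elim
      case (elim n)
      have bd: "y n + s *\<^sub>R l \<in> ball 0 \<rho>" "y n + s *\<^sub>R l + p \<in> ball 0 \<rho>" "norm (y n) + norm (s *\<^sub>R l) + norm l < \<rho>"
         if "s \<in> {0..1}" "p = l \<or> p = m" for s p
      proof -
        have s: "norm (s *\<^sub>R l) \<le> norm l" using that(1) by (auto intro: mult_left_le_one_le)
        have "norm (y n + s *\<^sub>R l) \<le> norm (y n) + norm (s *\<^sub>R l)" by (rule norm_triangle_ineq)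
        moreover have "norm (y n + s *\<^sub>R l + p) \<le> norm (y n + s *\<^sub>R l) + norm p" by (rule norm_triangle_ineq)
        moreover have "norm p \<le> norm l + norm m" using that(2) by auto
        ultimately show "y n + s *\<^sub>R l \<in> ball 0 \<rho>" "y n + s *\<^sub>R l + p \<in> ball 0 \<rho>" "norm (y n) + norm (s *\<^sub>R l) + norm l < \<rho>"
          using \<rho>[rule_format, of n] s norm_ge_zero[of l] norm_ge_zero[of m] unfolding mem_ball_0 by linarith+
      qed
      have bl: "((\<lambda>s. \<beta> p n (y n + s *\<^sub>R l)) has_real_derivative \<beta> p n (y n + s *\<^sub>R l) * \<Theta> p (\<lambda>n. l) n (y n + s *\<^sub>R l)) (at s)"
        if "s \<in> {0..1}" "p = l \<or> p = m" for s p
        using beta_line[where v="\<lambda>n. l", OF elim bd(1)[OF that] bd(2)[OF that] that(2) b(1)] .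
      have nz: "\<beta> l n (y n + s *\<^sub>R l) \<noteq> 0" if "s \<in> {0..1}" for s
      proof -
        have "norm (y n) + norm (s *\<^sub>R l) + norm l < \<rho>" using bd(3)[OF that, of l] by blast
        then have "norm (0::'a) + norm (y n + s *\<^sub>R l) + norm l < \<rho>"
          using norm_triangle_ineq[of "y n" "s *\<^sub>R l"] unfolding norm_zero by linarith
        from growth[where v="\<lambda>_. y n + s *\<^sub>R l", OF elim this] show ?thesis by (simp add: \<beta>_def F_0 F_l)
      qed
      have rd: "((\<lambda>s. r n (y n + s *\<^sub>R l)) has_real_derivative ?D n (y n + s *\<^sub>R l)) (at s within {0..1})" if "s \<in> {0..1}" for s
      proof -
        have "((\<lambda>s. r n (y n + s *\<^sub>R l)) has_real_derivative ?D n (y n + s *\<^sub>R l)) (at s)"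
          unfolding r_def using nz[OF that]
          by (auto intro!: derivative_eq_intros bl that simp: field_simps)
        then show ?thesis by (rule has_field_derivative_at_within)
      qed
      moreover have "continuous_on {0..1} (\<lambda>s. ?D n (y n + s *\<^sub>R l))"
      proof -
        have "norm (y n) + norm l + norm p < \<rho>" if "p = l \<or> p = m" for p
        proof -
          have "norm p \<le> norm l + norm m" using that by auto
          then show ?thesis using \<rho>[rule_format, of n] by linarith
        qed
        then have "continuous_on {0..1} (\<lambda>s. \<Theta> p (\<lambda>n. l) n (y n + s *\<^sub>R l))" if "p = l \<or> p = m" for p
          using Theta_line_cont[OF elim _ b(1)] that by blast
        moreover have "continuous_on {0..1} (\<lambda>s. r n (y n + s *\<^sub>R l))"
          by (rule DERIV_continuous_on[OF rd])
        ultimately show ?thesis by (intro continuous_intros) auto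
      qed
      ultimately show ?case by blast
    qed
  qed
  let ?x = "\<lambda>n s y. ?D n (y + s *\<^sub>R l) / \<beta> l n y"
  have e: "eqv (Q r) (\<lambda>n y. integral {0..1} (\<lambda>s. ?x n s y))"
    unfolding eqv_def
  proof (intro allI impI)
    fix y :: "nat \<Rightarrow> 'a" assume y: "Bseq y"
    show "\<forall>\<^sub>F n in sequentially. Q r n (y n) = integral {0..1} (\<lambda>s. ?x n s (y n))"
      using line[OF y]
    proof eventually_elim
      case (elim n)
      have "((\<lambda>s. ?D n (y n + s *\<^sub>R l)) has_integral r n (y n + 1 *\<^sub>R l) - r n (y n + 0 *\<^sub>R l)) {0..1}"
        by (rule fundamental_theorem_of_calculus) (use elim in \<open>auto simp: has_real_derivative_iff_has_vector_derivative\<close>)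
      from integral_unique[OF this] show ?case by (simp add: Q_def)
    qed
  qed
  show ?thesis
  proof (rule quot_class_cong[OF quot_class_integral e])
    show "cont ?x" unfolding cont_def
    proof (intro allI impI)
      fix y :: "nat \<Rightarrow> 'a" assume y: "Bseq y"
      show "\<forall>\<^sub>F n in sequentially. continuous_on {0..1} (\<lambda>s. ?x n s (y n))"
        using line[OF y] alpha_nz[OF y] by eventually_elim (auto intro!: continuous_intros)
    qed
    fix s :: "nat \<Rightarrow> real" assume s: "\<And>n. s n \<in> {0..1}"
    have bs: "Bseq (\<lambda>n. s n *\<^sub>R l)" using Bseq_scale01[OF b(1) s] .
    let ?v = "\<lambda>n. s n *\<^sub>R l"
    have "quot_class False j (\<lambda>n y. r n y + (-1))" by (intro quot_class_add rj quot_class_const) (simp add: seq_class_def)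
    then have "quot_class (False \<or> False \<or> True) j (\<lambda>n y. r n y * ((r n y + (-1)) * \<Lambda> n y))"
      by (intro quot_class_mult[OF KBk(2)] rj Lambda_cls[OF k j])
    then have "quot_class (False \<or> True) j (\<lambda>n y. cocycle ?v n y * translate ?v (\<lambda>n y. r n y * ((r n y + (-1)) * \<Lambda> n y)) n y)"
      by (intro quot_class_mult[OF KBk(2)] cocycle_False[OF KBk(1)] quot_class_tr[OF KBk(2)] bs) auto
    then have "quot_class True j (\<lambda>n y. cocycle ?v n y * translate ?v (\<lambda>n y. r n y * ((r n y + (-1)) * \<Lambda> n y)) n y)" by simp
    then show "quot_class True j (\<lambda>n y. ?x n (s n) y)"
    proof (rule quot_class_cong)
      show "eqv (\<lambda>n y. ?x n (s n) y) (\<lambda>n y. cocycle ?v n y * translate ?v (\<lambda>n y. r n y * ((r n y + (-1)) * \<Lambda> n y)) n y)"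
        unfolding eqv_def
      proof (intro allI impI)
        fix y :: "nat \<Rightarrow> 'a" assume y: "Bseq y"
        have y': "Bseq (\<lambda>n. y n + ?v n)" using Bseq_plus2[OF y bs] .
        show "\<forall>\<^sub>F n in sequentially. ?x n (s n) (y n) = cocycle ?v n (y n) * translate ?v (\<lambda>n y. r n y * ((r n y + (-1)) * \<Lambda> n y)) n (y n)"
          using ev_I[OF y' b(1)] ev_I[OF y' b(2)] ev_I[OF y' b(3)] alpha_nz[OF y']
        proof eventually_elim
          case (elim n)
          let ?z = "y n + s n *\<^sub>R l"
          have "\<Theta> m (\<lambda>n. l) n ?z - \<Theta> l (\<lambda>n. l) n ?z = (\<beta> m n ?z - \<beta> l n ?z) * \<Lambda> n ?z"
            by (rule Theta_diff(1)[OF k]) (use elim in auto)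
          moreover have "\<beta> m n ?z - \<beta> l n ?z = \<beta> l n ?z * (r n ?z - 1)" using elim(4) by (simp add: r_def field_simps)
          ultimately show ?case by (simp add: cocycle_def translate_def)
        qed
      qed
    qed
  qed
qed

text \<open>Bootstrap: boundedness of r at order j makes \<open>Q r\<close> small at order j, hence
  r bounded at order j + 1. It ends at k - 1 because \<open>Q_r_cls\<close> needs j <= k -
  2.\<close>

lemma r_cls: "quot_class True (k - 1) (\<lambda>n y. r n y - r\<^sub>0)"
proof -
  have Q: "Q (\<lambda>n y. r n y - r\<^sub>0) = Q r" by (simp add: Q_def fun_eq_iff)
  have *: "quot_class False j r" if "j < k" for j using that
  proof (induction j)
    case 0 show ?case by (rule r_0)
  next
    case (Suc j)
    then obtain k' where k': "k = Suc (Suc k')" by (intro that[of "k - 2"]) simp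
    then have "quot_class True j (Q r)" using Suc by (intro Q_r_cls) auto
    then show ?case using r_0 quot_class_weaken by auto
  qed
  show ?thesis
  proof (cases "k = 1")
    case True then show ?thesis using r_lim by auto
  next
    case False
    then obtain k' where k': "k = Suc (Suc k')" using k_pos by (intro that[of "k - 2"]) simp
    then have "quot_class True k' (Q r)" using * by (intro Q_r_cls) auto
    then show ?thesis using r_lim k' by (auto simp: Q)
  qed
qed

end

section \<open>Jets of the coframe from second differences of the primitive\<close>

locale leaf_seq_form = leaf_seq_ratio +
  fixes w :: "nat \<Rightarrow> 'a \<Rightarrow> real \<Rightarrow> 'a" and w\<^sub>0 :: "real \<Rightarrow> 'a" and \<Phi> :: "nat \<Rightarrow> 'a \<Rightarrow> real"
  assumes Phi_deriv: "\<forall>\<^sub>F n in sequentially. \<forall>y\<in>ball 0 \<rho>. (\<Phi> n has_derivative (\<lambda>h. w n y (F n y) \<bullet> h)) (at y)"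
    and w_FD: "param_class c True k (\<lambda>n y s. (w n y s - w\<^sub>0 s) \<bullet> v)"
    and w0_FD: "param_class c False k (\<lambda>n (y::'a) s. w\<^sub>0 s \<bullet> v)"
    and w_per: "s \<in> {-c<..<c} \<Longrightarrow> w n (y + l) s = w n y s" "s \<in> {-c<..<c} \<Longrightarrow> w n (y + m) s = w n y s"
begin

definition good\<^sub>\<Phi> :: "nat \<Rightarrow> real \<Rightarrow> bool" where
  "good\<^sub>\<Phi> n \<rho> \<longleftrightarrow> good n \<rho> \<and> (\<forall>y\<in>ball 0 \<rho>. (\<Phi> n has_derivative (\<lambda>h. w n y (F n y) \<bullet> h)) (at y))"

lemma ev_goodPhi: "\<forall>\<^sub>F n in sequentially. good\<^sub>\<Phi> n \<rho>"
  using ev_good[of \<rho>] Phi_deriv[of \<rho>] by eventually_elim (simp add: good\<^sub>\<Phi>_def)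

lemma w_cont: "continuous_on (UNIV \<times> {-c<..<c}) (\<lambda>(y, s). w n y s \<bullet> v)"
proof -
  have "continuous_on (UNIV \<times> {-c<..<c}) (\<lambda>z. (case z of (y, s) \<Rightarrow> (w n y s - w\<^sub>0 s) \<bullet> v) + (case z of (y, s) \<Rightarrow> w\<^sub>0 s \<bullet> v))"
    by (intro continuous_on_add param_class_cont2[OF w_FD] param_class_cont2[OF w0_FD])
  then show ?thesis by (simp add: case_prod_unfold inner_diff_left)
qed

lemma w_line_cont:
  assumes "good n \<rho>" "\<And>t. t \<in> {0..1} \<Longrightarrow> a + t *\<^sub>R v \<in> ball 0 \<rho>"
  shows "continuous_on {0..1} (\<lambda>t. w n (a + t *\<^sub>R v) (F n (a + t *\<^sub>R v)) \<bullet> v)"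
proof -
  have "continuous_on {0..1} (\<lambda>t. F n (a + t *\<^sub>R v))"
    by (rule continuous_on_compose2[OF F_cont[OF assms(1)]]) (use assms(2) in \<open>auto intro!: continuous_intros simp del: mem_ball mem_ball_0\<close>)
  then have "continuous_on {0..1} (\<lambda>t. (\<lambda>(y, s). w n y s \<bullet> v) (a + t *\<^sub>R v, F n (a + t *\<^sub>R v)))"
    by (intro continuous_on_compose2[OF w_cont])
      (use assms in \<open>auto intro!: continuous_intros simp: good_def simp del: mem_ball mem_ball_0 greaterThanLessThan_iff\<close>)
  then show ?thesis by simp
qed

lemma Phi_diff:
  assumes "good\<^sub>\<Phi> n \<rho>" "\<And>t. t \<in> {0..1} \<Longrightarrow> a + t *\<^sub>R v \<in> ball 0 \<rho>"
  shows "\<Phi> n (a + v) - \<Phi> n a = integral {0..1} (\<lambda>t. w n (a + t *\<^sub>R v) (F n (a + t *\<^sub>R v)) \<bullet> v)"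
proof -
  have "((\<lambda>t. w n (a + t *\<^sub>R v) (F n (a + t *\<^sub>R v)) \<bullet> v) has_integral \<Phi> n (a + 1 *\<^sub>R v) - \<Phi> n (a + 0 *\<^sub>R v)) {0..1}"
  proof (rule fundamental_theorem_of_calculus)
    fix t :: real assume t: "t \<in> {0..1}"
    have 1: "(\<Phi> n has_derivative (\<lambda>h. w n (a + t *\<^sub>R v) (F n (a + t *\<^sub>R v)) \<bullet> h)) (at (a + t *\<^sub>R v))"
      using assms t by (auto simp: good\<^sub>\<Phi>_def simp del: mem_ball mem_ball_0)
    have 2: "((\<lambda>t. a + t *\<^sub>R v) has_derivative (\<lambda>d. d *\<^sub>R v)) (at t)"
      by (auto intro!: derivative_eq_intros)
    have "((\<lambda>t. \<Phi> n (a + t *\<^sub>R v)) has_vector_derivative w n (a + t *\<^sub>R v) (F n (a + t *\<^sub>R v)) \<bullet> v) (at t)"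
      using diff_chain_at[OF 2 1] by (simp add: has_vector_derivative_def comp_def fun_eq_iff)
    then show "((\<lambda>t. \<Phi> n (a + t *\<^sub>R v)) has_vector_derivative w n (a + t *\<^sub>R v) (F n (a + t *\<^sub>R v)) \<bullet> v) (at t within {0..1})"
      by (rule has_vector_derivative_at_within)
  qed simp
  from integral_unique[OF this] show ?thesis by simp
qed

definition f :: "nat \<Rightarrow> 'a \<Rightarrow> real" where "f n y = \<Phi> n (y + m) - \<Phi> n y"

lemma ball_segment:
  assumes "norm a + norm v < \<rho>" "t \<in> {0..1}" shows "a + t *\<^sub>R v \<in> ball 0 \<rho>"
proof -
  have "norm (a + t *\<^sub>R v) \<le> norm a + norm (t *\<^sub>R v)" by (rule norm_triangle_ineq)
  moreover have "norm (t *\<^sub>R v) \<le> norm v" using assms(2) by (auto intro: mult_left_le_one_le)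
  ultimately show ?thesis using assms(1) unfolding mem_ball_0 by linarith
qed

lemma cocycle_trivial_i: "i \<le> k \<Longrightarrow> cocycle_trivial i" by (rule cocycle_trivial_k)

lemma Q1_trF: "Suc i \<le> k \<Longrightarrow> Bseq v \<Longrightarrow> Q1 i (translate v F)"
  by (rule Q1_tr[OF cocycle_trivial_k _ F_Q1])

lemma w_perl: "periodic c l (\<lambda>n y s. (w n y s - w\<^sub>0 s) \<bullet> v)" using w_per by (simp add: periodic_def)

text \<open>On the leaf, \<open>f\<close> is the integral of w . m over the segment from y to y + m.
  Replacing w by its limit costs o(1) at every order up to k, and \<open>lim_comp\<close> reads off
  the derivative of the limit.\<close>

lemma lim_f:
  assumes j: "j \<le> k" shows "lim j f ((deriv ^^ j) (\<lambda>s. w\<^sub>0 s \<bullet> m) 0)"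
proof -
  let ?x = "\<lambda>n t y. w n (y + t *\<^sub>R m) (F n (y + t *\<^sub>R m)) \<bullet> m"
  have b: "Bseq (\<lambda>n. m)" by simp
  have *: "\<forall>\<^sub>F n in sequentially. f n (y n) = integral {0..1} (\<lambda>t. ?x n t (y n)) \<and> continuous_on {0..1} (\<lambda>t. ?x n t (y n))"
    if y: "Bseq y" for y
  proof -
    obtain \<rho> where \<rho>: "\<forall>n. norm (y n) + norm m + norm (0::'a) < \<rho>" using ev_bound[OF y b] by blast
    show ?thesis using ev_goodPhi[of \<rho>]
    proof eventually_elim
      case (elim n)
      have s: "\<And>t. t \<in> {0..1} \<Longrightarrow> y n + t *\<^sub>R m \<in> ball 0 \<rho>" using ball_segment[of "y n" m \<rho>] \<rho> by auto
      show ?case using Phi_diff[OF elim s] w_line_cont[of n \<rho>, OF _ s] elim by (simp add: f_def good\<^sub>\<Phi>_def)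
    qed
  qed
  show ?thesis
  proof (rule lim_cong[OF lim_integral])
    show "eqv f (\<lambda>n y. integral {0..1} (\<lambda>t. ?x n t y))" using * by (simp add: eqv_def eventually_conj_iff)
    show "cont ?x" unfolding cont_def using * by (simp add: eventually_conj_iff)
    fix t :: "nat \<Rightarrow> real" assume t: "\<And>n. t n \<in> {0..1}"
    let ?v = "\<lambda>n. t n *\<^sub>R m"
    have bv: "Bseq ?v" using Bseq_scale01[OF b t] .
    have "quot_class True j (translate ?v (\<lambda>n y. (w n y (F n y) - w\<^sub>0 (F n y)) \<bullet> m))"
      using quot_class_comp[OF c_pos cocycle_trivial_i[OF j] param_class_mono[OF w_FD j] w_perl F_cls F_cls0] by (intro quot_class_tr[OF cocycle_trivial_i[OF j] bv])
    then have "lim j (translate ?v (\<lambda>n y. (w n y (F n y) - w\<^sub>0 (F n y)) \<bullet> m)) 0" by (rule quot_class_lim)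
    moreover have "lim j (\<lambda>n y. (\<lambda>s. w\<^sub>0 s \<bullet> m) (translate ?v F n y)) ((deriv ^^ j) (\<lambda>s. w\<^sub>0 s \<bullet> m) 0)"
      by (rule lim_comp[OF c_pos cocycle_trivial_i[OF j] param_class_mono[OF w0_FD j] translate_F_cls(2)[OF bv]]) (use Q1_trF bv j in auto)
    ultimately have "lim j (\<lambda>n y. translate ?v (\<lambda>n y. (w n y (F n y) - w\<^sub>0 (F n y)) \<bullet> m) n y + w\<^sub>0 (translate ?v F n y) \<bullet> m) (0 + (deriv ^^ j) (\<lambda>s. w\<^sub>0 s \<bullet> m) 0)"
      by (rule lim_add)
    then show "lim j (\<lambda>n y. ?x n (t n) y) ((deriv ^^ j) (\<lambda>s. w\<^sub>0 s \<bullet> m) 0)" by (simp add: translate_def inner_diff_left)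
  qed
qed

text \<open>\<open>\<Xi>\<^sub>1\<close> and the following \<open>\<Xi>\<^sub>0\<close> are the
  Hadamard factors of the error \<open>w - w\<^sub>0\<close> and of \<open>w\<^sub>0\<close> under
  the period m; only the latter survives in the limit.\<close>

definition \<Xi>\<^sub>1 :: "nat \<Rightarrow> 'a \<Rightarrow> real" where
  "\<Xi>\<^sub>1 n y = integral {0..1} (\<lambda>t. deriv (\<lambda>s. (w n y s - w\<^sub>0 s) \<bullet> l) (F n y + t * (translate (\<lambda>n. m) F n y - F n y)))"

definition \<Xi>\<^sub>0 :: "nat \<Rightarrow> 'a \<Rightarrow> real" where
  "\<Xi>\<^sub>0 n y = integral {0..1} (\<lambda>t. deriv (\<lambda>s. w\<^sub>0 s \<bullet> l) (F n y + t * (translate (\<lambda>n. m) F n y - F n y)))"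

lemma Xi1_cls:
  assumes "Suc i \<le> k" shows "quot_class True i \<Xi>\<^sub>1"
  unfolding \<Xi>\<^sub>1_def[abs_def]
proof (rule quot_class_integral)
  have KBi: "cocycle_trivial i" by (rule cocycle_trivial_k) (use assms in simp)
  have b: "Bseq (\<lambda>n. m)" by simp
  have FDi: "param_class c True i (\<lambda>n y. deriv (\<lambda>s. (w n y s - w\<^sub>0 s) \<bullet> l))" using param_class_mono[OF w_FD[of l] assms] by auto
  show "cont (\<lambda>n t y. deriv (\<lambda>s. (w n y s - w\<^sub>0 s) \<bullet> l) (F n y + t * (translate (\<lambda>n. m) F n y - F n y)))"
    by (rule cont_seg[OF c_pos FDi F_cls0 translate_F_cls(2)[OF b]])
  fix t :: "nat \<Rightarrow> real" assume t: "\<And>n. t n \<in> {0..1}"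
  show "quot_class True i (\<lambda>n y. deriv (\<lambda>s. (w n y s - w\<^sub>0 s) \<bullet> l) (F n y + t n * (translate (\<lambda>n. m) F n y - F n y)))"
    by (rule quot_class_comp[OF c_pos KBi FDi periodic_deriv[OF w_perl] quot_class_segment[OF F_cls translate_F_cls(1)[OF KBi b] t]
          quot_class_segment[OF F_cls0 translate_F_cls(2)[OF b] t]])
qed

lemma Xi0_lim:
  assumes k: "Suc i \<le> k" and v: "Bseq v"
  shows "lim i (translate v \<Xi>\<^sub>0) ((deriv ^^ i) (deriv (\<lambda>s. w\<^sub>0 s \<bullet> l)) 0)" "quot_class False i \<Xi>\<^sub>0"
proof -
  have KBi: "cocycle_trivial i" by (rule cocycle_trivial_k) (use k in simp)
  have b: "Bseq (\<lambda>n. m)" by simp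
  have b': "Bseq (\<lambda>n. m + v n)" using Bseq_plus2[OF b v] .
  have FDi: "param_class c False i (\<lambda>n (y::'a). deriv (\<lambda>s. w\<^sub>0 s \<bullet> l))" using param_class_mono[OF w0_FD[of l] k] by auto
  have p: "periodic c l (\<lambda>n (y::'a). deriv (\<lambda>s. w\<^sub>0 s \<bullet> l))" by (simp add: periodic_def)
  have "lim i (\<lambda>n y. integral {0..1} (\<lambda>t. deriv (\<lambda>s. w\<^sub>0 s \<bullet> l) (translate v F n y + t * (translate (\<lambda>n. m + v n) F n y - translate v F n y))))
     ((deriv ^^ i) (deriv (\<lambda>s. w\<^sub>0 s \<bullet> l)) 0)"
  proof (rule lim_integral[OF _ cont_seg[OF c_pos FDi translate_F_cls(2)[OF v] translate_F_cls(2)[OF b']]])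
    fix t :: "nat \<Rightarrow> real" assume t: "\<And>n. t n \<in> {0..1}"
    show "lim i (\<lambda>n y. deriv (\<lambda>s. w\<^sub>0 s \<bullet> l) (translate v F n y + t n * (translate (\<lambda>n. m + v n) F n y - translate v F n y))) ((deriv ^^ i) (deriv (\<lambda>s. w\<^sub>0 s \<bullet> l)) 0)"
      by (rule lim_comp[OF c_pos KBi FDi quot_class_segment[OF translate_F_cls(2)[OF v] translate_F_cls(2)[OF b'] t]])
        (use k in \<open>auto intro!: Q1_segment t Q1_trF v b'\<close>)
  qed
  then show "lim i (translate v \<Xi>\<^sub>0) ((deriv ^^ i) (deriv (\<lambda>s. w\<^sub>0 s \<bullet> l)) 0)"
    by (simp add: \<Xi>\<^sub>0_def[abs_def] translate_def[abs_def] add.assoc add.commute[of m])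
  show "quot_class False i \<Xi>\<^sub>0" unfolding \<Xi>\<^sub>0_def[abs_def]
  proof (rule quot_class_integral[OF _ cont_seg[OF c_pos FDi F_cls0 translate_F_cls(2)[OF b]]])
    fix t :: "nat \<Rightarrow> real" assume t: "\<And>n. t n \<in> {0..1}"
    show "quot_class False i (\<lambda>n y. deriv (\<lambda>s. w\<^sub>0 s \<bullet> l) (F n y + t n * (translate (\<lambda>n. m) F n y - F n y)))"
      by (rule quot_class_comp[OF c_pos KBi FDi p quot_class_segment[OF F_cls translate_F_cls(1)[OF KBi b] t]
          quot_class_segment[OF F_cls0 translate_F_cls(2)[OF b] t]])
  qed
qed

lemma w_increment:
  assumes "F n y \<in> {-c<..<c}" "F n (y + m) \<in> {-c<..<c}"
  shows "w n y (F n (y + m)) \<bullet> l - w n y (F n y) \<bullet> l = \<beta> m n y * (\<Xi>\<^sub>1 n y + \<Xi>\<^sub>0 n y)"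
proof -
  obtain k' where k': "k = Suc k'" using k_pos by (cases k) auto
  have 1: "param_class c True (Suc k') (\<lambda>n y s. (w n y s - w\<^sub>0 s) \<bullet> l)" using w_FD k' by simp
  then have 2: "param_class c True k' (\<lambda>n y. deriv (\<lambda>s. (w n y s - w\<^sub>0 s) \<bullet> l))" by auto
  have 3: "param_class c False (Suc k') (\<lambda>n (y::'a) s. w\<^sub>0 s \<bullet> l)" using w0_FD k' by simp
  then have 4: "param_class c False k' (\<lambda>n (y::'a). deriv (\<lambda>s. w\<^sub>0 s \<bullet> l))" by auto
  have d: "\<And>s. s \<in> {-c<..<c} \<Longrightarrow> (\<lambda>s. (w n y s - w\<^sub>0 s) \<bullet> l) differentiable (at s)" using 1 by auto
  have d0: "\<And>s. s \<in> {-c<..<c} \<Longrightarrow> (\<lambda>s. w\<^sub>0 s \<bullet> l) differentiable (at s)" using 3 by auto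
  note i1 = increment_integral(1)[OF convex_real_interval(8) open_greaterThanLessThan d param_class_cont[OF 2] assms]
  note i0 = increment_integral(1)[OF convex_real_interval(8) open_greaterThanLessThan d0 param_class_cont[OF 4] assms]
  show ?thesis using i1 i0 by (simp add: \<Xi>\<^sub>1_def \<Xi>\<^sub>0_def translate_def \<beta>_def distrib_left inner_diff_left)
qed

text \<open>The second difference of the primitive is regrouped as the l-increment at y + m minus
  the l-increment at y. By periodicity in m both integrands have the same first argument, so they
  differ by \<open>\<beta> m\<close> times a mean height derivative of w . l. Division by
  \<open>\<beta> l\<close> leaves the ratio r, a cocycle and \<open>\<Xi>\<^sub>0\<close>.\<close>

lemma lim_Qf:
  assumes k: "Suc i \<le> k" shows "lim i (Q f) (r\<^sub>0 * (deriv ^^ i) (deriv (\<lambda>s. w\<^sub>0 s \<bullet> l)) 0)"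
proof -
  let ?D = "\<lambda>n y. w n y (F n (y + m)) \<bullet> l - w n y (F n y) \<bullet> l"
  let ?x = "\<lambda>n s y. ?D n (y + s *\<^sub>R l) / \<beta> l n y"
  have KBi: "cocycle_trivial i" by (rule cocycle_trivial_k) (use k in simp)
  have KBs: "cocycle_trivial (Suc i)" by (rule cocycle_trivial_k) (use k in simp)
  have b: "Bseq (\<lambda>n. l)" "Bseq (\<lambda>n. m)" "Bseq (\<lambda>n. 0::'a)" by simp_all
  have *: "\<forall>\<^sub>F n in sequentially. Q f n (y n) = integral {0..1} (\<lambda>s. ?x n s (y n)) \<and> continuous_on {0..1} (\<lambda>s. ?x n s (y n))"
    if y: "Bseq y" for y
  proof -
    obtain \<rho> where \<rho>: "\<forall>n. norm (y n) + norm m + norm l < \<rho>" using ev_bound[OF y b(2)] by blast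
    show ?thesis using ev_goodPhi[of \<rho>] alpha_nz[OF y]
    proof eventually_elim
      case (elim n)
      have g: "good n \<rho>" using elim by (simp add: good\<^sub>\<Phi>_def)
      have s: "y n + m + t *\<^sub>R l \<in> ball 0 \<rho>" "y n + t *\<^sub>R l \<in> ball 0 \<rho>" if "t \<in> {0..1}" for t
        using ball_segment[of "y n + m" l \<rho>, OF _ that] ball_segment[of "y n" l \<rho>, OF _ that]
          norm_triangle_ineq[of "y n" m] norm_ge_zero[of m] \<rho>[rule_format, of n] by (force, force)
      have sw: "w n (y n + m + t *\<^sub>R l) (F n (y n + m + t *\<^sub>R l)) = w n (y n + t *\<^sub>R l) (F n (y n + t *\<^sub>R l + m))" if "t \<in> {0..1}" for t
      proof -
        have "F n (y n + t *\<^sub>R l + m) \<in> {-c<..<c}" using s(1)[OF that] g by (simp add: good_def algebra_simps)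
        from w_per(2)[OF this, of n "y n + t *\<^sub>R l"] show ?thesis by (simp add: algebra_simps)
      qed
      have c1: "continuous_on {0..1} (\<lambda>t. w n (y n + t *\<^sub>R l) (F n (y n + t *\<^sub>R l + m)) \<bullet> l)"
        by (rule continuous_on_eq[OF w_line_cont[OF g s(1)]]) (simp_all only: sw)
      have c0: "continuous_on {0..1} (\<lambda>t. w n (y n + t *\<^sub>R l) (F n (y n + t *\<^sub>R l)) \<bullet> l)"
        by (rule w_line_cont[OF g s(2)])
      have P1: "\<Phi> n (y n + m + l) - \<Phi> n (y n + m) = integral {0..1} (\<lambda>t. w n (y n + t *\<^sub>R l) (F n (y n + t *\<^sub>R l + m)) \<bullet> l)"
        by (rule trans[OF Phi_diff[OF elim(1) s(1)] integral_cong]) (simp_all only: sw)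
      have P0: "\<Phi> n (y n + l) - \<Phi> n (y n) = integral {0..1} (\<lambda>t. w n (y n + t *\<^sub>R l) (F n (y n + t *\<^sub>R l)) \<bullet> l)"
        by (rule Phi_diff[OF elim(1) s(2)])
      have "f n (y n + l) - f n (y n) = (\<Phi> n (y n + m + l) - \<Phi> n (y n + m)) - (\<Phi> n (y n + l) - \<Phi> n (y n))"
        by (simp add: f_def algebra_simps)
      also have "\<dots> = integral {0..1} (\<lambda>s. ?D n (y n + s *\<^sub>R l))"
        unfolding P1 P0 by (rule integral_diff[symmetric]) (auto intro: integrable_continuous_interval c1 c0)
      finally have "Q f n (y n) = integral {0..1} (\<lambda>s. ?x n s (y n))" by (simp add: Q_def)
      moreover have "continuous_on {0..1} (\<lambda>s. ?x n s (y n))" using elim(2)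
        by (intro continuous_on_divide[OF continuous_on_diff[OF c1 c0] continuous_on_const]) auto
      ultimately show ?case by blast
    qed
  qed
  show ?thesis
  proof (rule lim_cong[OF lim_integral])
    show "eqv (Q f) (\<lambda>n y. integral {0..1} (\<lambda>s. ?x n s y))" using * by (simp add: eqv_def eventually_conj_iff)
    show "cont ?x" unfolding cont_def using * by (simp add: eventually_conj_iff)
    fix s :: "nat \<Rightarrow> real" assume s: "\<And>n. s n \<in> {0..1}"
    let ?v = "\<lambda>n. s n *\<^sub>R l"
    have bs: "Bseq ?v" using Bseq_scale01[OF b(1) s] .
    have rk: "quot_class True i (\<lambda>n y. r n y - r\<^sub>0)" by (rule quot_class_mono[OF r_cls]) (use k in simp)
    have r: "quot_class False i r"
    proof -
      have "quot_class False i (\<lambda>n y. (r n y - r\<^sub>0) + r\<^sub>0)" by (intro quot_class_add quot_class_weaken[OF rk] quot_class_const) (simp add: seq_class_def)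
      then show ?thesis by simp
    qed
    have kp: "quot_class True i (\<lambda>n y. cocycle ?v n y - 1)" using KBs bs by auto
    have kp': "quot_class False i (cocycle ?v)" by (rule cocycle_False[OF KBs]) (use bs in auto)
    note m = quot_class_mult[OF KBi]
    have 1: "quot_class (False \<or> True) i (\<lambda>n y. cocycle ?v n y * translate ?v (\<lambda>n y. r n y * \<Xi>\<^sub>1 n y) n y)"
      by (intro m kp' quot_class_tr[OF KBi bs]) (use m[OF r Xi1_cls[OF k]] in simp)
    have 2: "quot_class (True \<or> False) i (\<lambda>n y. (cocycle ?v n y - 1) * translate ?v (\<lambda>n y. r n y * \<Xi>\<^sub>0 n y) n y)"
      by (intro m kp quot_class_tr[OF KBi bs]) (use m[OF r Xi0_lim(2)[OF k bs]] in simp)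
    have 3: "quot_class True i (translate ?v (\<lambda>n y. (r n y - r\<^sub>0) * \<Xi>\<^sub>0 n y))"
      by (intro quot_class_tr[OF KBi bs]) (use m[OF rk Xi0_lim(2)[OF k bs]] in simp)
    \<comment> \<open>The three errors: w against its limit, the cocycle against 1, the ratio
      against its limit.\<close>
    have "quot_class True i (\<lambda>n y. cocycle ?v n y * translate ?v (\<lambda>n y. r n y * \<Xi>\<^sub>1 n y) n y +
        (cocycle ?v n y - 1) * translate ?v (\<lambda>n y. r n y * \<Xi>\<^sub>0 n y) n y + translate ?v (\<lambda>n y. (r n y - r\<^sub>0) * \<Xi>\<^sub>0 n y) n y)"
      by (intro quot_class_add 3) (use 1 2 in simp_all)
    moreover have "lim i (\<lambda>n y. r\<^sub>0 * translate ?v \<Xi>\<^sub>0 n y) (r\<^sub>0 * (deriv ^^ i) (deriv (\<lambda>s. w\<^sub>0 s \<bullet> l)) 0)"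
      unfolding lim_def Qn_cmult using Xi0_lim(1)[OF k bs] by (auto simp: lim_def intro!: tendsto_mult_left)
    ultimately
    have "lim i (\<lambda>n y. (cocycle ?v n y * translate ?v (\<lambda>n y. r n y * \<Xi>\<^sub>1 n y) n y +
        (cocycle ?v n y - 1) * translate ?v (\<lambda>n y. r n y * \<Xi>\<^sub>0 n y) n y + translate ?v (\<lambda>n y. (r n y - r\<^sub>0) * \<Xi>\<^sub>0 n y) n y)
        + r\<^sub>0 * translate ?v \<Xi>\<^sub>0 n y) (0 + r\<^sub>0 * (deriv ^^ i) (deriv (\<lambda>s. w\<^sub>0 s \<bullet> l)) 0)"
      by (intro lim_add quot_class_lim)
    then have "lim i (\<lambda>n y. cocycle ?v n y * translate ?v (\<lambda>n y. r n y * (\<Xi>\<^sub>1 n y + \<Xi>\<^sub>0 n y)) n y) (r\<^sub>0 * (deriv ^^ i) (deriv (\<lambda>s. w\<^sub>0 s \<bullet> l)) 0)"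
      by (simp add: translate_def algebra_simps)
    then show "lim i (\<lambda>n y. ?x n (s n) y) (r\<^sub>0 * (deriv ^^ i) (deriv (\<lambda>s. w\<^sub>0 s \<bullet> l)) 0)"
    proof (rule lim_cong)
      show "eqv (\<lambda>n y. ?x n (s n) y) (\<lambda>n y. cocycle ?v n y * translate ?v (\<lambda>n y. r n y * (\<Xi>\<^sub>1 n y + \<Xi>\<^sub>0 n y)) n y)"
        unfolding eqv_def
      proof (intro allI impI)
        fix y :: "nat \<Rightarrow> 'a" assume y: "Bseq y"
        have y': "Bseq (\<lambda>n. y n + ?v n)" using Bseq_plus2[OF y bs] .
        show "\<forall>\<^sub>F n in sequentially. ?x n (s n) (y n) = cocycle ?v n (y n) * translate ?v (\<lambda>n y. r n y * (\<Xi>\<^sub>1 n y + \<Xi>\<^sub>0 n y)) n (y n)"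
          using ev_I[OF y' b(2)] ev_I[OF y' b(3)] alpha_nz[OF y']
          by eventually_elim (simp add: w_increment cocycle_def translate_def r_def)
      qed
    qed
  qed
qed

text \<open>One limit computed twice: the quotients of \<open>f\<close>, seen through the
  m-increments of the primitive and through its l-increments.\<close>

theorem flat_ratio:
  assumes "1 \<le> j" "j \<le> k"
  shows "(deriv ^^ j) (\<lambda>s. w\<^sub>0 s \<bullet> m) 0 = r\<^sub>0 * (deriv ^^ j) (\<lambda>s. w\<^sub>0 s \<bullet> l) 0"
proof -
  obtain i where i: "j = Suc i" using assms(1) by (cases j) auto
  have b: "Bseq (\<lambda>n. 0::'a)" by simp
  have "lim i (Q f) ((deriv ^^ j) (\<lambda>s. w\<^sub>0 s \<bullet> m) 0)" using lim_f[OF assms(2)] unfolding i lim_Suc .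
  moreover have "lim i (Q f) (r\<^sub>0 * (deriv ^^ j) (\<lambda>s. w\<^sub>0 s \<bullet> l) 0)"
    using lim_Qf[of i] assms(2) unfolding i by (simp add: funpow_Suc_right del: funpow.simps)
  ultimately show ?thesis unfolding lim_def using b LIMSEQ_unique by blast
qed

end

section \<open>Calculus of parametrised function classes\<close>

lemma deriv_cong_on:
  assumes "open S" "s \<in> S" "\<And>s. s \<in> S \<Longrightarrow> f s = g s" shows "deriv f s = deriv g s"
  by (rule deriv_cong_ev) (use eventually_nhds_in_open[OF assms(1,2)] assms(3) in \<open>auto elim!: eventually_mono\<close>)

lemma param_class_cong:
  assumes "param_class c z k \<phi>" "\<And>n y s. s \<in> {-c<..<c} \<Longrightarrow> \<phi>' n y s = \<phi> n y s"
  shows "param_class c z k \<phi>'"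
proof -
  have base: "param_class c z 0 \<phi>'" if "param_class c z 0 \<phi>" "\<And>n y s. s \<in> {-c<..<c} \<Longrightarrow> \<phi>' n y s = \<phi> n y s" for \<phi> \<phi>' :: "nat \<Rightarrow> 'a \<Rightarrow> real \<Rightarrow> real"
  proof -
    have "continuous_on (UNIV \<times> {-c<..<c}) (\<lambda>(y, s). \<phi>' n y s)" for n
      by (rule continuous_on_eq[of _ "\<lambda>(y, s). \<phi> n y s"]) (use that in auto)
    moreover have "seq_class z (\<lambda>n. \<phi>' n (y n) (s n))" if "\<forall>n. s n \<in> {-c<..<c}" for y s
      using \<open>param_class c z 0 \<phi>\<close> that \<open>\<And>n y s. s \<in> {-c<..<c} \<Longrightarrow> \<phi>' n y s = \<phi> n y s\<close> by (simp del: greaterThanLessThan_iff)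
    ultimately show ?thesis by simp
  qed
  show ?thesis using assms
  proof (induction k arbitrary: \<phi> \<phi>')
    case 0 then show ?case by (rule base)
  next
    case (Suc k)
    have b: "param_class c z 0 \<phi>'" using base[OF param_class_0[OF Suc.prems(1)] Suc.prems(2)] .
    have "param_class c z k (\<lambda>n y. deriv (\<phi>' n y))"
    proof (rule Suc.IH[of "\<lambda>n y. deriv (\<phi> n y)"])
      show "deriv (\<phi>' n y) s = deriv (\<phi> n y) s" if "s \<in> {-c<..<c}" for n y s
        by (rule deriv_cong_on[OF open_greaterThanLessThan that]) (rule Suc.prems(2))
    qed (use Suc.prems in auto)
    moreover have "\<phi>' n y differentiable (at s)" if "s \<in> {-c<..<c}" for n y s
    proof -
      have "\<phi> n y differentiable (at s)" using Suc.prems(1) that by auto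
      from differentiable_cong_open[OF open_greaterThanLessThan that _ this] show ?thesis by (simp add: Suc.prems(2))
    qed
    ultimately show ?case using b by auto
  qed
qed

lemma param_class_deriv:
  assumes "param_class c z (Suc k) \<phi>" "s \<in> {-c<..<c}" shows "(\<phi> n y has_real_derivative deriv (\<phi> n y) s) (at s)"
  using assms by (auto simp: DERIV_deriv_iff_real_differentiable)

lemma param_class_SucI:
  assumes "param_class c z 0 \<phi>" "\<And>n y s. s \<in> {-c<..<c} \<Longrightarrow> (\<phi> n y has_real_derivative D n y s) (at s)" "param_class c z k D"
  shows "param_class c z (Suc k) \<phi>"
proof -
  have "param_class c z k (\<lambda>n y. deriv (\<phi> n y))"
    by (rule param_class_cong[OF assms(3)]) (use assms(2) DERIV_imp_deriv in blast)
  moreover have "\<phi> n y differentiable (at s)" if "s \<in> {-c<..<c}" for n y s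
    using assms(2)[OF that] real_differentiable_def by blast
  ultimately show ?thesis using assms(1) by auto
qed

lemma param_class_SucD: "param_class c z (Suc k) \<phi> \<Longrightarrow> param_class c z k \<phi>"
  by (rule param_class_mono[OF _ le_SucI[OF order_refl]])

lemma param_class_add: "param_class c z k f \<Longrightarrow> param_class c z k g \<Longrightarrow> param_class c z k (\<lambda>n y s. f n y s + g n y s)"
proof -
  have base: "param_class c z 0 (\<lambda>n y s. f n y s + g n y s)" if "param_class c z 0 f" "param_class c z 0 g" for f g :: "nat \<Rightarrow> 'a \<Rightarrow> real \<Rightarrow> real"
    using that by (auto simp: case_prod_unfold intro!: continuous_on_add seq_class_add simp del: greaterThanLessThan_iff)
  show "param_class c z k f \<Longrightarrow> param_class c z k g \<Longrightarrow> param_class c z k (\<lambda>n y s. f n y s + g n y s)"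
  proof (induction k arbitrary: f g)
    case 0 then show ?case by (rule base)
  next
    case (Suc k)
    show ?case
      by (rule param_class_SucI[OF base[OF param_class_0[OF Suc.prems(1)] param_class_0[OF Suc.prems(2)]] DERIV_add[OF param_class_deriv[OF Suc.prems(1)] param_class_deriv[OF Suc.prems(2)]] Suc.IH])
       (use Suc.prems in auto)
  qed
qed

lemma param_class_mult: "param_class c a k f \<Longrightarrow> param_class c b k g \<Longrightarrow> param_class c (a \<or> b) k (\<lambda>n y s. f n y s * g n y s)"
proof -
  have base: "param_class c (a \<or> b) 0 (\<lambda>n y s. f n y s * g n y s)" if "param_class c a 0 f" "param_class c b 0 g" for f g :: "nat \<Rightarrow> 'a \<Rightarrow> real \<Rightarrow> real"
    using that by (auto simp: case_prod_unfold intro!: continuous_on_mult seq_class_mult simp del: greaterThanLessThan_iff)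
  show "param_class c a k f \<Longrightarrow> param_class c b k g \<Longrightarrow> param_class c (a \<or> b) k (\<lambda>n y s. f n y s * g n y s)"
  proof (induction k arbitrary: f g)
    case 0 then show ?case by (rule base)
  next
    case (Suc k)
    have 1: "param_class c (a \<or> b) k (\<lambda>n y s. deriv (f n y) s * g n y s)" by (rule Suc.IH) (use Suc.prems param_class_SucD in auto)
    have 2: "param_class c (a \<or> b) k (\<lambda>n y s. f n y s * deriv (g n y) s)" by (rule Suc.IH) (use Suc.prems param_class_SucD in auto)
    show ?case
    proof (rule param_class_SucI[OF base[OF param_class_0[OF Suc.prems(1)] param_class_0[OF Suc.prems(2)]] _ param_class_add[OF 1 2]])
      show "((\<lambda>s. f n y s * g n y s) has_real_derivative deriv (f n y) s * g n y s + f n y s * deriv (g n y) s) (at s)"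
        if "s \<in> {-c<..<c}" for n y s
        using DERIV_mult[OF param_class_deriv[OF Suc.prems(1) that] param_class_deriv[OF Suc.prems(2) that]] by (simp add: mult.commute)
    qed
  qed
qed

lemma param_class_const: "param_class c False k (\<lambda>n y s. a)"
proof (induction k arbitrary: a)
  case 0 then show ?case by (auto simp: case_prod_unfold seq_class_def)
next
  case (Suc k)
  show ?case by (rule param_class_SucI[where D="\<lambda>n y s. 0"]) (use Suc in \<open>auto simp: case_prod_unfold seq_class_def\<close>)
qed

lemma param_class_cmult: "param_class c z k f \<Longrightarrow> param_class c z k (\<lambda>n y s. a * f n y s)"
  using param_class_mult[OF param_class_const, of c z k f a] by simp

lemma param_class_inverse:
  assumes "param_class c False k f" "\<And>n y s. s \<in> {-c<..<c} \<Longrightarrow> \<bar>f n y s\<bar> \<ge> e" "e > 0"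
  shows "param_class c False k (\<lambda>n y s. inverse (f n y s))"
  using assms(1)
proof (induction k)
  case 0
  have nz: "s \<in> {-c<..<c} \<Longrightarrow> f n y s \<noteq> 0" for n y s using assms(2)[of s n y] assms(3) by auto
  have "Bseq (\<lambda>n. inverse (f n (y n) (s n)))" if "\<forall>n. s n \<in> {-c<..<c}" for y s
  proof (rule BseqI'[of _ "inverse e"])
    fix n show "norm (inverse (f n (y n) (s n))) \<le> inverse e"
      using le_imp_inverse_le[OF assms(2)[of "s n" n "y n"] assms(3)] that by simp
  qed
  moreover have "continuous_on (UNIV \<times> {-c<..<c}) (\<lambda>(y, s). inverse (f n y s))" for n
    using param_class_cont2[OF 0, of n] nz by (auto simp: case_prod_unfold intro!: continuous_on_inverse)
  ultimately show ?case by (simp add: seq_class_def)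
next
  case (Suc k)
  have nz: "s \<in> {-c<..<c} \<Longrightarrow> f n y s \<noteq> 0" for n y s using assms(2)[of s n y] assms(3) by auto
  have i: "param_class c False k (\<lambda>n y s. inverse (f n y s))" using Suc param_class_SucD by blast
  have "param_class c False k (\<lambda>n y. deriv (f n y))" using Suc.prems by auto
  from param_class_mult[OF this param_class_mult[OF i i]] have "param_class c False k (\<lambda>n y s. deriv (f n y) s * (inverse (f n y s) * inverse (f n y s)))" by simp
  note D = param_class_cmult[OF this, of "-1"]
  show ?case
  proof (rule param_class_SucI[OF param_class_0[OF i] _ D])
    show "((\<lambda>s. inverse (f n y s)) has_real_derivative -1 * (deriv (f n y) s * (inverse (f n y s) * inverse (f n y s)))) (at s)"
      if "s \<in> {-c<..<c}" for n y s
      using DERIV_inverse_fun[OF param_class_deriv[OF Suc.prems that] nz[OF that]] by (simp add: power2_eq_square field_simps)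
  qed
qed

section \<open>Convergence of the dual frame\<close>

text \<open>Convergence to \<open>\<psi>\<close> with k height derivatives, uniformly in y.
  Boundedness of the limit is included, which makes the class closed under products and, away from
  0, under inverses.\<close>

definition approx_class :: "real \<Rightarrow> nat \<Rightarrow> (nat \<Rightarrow> 'a::topological_space \<Rightarrow> real \<Rightarrow> real) \<Rightarrow> (real \<Rightarrow> real) \<Rightarrow> bool" where
  "approx_class c k \<phi> \<psi> \<longleftrightarrow> param_class c True k (\<lambda>n y s. \<phi> n y s - \<psi> s) \<and> param_class c False k (\<lambda>n (y::'a) s. \<psi> s)"

lemma approx_class_D:
  fixes \<phi> :: "nat \<Rightarrow> 'a::topological_space \<Rightarrow> real \<Rightarrow> real"
  assumes "approx_class c k \<phi> \<psi>" shows "param_class c True k (\<lambda>n y s. \<phi> n y s - \<psi> s)" "param_class c False k (\<lambda>n (y::'a) s. \<psi> s)"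
  using assms by (simp_all only: approx_class_def)

lemma approx_class_FD: "approx_class c k \<phi> \<psi> \<Longrightarrow> param_class c False k \<phi>"
  using param_class_add[OF param_class_weaken[OF approx_class_D(1)[of c k \<phi> \<psi>]] approx_class_D(2)[of c k \<phi> \<psi>]] by simp

lemma approx_class_add: assumes "approx_class c k f f'" "approx_class c k g g'" shows "approx_class c k (\<lambda>n y s. f n y s + g n y s) (\<lambda>s. f' s + g' s)"
proof -
  have "param_class c True k (\<lambda>n y s. (f n y s - f' s) + (g n y s - g' s))" by (rule param_class_add[OF approx_class_D(1)[OF assms(1)] approx_class_D(1)[OF assms(2)]])
  moreover have "param_class c False k (\<lambda>n (y::'a) s. f' s + g' s)" by (rule param_class_add[OF approx_class_D(2)[OF assms(1)] approx_class_D(2)[OF assms(2)]])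
  ultimately show ?thesis unfolding approx_class_def by (simp add: algebra_simps)
qed

lemma param_class_True_zero: "param_class c True k (\<lambda>n y s. 0)"
proof (induction k)
  case 0 then show ?case by (auto simp: case_prod_unfold seq_class_def)
next
  case (Suc k)
  show ?case by (rule param_class_SucI[where D="\<lambda>n y s. 0"]) (use Suc in \<open>auto simp: case_prod_unfold seq_class_def\<close>)
qed

lemma approx_class_const: "approx_class c k (\<lambda>n y s. a) (\<lambda>s. a)"
  unfolding approx_class_def using param_class_True_zero param_class_const by auto

lemma approx_class_mult: assumes "approx_class c k f f'" "approx_class c k g g'" shows "approx_class c k (\<lambda>n y s. f n y s * g n y s) (\<lambda>s. f' s * g' s)"
proof -
  have 1: "param_class c (True \<or> False) k (\<lambda>n y s. (f n y s - f' s) * g n y s)"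
    by (rule param_class_mult[OF approx_class_D(1)[OF assms(1)] approx_class_FD[OF assms(2)]])
  have 2: "param_class c (False \<or> True) k (\<lambda>n y s. f' s * (g n y s - g' s))"
    by (rule param_class_mult[OF approx_class_D(2)[OF assms(1)] approx_class_D(1)[OF assms(2)]])
  have "param_class c True k (\<lambda>n y s. (f n y s - f' s) * g n y s + f' s * (g n y s - g' s))"
    using param_class_add 1 2 by auto
  moreover have "param_class c (False \<or> False) k (\<lambda>n (y::'a) s. f' s * g' s)"
    by (rule param_class_mult[OF approx_class_D(2)[OF assms(1)] approx_class_D(2)[OF assms(2)]])
  ultimately show ?thesis unfolding approx_class_def by (simp add: algebra_simps)
qed

lemma approx_class_inverse:
  assumes "approx_class c k f f'" "\<And>n y s. s \<in> {-c<..<c} \<Longrightarrow> \<bar>f n y s\<bar> \<ge> e" "\<And>s. s \<in> {-c<..<c} \<Longrightarrow> \<bar>f' s\<bar> \<ge> e" "e > 0"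
  shows "approx_class c k (\<lambda>n y s. inverse (f n y s)) (\<lambda>s. inverse (f' s))"
proof -
  have 1: "param_class c False k (\<lambda>n y s. inverse (f n y s))" by (rule param_class_inverse[OF approx_class_FD[OF assms(1)] assms(2,4)])
  have 2: "param_class c False k (\<lambda>n (y::'a) s. inverse (f' s))" by (rule param_class_inverse[OF approx_class_D(2)[OF assms(1)] assms(3,4)])
  have 3: "param_class c (True \<or> False \<or> False) k (\<lambda>n y s. (f n y s - f' s) * (inverse (f n y s) * inverse (f' s)))"
    by (rule param_class_mult[OF approx_class_D(1)[OF assms(1)] param_class_mult[OF 1 2]])
  have "param_class c True k (\<lambda>n y s. -1 * ((f n y s - f' s) * (inverse (f n y s) * inverse (f' s))))" using param_class_cmult[OF 3, of "-1"] by simp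
  then have "param_class c True k (\<lambda>n y s. inverse (f n y s) - inverse (f' s))"
  proof (rule param_class_cong)
    fix n y s assume s: "s \<in> {-c<..<c}"
    have "f n y s \<noteq> 0" "f' s \<noteq> 0" using assms(2)[OF s, of n y] assms(3)[OF s] assms(4) by auto
    then show "inverse (f n y s) - inverse (f' s) = -1 * ((f n y s - f' s) * (inverse (f n y s) * inverse (f' s)))" by (simp add: field_simps)
  qed
  then show ?thesis using 2 by (simp add: approx_class_def)
qed

lemma approx_class_cmult: "approx_class c k f f' \<Longrightarrow> approx_class c k (\<lambda>n y s. a * f n y s) (\<lambda>s. a * f' s)"
  using approx_class_mult[OF approx_class_const] by blast

lemma approx_class_sum: "(\<And>i. i \<in> A \<Longrightarrow> approx_class c k (f i) (f' i)) \<Longrightarrow> approx_class c k (\<lambda>n y s. \<Sum>i\<in>A. f i n y s) (\<lambda>s. \<Sum>i\<in>A. f' i s)"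
  by (induction A rule: infinite_finite_induct) (auto intro: approx_class_const approx_class_add)

lemma approx_class_prod: "(\<And>i. i \<in> A \<Longrightarrow> approx_class c k (f i) (f' i)) \<Longrightarrow> approx_class c k (\<lambda>n y s. \<Prod>i\<in>A. f i n y s) (\<lambda>s. \<Prod>i\<in>A. f' i s)"
  by (induction A rule: infinite_finite_induct) (auto intro: approx_class_const approx_class_mult)

lemma partial_z:
  fixes f :: "'a::euclidean_space \<times> real \<Rightarrow> real"
  assumes "f differentiable (at (y, s))"
  shows "((\<lambda>s. f (y, s)) has_real_derivative partial_deriv (0, 1) f (y, s)) (at s)"
proof -
  have d: "(f has_derivative (\<lambda>h. partial_deriv h f (y, s))) (at (y, s))" by (rule has_derivative_frechet[OF assms])
  have lin: "linear (\<lambda>h. partial_deriv h f (y, s))" by (rule has_derivative_linear[OF d])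
  have e: "(\<lambda>t. partial_deriv (0, t) f (y, s)) = (*) (partial_deriv (0, 1) f (y, s))"
  proof
    fix t show "partial_deriv (0, t) f (y, s) = partial_deriv (0, 1) f (y, s) * t"
      using linear_scale[OF lin, of t "(0,1)"] by simp
  qed
  have "((\<lambda>s. (y, s)) has_derivative (\<lambda>t. (0, t))) (at s)" by (auto intro!: derivative_eq_intros)
  from diff_chain_at[OF this d] show ?thesis by (simp add: has_field_derivative_def comp_def e)
qed

text \<open>The pure z-derivatives in the \<open>C^k\<close> norm supply the estimates. Absorbing
  the innermost derivative of the list into the function turns order i + 1 for \<open>D n\<close>
  into order i for its z-derivative.\<close>

lemma param_class_of_close:
  fixes D :: "nat \<Rightarrow> 'a::euclidean_space \<times> real \<Rightarrow> real"
  assumes "\<And>n. Ck_on k (D n) (UNIV \<times> {-c<..<c})"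
    "\<And>n i p. i \<le> k \<Longrightarrow> p \<in> UNIV \<times> {-c<..<c} \<Longrightarrow> \<bar>iter_partial (replicate i (0, 1)) (D n) p\<bar> \<le> \<delta> n"
    "\<delta> \<longlonglongrightarrow> 0"
  shows "param_class c True k (\<lambda>n y s. D n (y, s))"
  using assms(1,2)
proof (induction k arbitrary: D)
  case 0
  have "(\<lambda>n. D n (y n, s n)) \<longlonglongrightarrow> 0" if "\<forall>n. s n \<in> {-c<..<c}" for y s
    by (rule Lim_null_comparison[OF _ assms(3)]) (use 0(2)[of 0] that in auto)
  then show ?case using 0(1) by (auto simp: case_prod_unfold seq_class_def)
next
  case (Suc k)
  have b: "param_class c True 0 (\<lambda>n y s. D n (y, s))"
  proof -
    have "(\<lambda>n. D n (y n, s n)) \<longlonglongrightarrow> 0" if "\<forall>n. s n \<in> {-c<..<c}" for y s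
      by (rule Lim_null_comparison[OF _ assms(3)]) (use Suc.prems(2)[of 0] that in auto)
    moreover have "continuous_on (UNIV \<times> {-c<..<c}) (D n)" for n using Ck_on_mono[OF Suc.prems(1), of 0] by simp
    ultimately show ?thesis by (auto simp: case_prod_unfold seq_class_def)
  qed
  have ez: "(0, 1::real) \<in> (Basis :: ('a \<times> real) set)" by (simp add: Basis_prod_def)
  have "param_class c True k (\<lambda>n y s. partial_deriv (0, 1) (D n) (y, s))"
  proof (rule Suc.IH)
    show "Ck_on k (partial_deriv (0, 1) (D n)) (UNIV \<times> {-c<..<c})" for n using Suc.prems(1)[of n] ez by simp
    fix n i and p :: "'a \<times> real" assume i: "i \<le> k" and p: "p \<in> UNIV \<times> {-c<..<c}"
    have "iter_partial (bs @ [b]) f = iter_partial bs (partial_deriv b f)" for bs :: "('a \<times> real) list" and b and f :: "'a \<times> real \<Rightarrow> real"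
      by (induction bs) auto
    then have "iter_partial (replicate i (0, 1)) (partial_deriv (0, 1) (D n)) p = iter_partial (replicate (Suc i) (0, 1)) (D n) p"
      by (metis replicate_Suc replicate_append_same)
    then show "\<bar>iter_partial (replicate i (0, 1)) (partial_deriv (0, 1) (D n)) p\<bar> \<le> \<delta> n"
      using Suc.prems(2)[of "Suc i" p n] i p by (simp del: iter_partial.simps replicate_Suc)
  qed
  then show ?case
    by (rule param_class_SucI[OF b, rotated]) (use Suc.prems(1) in \<open>auto intro!: partial_z\<close>)
qed

lemma param_class_of_Ck:
  fixes \<psi> :: "real \<Rightarrow> real"
  assumes "Ck_on k \<psi> S" "open S" "{-c..c} \<subseteq> S"
  shows "param_class c False k (\<lambda>n (y::'a::topological_space). \<psi>)"
  using assms(1)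
proof (induction k arbitrary: \<psi>)
  case 0
  have c: "continuous_on {-c..c} \<psi>" using 0 assms(3) continuous_on_subset by auto
  then have "bounded (\<psi> ` {-c..c})" by (intro compact_imp_bounded compact_continuous_image) auto
  then obtain K where K: "\<forall>s\<in>{-c..c}. norm (\<psi> s) \<le> K" by (auto simp: bounded_iff)
  have "Bseq (\<lambda>n. \<psi> (s n))" if "\<forall>n. s n \<in> {-c<..<c}" for s
    by (rule BseqI'[of _ K]) (use K that in \<open>auto simp: less_imp_le\<close>)
  moreover have "continuous_on (UNIV \<times> {-c<..<c}) (\<lambda>z. \<psi> (snd (z :: 'a \<times> real)))"
    by (rule continuous_on_compose2[OF c]) (auto intro!: continuous_intros)
  ultimately show ?case by (auto simp: case_prod_unfold seq_class_def)
next
  case (Suc k)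
  have b: "param_class c False k (\<lambda>n (y::'a). \<psi>)" using Suc Ck_on_SucD by blast
  show ?case
  proof (rule param_class_SucI[OF param_class_0[OF b]])
    show "param_class c False k (\<lambda>n (y::'a). partial_deriv 1 \<psi>)" by (rule Suc.IH) (use Suc.prems in auto)
    show "(\<psi> has_real_derivative partial_deriv 1 \<psi> s) (at s)" if "s \<in> {-c<..<c}" for s
      using Ck_on_real_deriv(1)[OF Suc.prems assms(2) subsetD[OF assms(3)], of s] that
      by (simp add: has_real_derivative_iff_has_vector_derivative)
  qed
qed

section \<open>Compactness of the orbit of a closed leaf\<close>

text \<open>exp(2 C t) g^2 is nondecreasing and exp(-2 C t) g^2 is nonincreasing, so a zero at t0
  spreads to the left by the first and to the right by the second.\<close>

lemma gronwall_zero_Icc: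
  fixes g :: "real \<Rightarrow> real"
  assumes d: "\<And>t. t \<in> {a..b} \<Longrightarrow> (g has_real_derivative g' t) (at t within {a..b})"
    and C: "\<And>t. t \<in> {a..b} \<Longrightarrow> \<bar>g' t\<bar> \<le> C * \<bar>g t\<bar>" and t0: "t0 \<in> {a..b}" "g t0 = 0" and t: "t \<in> {a..b}"
  shows "g t = 0"
proof -
  have cg: "continuous_on {a..b} g" using d by (rule DERIV_continuous_on)
  have D: "((\<lambda>t. exp (s * t) * (g t)\<^sup>2) has_real_derivative exp (s * t) * (s * (g t)\<^sup>2 + 2 * g t * g' t)) (at t)" if "a < t" "t < b" for t s
  proof -
    have "(g has_real_derivative g' t) (at t)" using d[of t] that by (simp add: at_within_Icc_at)
    then show ?thesis by (auto intro!: derivative_eq_intros simp: algebra_simps)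
  qed
  have B: "\<bar>2 * g t * g' t\<bar> \<le> 2 * C * (g t)\<^sup>2" if "t \<in> {a..b}" for t
    using mult_left_mono[OF C[OF that], of "2 * \<bar>g t\<bar>"] by (simp add: abs_mult power2_eq_square algebra_simps)
  have c2: "continuous_on {u..v} (\<lambda>t. exp (s * t) * (g t)\<^sup>2)" if "u \<in> {a..b}" "v \<in> {a..b}" for s u v
    using that by (intro continuous_intros continuous_on_subset[OF cg]) auto
  show ?thesis
  proof (cases "t \<le> t0")
    case True
    have "exp (2 * C * t) * (g t)\<^sup>2 \<le> exp (2 * C * t0) * (g t0)\<^sup>2"
    proof (rule DERIV_nonneg_imp_increasing_open[where f="\<lambda>t. exp (2 * C * t) * (g t)\<^sup>2", OF True])
      fix x assume x: "t < x" "x < t0"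
      then have "a < x" "x < b" "x \<in> {a..b}" using t t0 by auto
      then show "\<exists>y. ((\<lambda>t. exp (2 * C * t) * (g t)\<^sup>2) has_real_derivative y) (at x) \<and> 0 \<le> y"
        by (intro exI[of _ "exp (2 * C * x) * (2 * C * (g x)\<^sup>2 + 2 * g x * g' x)"] conjI D mult_nonneg_nonneg) (use B[of x] in \<open>auto simp: abs_le_iff\<close>)
    qed (use c2 t t0 in auto)
    then show ?thesis using t0(2) by (simp add: mult_le_0_iff)
  next
    case False
    have "exp (- 2 * C * t0) * (g t0)\<^sup>2 \<ge> exp (- 2 * C * t) * (g t)\<^sup>2"
    proof (rule DERIV_nonpos_imp_decreasing_open[where f="\<lambda>t. exp (- 2 * C * t) * (g t)\<^sup>2"])
      show "t0 \<le> t" using False by simp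
      fix x assume x: "t0 < x" "x < t"
      then have "a < x" "x < b" "x \<in> {a..b}" using t t0 by auto
      then show "\<exists>y. ((\<lambda>t. exp (- 2 * C * t) * (g t)\<^sup>2) has_real_derivative y) (at x) \<and> y \<le> 0"
        by (intro exI[of _ "exp (- 2 * C * x) * (- 2 * C * (g x)\<^sup>2 + 2 * g x * g' x)"] conjI D mult_nonneg_nonpos) (use B[of x] in \<open>auto simp: abs_le_iff\<close>)
    qed (rule c2[OF t0(1) t])
    then show ?thesis using t0(2) by (simp add: mult_le_0_iff)
  qed
qed

lemma gronwall_zero:
  fixes g :: "real \<Rightarrow> real"
  assumes d: "\<And>t. t \<in> closed_segment 0 T \<Longrightarrow> (g has_real_derivative g' t) (at t within closed_segment 0 T)"
    and C: "\<And>t. t \<in> closed_segment 0 T \<Longrightarrow> \<bar>g' t\<bar> \<le> C * \<bar>g t\<bar>" and t0: "t0 \<in> closed_segment 0 T" "g t0 = 0" and t: "t \<in> closed_segment 0 T"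
  shows "g t = 0"
proof -
  have "closed_segment 0 T = {min 0 T..max 0 T}" by (auto simp: closed_segment_eq_real_ivl)
  then show ?thesis using gronwall_zero_Icc[of "min 0 T" "max 0 T" g g' C t0 t] assms by simp
qed

lemma norm_components_le: "norm (fst p) \<le> norm p" "norm (snd p) \<le> norm p"
  using norm_fst_le[of "fst p" "snd p"] norm_snd_le[of "snd p" "fst p"] by simp_all

section \<open>Entries of the inverse matrix\<close>

lemma matrix_inv_inverse:
  fixes A :: "real^'n^'n"
  assumes "invertible A" shows "A ** matrix_inv A = mat 1" "matrix_inv A ** A = mat 1"
  using someI_ex[OF assms[unfolded invertible_def]] unfolding matrix_inv_def by blast+

text \<open>Cramer's rule: an entry of the inverse is a polynomial in the entries divided by the
  determinant, so smoothness and convergence of inverses follow from sums, products and one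
  reciprocal.\<close>

lemma matrix_inv_entry:
  fixes A :: "real^'n^'n"
  assumes "det A \<noteq> 0"
  shows "matrix_inv A $ k $ i = det (\<chi> r j. if j = k then (if r = i then 1 else 0) else A $ r $ j) * inverse (det A)"
proof -
  have inv: "invertible A" using assms by (simp add: invertible_det_nz)
  then have "A ** matrix_inv A = mat 1" by (rule matrix_inv_inverse)
  then have "A *v (matrix_inv A *v axis i 1) = axis i 1" by (simp add: matrix_vector_mul_assoc)
  then have "matrix_inv A *v axis i 1 = (\<chi> k. det (\<chi> r j. if j = k then (axis i 1 :: real^'n) $ r else A $ r $ j) / det A)"
    using cramer[OF assms] by blast
  moreover have "(matrix_inv A *v axis i 1) $ k = matrix_inv A $ k $ i"
    by (simp add: matrix_vector_mul_component inner_axis)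
  ultimately have "matrix_inv A $ k $ i = det (\<chi> r j. if j = k then (axis i 1 :: real^'n) $ r else A $ r $ j) / det A" by simp
  moreover have "(axis i 1 :: real^'n) $ r = (if r = i then 1 else 0)" for r by (simp add: axis_def)
  ultimately show ?thesis by (simp only: divide_inverse)
qed

lemma Ck_on_det:
  fixes M :: "'a::euclidean_space \<Rightarrow> real^'n^'n"
  assumes "open S" "\<And>i j. Ck_on m (\<lambda>x. M x $ i $ j) S" shows "Ck_on m (\<lambda>x. det (M x)) S"
  unfolding det_def by (intro Ck_on_sum Ck_on_mult Ck_on_const Ck_on_prod assms)

lemma Ck_on_matrix_inv:
  fixes M :: "'a::euclidean_space \<Rightarrow> real^'n^'n"
  assumes "open S" "\<And>i j. Ck_on m (\<lambda>x. M x $ i $ j) S" "\<And>x. x \<in> S \<Longrightarrow> det (M x) \<noteq> 0"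
  shows "Ck_on m (\<lambda>x. matrix_inv (M x) $ k $ i) S"
proof (rule Ck_on_cong[OF assms(1)])
  show "det (\<chi> r j. if j = k then (if r = i then 1 else 0) else M x $ r $ j) * inverse (det (M x)) = matrix_inv (M x) $ k $ i"
    if "x \<in> S" for x using matrix_inv_entry[OF assms(3)[OF that]] by simp
  have "Ck_on m (\<lambda>x. (\<chi> r j. if j = k then (if r = i then 1 else 0) else M x $ r $ j) $ r $ j) S" for r j
    using assms(1,2) by (cases "j = k") (auto intro: Ck_on_const)
  then show "Ck_on m (\<lambda>x. det (\<chi> r j. if j = k then (if r = i then 1 else 0) else M x $ r $ j) * inverse (det (M x))) S"
    by (intro Ck_on_mult Ck_on_det Ck_on_inverse assms) auto
qed

lemma Ck_on_vec:
  fixes f :: "'a::euclidean_space \<Rightarrow> real^'n"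
  assumes "open S" "\<And>i. Ck_on m (\<lambda>x. f x $ i) S" shows "Ck_on m f S"
  by (rule Ck_on_components[OF assms(1)]) (auto simp: Basis_vec_def inner_axis intro: assms(2))

lemma Ck_on_nth:
  fixes f :: "'a::euclidean_space \<Rightarrow> 'b::euclidean_space^'n"
  shows "open S \<Longrightarrow> Ck_on m f S \<Longrightarrow> Ck_on m (\<lambda>x. f x $ i) S"
  by (rule Ck_on_linear_compose[OF _ bounded_linear_vec_nth])

lemma approx_class_det:
  assumes "\<And>i j. approx_class c k (\<lambda>n y s. M n y s $ i $ j) (\<lambda>s. M' s $ i $ j)"
  shows "approx_class c k (\<lambda>n y s. det (M n y s)) (\<lambda>s. det (M' s))"
  unfolding det_def by (intro approx_class_sum approx_class_cmult approx_class_prod assms)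

lemma approx_class_cong:
  assumes "approx_class c k f f'" "\<And>n y s. s \<in> {-c<..<c} \<Longrightarrow> g n y s = f n y s" "\<And>s. s \<in> {-c<..<c} \<Longrightarrow> g' s = f' s"
  shows "approx_class c k g g'"
  unfolding approx_class_def using param_class_cong[OF approx_class_D(1)[OF assms(1)]] param_class_cong[OF approx_class_D(2)[OF assms(1)]] assms(2,3) by auto

lemma approx_class_matrix_inv:
  assumes "\<And>i j. approx_class c k (\<lambda>n y s. M n y s $ i $ j) (\<lambda>s. M' s $ i $ j)" "e > 0"
    "\<And>n y s. s \<in> {-c<..<c} \<Longrightarrow> \<bar>det (M n y s)\<bar> \<ge> e" "\<And>s. s \<in> {-c<..<c} \<Longrightarrow> \<bar>det (M' s)\<bar> \<ge> e"
  shows "approx_class c k (\<lambda>n y s. matrix_inv (M n y s) $ q $ i) (\<lambda>s. matrix_inv (M' s) $ q $ i)"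
proof (rule approx_class_cong[OF approx_class_mult[OF approx_class_det approx_class_inverse[OF approx_class_det[OF assms(1)] assms(3,4,2)]]])
  show "approx_class c k (\<lambda>n y s. (\<chi> r j. if j = q then (if r = i then 1 else 0) else M n y s $ r $ j) $ r $ j)
      (\<lambda>s. (\<chi> r j. if j = q then (if r = i then 1 else 0) else M' s $ r $ j) $ r $ j)" for r j
    using assms(1) by (cases "j = q") (auto intro: approx_class_const)
  show "matrix_inv (M n y s) $ q $ i = det (\<chi> r j. if j = q then (if r = i then 1 else 0) else M n y s $ r $ j) * inverse (det (M n y s))"
    if "s \<in> {-c<..<c}" for n y s by (rule matrix_inv_entry) (use assms(3)[OF that, of n y] assms(2) in auto)
  show "matrix_inv (M' s) $ q $ i = det (\<chi> r j. if j = q then (if r = i then 1 else 0) else M' s $ r $ j) * inverse (det (M' s))"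
    if "s \<in> {-c<..<c}" for s by (rule matrix_inv_entry) (use assms(4)[OF that] assms(2) in auto)
qed

section \<open>The dual coframe of a commuting family\<close>

lemma partial_deriv_cont:
  fixes f :: "'a::euclidean_space \<Rightarrow> 'b::real_normed_vector"
  assumes "Ck_on (Suc 0) f S" shows "continuous_on S (\<lambda>x. partial_deriv h f x)"
proof -
  have "continuous_on S (\<lambda>x. \<Sum>b\<in>Basis. (h \<bullet> b) *\<^sub>R partial_deriv b f x)"
    using assms by (intro continuous_intros) auto
  then show ?thesis
  proof (rule continuous_on_eq)
    fix x assume x: "x \<in> S"
    have lin: "linear (\<lambda>h. partial_deriv h f x)" by (rule has_derivative_linear[OF Ck_on_derivD[OF assms x]])
    have "partial_deriv (\<Sum>b\<in>Basis. (h \<bullet> b) *\<^sub>R b) f x = (\<Sum>b\<in>Basis. (h \<bullet> b) *\<^sub>R partial_deriv b f x)"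
      by (simp only: linear_sum[OF lin] linear_scale[OF lin])
    then show "(\<Sum>b\<in>Basis. (h \<bullet> b) *\<^sub>R partial_deriv b f x) = partial_deriv h f x"
      by (simp add: euclidean_representation)
  qed
qed

text \<open>Fields lifted to the universal cover. Smoothness and commutation hold on the strip of
  half-width \<open>\<epsilon>\<close>, independence of the horizontal parts only on the narrower
  strip of half-width \<open>c\<close>, in which leaves are sought.\<close>

locale cover_family =
  fixes V :: "'n::finite \<Rightarrow> (real^'n) \<times> real \<Rightarrow> (real^'n) \<times> real" and \<epsilon> c :: real
  assumes c: "0 < c" "c < \<epsilon>"
    and smooth: "smooth_on (V j) (UNIV \<times> {-\<epsilon><..<\<epsilon>})"
    and commute: "p \<in> UNIV \<times> {-\<epsilon><..<\<epsilon>} \<Longrightarrow> lie_bracket (V i) (V j) p = 0"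
    and det: "p \<in> UNIV \<times> {-c<..<c} \<Longrightarrow> det (\<chi> i j. fst (V j p) $ i) \<noteq> 0"
begin

definition frame_matrix_at :: "(real^'n) \<times> real \<Rightarrow> real^'n^'n" where "frame_matrix_at p = (\<chi> i j. fst (V j p) $ i)"
definition w :: "'n \<Rightarrow> (real^'n) \<times> real \<Rightarrow> real^'n" where "w j p = matrix_inv (frame_matrix_at p) $ j"
text \<open>The slope of the hyperplane spanned by the fields: that hyperplane is the graph of v |->
  \<open>\<omega> p\<close> . v over the horizontal directions, by \<open>frame\<close>.\<close>

definition \<omega> :: "(real^'n) \<times> real \<Rightarrow> real^'n" where "\<omega> p = (\<Sum>j\<in>UNIV. snd (V j p) *\<^sub>R w j p)"

abbreviation "U \<equiv> (UNIV :: (real^'n) set) \<times> {-c<..<c}"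
abbreviation "U\<epsilon> \<equiv> (UNIV :: (real^'n) set) \<times> {-\<epsilon><..<\<epsilon>}"

lemma openU: "open U" "open U\<epsilon>" "U \<subseteq> U\<epsilon>" using c by (auto intro!: open_Times)

lemma V_Ck: "Ck_on m (V j) U\<epsilon>" using smooth by (simp add: smooth_on_def)

lemma V_Ck': "Ck_on m (V j) U" by (rule Ck_on_subset[OF V_Ck openU(3)])

lemma V_comp_Ck: "Ck_on m (\<lambda>p. fst (V j p) $ i) U" "Ck_on m (\<lambda>p. snd (V j p)) U"
proof -
  have "Ck_on m (\<lambda>p. fst (V j p)) U" by (rule Ck_on_linear_compose[OF openU(1) bounded_linear_fst V_Ck'])
  then show "Ck_on m (\<lambda>p. fst (V j p) $ i) U" by (rule Ck_on_nth[OF openU(1)])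
  show "Ck_on m (\<lambda>p. snd (V j p)) U" by (rule Ck_on_linear_compose[OF openU(1) bounded_linear_snd V_Ck'])
qed

lemma w_Ck: "Ck_on m (w j) U"
  unfolding w_def[abs_def]
  by (intro Ck_on_vec Ck_on_matrix_inv openU) (use det V_comp_Ck in \<open>auto simp: frame_matrix_at_def\<close>)

lemma om_Ck: "Ck_on m \<omega> U"
  unfolding \<omega>_def[abs_def] by (intro Ck_on_sum Ck_on_scaleR openU V_comp_Ck w_Ck)

lemma inv: assumes "p \<in> U" shows "frame_matrix_at p ** matrix_inv (frame_matrix_at p) = mat 1" "matrix_inv (frame_matrix_at p) ** frame_matrix_at p = mat 1"
proof -
  have "invertible (frame_matrix_at p)" using det[OF assms] by (simp add: invertible_det_nz frame_matrix_at_def)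
  then show "frame_matrix_at p ** matrix_inv (frame_matrix_at p) = mat 1" "matrix_inv (frame_matrix_at p) ** frame_matrix_at p = mat 1"
    by (rule matrix_inv_inverse)+
qed

lemma frame_matrix_at_mult: "frame_matrix_at p *v x = (\<Sum>j\<in>UNIV. x $ j *\<^sub>R fst (V j p))"
  by (simp add: vec_eq_iff matrix_vector_mult_def frame_matrix_at_def mult.commute)

lemma w_inner: "w j p \<bullet> v = (matrix_inv (frame_matrix_at p) *v v) $ j"
  by (simp add: w_def matrix_vector_mul_component)

lemma frame: assumes "p \<in> U" shows "(\<Sum>j\<in>UNIV. (w j p \<bullet> v) *\<^sub>R V j p) = (v, \<omega> p \<bullet> v)"
proof -
  have "(\<Sum>j\<in>UNIV. (w j p \<bullet> v) *\<^sub>R fst (V j p)) = frame_matrix_at p *v (matrix_inv (frame_matrix_at p) *v v)"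
    by (simp add: frame_matrix_at_mult w_inner)
  also have "\<dots> = v" by (simp add: matrix_vector_mul_assoc inv(1)[OF assms])
  finally have "fst (\<Sum>j\<in>UNIV. (w j p \<bullet> v) *\<^sub>R V j p) = v" by (simp add: fst_sum)
  moreover have "snd (\<Sum>j\<in>UNIV. (w j p \<bullet> v) *\<^sub>R V j p) = \<omega> p \<bullet> v"
    by (simp add: snd_sum \<omega>_def inner_sum_left mult.commute)
  ultimately show ?thesis by (metis prod.collapse)
qed

lemma w_V: assumes "p \<in> U" shows "w i p \<bullet> fst (V j p) = (if i = j then 1 else 0)"
proof -
  have "fst (V j p) = frame_matrix_at p *v axis j 1" by (simp add: vec_eq_iff matrix_vector_mul_component inner_axis frame_matrix_at_def)
  then have "w i p \<bullet> fst (V j p) = (axis j 1 :: real^'n) $ i"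
    by (simp add: w_inner matrix_vector_mul_assoc inv(2)[OF assms])
  then show ?thesis by (simp add: axis_def)
qed

lemma om_V: assumes "p \<in> U" shows "\<omega> p \<bullet> fst (V j p) = snd (V j p)"
  by (simp add: \<omega>_def inner_sum_left w_V[OF assms] if_distrib sum.delta cong: if_cong)

text \<open>Differentiate the identity of \<open>frame\<close> along the lift of u and
  antisymmetrise in u and v. Commutation cancels the terms that contain derivatives of the fields,
  so the antisymmetric parts of the derivatives of the \<open>w j\<close>, as coefficients of the
  fields, combine to a purely vertical vector. The horizontal parts are independent, so each
  coefficient vanishes, and with them the vertical component.\<close>

lemma integrable:
  assumes p: "p \<in> U"
  shows "partial_deriv (v, \<omega> p \<bullet> v) \<omega> p \<bullet> u = partial_deriv (u, \<omega> p \<bullet> u) \<omega> p \<bullet> v"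
    "partial_deriv (v, \<omega> p \<bullet> v) (w j) p \<bullet> u = partial_deriv (u, \<omega> p \<bullet> u) (w j) p \<bullet> v"
proof -
  let ?E = "\<lambda>v. (v, \<omega> p \<bullet> v)"
  have dw: "(w j has_derivative (\<lambda>h. partial_deriv h (w j) p)) (at p)" for j by (rule Ck_on_derivD[OF w_Ck p])
  have do: "(\<omega> has_derivative (\<lambda>h. partial_deriv h \<omega> p)) (at p)" by (rule Ck_on_derivD[OF om_Ck p])
  have dV: "(V j has_derivative (\<lambda>h. partial_deriv h (V j) p)) (at p)" for j by (rule Ck_on_derivD[OF V_Ck' p])
  have linV: "linear (\<lambda>h. partial_deriv h (V j) p)" for j by (rule has_derivative_linear[OF dV])
  have comm: "partial_deriv (V i p) (V j) p = partial_deriv (V j p) (V i) p" for i j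
    using commute[of p i j] p openU(3) by (auto simp: lie_bracket_def partial_deriv_def)
  have key: "(0, partial_deriv h \<omega> p \<bullet> v) = (\<Sum>j\<in>UNIV. (partial_deriv h (w j) p \<bullet> v) *\<^sub>R V j p) + (\<Sum>j\<in>UNIV. (w j p \<bullet> v) *\<^sub>R partial_deriv h (V j) p)" for h v
  proof -
    have 1: "((\<lambda>p. \<Sum>j\<in>UNIV. (w j p \<bullet> v) *\<^sub>R V j p) has_derivative (\<lambda>h. \<Sum>j\<in>UNIV. (w j p \<bullet> v) *\<^sub>R partial_deriv h (V j) p + (partial_deriv h (w j) p \<bullet> v) *\<^sub>R V j p)) (at p)"
      by (intro has_derivative_sum has_derivative_scaleR has_derivative_inner_left dw dV)
    have "((\<lambda>p. (v, \<omega> p \<bullet> v)) has_derivative (\<lambda>h. (0, partial_deriv h \<omega> p \<bullet> v))) (at p)"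
      by (intro has_derivative_Pair has_derivative_const has_derivative_inner_left do)
    then have 2: "((\<lambda>p. \<Sum>j\<in>UNIV. (w j p \<bullet> v) *\<^sub>R V j p) has_derivative (\<lambda>h. (0, partial_deriv h \<omega> p \<bullet> v))) (at p)"
      by (rule has_derivative_transform_within_open[OF _ openU(1) p]) (simp add: frame)
    from fun_cong[OF has_derivative_unique[OF 1 2], of h] show ?thesis by (simp add: sum.distrib add.commute)
  qed
  have VE: "partial_deriv (?E u) (V j) p = (\<Sum>i\<in>UNIV. (w i p \<bullet> u) *\<^sub>R partial_deriv (V i p) (V j) p)" for j u
    unfolding frame[OF p, symmetric] by (simp only: linear_sum[OF linV] linear_scale[OF linV])
  \<comment> \<open>Expanding the lift in the frame gives a double sum that is symmetric because the
    fields commute.\<close>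
  have S: "(\<Sum>j\<in>UNIV. (w j p \<bullet> v) *\<^sub>R partial_deriv (?E u) (V j) p) = (\<Sum>j\<in>UNIV. (w j p \<bullet> u) *\<^sub>R partial_deriv (?E v) (V j) p)" for u v
    unfolding VE scaleR_sum_right
    by (subst sum.swap) (simp add: comm mult.commute)
  let ?s = "\<lambda>j. partial_deriv (?E u) (w j) p \<bullet> v - partial_deriv (?E v) (w j) p \<bullet> u"
  have eq: "(0, partial_deriv (?E u) \<omega> p \<bullet> v - partial_deriv (?E v) \<omega> p \<bullet> u) = (\<Sum>j\<in>UNIV. ?s j *\<^sub>R V j p)"
  proof -
    have "(0, partial_deriv (?E u) \<omega> p \<bullet> v - partial_deriv (?E v) \<omega> p \<bullet> u) = (0, partial_deriv (?E u) \<omega> p \<bullet> v) - (0 :: real^'n, partial_deriv (?E v) \<omega> p \<bullet> u)" by simp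
    also have "\<dots> = (\<Sum>j\<in>UNIV. ?s j *\<^sub>R V j p)"
      unfolding key using S[of v u] by (simp add: scaleR_diff_left sum_subtractf)
    finally show ?thesis .
  qed
  have "frame_matrix_at p *v (\<chi> j. ?s j) = fst (\<Sum>j\<in>UNIV. ?s j *\<^sub>R V j p)" by (simp add: frame_matrix_at_mult fst_sum)
  also have "\<dots> = 0" unfolding eq[symmetric] by simp
  finally have "matrix_inv (frame_matrix_at p) *v (frame_matrix_at p *v (\<chi> j. ?s j)) = 0" by simp
  then have s0: "(\<chi> j. ?s j) = 0" by (simp add: matrix_vector_mul_assoc inv(2)[OF p])
  have s: "?s j = 0" for j using arg_cong[OF s0, of "\<lambda>x. x $ j"] by simp
  then show "partial_deriv (v, \<omega> p \<bullet> v) (w j) p \<bullet> u = partial_deriv (u, \<omega> p \<bullet> u) (w j) p \<bullet> v" by (metis eq_iff_diff_eq_0)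
  show "partial_deriv (v, \<omega> p \<bullet> v) \<omega> p \<bullet> u = partial_deriv (u, \<omega> p \<bullet> u) \<omega> p \<bullet> v"
    using eq unfolding s by (simp add: zero_prod_def[symmetric]) (simp add: zero_prod_def)
qed


lemma flow_field_lipschitz:
  assumes K: "compact K" "convex K" "K \<subseteq> UNIV \<times> {-\<epsilon><..<\<epsilon>}"
  shows "\<exists>C\<ge>0. \<forall>p\<in>K. \<forall>q\<in>K. norm (V j p - V j q) \<le> C * norm (p - q)"
proof -
  have cd: "continuous_on K (\<lambda>p. partial_deriv b (V j) p)" for b
    by (rule continuous_on_subset[OF partial_deriv_cont[OF V_Ck] K(3)])
  have "bounded (partial_deriv b (V j) ` K)" for b by (intro compact_imp_bounded compact_continuous_image cd K(1))
  then have "\<forall>b. \<exists>C. \<forall>p\<in>K. norm (partial_deriv b (V j) p) \<le> C" by (auto simp: bounded_iff)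
  then obtain C where C: "\<And>b p. p \<in> K \<Longrightarrow> norm (partial_deriv b (V j) p) \<le> C b" by metis
  have "norm (V j p - V j q) \<le> (\<Sum>b\<in>Basis. \<bar>C b\<bar>) * norm (p - q)" if "p \<in> K" "q \<in> K" for p q
  proof (rule differentiable_bound[OF K(2) _ _ that])
    fix x assume x: "x \<in> K"
    have d: "(V j has_derivative (\<lambda>h. partial_deriv h (V j) x)) (at x)" by (rule Ck_on_derivD[OF V_Ck]) (use x K in auto)
    then show "(V j has_derivative (\<lambda>h. partial_deriv h (V j) x)) (at x within K)" by (rule has_derivative_at_withinI)
    have lin: "linear (\<lambda>h. partial_deriv h (V j) x)" by (rule has_derivative_linear[OF d])
    show "onorm (\<lambda>h. partial_deriv h (V j) x) \<le> (\<Sum>b\<in>Basis. \<bar>C b\<bar>)"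
    proof (rule onorm_le)
      fix h :: "(real^'n) \<times> real"
      have "partial_deriv (\<Sum>b\<in>Basis. (h \<bullet> b) *\<^sub>R b) (V j) x = (\<Sum>b\<in>Basis. (h \<bullet> b) *\<^sub>R partial_deriv b (V j) x)"
        by (simp only: linear_sum[OF lin] linear_scale[OF lin])
      then have "norm (partial_deriv h (V j) x) \<le> (\<Sum>b\<in>Basis. norm ((h \<bullet> b) *\<^sub>R partial_deriv b (V j) x))"
        unfolding euclidean_representation by (simp only: norm_sum)
      also have "\<dots> \<le> (\<Sum>b\<in>Basis. \<bar>C b\<bar> * norm h)"
      proof (rule sum_mono)
        fix b :: "(real^'n) \<times> real" assume "b \<in> Basis"
        then have "norm h * norm (partial_deriv b (V j) x) \<ge> \<bar>h \<bullet> b\<bar> * norm (partial_deriv b (V j) x)"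
          by (intro mult_right_mono Basis_le_norm) auto
        moreover have "norm h * norm (partial_deriv b (V j) x) \<le> norm h * \<bar>C b\<bar>"
          using C[OF x, of b] by (intro mult_left_mono) auto
        ultimately show "norm ((h \<bullet> b) *\<^sub>R partial_deriv b (V j) x) \<le> \<bar>C b\<bar> * norm h" by (simp add: mult.commute)
      qed
      finally show "norm (partial_deriv h (V j) x) \<le> (\<Sum>b\<in>Basis. \<bar>C b\<bar>) * norm h" by (simp add: sum_distrib_right)
    qed
  qed
  then show ?thesis by (intro exI[of _ "\<Sum>b\<in>Basis. \<bar>C b\<bar>"]) (auto intro: sum_nonneg)
qed

text \<open>The vertical distance g to the graph satisfies |g'| <= C |g|, since on the graph the
  field is tangent to it (\<open>om_V\<close>). A priori the curve may leave the narrow strip, so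
  the Lipschitz bound is taken on a compact box in the wide one, containing the curve and the graph
  below or above it.\<close>

lemma stays_on_leaf:
  fixes G :: "real^'n \<Rightarrow> real" and \<gamma> :: "real \<Rightarrow> (real^'n) \<times> real"
  assumes G: "\<And>y. (G has_derivative (\<lambda>h. \<omega> (y, G y) \<bullet> h)) (at y)" "\<And>y. G y \<in> {-c<..<c}"
    and \<gamma>: "\<And>t. t \<in> closed_segment 0 T \<Longrightarrow> \<gamma> t \<in> UNIV \<times> {-\<epsilon><..<\<epsilon>} \<and>
       (\<gamma> has_vector_derivative V j (\<gamma> t)) (at t within closed_segment 0 T)"
    and start: "snd (\<gamma> 0) = G (fst (\<gamma> 0))"
  shows "snd (\<gamma> T) = G (fst (\<gamma> T))"
proof -
  let ?S = "closed_segment 0 T"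
  have c\<gamma>: "continuous_on ?S \<gamma>" unfolding continuous_on_eq_continuous_within using \<gamma> has_vector_derivative_continuous by blast
  have cy: "compact ((fst \<circ> \<gamma>) ` ?S)" "compact ((snd \<circ> \<gamma>) ` ?S)"
    by (intro compact_continuous_image continuous_on_compose c\<gamma> continuous_intros compact_segment)+
  have cG: "continuous_on A G" for A by (rule continuous_at_imp_continuous_on) (use G(1) has_derivative_continuous in blast)
  obtain Y where Y: "\<And>t. t \<in> ?S \<Longrightarrow> norm (fst (\<gamma> t)) \<le> Y" using compact_imp_bounded[OF cy(1)] by (auto simp: bounded_iff)
  have "compact ((\<lambda>t. \<bar>snd (\<gamma> t)\<bar>) ` ?S)" by (intro compact_continuous_image continuous_intros c\<gamma> compact_segment)
  then obtain tm where tm: "tm \<in> ?S" "\<And>t. t \<in> ?S \<Longrightarrow> \<bar>snd (\<gamma> t)\<bar> \<le> \<bar>snd (\<gamma> tm)\<bar>"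
    using compact_attains_sup[of "(\<lambda>t. \<bar>snd (\<gamma> t)\<bar>) ` ?S"] by auto
  \<comment> \<open>High enough for the graph, which stays within height c, and for the curve, whose
    height is extreme at tm.\<close>
  define b where "b = max c \<bar>snd (\<gamma> tm)\<bar>"
  have b: "b < \<epsilon>" "c \<le> b" using \<gamma>[OF tm(1)] c by (auto simp: b_def mem_Times_iff)
  let ?K = "cball (0::real^'n) Y \<times> {-b..b}"
  have K: "compact ?K" "convex ?K" "?K \<subseteq> UNIV \<times> {-\<epsilon><..<\<epsilon>}" using b by (auto intro!: compact_Times convex_Times compact_cball convex_cball)
  obtain C where C: "C \<ge> 0" "\<And>p q. p \<in> ?K \<Longrightarrow> q \<in> ?K \<Longrightarrow> norm (V j p - V j q) \<le> C * norm (p - q)" using flow_field_lipschitz[OF K] by blast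
  have com: "continuous_on U \<omega>" using om_Ck[of 0] by simp
  have "continuous_on (cball 0 Y) (\<lambda>y. \<omega> (y, G y))"
    by (rule continuous_on_compose2[OF com]) (use G(2) in \<open>auto intro!: continuous_intros cG\<close>)
  then have "compact ((\<lambda>y. \<omega> (y, G y)) ` cball 0 Y)" by (intro compact_continuous_image) auto
  then obtain W where W: "\<And>y. y \<in> cball 0 Y \<Longrightarrow> norm (\<omega> (y, G y)) \<le> W" using compact_imp_bounded by (fastforce simp: bounded_iff)
  let ?g = "\<lambda>t. snd (\<gamma> t) - G (fst (\<gamma> t))"
  let ?g' = "\<lambda>t. snd (V j (\<gamma> t)) - \<omega> (fst (\<gamma> t), G (fst (\<gamma> t))) \<bullet> fst (V j (\<gamma> t))"
  have "?g T = 0"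
  proof (rule gronwall_zero[where g="?g" and g'="?g'" and C="C + W * C" and ?t0.0=0 and t=T and T=T])
    fix t assume t: "t \<in> ?S"
    let ?y = "fst (\<gamma> t)" and ?p = "(fst (\<gamma> t), G (fst (\<gamma> t)))"
    have d: "(\<gamma> has_derivative (\<lambda>h. h *\<^sub>R V j (\<gamma> t))) (at t within ?S)" using \<gamma>[OF t] by (simp add: has_vector_derivative_def)
    have dG: "(G has_derivative (\<lambda>h. \<omega> ?p \<bullet> h)) (at (fst (\<gamma> t)) within (\<lambda>t. fst (\<gamma> t)) ` ?S)" using G(1) by (rule has_derivative_at_withinI)
    have "(?g has_derivative (\<lambda>h. snd (h *\<^sub>R V j (\<gamma> t)) - \<omega> ?p \<bullet> fst (h *\<^sub>R V j (\<gamma> t)))) (at t within ?S)"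
      by (intro has_derivative_diff has_derivative_snd d diff_chain_within[OF has_derivative_fst[OF d] dG, unfolded comp_def])
    then show "(?g has_real_derivative ?g' t) (at t within ?S)"
      unfolding has_field_derivative_def by (rule has_derivative_eq_rhs) (auto simp: algebra_simps)
    have y: "?y \<in> cball 0 Y" using Y[OF t] by simp
    have p: "?p \<in> U" using G(2) by simp
    have pK: "?p \<in> ?K" using y b(2) G(2)[of ?y] by auto
    have gK: "\<gamma> t \<in> ?K" using y tm(2)[OF t] by (auto simp: mem_Times_iff b_def)
    have n: "norm (V j (\<gamma> t) - V j ?p) \<le> C * \<bar>?g t\<bar>"
      using C(2)[OF gK pK] by (simp add: norm_prod_def)
    have "?g' t = snd (V j (\<gamma> t) - V j ?p) - \<omega> ?p \<bullet> fst (V j (\<gamma> t) - V j ?p)"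
      using om_V[OF p, of j] by (simp add: inner_diff_right)
    also have "\<bar>\<dots>\<bar> \<le> C * \<bar>?g t\<bar> + W * (C * \<bar>?g t\<bar>)"
    proof (intro order_trans[OF abs_triangle_ineq4] add_mono)
      show "\<bar>snd (V j (\<gamma> t) - V j ?p)\<bar> \<le> C * \<bar>?g t\<bar>" using order_trans[OF norm_components_le(2) n] by simp
      have "norm (\<omega> ?p) * norm (fst (V j (\<gamma> t) - V j ?p)) \<le> W * (C * \<bar>?g t\<bar>)"
        using W[OF y] order_trans[OF norm_components_le(1) n] order_trans[OF norm_ge_zero W[OF y]] by (intro mult_mono) auto
      then show "\<bar>\<omega> ?p \<bullet> fst (V j (\<gamma> t) - V j ?p)\<bar> \<le> W * (C * \<bar>?g t\<bar>)" using Cauchy_Schwarz_ineq2 order_trans by blast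
    qed
    finally show "\<bar>?g' t\<bar> \<le> (C + W * C) * \<bar>?g t\<bar>" by (simp add: algebra_simps)
  qed (use start in auto)
  then show ?thesis by simp
qed

end

text \<open>Global inversion of a map close to linear: in the variable u = P y the equation for a
  preimage is a fixed-point problem with contraction constant 1/2. The same smallness bounds |y -
  y'| by the distance of the images, so the inverse is Lipschitz and hence differentiable.\<close>

lemma perturbed_linear_inverse:
  fixes \<Phi> :: "'a::euclidean_space \<Rightarrow> 'a"
  assumes d: "\<And>y. (\<Phi> has_derivative \<Phi>' y) (at y)" and inv: "\<And>y. A y \<circ> \<Phi>' y = id" "\<And>y. linear (A y)"
    and P: "linear P" "linear P'" "\<And>v. P' (P v) = v" "\<And>v. P (P' v) = v" and \<kappa>: "\<And>y v. norm (\<Phi>' y v - P v) \<le> \<kappa> * norm v"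
    and \<kappa>P: "\<And>v. \<kappa> * norm (P' v) \<le> norm v / 2" "\<kappa> \<ge> 0"
  shows "\<exists>\<Psi>. (\<forall>y. \<Psi> (\<Phi> y) = y) \<and> (\<forall>s. \<Phi> (\<Psi> s) = s) \<and> (\<forall>s. (\<Psi> has_derivative A (\<Psi> s)) (at s))"
proof -
  have bP: "bounded_linear P" "bounded_linear P'" using P linear_conv_bounded_linear by blast+
  define \<eta> where "\<eta> y = \<Phi> y - P y" for y
  have lip: "norm (\<eta> y - \<eta> y') \<le> \<kappa> * norm (y - y')" for y y'
  proof (rule differentiable_bound[where S=UNIV and f'="\<lambda>y v. \<Phi>' y v - P v"])
    fix x show "(\<eta> has_derivative (\<lambda>v. \<Phi>' x v - P v)) (at x within UNIV)"
      unfolding \<eta>_def[abs_def] using d bP by (auto intro!: has_derivative_diff bounded_linear_imp_has_derivative)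
    show "onorm (\<lambda>v. \<Phi>' x v - P v) \<le> \<kappa>" by (rule onorm_le) (rule \<kappa>)
  qed auto
  have ex: "\<exists>!u. s - \<eta> (P' u) = u" for s
  proof (rule banach_fix_type[of "1/2"])
    show "\<forall>x y. dist (s - \<eta> (P' x)) (s - \<eta> (P' y)) \<le> 1 / 2 * dist x y"
    proof (intro allI)
      fix x y
      have "norm (\<eta> (P' y) - \<eta> (P' x)) \<le> \<kappa> * norm (P' y - P' x)" by (rule lip)
      also have "\<dots> = \<kappa> * norm (P' (y - x))" using P(2) by (simp add: linear_diff)
      also have "\<dots> \<le> norm (y - x) / 2" by (rule \<kappa>P)
      finally show "dist (s - \<eta> (P' x)) (s - \<eta> (P' y)) \<le> 1 / 2 * dist x y"
        by (simp add: dist_norm norm_minus_commute)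
    qed
  qed auto
  have surj: "\<exists>y. \<Phi> y = s" for s
  proof -
    obtain u where "s - \<eta> (P' u) = u" using ex by blast
    then have "\<Phi> (P' u) = s" using P(4)[of u] by (simp add: \<eta>_def algebra_simps)
    then show ?thesis by blast
  qed
  have low: "norm (y - y') \<le> 2 * onorm P' * norm (\<Phi> y - \<Phi> y')" for y y'
  proof -
    let ?v = "P (y - y')"
    have "\<Phi> y - \<Phi> y' = ?v + (\<eta> y - \<eta> y')" using P(1) by (simp add: \<eta>_def linear_diff)
    then have "norm ?v \<le> norm (\<Phi> y - \<Phi> y') + norm (\<eta> y - \<eta> y')" using norm_triangle_ineq4[of "\<Phi> y - \<Phi> y'" "\<eta> y - \<eta> y'"] by simp
    also have "norm (\<eta> y - \<eta> y') \<le> norm ?v / 2" using order_trans[OF lip[of y y']] \<kappa>P(1)[of ?v] unfolding P(3) by blast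
    finally have 1: "norm ?v \<le> 2 * norm (\<Phi> y - \<Phi> y')" by simp
    have "norm (y - y') = norm (P' ?v)" using P(3) by simp
    also have "\<dots> \<le> onorm P' * norm ?v" by (rule onorm[OF bP(2)])
    also have "\<dots> \<le> onorm P' * (2 * norm (\<Phi> y - \<Phi> y'))" by (rule mult_left_mono[OF 1 onorm_pos_le[OF bP(2)]])
    finally show ?thesis by simp
  qed
  define \<Psi> where "\<Psi> s = (SOME y. \<Phi> y = s)" for s
  have \<Psi>: "\<Phi> (\<Psi> s) = s" for s unfolding \<Psi>_def using surj by (rule someI_ex)
  have \<Psi>': "\<Psi> (\<Phi> y) = y" for y using low[of "\<Psi> (\<Phi> y)" y] \<Psi>[of "\<Phi> y"] by simp
  have "(\<Psi> has_derivative A (\<Psi> s)) (at s)" for s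
  proof (rule has_derivative_inverse_basic[where f=\<Phi> and T=UNIV])
    show "(\<Phi> has_derivative \<Phi>' (\<Psi> s)) (at (\<Psi> s))" by (rule d)
    show "bounded_linear (A (\<Psi> s))" using inv(2) linear_conv_bounded_linear by blast
    show "A (\<Psi> s) \<circ> \<Phi>' (\<Psi> s) = id" by (rule inv)
    show "continuous (at s) \<Psi>"
    proof -
      have "norm (\<Psi> s - \<Psi> s') \<le> (2 * onorm P') * norm (s - s')" for s s' using low[of "\<Psi> s" "\<Psi> s'"] \<Psi> by simp
      then have "(2 * onorm P')-lipschitz_on UNIV \<Psi>"
        by (intro lipschitz_onI) (auto simp: dist_norm onorm_pos_le[OF bP(2)])
      then show ?thesis using lipschitz_on_continuous_within[of _ UNIV] by auto
    qed
  qed (use \<Psi> in auto)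
  then show ?thesis using \<Psi> \<Psi>' by blast
qed

lemma mult_axis_sum: "B *v v = (\<Sum>i\<in>UNIV. v $ i *\<^sub>R (B *v axis i (1::real)))"
  by (simp add: vec_eq_iff matrix_vector_mult_def axis_def mult.commute if_distrib cong: if_cong)

lemma mult_uminus: "(B :: real^'n^'m) *v (- x) = - (B *v x)"
  by (rule linear_neg[OF matrix_vector_mul_linear])

lemma axis_sum: "(\<Sum>i\<in>UNIV. v $ i *\<^sub>R axis i (1::real)) = v"
  by (simp add: vec_eq_iff axis_def if_distrib cong: if_cong)

lemma line_derivative:
  assumes "(F has_derivative (\<lambda>h. a \<bullet> h)) (at (y + t *\<^sub>R x))"
  shows "((\<lambda>t. F (y + t *\<^sub>R x)) has_real_derivative a \<bullet> x) (at t)"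
proof -
  have "((\<lambda>t. y + t *\<^sub>R x) has_derivative (\<lambda>h. h *\<^sub>R x)) (at t)" by (auto intro!: derivative_eq_intros)
  from diff_chain_at[OF this assms] show ?thesis
    by (simp add: has_field_derivative_def comp_def mult_commute_abs)
qed

text \<open>Uniqueness of leaves makes the translate by a basis vector agree with F once it does so
  at one point; the extension moves every point into the fundamental cell. The radius 4 D leaves
  room for a point of the cell (D), a walk to neighbouring cells with coefficients -1, 0, 1 (D), and
  one further step in either direction (2 D).\<close>

lemma periodic_extension:
  fixes F :: "real^'n \<Rightarrow> real" and \<omega> :: "(real^'n) \<times> real \<Rightarrow> real^'n" and B :: "real^'n^'n"
  defines "D \<equiv> (\<Sum>i\<in>UNIV. norm (B *v axis i 1))" and "L \<equiv> (\<lambda>m. B *v m) ` {m. \<forall>i. m $ i \<in> \<int>}"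
  assumes B: "invertible B" and R: "4 * D < R"
    and F: "\<And>y. y \<in> ball 0 R \<Longrightarrow> (F has_derivative (\<lambda>h. \<omega> (y, F y) \<bullet> h)) (at y)" "\<And>y. y \<in> ball 0 R \<Longrightarrow> F y \<in> {-c<..<c}"
    and lip: "\<And>y s s'. s \<in> {-c<..<c} \<Longrightarrow> s' \<in> {-c<..<c} \<Longrightarrow> norm (\<omega> (y, s) - \<omega> (y, s')) \<le> d * \<bar>s - s'\<bar>"
    and periodic: "\<And>y s l. l \<in> L \<Longrightarrow> \<omega> (y + l, s) = \<omega> (y, s)"
    and zero: "\<And>i. F (B *v axis i 1) = F 0"
  shows "\<exists>G. (\<forall>y. (G has_derivative (\<lambda>h. \<omega> (y, G y) \<bullet> h)) (at y)) \<and> (\<forall>y. \<forall>l\<in>L. G (y + l) = G y) \<and>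
     (\<forall>y. \<exists>x\<in>ball 0 R. G y = F x) \<and> G 0 = F 0"
proof -
  let ?e = "\<lambda>i. B *v axis i 1"
  have D0: "D \<ge> 0" unfolding D_def by (rule sum_nonneg) simp
  have eD: "norm (?e i) \<le> D" for i unfolding D_def by (rule member_le_sum) auto
  have eL: "?e i \<in> L" for i unfolding L_def by (auto simp: axis_def)
  \<comment> \<open>By periodicity of \<open>\<omega>\<close> both sides solve the same equation
    along the segment from 0 to x, and they agree at its start.\<close>
  have shift: "F (x + m) = F x" if m: "m \<in> L" "F m = F 0" and x: "norm x + norm m < R" for x m
  proof -
    have b: "m + t *\<^sub>R x \<in> ball 0 R" "0 + t *\<^sub>R x \<in> ball 0 R" if "t \<in> closed_segment 0 1" for t
    proof -
      have "norm (t *\<^sub>R x) \<le> norm x" using that by (auto simp: closed_segment_eq_real_ivl intro: mult_left_le_one_le)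
      then show "m + t *\<^sub>R x \<in> ball 0 R" "0 + t *\<^sub>R x \<in> ball 0 R"
        using x norm_triangle_ineq[of m "t *\<^sub>R x"] norm_ge_zero[of m] unfolding mem_ball_0 add_0_left by linarith+
    qed
    let ?g = "\<lambda>t. F (m + t *\<^sub>R x) - F (0 + t *\<^sub>R x)"
    let ?g' = "\<lambda>t. \<omega> (m + t *\<^sub>R x, F (m + t *\<^sub>R x)) \<bullet> x - \<omega> (0 + t *\<^sub>R x, F (0 + t *\<^sub>R x)) \<bullet> x"
    have "?g 1 = 0"
    proof (rule gronwall_zero[where T=1 and g="?g" and g'="?g'" and C="d * norm x" and ?t0.0=0 and t=1])
      fix t :: real assume t: "t \<in> closed_segment 0 1"
      show "(?g has_real_derivative ?g' t) (at t within closed_segment 0 1)"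
        by (intro has_field_derivative_at_within[OF DERIV_diff] line_derivative F(1) b t)
      have "?g' t = (\<omega> (t *\<^sub>R x, F (m + t *\<^sub>R x)) - \<omega> (t *\<^sub>R x, F (0 + t *\<^sub>R x))) \<bullet> x"
        using periodic[OF m(1), of "t *\<^sub>R x"] by (simp add: inner_diff_left add.commute)
      also have "\<bar>\<dots>\<bar> \<le> (d * \<bar>?g t\<bar>) * norm x"
        by (intro order_trans[OF Cauchy_Schwarz_ineq2] mult_right_mono lip F(2) b t norm_ge_zero)
      finally show "\<bar>?g' t\<bar> \<le> d * norm x * \<bar>?g t\<bar>" by (simp add: algebra_simps)
    qed (use m(2) in \<open>auto simp: closed_segment_eq_real_ivl\<close>)
    then show ?thesis by (simp add: add.commute)
  qed
  have se: "F (x + ?e i) = F x" "F (x - ?e i) = F x" if "norm x + 2 * norm (?e i) < R" for x i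
  proof -
    show "F (x + ?e i) = F x" by (rule shift[OF eL zero]) (use that norm_ge_zero[of "?e i"] in linarith)
    have "F ((x - ?e i) + ?e i) = F (x - ?e i)"
      by (rule shift[OF eL zero]) (use that norm_triangle_ineq4[of x "?e i"] in linarith)
    then show "F (x - ?e i) = F x" by simp
  qed
  have multi: "F (x + (\<Sum>i\<in>S. k i *\<^sub>R ?e i)) = F x" if "norm x \<le> D" "\<And>i. k i \<in> {-1, 0, 1::real}" "finite S" for x k and S :: "'n set"
    using that(3)
  proof (induction S)
    case (insert i S)
    have "norm (\<Sum>i\<in>S. k i *\<^sub>R ?e i) \<le> (\<Sum>i\<in>S. norm (?e i))"
    proof (rule order_trans[OF norm_sum sum_mono])
      fix j show "norm (k j *\<^sub>R ?e j) \<le> norm (?e j)" using that(2)[of j] by auto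
    qed
    also have "\<dots> \<le> D" unfolding D_def by (rule sum_mono2) auto
    finally have "norm (x + (\<Sum>i\<in>S. k i *\<^sub>R ?e i)) \<le> 2 * D" using that(1) norm_triangle_ineq[of x "\<Sum>i\<in>S. k i *\<^sub>R ?e i"] by linarith
    then have n: "norm (x + (\<Sum>i\<in>S. k i *\<^sub>R ?e i)) + 2 * norm (?e i) < R" using eD[of i] R by linarith
    have "F (x + (\<Sum>i\<in>S. k i *\<^sub>R ?e i) + k i *\<^sub>R ?e i) = F (x + (\<Sum>i\<in>S. k i *\<^sub>R ?e i))"
      using that(2)[of i] se[OF n] by auto
    then show ?case using insert by (simp add: algebra_simps)
  qed simp
  define u where "u y = matrix_inv B *v y" for y
  have Bu: "B *v u y = y" for y by (simp add: u_def matrix_vector_mul_assoc matrix_inv_inverse[OF B])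
  define cell where "cell y = B *v (\<chi> i. of_int \<lfloor>u y $ i\<rfloor>)" for y
  have diff: "y - cell y = B *v (\<chi> i. frac (u y $ i))" for y
  proof -
    have "y - cell y = B *v u y - B *v (\<chi> i. of_int \<lfloor>u y $ i\<rfloor>)" by (simp add: Bu cell_def)
    also have "\<dots> = B *v (u y - (\<chi> i. of_int \<lfloor>u y $ i\<rfloor>))" by (simp add: matrix_vector_mult_diff_distrib)
    also have "u y - (\<chi> i. of_int \<lfloor>u y $ i\<rfloor>) = (\<chi> i. frac (u y $ i))" by (simp add: vec_eq_iff frac_def)
    finally show ?thesis .
  qed
  have small: "norm (y - cell y) \<le> D" for y
  proof -
    have "norm (y - cell y) \<le> (\<Sum>i\<in>UNIV. norm (frac (u y $ i) *\<^sub>R ?e i))"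
      unfolding diff mult_axis_sum[of B "\<chi> i. frac (u y $ i)"] by (simp only: vec_lambda_beta norm_sum)
    also have "\<dots> \<le> D" unfolding D_def
      by (intro sum_mono) (auto simp: frac_ge_0 intro!: mult_left_le_one_le less_imp_le[OF frac_lt_1])
    finally show ?thesis .
  qed
  have smallR: "y - cell y \<in> ball 0 R" for y using small[of y] D0 R unfolding mem_ball_0 by linarith
  define G where "G y = F (y - cell y)" for y
  \<comment> \<open>Near y each floor changes by at most one, so G is locally F after a single
    translation. This makes G differentiable across the boundaries of cells too.\<close>
  have loc: "G y' = F (y' - cell y)" if "norm (u (y' - y)) < 1" for y y'
  proof -
    define k :: "'n \<Rightarrow> real" where "k i = of_int (\<lfloor>u y' $ i\<rfloor> - \<lfloor>u y $ i\<rfloor> :: int)" for i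
    have k: "k i \<in> {-1, 0, 1::real}" for i
    proof -
      have "\<bar>u y' $ i - u y $ i\<bar> < 1"
        using le_less_trans[OF component_le_norm_cart that, of i] by (simp add: u_def matrix_vector_mult_diff_distrib)
      then have "\<lfloor>u y' $ i\<rfloor> - \<lfloor>u y $ i\<rfloor> \<in> {-1, 0, 1}" by (auto; linarith)
      then show ?thesis by (auto simp: k_def)
    qed
    have "cell y' - cell y = B *v ((\<chi> i. of_int \<lfloor>u y' $ i\<rfloor>) - (\<chi> i. of_int \<lfloor>u y $ i\<rfloor>))"
      by (simp only: cell_def matrix_vector_mult_diff_distrib)
    also have "(\<chi> i. of_int \<lfloor>u y' $ i\<rfloor>) - (\<chi> i. of_int \<lfloor>u y $ i\<rfloor>) = (\<chi> i. k i)" by (simp add: vec_eq_iff k_def)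
    finally have "cell y' - cell y = B *v (\<chi> i. k i)" .
    then have e: "y' - cell y = (y' - cell y') + (\<Sum>i\<in>UNIV. k i *\<^sub>R ?e i)"
      using mult_axis_sum[of B "\<chi> i. k i"] by (simp add: algebra_simps)
    show ?thesis unfolding G_def e by (rule multi[symmetric, OF small k finite_class.finite_UNIV])
  qed
  have "(G has_derivative (\<lambda>h. \<omega> (y, G y) \<bullet> h)) (at y)" for y
  proof -
    have Ly: "- cell y \<in> L" unfolding L_def cell_def
      by (rule image_eqI[of _ _ "- (\<chi> i. of_int \<lfloor>u y $ i\<rfloor>)"]) (simp_all add: mult_uminus)
    have 1: "((\<lambda>y'. y' - cell y) has_derivative (\<lambda>h. h)) (at y)" by (auto intro!: derivative_eq_intros)
    have "((\<lambda>y'. F (y' - cell y)) has_derivative (\<lambda>h. \<omega> (y - cell y, F (y - cell y)) \<bullet> h)) (at y)"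
      using diff_chain_at[OF 1 F(1)[OF smallR]] by (simp add: comp_def)
    moreover have "\<omega> (y - cell y, F (y - cell y)) = \<omega> (y, G y)" using periodic[OF Ly, of y] by (simp add: G_def)
    ultimately have d: "((\<lambda>y'. F (y' - cell y)) has_derivative (\<lambda>h. \<omega> (y, G y) \<bullet> h)) (at y)" by simp
    have "continuous_on UNIV (\<lambda>y'. norm (u (y' - y)))"
      unfolding u_def
      by (intro continuous_on_norm continuous_on_compose2[OF matrix_vector_mult_linear_continuous_on[of UNIV]] continuous_on_diff continuous_on_id continuous_on_const) auto
    then have "open {y'. norm (u (y' - y)) < 1}" by (intro open_Collect_less) (auto intro: continuous_intros)
    then show ?thesis
      by (rule has_derivative_transform_within_open[OF d]) (simp_all add: loc u_def)
  qed
  moreover have "G (y + l) = G y" if lL: "l \<in> L" for y l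
  proof -
    obtain m where m: "l = B *v m" "\<forall>i. m $ i \<in> \<int>" using lL by (auto simp: L_def)
    have "u (y + l) = u y + m" by (simp add: u_def m(1) matrix_vector_right_distrib matrix_vector_mul_assoc matrix_inv_inverse[OF B])
    then have "frac (u (y + l) $ i) = frac (u y $ i)" for i using m(2)[rule_format, of i] by (auto elim!: Ints_cases simp: frac_def)
    then show ?thesis unfolding G_def diff by simp
  qed
  moreover have "\<exists>x\<in>ball 0 R. G y = F x" for y using smallR by (auto simp: G_def)
  moreover have "G 0 = F 0" by (simp add: G_def cell_def u_def) (simp add: zero_vec_def[symmetric])
  ultimately show ?thesis by blast
qed

lemma torus_proj_eq:
  fixes L :: "(real^'n) set"
  assumes "lattice_in L" shows "torus_proj L a = torus_proj L b \<longleftrightarrow> b - a \<in> L" "0 \<in> L" "x \<in> L \<Longrightarrow> - x \<in> L" "x \<in> L \<Longrightarrow> y \<in> L \<Longrightarrow> x + y \<in> L"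
proof -
  obtain B :: "real^'n^'n" where L: "L = (\<lambda>m. B *v m) ` {m. \<forall>i. m $ i \<in> \<int>}" using assms by (auto simp: lattice_in_def)
  show 0: "0 \<in> L" unfolding L by (rule image_eqI[of _ _ 0]) auto
  show n: "- x \<in> L" if xL: "x \<in> L" for x
  proof -
    obtain m where "x = B *v m" "\<forall>i. m $ i \<in> \<int>" using xL L by auto
    then show ?thesis unfolding L by (intro image_eqI[of _ _ "- m"]) (simp_all add: mult_uminus)
  qed
  show p: "x + y \<in> L" if xL: "x \<in> L" "y \<in> L" for x y
  proof -
    obtain m m' where "x = B *v m" "\<forall>i. m $ i \<in> \<int>" "y = B *v m'" "\<forall>i. m' $ i \<in> \<int>" using xL L by auto
    then show ?thesis unfolding L by (intro image_eqI[of _ _ "m + m'"]) (simp_all add: matrix_vector_right_distrib)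
  qed
  have m: "torus_proj L a = {y. y - a \<in> L}" for a by (auto simp: torus_proj_def lattice_rel_def)
  show "torus_proj L a = torus_proj L b \<longleftrightarrow> b - a \<in> L"
  proof
    assume "torus_proj L a = torus_proj L b"
    moreover have "b \<in> torus_proj L b" using 0 by (simp add: m)
    ultimately have "b \<in> torus_proj L a" by (simp only:)
    then show "b - a \<in> L" by (simp add: m)
  next
    assume h: "b - a \<in> L"
    have "y - a \<in> L \<longleftrightarrow> y - b \<in> L" for y
      using p[of "y - b" "b - a"] p[of "y - a" "- (b - a)"] n[OF h] h by auto
    then show "torus_proj L a = torus_proj L b" by (simp add: m)
  qed
qed

context cover_family
begin

text \<open>On the graph of F the derivative of the form \<open>w k\<close> is its derivative along
  lifted vectors, and the second part of \<open>integrable\<close> states that the restricted form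
  is closed.\<close>

lemma leaf_primitive:
  assumes B: "open B" "convex B" "0 \<in> B"
    and F: "\<And>y. y \<in> B \<Longrightarrow> (F has_derivative (\<lambda>h. \<omega> (y, F y) \<bullet> h)) (at y)" "\<And>y. y \<in> B \<Longrightarrow> F y \<in> {-c<..<c}"
  shows "\<exists>\<Phi>. \<Phi> 0 = 0 \<and> (\<forall>y\<in>B. (\<Phi> has_derivative (\<lambda>h. w k (y, F y) \<bullet> h)) (at y))"
proof (rule poincare[OF B, where \<beta>' = "\<lambda>y h. partial_deriv (h, \<omega> (y, F y) \<bullet> h) (w k) (y, F y)"])
  have U: "(y, F y) \<in> U" if "y \<in> B" for y using F(2)[OF that] by simp
  have dw: "(w k has_derivative (\<lambda>h. partial_deriv h (w k) p)) (at p)" if "p \<in> U" for p by (rule Ck_on_derivD[OF w_Ck that])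
  show "((\<lambda>y. w k (y, F y)) has_derivative (\<lambda>h. partial_deriv (h, \<omega> (y, F y) \<bullet> h) (w k) (y, F y))) (at y)" if "y \<in> B" for y
    using diff_chain_at[OF has_derivative_Pair[OF has_derivative_ident F(1)[OF that]] dw[OF U[OF that]]] by (simp add: comp_def)
  show "partial_deriv (v, \<omega> (y, F y) \<bullet> v) (w k) (y, F y) \<bullet> u = partial_deriv (u, \<omega> (y, F y) \<bullet> u) (w k) (y, F y) \<bullet> v" if "y \<in> B" for y u v
    by (rule integrable(2)[OF U[OF that]])
  show "continuous_on B (\<lambda>y. partial_deriv (h, \<omega> (y, F y) \<bullet> h) (w k) (y, F y))" for h
  proof -
    have cF: "continuous_on B F" by (rule continuous_at_imp_continuous_on) (use F(1) has_derivative_continuous in blast)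
    have cp: "continuous_on B (\<lambda>y. partial_deriv v (w k) (y, F y))" for v
      by (rule continuous_on_compose2[OF partial_deriv_cont[OF w_Ck]]) (use U in \<open>auto intro!: continuous_intros cF\<close>)
    have co: "continuous_on B (\<lambda>y. \<omega> (y, F y))"
      by (rule continuous_on_compose2[of U]) (use om_Ck[of 0] U in \<open>auto intro!: continuous_intros cF\<close>)
    have "continuous_on B (\<lambda>y. partial_deriv (h, 0) (w k) (y, F y) + (\<omega> (y, F y) \<bullet> h) *\<^sub>R partial_deriv (0, 1) (w k) (y, F y))"
      by (intro continuous_intros cp co)
    then show ?thesis
    proof (rule continuous_on_eq)
      fix y assume y: "y \<in> B"
      have lin: "linear (\<lambda>h. partial_deriv h (w k) (y, F y))" by (rule has_derivative_linear[OF dw[OF U[OF y]]])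
      have "partial_deriv ((h, 0) + (\<omega> (y, F y) \<bullet> h) *\<^sub>R (0, 1)) (w k) (y, F y) = partial_deriv (h, 0) (w k) (y, F y) + (\<omega> (y, F y) \<bullet> h) *\<^sub>R partial_deriv (0, 1) (w k) (y, F y)"
        by (simp only: linear_add[OF lin] linear_scale[OF lin])
      then show "partial_deriv (h, 0) (w k) (y, F y) + (\<omega> (y, F y) \<bullet> h) *\<^sub>R partial_deriv (0, 1) (w k) (y, F y) = partial_deriv (h, \<omega> (y, F y) \<bullet> h) (w k) (y, F y)" by simp
    qed
  qed
qed

text \<open>The orbit is the whole image of the graph of G, which is compact by periodicity.
  Containment in the image is \<open>stays_on_leaf\<close> but does not suffice, as subsets of
  compact sets need not be compact. For the converse, the primitives of the coframe form a map under
  which the fields become the coordinate fields; closeness to P makes it globally invertible, so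
  every point of the leaf is reached by moving along the axes in turn.\<close>

theorem compact_orbit:
  fixes X :: "'n \<Rightarrow> 'n vfield" and L :: "(real^'n) set"
  assumes L: "lattice_in L" and X: "\<And>j y z. V j (y, z) = X j (M_proj L (y\<^sub>0 + y, z))"
    and G: "\<And>y. (G has_derivative (\<lambda>h. \<omega> (y, G y) \<bullet> h)) (at y)" "\<And>y. G y \<in> {-c<..<c}"
      "\<And>y l. l \<in> L \<Longrightarrow> G (y + l) = G y" "G 0 = 0"
    and P: "\<And>y v. norm ((\<chi> k. w k (y, G y) \<bullet> v) - P *v v) \<le> \<kappa> * norm v" "P ** P' = mat 1" "P' ** P = mat 1"
      "\<And>v. \<kappa> * norm (P' *v v) \<le> norm v / 2" "\<kappa> \<ge> 0"
  shows "compactin (M_topology L \<epsilon>) (orbit L \<epsilon> X (torus_proj L y\<^sub>0, 0))"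
proof -
  define q where "q y = (torus_proj L (y\<^sub>0 + y), G y)" for y
  note Lp = torus_proj_eq[OF L]
  have GI: "G y \<in> {-\<epsilon><..<\<epsilon>}" for y using G(2)[of y] c by auto
  have U: "(y, G y) \<in> U" for y using G(2) by simp
  have step: "r \<in> range q" if ics: "integral_curve_step L \<epsilon> (X j) p r" and pq: "p \<in> range q" for p r j
  proof -
    obtain y where y: "p = q y" using pq by auto
    obtain T \<gamma> where \<gamma>: "\<And>t. t \<in> closed_segment 0 T \<Longrightarrow> \<gamma> t \<in> M_cover \<epsilon> \<and> (\<gamma> has_vector_derivative X j (M_proj L (\<gamma> t))) (at t within closed_segment 0 T)"
      "M_proj L (\<gamma> 0) = p" "M_proj L (\<gamma> T) = r" using ics unfolding integral_curve_step_def by blast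
    let ?\<gamma> = "\<lambda>t. \<gamma> t - (y\<^sub>0, 0)"
    have "snd (?\<gamma> T) = G (fst (?\<gamma> T))"
    proof (rule stays_on_leaf[where \<gamma>="?\<gamma>" and T=T and j=j, OF G(1,2)])
      fix t assume t: "t \<in> closed_segment 0 T"
      have "V j (?\<gamma> t) = X j (M_proj L (\<gamma> t))" using X[of j "fst (\<gamma> t) - y\<^sub>0" "snd (\<gamma> t)"] by (simp add: minus_prod_def)
      moreover have "(?\<gamma> has_vector_derivative X j (M_proj L (\<gamma> t)) - 0) (at t within closed_segment 0 T)"
        using \<gamma>(1)[OF t] by (intro has_vector_derivative_diff has_vector_derivative_const) auto
      ultimately show "?\<gamma> t \<in> U\<epsilon> \<and> (?\<gamma> has_vector_derivative V j (?\<gamma> t)) (at t within closed_segment 0 T)"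
        using \<gamma>(1)[OF t] by (auto simp: M_cover_def mem_Times_iff)
    next
      have "torus_proj L (y\<^sub>0 + y) = torus_proj L (fst (\<gamma> 0))" "snd (\<gamma> 0) = G y"
        using \<gamma>(2) by (auto simp: y q_def M_proj_def case_prod_unfold)
      then have l: "fst (\<gamma> 0) - (y\<^sub>0 + y) \<in> L" using Lp(1) by blast
      have "G (y + (fst (\<gamma> 0) - (y\<^sub>0 + y))) = G y" by (rule G(3)[OF l])
      moreover have "y + (fst (\<gamma> 0) - (y\<^sub>0 + y)) = fst (?\<gamma> 0)" by simp
      ultimately show "snd (?\<gamma> 0) = G (fst (?\<gamma> 0))" using \<open>snd (\<gamma> 0) = G y\<close> by (simp del: fst_diff)
    qed
    then have "r = q (fst (?\<gamma> T))" using \<gamma>(3) by (auto simp: q_def M_proj_def case_prod_unfold)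
    then show ?thesis by blast
  qed
  have sub: "orbit L \<epsilon> X (torus_proj L y\<^sub>0, 0) \<subseteq> range q"
  proof
    fix r assume "r \<in> orbit L \<epsilon> X (torus_proj L y\<^sub>0, 0)"
    then have "(\<lambda>r s. \<exists>j. integral_curve_step L \<epsilon> (X j) r s)\<^sup>*\<^sup>* (torus_proj L y\<^sub>0, 0) r" by (simp add: orbit_def)
    then show "r \<in> range q"
    proof induction
      case base
      have "q 0 = (torus_proj L y\<^sub>0, 0)" by (simp add: q_def G(4))
      then show ?case by (metis rangeI)
    next
      case (step r s) then show ?case using \<open>\<And>r p j. integral_curve_step L \<epsilon> (X j) p r \<Longrightarrow> p \<in> range q \<Longrightarrow> r \<in> range q\<close> by blast
    qed
  qed
  have "\<exists>\<Phi>. \<Phi> 0 = 0 \<and> (\<forall>y\<in>UNIV. (\<Phi> has_derivative (\<lambda>h. w k (y, G y) \<bullet> h)) (at y))" for k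
    by (rule leaf_primitive) (use G in auto)
  then obtain \<Phi>c where \<Phi>c: "\<And>k. \<Phi>c k 0 = 0" "\<And>k y. (\<Phi>c k has_derivative (\<lambda>h. w k (y, G y) \<bullet> h)) (at y)" by (metis UNIV_I)
  define \<Phi> :: "real^'n \<Rightarrow> real^'n" where "\<Phi> y = (\<chi> k. \<Phi>c k y)" for y
  have \<Phi>0: "\<Phi> 0 = 0" by (simp add: \<Phi>_def \<Phi>c(1) vec_eq_iff)
  have \<Phi>d: "(\<Phi> has_derivative (\<lambda>h. \<chi> k. w k (y, G y) \<bullet> h)) (at y)" for y
    unfolding has_derivative_componentwise_within[of \<Phi>]
    by (auto simp: Basis_vec_def inner_axis \<Phi>_def \<Phi>c(2))
  have "\<exists>\<Psi>. (\<forall>y. \<Psi> (\<Phi> y) = y) \<and> (\<forall>s. \<Phi> (\<Psi> s) = s) \<and> (\<forall>s. (\<Psi> has_derivative (\<lambda>h. frame_matrix_at (\<Psi> s, G (\<Psi> s)) *v h)) (at s))"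
  proof (rule perturbed_linear_inverse[where \<Phi>=\<Phi> and A="\<lambda>y h. frame_matrix_at (y, G y) *v h" and P="\<lambda>v. P *v v" and P'="\<lambda>v. P' *v v", OF \<Phi>d])
    have e: "(\<chi> k. w k p \<bullet> h) = matrix_inv (frame_matrix_at p) *v h" for p h by (simp add: vec_eq_iff w_inner)
    show "(\<lambda>h. frame_matrix_at (y, G y) *v h) \<circ> (\<lambda>h. \<chi> k. w k (y, G y) \<bullet> h) = id" for y
      by (simp add: fun_eq_iff e matrix_vector_mul_assoc inv(1)[OF U])
  qed (use P in \<open>auto simp: matrix_vector_mul_assoc\<close>)
  then obtain \<Psi> where \<Psi>: "\<And>y. \<Psi> (\<Phi> y) = y" "\<And>s. (\<Psi> has_derivative (\<lambda>h. frame_matrix_at (\<Psi> s, G (\<Psi> s)) *v h)) (at s)" by blast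
  define O' where "O' = orbit L \<epsilon> X (torus_proj L y\<^sub>0, 0)"
  \<comment> \<open>In the straightened coordinates the j-th field is constant, so motion along axis
    j is an integral curve for any time T.\<close>
  have move: "q (\<Psi> (s + T *\<^sub>R axis j 1)) \<in> O'" if "q (\<Psi> s) \<in> O'" for s T j
  proof -
    let ?x = "\<lambda>t. \<Psi> (s + t *\<^sub>R axis j 1)"
    let ?\<gamma> = "\<lambda>t. (y\<^sub>0 + ?x t, G (?x t))"
    have d: "(?\<gamma> has_vector_derivative X j (M_proj L (?\<gamma> t))) (at t)" for t
    proof -
      have 1: "((\<lambda>t. s + t *\<^sub>R axis j 1) has_derivative (\<lambda>h. h *\<^sub>R axis j 1)) (at t)" by (auto intro!: derivative_eq_intros)
      have "frame_matrix_at p *v (axis j 1) = fst (V j p)" for p by (simp add: vec_eq_iff matrix_vector_mul_component inner_axis frame_matrix_at_def)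
      then have 2: "(?x has_derivative (\<lambda>h. h *\<^sub>R fst (V j (?x t, G (?x t))))) (at t)"
        using diff_chain_at[OF 1 \<Psi>(2)] by (simp add: comp_def matrix_vector_mult_scaleR)
      have 3: "((\<lambda>t. G (?x t)) has_derivative (\<lambda>h. \<omega> (?x t, G (?x t)) \<bullet> (h *\<^sub>R fst (V j (?x t, G (?x t)))))) (at t)"
        using diff_chain_at[OF 2 G(1)] by (simp add: comp_def)
      have "(?\<gamma> has_derivative (\<lambda>h. (0 + h *\<^sub>R fst (V j (?x t, G (?x t))), \<omega> (?x t, G (?x t)) \<bullet> (h *\<^sub>R fst (V j (?x t, G (?x t))))))) (at t)"
        by (intro has_derivative_Pair has_derivative_add has_derivative_const 2 3)
      then have "(?\<gamma> has_vector_derivative V j (?x t, G (?x t))) (at t)"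
        unfolding has_vector_derivative_def by (rule has_derivative_eq_rhs) (simp add: fun_eq_iff om_V[OF U] prod_eq_iff)
      then show ?thesis using X by simp
    qed
    have "integral_curve_step L \<epsilon> (X j) (q (\<Psi> s)) (q (?x T))"
      unfolding integral_curve_step_def
    proof (intro exI[of _ T] exI[of _ ?\<gamma>] conjI ballI)
      show "?\<gamma> t \<in> M_cover \<epsilon>" for t using GI by (auto simp: M_cover_def)
      show "(?\<gamma> has_vector_derivative X j (M_proj L (?\<gamma> t))) (at t within closed_segment 0 T)" for t
        by (rule has_vector_derivative_at_within[OF d])
    qed (simp_all add: q_def M_proj_def)
    then show ?thesis using that unfolding O'_def orbit_def by (auto intro: rtranclp.rtrancl_into_rtrancl)
  qed
  have reach: "q (\<Psi> (\<Sum>i\<in>S. s $ i *\<^sub>R axis i 1)) \<in> O'" if "finite S" for s S using that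
  proof (induction S)
    case empty
    have "\<Psi> 0 = 0" using \<Psi>(1)[of 0] \<Phi>0 by simp
    then have "q (\<Psi> 0) = (torus_proj L y\<^sub>0, 0)" by (simp add: q_def G(4))
    then show ?case by (simp add: O'_def orbit_def)
  next
    case (insert i S) then show ?case using move[of "\<Sum>i\<in>S. s $ i *\<^sub>R axis i 1" "s $ i" i] by (simp add: add.commute)
  qed
  have "q y \<in> O'" for y
    using reach[of UNIV "\<Phi> y"] \<Psi>(1)[of y] by (simp add: axis_sum)
  then have eq: "O' = range q" using sub O'_def by blast
  obtain B :: "real^'n^'n" where B: "invertible B" "L = (\<lambda>m. B *v m) ` {m. \<forall>i. m $ i \<in> \<int>}" using L by (auto simp: lattice_in_def)
  define D where "D = (\<Sum>i\<in>UNIV. norm (B *v axis i 1))"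
  have "q y \<in> q ` cball 0 D" for y
  proof -
    define v where "v = matrix_inv B *v y"
    define m where "m = B *v (\<chi> i. of_int \<lfloor>v $ i\<rfloor>)"
    have mL: "m \<in> L" unfolding B m_def by (rule imageI) simp
    have "y - m = B *v (v - (\<chi> i. of_int \<lfloor>v $ i\<rfloor>))"
      by (simp add: m_def v_def matrix_vector_mult_diff_distrib matrix_vector_mul_assoc matrix_inv_inverse[OF B(1)])
    also have "v - (\<chi> i. of_int \<lfloor>v $ i\<rfloor>) = (\<chi> i. frac (v $ i))" by (simp add: vec_eq_iff frac_def)
    finally have "norm (y - m) \<le> (\<Sum>i\<in>UNIV. norm (frac (v $ i) *\<^sub>R (B *v axis i 1)))"
      by (simp only: mult_axis_sum[of B "\<chi> i. frac (v $ i)"] vec_lambda_beta norm_sum)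
    also have "\<dots> \<le> D" unfolding D_def
      by (intro sum_mono) (auto simp: frac_ge_0 intro!: mult_left_le_one_le less_imp_le[OF frac_lt_1])
    finally have "y - m \<in> cball 0 D" by simp
    moreover have "q (y - m) = q y"
    proof -
      have "torus_proj L (y\<^sub>0 + (y - m)) = torus_proj L (y\<^sub>0 + y)" using mL by (simp add: Lp(1))
      moreover have "G (y - m + m) = G (y - m)" by (rule G(3)[OF mL])
      ultimately show ?thesis by (simp add: q_def)
    qed
    ultimately show ?thesis by (metis imageI)
  qed
  then have "range q = q ` cball 0 D" by auto
  moreover have "compactin (M_topology L \<epsilon>) (q ` cball 0 D)"
  proof (rule image_compactin)
    show "compactin euclidean (cball (0::real^'n) D)" by (simp add: compact_cball)
    have c1: "continuous_map euclidean (torus_topology L) (\<lambda>y. torus_proj L (y\<^sub>0 + y))"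
    proof -
      have "continuous_map euclidean (torus_topology L) (torus_proj L \<circ> (\<lambda>y. y\<^sub>0 + y))"
        by (rule continuous_map_compose[OF _ quotient_imp_continuous_map[OF quotient_map_torus_proj]])
          (auto intro!: continuous_intros)
      then show ?thesis by (simp add: comp_def)
    qed
    have "continuous_on UNIV G" by (rule continuous_at_imp_continuous_on) (use G(1) has_derivative_continuous in blast)
    then have c2: "continuous_map euclidean (top_of_set {-\<epsilon><..<\<epsilon>}) G"
      using GI by (simp add: continuous_map_in_subtopology image_subset_iff)
    show "continuous_map euclidean (M_topology L \<epsilon>) q"
      unfolding M_topology_def q_def[abs_def] using c1 c2 by (simp add: continuous_map_pairedI)
  qed
  ultimately show ?thesis using eq by (simp add: O'_def)
qed

end

text \<open>Counterparts of the notions of \<open>cover_family\<close> in fixed coordinates. There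
  the fields are translated so that the leaf starts over the origin; estimates for a sequence of
  families with varying starting points need the untranslated version.\<close>

definition frame_matrix :: "(real^'n) set \<Rightarrow> ('n \<Rightarrow> 'n vfield) \<Rightarrow> (real^'n) \<times> real \<Rightarrow> real^'n^'n" where
  "frame_matrix L X p = (\<chi> i j. fst (X j (M_proj L p)) $ i)"
definition coframe :: "(real^'n) set \<Rightarrow> ('n \<Rightarrow> 'n vfield) \<Rightarrow> 'n \<Rightarrow> (real^'n) \<times> real \<Rightarrow> real^'n" where
  "coframe L X j p = matrix_inv (frame_matrix L X p) $ j"
definition slope :: "(real^'n) set \<Rightarrow> ('n \<Rightarrow> 'n vfield) \<Rightarrow> (real^'n) \<times> real \<Rightarrow> real^'n" where
  "slope L X p = (\<Sum>j\<in>UNIV. snd (X j (M_proj L p)) *\<^sub>R coframe L X j p)"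

lemma Ck_on_shift:
  assumes "open S" "\<And>x. x \<in> S \<Longrightarrow> x + a \<in> S" "Ck_on m f S" shows "Ck_on m (\<lambda>x. f (x + a)) S"
  using assms(3)
proof (induction m arbitrary: f)
  case 0 then show ?case using assms(2) by (auto intro!: continuous_on_compose2[of S f] continuous_intros)
next
  case (Suc m)
  show ?case
  proof (rule Ck_on_SucI[OF assms(1)])
    fix x assume x: "x \<in> S"
    have "((\<lambda>x. x + a) has_derivative (\<lambda>h. h)) (at x)" by (auto intro!: derivative_eq_intros)
    from diff_chain_at[OF this Ck_on_derivD[OF Suc.prems assms(2)[OF x]]]
    show "((\<lambda>x. f (x + a)) has_derivative (\<lambda>h. partial_deriv h f (x + a))) (at x)" by (simp add: comp_def)
  next
    show "Ck_on m (\<lambda>x. partial_deriv b f (x + a)) S" if "b \<in> Basis" for b using Suc that by simp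
  qed
qed

lemma frechet_shift:
  assumes "f differentiable (at (x + a))"
  shows "frechet_derivative (\<lambda>x. f (x + a)) (at x) = frechet_derivative f (at (x + a))"
proof -
  have "((\<lambda>x. x + a) has_derivative (\<lambda>h. h)) (at x)" by (auto intro!: derivative_eq_intros)
  from diff_chain_at[OF this assms[unfolded frechet_derivative_works]]
  have "((\<lambda>x. f (x + a)) has_derivative frechet_derivative f (at (x + a))) (at x)" by (simp add: comp_def)
  then show ?thesis by (rule frechet_derivative_at[symmetric])
qed

text \<open>If the leaf through the starting point returned to height 0 at every basis vector, then
  \<open>periodic_extension\<close> and \<open>compact_orbit\<close> would make the orbit compact.
  The three bounds on \<open>d * R\<close> keep the leaf inside the strip, make the iteration
  contract, and confine the leaf to heights where the coframe is close to P.\<close>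

lemma one_step:
  fixes L :: "(real^'n) set" and X :: "'n \<Rightarrow> 'n vfield" and B P P' :: "real^'n^'n"
  defines "D \<equiv> (\<Sum>i\<in>UNIV. norm (B *v axis i 1))"
  assumes B: "invertible B" and LB: "L = (\<lambda>m. B *v m) ` {m. \<forall>i. m $ i \<in> \<int>}"
    and c: "0 < c" "c < \<epsilon>"
    and X: "\<And>j. smooth_vfield L \<epsilon> (X j)" "\<And>i j. vfields_commute L \<epsilon> (X i) (X j)"
    and det: "\<And>y s. s \<in> {-c<..<c} \<Longrightarrow> det (frame_matrix L X (y, s)) \<noteq> 0"
    and R: "4 * D < R"
    and bd: "\<And>y s. s \<in> {-c<..<c} \<Longrightarrow> norm (slope L X (y, s)) \<le> d"
      "\<And>y s. s \<in> {-c<..<c} \<Longrightarrow> norm (partial_deriv (0, 1) (slope L X) (y, s)) \<le> d"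
    and dR: "d * R \<le> c / 2" "d * R \<le> 1 / 2" "d * R \<le> \<eta>"
    and P: "\<And>y s v. s \<in> {-c<..<c} \<Longrightarrow> \<bar>s\<bar> \<le> \<eta> \<Longrightarrow> norm ((\<chi> k. coframe L X k (y, s) \<bullet> v) - P *v v) \<le> \<kappa> * norm v"
      "P ** P' = mat 1" "P' ** P = mat 1" "\<And>v. \<kappa> * norm (P' *v v) \<le> norm v / 2" "\<kappa> \<ge> 0"
    and nc: "\<not> compactin (M_topology L \<epsilon>) (orbit L \<epsilon> X (torus_proj L y\<^sub>0, 0))"
  shows "\<exists>F \<Phi>. F 0 = 0 \<and> (\<forall>y\<in>ball 0 R. (F has_derivative (\<lambda>h. slope L X (y\<^sub>0 + y, F y) \<bullet> h)) (at y) \<and> \<bar>F y\<bar> \<le> d * R \<and> F y \<in> {-c<..<c} \<and>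
     (\<forall>k. (\<Phi> k has_derivative (\<lambda>h. coframe L X k (y\<^sub>0 + y, F y) \<bullet> h)) (at y))) \<and> (\<exists>i. F (B *v axis i 1) \<noteq> 0)"
proof -
  let ?S = "(UNIV :: (real^'n) set) \<times> {-\<epsilon><..<\<epsilon>}" and ?U = "(UNIV :: (real^'n) set) \<times> {-c<..<c}"
  have L: "lattice_in L" using B LB by (auto simp: lattice_in_def)
  define V where "V j p = X j (M_proj L (p + (y\<^sub>0, 0)))" for j p
  have V_eq: "V j (y, z) = X j (M_proj L (y\<^sub>0 + y, z))" for j y z by (simp add: V_def add.commute)
  have oS: "open ?S" "\<And>x. x \<in> ?S \<Longrightarrow> x + (y\<^sub>0, 0) \<in> ?S" by (auto intro!: open_Times)
  have XCk: "Ck_on m (X j \<circ> M_proj L) ?S" for m j using X(1)[of j] by (simp add: smooth_vfield_def smooth_on_def M_cover_def)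
  have D0: "D \<ge> 0" unfolding D_def by (rule sum_nonneg) simp
  then have R0: "R > 0" using R by linarith
  interpret cf: cover_family V \<epsilon> c
  proof
    show "0 < c" "c < \<epsilon>" by (fact c)+
    show "smooth_on (V j) ?S" for j
      unfolding smooth_on_def V_def[abs_def] using Ck_on_shift[OF oS XCk[of _ j]] by (simp add: comp_def)
    show "lie_bracket (V i) (V j) p = 0" if "p \<in> ?S" for p i j
    proof -
      have d: "(\<lambda>q. X j (M_proj L q)) differentiable (at (p + (y\<^sub>0, 0)))" for j
        by (rule bspec[OF conjunct1[OF XCk[of "Suc 0" j, unfolded comp_def Ck_on.simps]] oS(2)[OF that]])
      have "lie_bracket (X i \<circ> M_proj L) (X j \<circ> M_proj L) (p + (y\<^sub>0, 0)) = 0"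
        by (rule bspec[OF X(2)[of i j, unfolded vfields_commute_def M_cover_def] oS(2)[OF that]])
      then show ?thesis unfolding lie_bracket_def V_def[abs_def] by (simp add: comp_def frechet_shift[OF d])
    qed
    show "det (\<chi> i j. fst (V j p) $ i) \<noteq> 0" if "p \<in> ?U" for p
    proof -
      have "det (frame_matrix L X (y\<^sub>0 + fst p, snd p)) \<noteq> 0" using det that by (auto simp: mem_Times_iff)
      then show ?thesis using V_eq[of _ "fst p" "snd p"] by (simp add: frame_matrix_def)
    qed
  qed
  have frame_matrix_at: "cf.frame_matrix_at p = frame_matrix L X (p + (y\<^sub>0, 0))" for p by (simp add: cf.frame_matrix_at_def frame_matrix_def V_def)
  have w: "cf.w j p = coframe L X j (p + (y\<^sub>0, 0))" for j p by (simp add: cf.w_def coframe_def frame_matrix_at)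
  have om: "cf.\<omega> p = slope L X (p + (y\<^sub>0, 0))" for p by (simp add: cf.\<omega>_def slope_def w V_def)
  have om': "cf.\<omega> = (\<lambda>p. slope L X (p + (y\<^sub>0, 0)))" using om by auto
  have doD: "(cf.\<omega> has_derivative (\<lambda>h. partial_deriv h cf.\<omega> p)) (at p)" if "p \<in> ?U" for p by (rule Ck_on_derivD[OF cf.om_Ck that])
  have zder: "norm (partial_deriv (0, 1) cf.\<omega> (y, s)) \<le> d" if s: "s \<in> {-c<..<c}" for y s
  proof -
    have "((\<lambda>x. x + (- y\<^sub>0, 0::real)) has_derivative (\<lambda>h. h)) (at (y\<^sub>0 + y, s))" by (auto intro!: derivative_eq_intros)
    moreover have "(cf.\<omega> has_derivative (\<lambda>h. partial_deriv h cf.\<omega> (y, s))) (at ((y\<^sub>0 + y, s) + (- y\<^sub>0, 0)))" using doD[of "(y, s)"] s by simp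
    ultimately have "(cf.\<omega> \<circ> (\<lambda>x. x + (- y\<^sub>0, 0)) has_derivative ((\<lambda>h. partial_deriv h cf.\<omega> (y, s)) \<circ> (\<lambda>h. h))) (at (y\<^sub>0 + y, s))"
      by (rule diff_chain_at)
    then have "(slope L X has_derivative (\<lambda>h. partial_deriv h cf.\<omega> (y, s))) (at (y\<^sub>0 + y, s))"
      by (simp add: om comp_def add.assoc zero_prod_def[symmetric])
    then have "partial_deriv (0, 1) (slope L X) (y\<^sub>0 + y, s) = partial_deriv (0, 1) cf.\<omega> (y, s)" by (rule partial_deriv_eq)
    then show ?thesis using bd(2)[OF s, of "y\<^sub>0 + y"] by simp
  qed
  interpret lf: leaf_form "\<lambda>y s. cf.\<omega> (y, s)" "\<lambda>y s h. partial_deriv h cf.\<omega> (y, s)" c d R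
  proof
    show "0 < c" "0 < R" by (fact c R0)+
    show "((\<lambda>p. cf.\<omega> (fst p, snd p)) has_derivative (\<lambda>h. partial_deriv h cf.\<omega> (y, s))) (at (y, s))" if "s \<in> {-c<..<c}" for y s
      using doD[of "(y, s)"] that by simp
    show "continuous_on ?U (\<lambda>(y, s). partial_deriv h cf.\<omega> (y, s))" for h
      using partial_deriv_cont[OF cf.om_Ck, of h] by (simp add: case_prod_unfold)
    show "norm (cf.\<omega> (y, s)) \<le> d" if "s \<in> {-c<..<c}" for y s using bd(1)[OF that, of "y + y\<^sub>0"] by (simp add: om)
    show "norm (partial_deriv (0, 1) cf.\<omega> (y, s)) \<le> d" if "s \<in> {-c<..<c}" for y s by (rule zder[OF that])
    show "partial_deriv (v, cf.\<omega> (y, s) \<bullet> v) cf.\<omega> (y, s) \<bullet> u = partial_deriv (u, cf.\<omega> (y, s) \<bullet> u) cf.\<omega> (y, s) \<bullet> v" if "s \<in> {-c<..<c}" for y s u v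
      by (rule cf.integrable(1)) (use that in simp)
  qed (use dR in auto)
  have Fd: "(lf.F has_derivative (\<lambda>h. cf.\<omega> (y, lf.F y) \<bullet> h)) (at y)" if "y \<in> ball 0 R" for y by (rule lf.F_deriv[OF that])
  have FI: "lf.F y \<in> {-c<..<c}" if "y \<in> ball 0 R" for y by (rule lf.F_I[OF that])
  have Fb: "\<bar>lf.F y\<bar> \<le> d * R" if "y \<in> ball 0 R" for y
  proof -
    have "d * norm y \<le> d * R" using that lf.d by (intro mult_left_mono) auto
    then show ?thesis using lf.F_bd[OF that] by linarith
  qed
  have "\<exists>\<Phi>. \<Phi> 0 = 0 \<and> (\<forall>y\<in>ball 0 R. (\<Phi> has_derivative (\<lambda>h. cf.w k (y, lf.F y) \<bullet> h)) (at y))" for k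
    by (rule cf.leaf_primitive[OF open_ball convex_ball _ Fd FI]) (use R0 in simp)
  then obtain \<Phi> where \<Phi>: "\<And>k y. y \<in> ball 0 R \<Longrightarrow> (\<Phi> k has_derivative (\<lambda>h. cf.w k (y, lf.F y) \<bullet> h)) (at y)" by metis
  have "\<exists>i. lf.F (B *v axis i 1) \<noteq> 0"
  proof (rule ccontr)
    assume "\<not> ?thesis"
    then have z: "lf.F (B *v axis i 1) = lf.F 0" for i by (simp add: lf.F_0)
    have periodic: "cf.\<omega> (y + l, s) = cf.\<omega> (y, s)" if "l \<in> L" for y s l
    proof -
      have "torus_proj L (y + l + y\<^sub>0) = torus_proj L (y + y\<^sub>0)" using torus_proj_eq(1)[OF L] torus_proj_eq(3)[OF L that] by simp
      then have "M_proj L (y + l + y\<^sub>0, s) = M_proj L (y + y\<^sub>0, s)" by (simp add: M_proj_def)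
      then show ?thesis by (simp add: om slope_def coframe_def frame_matrix_def)
    qed
    have "\<exists>G. (\<forall>y. (G has_derivative (\<lambda>h. cf.\<omega> (y, G y) \<bullet> h)) (at y)) \<and> (\<forall>y. \<forall>l\<in>L. G (y + l) = G y) \<and>
     (\<forall>y. \<exists>x\<in>ball 0 R. G y = lf.F x) \<and> G 0 = lf.F 0"
      unfolding LB
      by (rule periodic_extension[OF B R[unfolded D_def] Fd FI lf.lip periodic[unfolded LB] z])
    then obtain G where G: "\<And>y. (G has_derivative (\<lambda>h. cf.\<omega> (y, G y) \<bullet> h)) (at y)" "\<And>y l. l \<in> L \<Longrightarrow> G (y + l) = G y"
      "\<And>y. \<exists>x\<in>ball 0 R. G y = lf.F x" "G 0 = 0" using lf.F_0 by metis
    have GI: "G y \<in> {-c<..<c}" "\<bar>G y\<bar> \<le> \<eta>" for y using G(3)[of y] FI Fb dR(3) by force+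
    have "compactin (M_topology L \<epsilon>) (orbit L \<epsilon> X (torus_proj L y\<^sub>0, 0))"
    proof (rule cf.compact_orbit[OF L V_eq G(1) GI(1) G(2) G(4) _ P(2,3,4,5)])
      show "norm ((\<chi> k. cf.w k (y, G y) \<bullet> v) - P *v v) \<le> \<kappa> * norm v" for y v
        using P(1)[OF GI(1)[of y] GI(2)[of y], of "y + y\<^sub>0" v] by (simp add: w)
    qed
    then show False using nc by simp
  qed
  moreover have "cf.\<omega> (y, s) = slope L X (y\<^sub>0 + y, s)" "cf.w k (y, s) = coframe L X k (y\<^sub>0 + y, s)" for y s k by (simp_all add: om w add.commute)
  ultimately show ?thesis using Fd FI Fb \<Phi> lf.F_0 by (intro exI[of _ lf.F] exI[of _ \<Phi>]) auto
qed

section \<open>Uniform estimates for a converging sequence of families\<close>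

lemma param_class_unif:
  assumes "param_class c True j \<phi>" "c > 0" "e > 0"
  shows "\<forall>\<^sub>F n in sequentially. \<forall>y. \<forall>s\<in>{-c<..<c}. \<bar>\<phi> n y s\<bar> < e"
proof -
  \<comment> \<open>The class tests uniformity on sequences of points, so for each n a point
    violating the bound is chosen, or an arbitrary one if there is none.\<close>
  have "\<forall>n. \<exists>y s. s \<in> {-c<..<c} \<and> ((\<exists>y. \<exists>s\<in>{-c<..<c}. \<not> \<bar>\<phi> n y s\<bar> < e) \<longrightarrow> \<not> \<bar>\<phi> n y s\<bar> < e)"
  proof
    fix n show "\<exists>y s. s \<in> {-c<..<c} \<and> ((\<exists>y. \<exists>s\<in>{-c<..<c}. \<not> \<bar>\<phi> n y s\<bar> < e) \<longrightarrow> \<not> \<bar>\<phi> n y s\<bar> < e)"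
    proof (cases "\<exists>y. \<exists>s\<in>{-c<..<c}. \<not> \<bar>\<phi> n y s\<bar> < e")
      case True then show ?thesis by blast
    next
      case False then show ?thesis using assms(2) by (intro exI[of _ undefined] exI[of _ 0]) auto
    qed
  qed
  then obtain y s where ys: "\<And>n. s n \<in> {-c<..<c}" "\<And>n. (\<exists>y. \<exists>s\<in>{-c<..<c}. \<not> \<bar>\<phi> n y s\<bar> < e) \<Longrightarrow> \<not> \<bar>\<phi> n (y n) (s n)\<bar> < e" by metis
  have "seq_class True (\<lambda>n. \<phi> n (y n) (s n))" using param_class_0[OF assms(1)] ys(1) by simp
  then have "\<forall>\<^sub>F n in sequentially. dist (\<phi> n (y n) (s n)) 0 < e" using assms(3) unfolding seq_class_def by (simp add: tendsto_iff)
  then show ?thesis by eventually_elim (use ys(2) in fastforce)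
qed

lemma param_class_shift:
  fixes \<phi> :: "nat \<Rightarrow> 'a::topological_monoid_add \<Rightarrow> real \<Rightarrow> real"
  assumes "param_class c z k \<phi>" shows "param_class c z k (\<lambda>n y. \<phi> n (a n + y))"
  using assms
proof (induction k arbitrary: \<phi>)
  have cont: "continuous_on (UNIV \<times> {-c<..<c}) (\<lambda>(y, s). \<phi> n (a n + y) s)"
    if "\<And>n. continuous_on (UNIV \<times> {-c<..<c}) (\<lambda>(y, s). \<phi> n y s)" for n and \<phi> :: "nat \<Rightarrow> 'a \<Rightarrow> real \<Rightarrow> real"
  proof -
    have "continuous_on (UNIV \<times> {-c<..<c}) (\<lambda>p. (\<lambda>(y, s). \<phi> n y s) (a n + fst p, snd p))"
      by (rule continuous_on_compose2[OF that]) (auto intro!: continuous_intros)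
    then show ?thesis by (simp add: case_prod_unfold)
  qed
  {
    case 0 then show ?case using cont by auto
  next
    case (Suc k) then show ?case using cont by (auto simp del: greaterThanLessThan_iff)
  }
qed

lemma param_class_seq:
  assumes "Bseq a" shows "param_class c False k (\<lambda>n y s. a n)"
proof (cases k)
  case 0 then show ?thesis using assms by (auto simp: case_prod_unfold seq_class_def)
next
  case (Suc i)
  show ?thesis unfolding Suc
    by (rule param_class_SucI[where D="\<lambda>n y s. 0"]) (use assms param_class_const[of c i 0] in \<open>auto simp: case_prod_unfold seq_class_def\<close>)
qed

lemma close_bound:
  assumes "close_commuting_family L \<epsilon> k (horizontal_family A) \<delta> X" "length bs \<le> k" "set bs \<subseteq> Basis" "b \<in> Basis" "p \<in> M_cover \<epsilon>"
  shows "\<bar>iter_partial bs (\<lambda>q. (X j (M_proj L q) - horizontal_family A j (M_proj L q)) \<bullet> b) p\<bar> \<le> \<delta>"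
proof -
  have "ereal \<bar>iter_partial bs (\<lambda>q. (X j (M_proj L q) - horizontal_family A j (M_proj L q)) \<bullet> b) p\<bar>
     \<le> Ck_norm L \<epsilon> k (\<lambda>p. X j p - horizontal_family A j p)"
    unfolding Ck_norm_def by (rule Sup_upper) (use assms in blast)
  also have "\<dots> < ereal \<delta>" using assms(1) by (simp add: close_commuting_family_def)
  finally show ?thesis by simp
qed

lemma snd_Ck:
  assumes "Ck_on m \<phi> {-\<epsilon><..<\<epsilon>}" shows "Ck_on m (\<lambda>q. \<phi> (snd q)) (M_cover \<epsilon> :: ((real^'n) \<times> real) set)"
proof -
  have o: "open (M_cover \<epsilon> :: ((real^'n) \<times> real) set)" by (simp add: M_cover_def open_Times)
  show ?thesis
    by (rule Ck_on_compose[OF o _ assms Ck_on_linear[OF o bounded_linear_snd]]) (auto simp: M_cover_def)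
qed

lemma horizontal_Ck:
  fixes A :: "real \<Rightarrow> real^'n^'n"
  assumes "smooth_on A {-\<epsilon><..<\<epsilon>}"
  shows "Ck_on m (\<lambda>q. horizontal_family A j (M_proj L q)) (M_cover \<epsilon>)"
proof -
  have o: "open (M_cover \<epsilon> :: ((real^'n) \<times> real) set)" by (simp add: M_cover_def open_Times)
  have "linear (\<lambda>M :: real^'n^'n. (\<chi> i. M $ i $ j, 0 :: real))" by (rule linearI) (auto simp: vec_eq_iff)
  then have "bounded_linear (\<lambda>M :: real^'n^'n. (\<chi> i. M $ i $ j, 0 :: real))" by (simp add: linear_conv_bounded_linear)
  then have "Ck_on m (\<lambda>q. (\<lambda>M :: real^'n^'n. (\<chi> i. M $ i $ j, 0 :: real)) (A (snd q))) (M_cover \<epsilon> :: ((real^'n) \<times> real) set)"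
    by (rule Ck_on_linear_compose[OF o _ snd_Ck]) (use assms in \<open>simp add: smooth_on_def\<close>)
  then show ?thesis by (simp add: horizontal_family_def M_proj_def case_prod_unfold)
qed

lemma entries_close:
  fixes A :: "real \<Rightarrow> real^'n^'n"
  assumes A: "smooth_on A {-\<epsilon><..<\<epsilon>}" and c: "0 < c" "c < \<epsilon>"
    and X: "\<And>n. close_commuting_family L \<epsilon> k (horizontal_family A) (\<delta> n) (X n)" and \<delta>: "\<delta> \<longlonglongrightarrow> 0"
  shows "approx_class c k (\<lambda>n y s. frame_matrix L (X n) (y, s) $ i $ j) (\<lambda>s. A s $ i $ j)"
    and "param_class c True k (\<lambda>n y s. snd (X n j (M_proj L (y, s))))"
proof -
  have o: "open (M_cover \<epsilon> :: ((real^'n) \<times> real) set)" by (simp add: M_cover_def open_Times)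
  have sub: "UNIV \<times> {-c<..<c} \<subseteq> (M_cover \<epsilon> :: ((real^'n) \<times> real) set)" using c by (auto simp: M_cover_def)
  have D: "param_class c True k (\<lambda>n y s. (X n j (M_proj L (y, s)) - horizontal_family A j (M_proj L (y, s))) \<bullet> b)" if b: "b \<in> Basis" for b
  proof (rule param_class_of_close[where D="\<lambda>n q. (X n j (M_proj L q) - horizontal_family A j (M_proj L q)) \<bullet> b", OF _ _ \<delta>])
    show "Ck_on k (\<lambda>q. (X n j (M_proj L q) - horizontal_family A j (M_proj L q)) \<bullet> b) (UNIV \<times> {-c<..<c})" for n
    proof (rule Ck_on_subset[OF Ck_on_inner[OF o Ck_on_diff[OF o _ horizontal_Ck[OF A]]] sub])
      have "smooth_vfield L \<epsilon> (X n j)" using X[of n] by (simp add: close_commuting_family_def)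
      then show "Ck_on k (\<lambda>q. X n j (M_proj L q)) (M_cover \<epsilon>)" by (simp add: smooth_vfield_def smooth_on_def comp_def)
    qed
    show "\<bar>iter_partial (replicate i (0, 1)) (\<lambda>q. (X n j (M_proj L q) - horizontal_family A j (M_proj L q)) \<bullet> b) p\<bar> \<le> \<delta> n"
      if "i \<le> k" "p \<in> UNIV \<times> {-c<..<c}" for n i p
      by (rule close_bound[OF X]) (use that sub b in \<open>auto simp: Basis_prod_def\<close>)
  qed
  have "axis i (1::real) \<in> Basis" by (auto simp: Basis_vec_def)
  then have "param_class c True k (\<lambda>n y s. (X n j (M_proj L (y, s)) - horizontal_family A j (M_proj L (y, s))) \<bullet> (axis i 1, 0))"
    by (intro D) (simp add: Basis_prod_def)
  then have "param_class c True k (\<lambda>n y s. frame_matrix L (X n) (y, s) $ i $ j - A s $ i $ j)"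
    by (simp add: frame_matrix_def horizontal_family_def M_proj_def inner_prod_def inner_axis)
  moreover have "param_class c False k (\<lambda>n (y::real^'n). \<lambda>s. A s $ i $ j)"
  proof (rule param_class_of_Ck)
    show "Ck_on k (\<lambda>s. A s $ i $ j) {-\<epsilon><..<\<epsilon>}"
      using A by (intro Ck_on_nth) (auto simp: smooth_on_def)
  qed (use c in auto)
  ultimately show "approx_class c k (\<lambda>n y s. frame_matrix L (X n) (y, s) $ i $ j) (\<lambda>s. A s $ i $ j)" by (simp add: approx_class_def)
  have "param_class c True k (\<lambda>n y s. (X n j (M_proj L (y, s)) - horizontal_family A j (M_proj L (y, s))) \<bullet> (0, 1))"
    by (intro D) (simp add: Basis_prod_def)
  then show "param_class c True k (\<lambda>n y s. snd (X n j (M_proj L (y, s))))"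
    by (simp add: horizontal_family_def M_proj_def inner_prod_def)
qed

lemma param_class_sum: "(\<And>i. i \<in> S \<Longrightarrow> param_class c True k (f i)) \<Longrightarrow> param_class c True k (\<lambda>n y s. \<Sum>i\<in>S. f i n y s)"
  by (induction S rule: infinite_finite_induct) (auto intro: param_class_True_zero param_class_add)

text \<open>Every term of the slope has the vertical component of a field as a factor. It is o(1)
  because the limiting fields are horizontal, while the coframe stays bounded.\<close>

lemma frame_close:
  fixes A :: "real \<Rightarrow> real^'n^'n"
  assumes A: "smooth_on A {-\<epsilon><..<\<epsilon>}" and c: "0 < c" "c < \<epsilon>"
    and X: "\<And>n. close_commuting_family L \<epsilon> k (horizontal_family A) (\<delta> n) (X n)" and \<delta>: "\<delta> \<longlonglongrightarrow> 0"
    and e: "e > 0" "\<And>s. s \<in> {-c<..<c} \<Longrightarrow> \<bar>det (A s)\<bar> \<ge> e" "\<And>n y s. s \<in> {-c<..<c} \<Longrightarrow> \<bar>det (frame_matrix L (X n) (y, s))\<bar> \<ge> e"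
  shows "approx_class c k (\<lambda>n y s. coframe L (X n) q (y, s) $ i) (\<lambda>s. matrix_inv (A s) $ q $ i)"
    and "param_class c True k (\<lambda>n y s. slope L (X n) (y, s) $ i)"
proof -
  show W: "approx_class c k (\<lambda>n y s. coframe L (X n) q (y, s) $ i) (\<lambda>s. matrix_inv (A s) $ q $ i)" for q
    unfolding coframe_def
    by (rule approx_class_matrix_inv[OF entries_close(1)[OF A c X \<delta>] e(1,3,2)])
  have "param_class c (True \<or> False) k (\<lambda>n y s. snd (X n j (M_proj L (y, s))) * coframe L (X n) j (y, s) $ i)" for j
    by (rule param_class_mult[OF entries_close(2)[OF A c X \<delta>] approx_class_FD[OF W]])
  then have "param_class c True k (\<lambda>n y s. \<Sum>j\<in>UNIV. snd (X n j (M_proj L (y, s))) * coframe L (X n) j (y, s) $ i)"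
    by (intro param_class_sum) simp
  then show "param_class c True k (\<lambda>n y s. slope L (X n) (y, s) $ i)" by (simp add: slope_def)
qed

lemma param_class_inner:
  fixes f :: "nat \<Rightarrow> 'a::topological_space \<Rightarrow> real \<Rightarrow> real^'n"
  assumes "\<And>i. param_class c z k (\<lambda>n y s. f n y s $ i)" "Bseq v" shows "param_class c z k (\<lambda>n y s. f n y s \<bullet> v n)"
proof -
  have b: "Bseq (\<lambda>n. v n $ i)" for i
  proof -
    obtain K where "\<And>n. norm (v n) \<le> K" using assms(2) by (auto simp: Bseq_def)
    then show ?thesis by (intro BseqI'[of _ K]) (auto intro: order_trans[OF component_le_norm_cart])
  qed
  have *: "param_class c z k (\<lambda>n y s. v n $ i * f n y s $ i)" for i
    using param_class_mult[OF param_class_seq[OF b] assms(1)] by simp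
  have "param_class c z k (\<lambda>n y s. \<Sum>i\<in>S. v n $ i * f n y s $ i)" if "finite S" for S using that
  proof induction
    case empty show ?case
    proof (cases z)
      case True then show ?thesis using param_class_True_zero by simp
    next
      case False then show ?thesis using param_class_const[of c k 0] by simp
    qed
  next
    case (insert i S) then show ?case using param_class_add[OF *[of i]] by simp
  qed
  then show ?thesis by (simp add: inner_vec_def mult.commute)
qed

lemma matrix_norm_bound:
  fixes M :: "real^'n^'n"
  assumes "\<And>k i. \<bar>M $ k $ i\<bar> \<le> e" shows "norm (M *v v) \<le> (real CARD('n) * real CARD('n) * e) * norm v"
proof -
  have e0: "e \<ge> 0" using assms[of undefined undefined] by linarith
  have "norm (M *v v) \<le> (\<Sum>k\<in>UNIV. \<bar>(M *v v) $ k\<bar>)" by (rule norm_le_l1_cart)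
  also have "\<dots> \<le> (\<Sum>k\<in>(UNIV::'n set). \<Sum>i\<in>(UNIV::'n set). e * norm v)"
  proof (rule sum_mono)
    fix k :: 'n
    have "\<bar>(M *v v) $ k\<bar> \<le> (\<Sum>i\<in>UNIV. \<bar>M $ k $ i * v $ i\<bar>)" by (simp add: matrix_vector_mult_def)
    also have "\<dots> \<le> (\<Sum>i\<in>(UNIV::'n set). e * norm v)"
      unfolding abs_mult using e0 by (intro sum_mono mult_mono assms component_le_norm_cart) auto
    finally show "\<bar>(M *v v) $ k\<bar> \<le> (\<Sum>i\<in>(UNIV::'n set). e * norm v)" .
  qed
  also have "\<dots> = (real CARD('n) * real CARD('n) * e) * norm v" by simp
  finally show ?thesis .
qed

lemma slope_bounds:
  fixes L :: "(real^'n) set"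
  assumes "\<And>i. param_class c True k (\<lambda>n y s. slope L (X n) (y, s) $ i)" "k \<ge> 1" "c > 0" "d > 0"
    and d: "\<And>n y s. s \<in> {-c<..<c} \<Longrightarrow> slope L (X n) differentiable (at (y, s))"
  shows "\<forall>\<^sub>F n in sequentially. \<forall>y. \<forall>s\<in>{-c<..<c}. norm (slope L (X n) (y, s)) \<le> d \<and> norm (partial_deriv (0, 1) (slope L (X n)) (y, s)) \<le> d"
proof -
  obtain k' where k': "k = Suc k'" using assms(2) by (cases k) auto
  define e where "e = d / real CARD('n)"
  have e: "e > 0" using assms(4) by (simp add: e_def)
  have FDd: "param_class c True k' (\<lambda>n y. deriv (\<lambda>s. slope L (X n) (y, s) $ i))" for i using assms(1)[of i] k' by auto
  have "\<forall>\<^sub>F n in sequentially. \<forall>i. (\<forall>y. \<forall>s\<in>{-c<..<c}. \<bar>slope L (X n) (y, s) $ i\<bar> < e) \<and> (\<forall>y. \<forall>s\<in>{-c<..<c}. \<bar>deriv (\<lambda>s. slope L (X n) (y, s) $ i) s\<bar> < e)"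
    by (intro eventually_all_finite eventually_conj param_class_unif[OF assms(1) assms(3) e] param_class_unif[OF FDd assms(3) e])
  then show ?thesis
  proof eventually_elim
    case (elim n)
    show ?case
    proof (intro allI ballI conjI)
      fix y :: "real^'n" and s assume s: "s \<in> {-c<..<c}"
      have "norm (slope L (X n) (y, s)) \<le> (\<Sum>i\<in>UNIV. \<bar>slope L (X n) (y, s) $ i\<bar>)" by (rule norm_le_l1_cart)
      also have "\<dots> \<le> (\<Sum>i\<in>(UNIV::'n set). e)" using elim s by (intro sum_mono less_imp_le) blast
      finally show "norm (slope L (X n) (y, s)) \<le> d" by (simp add: e_def)
      have pd: "partial_deriv (0, 1) (slope L (X n)) (y, s) $ i = deriv (\<lambda>s. slope L (X n) (y, s) $ i) s" for i
      proof -
        have 1: "((\<lambda>p. slope L (X n) p $ i) has_derivative (\<lambda>h. partial_deriv h (slope L (X n)) (y, s) $ i)) (at (y, s))"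
          using bounded_linear.has_derivative[OF bounded_linear_vec_nth has_derivative_frechet[OF d[OF s]]] .
        then have "(\<lambda>p. slope L (X n) p $ i) differentiable (at (y, s))" by (auto simp: differentiable_def)
        from DERIV_imp_deriv[OF partial_z[OF this]] show ?thesis using partial_deriv_eq[OF 1] by simp
      qed
      have "norm (partial_deriv (0, 1) (slope L (X n)) (y, s)) \<le> (\<Sum>i\<in>UNIV. \<bar>partial_deriv (0, 1) (slope L (X n)) (y, s) $ i\<bar>)" by (rule norm_le_l1_cart)
      also have "\<dots> \<le> (\<Sum>i\<in>(UNIV::'n set). e)" unfolding pd using elim s by (intro sum_mono less_imp_le) blast
      finally show "norm (partial_deriv (0, 1) (slope L (X n)) (y, s)) \<le> d" by (simp add: e_def)
    qed
  qed
qed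

lemma slope_Ck:
  fixes L :: "(real^'n) set"
  assumes "\<And>j. smooth_vfield L \<epsilon> (X j)" "c < \<epsilon>" "\<And>y s. s \<in> {-c<..<c} \<Longrightarrow> det (frame_matrix L X (y, s)) \<noteq> 0"
  shows "Ck_on m (slope L X) (UNIV \<times> {-c<..<c})"
proof -
  let ?U = "(UNIV :: (real^'n) set) \<times> {-c<..<c}"
  have o: "open ?U" by (simp add: open_Times)
  have X: "Ck_on m (\<lambda>p. X j (M_proj L p)) ?U" for j
  proof (rule Ck_on_subset)
    show "Ck_on m (\<lambda>p. X j (M_proj L p)) (M_cover \<epsilon>)" using assms(1)[of j] by (simp add: smooth_vfield_def smooth_on_def comp_def)
    show "?U \<subseteq> M_cover \<epsilon>" using assms(2) by (auto simp: M_cover_def)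
  qed
  have f: "Ck_on m (\<lambda>p. frame_matrix L X p $ i $ j) ?U" for i j
    unfolding frame_matrix_def vec_lambda_beta by (intro Ck_on_nth[OF o] Ck_on_linear_compose[OF o bounded_linear_fst] X)
  have w: "Ck_on m (coframe L X j) ?U" for j
    unfolding coframe_def[abs_def] by (intro Ck_on_vec[OF o] Ck_on_matrix_inv[OF o f]) (use assms(3) in auto)
  show ?thesis unfolding slope_def[abs_def]
    by (intro Ck_on_sum Ck_on_scaleR o w Ck_on_linear_compose[OF o bounded_linear_snd] X)
qed

section \<open>Iterated derivatives and flat functions\<close>

lemma derivs_cong:
  assumes "open S" "s \<in> S" "\<And>s. s \<in> S \<Longrightarrow> f s = g s" shows "(deriv ^^ j) f s = (deriv ^^ j) g s"
  using assms(2,3)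
proof (induction j arbitrary: f g s)
  case (Suc j)
  have "(deriv ^^ j) (deriv f) s = (deriv ^^ j) (deriv g) s"
    by (rule Suc.IH[OF Suc.prems(1)]) (use Suc.prems(2) deriv_cong_on[OF assms(1)] in blast)
  then show ?case by (simp add: funpow_Suc_right del: funpow.simps)
qed simp

lemma Ck_deriv:
  fixes f :: "real \<Rightarrow> real"
  assumes "open S" "Ck_on (Suc m) f S"
  shows "Ck_on m (deriv f) S" "s \<in> S \<Longrightarrow> (f has_real_derivative deriv f s) (at s)"
proof -
  have d: "(f has_real_derivative partial_deriv 1 f s) (at s)" if "s \<in> S" for s
    using Ck_on_real_deriv(1)[OF assms(2,1) that] by (simp add: has_real_derivative_iff_has_vector_derivative)
  show "Ck_on m (deriv f) S"
    by (rule Ck_on_cong[OF assms(1), of "partial_deriv 1 f"]) (use assms(2) DERIV_imp_deriv[OF d] in auto)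
  show "(f has_real_derivative deriv f s) (at s)" if "s \<in> S" using d[OF that] DERIV_imp_deriv[OF d[OF that]] by simp
qed

lemma derivs_linear:
  fixes f g :: "real \<Rightarrow> real"
  assumes "open S" "s \<in> S" "Ck_on j f S" "Ck_on j g S"
  shows "(deriv ^^ j) (\<lambda>s. a * f s + b * g s) s = a * (deriv ^^ j) f s + b * (deriv ^^ j) g s"
  using assms(2-)
proof (induction j arbitrary: f g s)
  case (Suc j)
  have "deriv (\<lambda>s. a * f s + b * g s) t = a * deriv f t + b * deriv g t" if "t \<in> S" for t
    by (rule DERIV_imp_deriv) (auto intro!: derivative_eq_intros Ck_deriv(2)[OF assms(1) Suc.prems(2) that] Ck_deriv(2)[OF assms(1) Suc.prems(3) that])
  then have "(deriv ^^ j) (deriv (\<lambda>s. a * f s + b * g s)) s = (deriv ^^ j) (\<lambda>t. a * deriv f t + b * deriv g t) s"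
    by (intro derivs_cong[OF assms(1) Suc.prems(1)])
  also have "\<dots> = a * (deriv ^^ j) (deriv f) s + b * (deriv ^^ j) (deriv g) s"
    by (intro Suc.IH Suc.prems(1) Ck_deriv(1)[OF assms(1)] Suc.prems(2,3))
  finally show ?case by (simp add: funpow_Suc_right del: funpow.simps)
qed simp

lemma derivs_const: "(deriv ^^ Suc j) (\<lambda>s. a :: real) s = 0"
proof (induction j arbitrary: a)
  case (Suc j)
  have "deriv (\<lambda>s. a) = (\<lambda>s. 0)" by simp
  then show ?case using Suc[of 0] by (metis comp_apply funpow_Suc_right)
qed simp

lemma derivs_sum:
  fixes f :: "'i \<Rightarrow> real \<Rightarrow> real"
  assumes "open S" "s \<in> S" "finite T" "\<And>i. Ck_on j (f i) S"
  shows "(deriv ^^ j) (\<lambda>s. \<Sum>i\<in>T. a i * f i s) s = (\<Sum>i\<in>T. a i * (deriv ^^ j) (f i) s)"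
  using assms(3)
proof induction
  case empty
  have "(deriv ^^ j) (\<lambda>s. 0 :: real) s = 0" by (cases j) (auto simp: derivs_const simp del: funpow.simps(2))
  then show ?case by simp
next
  case (insert i T)
  have "(deriv ^^ j) (\<lambda>s. a i * f i s + 1 * (\<Sum>i\<in>T. a i * f i s)) s = a i * (deriv ^^ j) (f i) s + 1 * (deriv ^^ j) (\<lambda>s. \<Sum>i\<in>T. a i * f i s) s"
    by (rule derivs_linear[OF assms(1,2)]) (auto intro!: assms Ck_on_sum Ck_on_mult Ck_on_const)
  then show ?case using insert by simp
qed

definition flat :: "nat \<Rightarrow> (real \<Rightarrow> real) \<Rightarrow> bool" where "flat k f \<longleftrightarrow> (\<forall>j\<le>k. (deriv ^^ j) f 0 = 0)"

lemma flat_Suc: "flat (Suc k) f \<longleftrightarrow> f 0 = 0 \<and> flat k (deriv f)"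
proof -
  have "(\<forall>j\<le>Suc k. (deriv ^^ j) f 0 = 0) \<longleftrightarrow> (deriv ^^ 0) f 0 = 0 \<and> (\<forall>j\<le>k. (deriv ^^ Suc j) f 0 = 0)"
    by (metis Suc_le_mono le0 not0_implies_Suc)
  then show ?thesis by (simp add: flat_def funpow_Suc_right del: funpow.simps(2))
qed

lemma flat_cong: "open S \<Longrightarrow> 0 \<in> S \<Longrightarrow> (\<And>s. s \<in> S \<Longrightarrow> f s = g s) \<Longrightarrow> flat k f \<Longrightarrow> flat k g"
  unfolding flat_def using derivs_cong by metis

lemma flat_add:
  assumes "open S" "0 \<in> S" "Ck_on k f S" "Ck_on k g S" "flat k f" "flat k g" shows "flat k (\<lambda>s. f s + g s)"
  unfolding flat_def
proof (intro allI impI)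
  fix j assume j: "j \<le> k"
  show "(deriv ^^ j) (\<lambda>s. f s + g s) 0 = 0"
    using derivs_linear[OF assms(1,2) Ck_on_mono[OF assms(3) j] Ck_on_mono[OF assms(4) j], of 1 1] assms(5,6) j by (simp add: flat_def)
qed

text \<open>Functions whose k-jet at 0 vanishes, the value included, form an ideal.\<close>

lemma flat_mult:
  assumes "open S" "0 \<in> S" "Ck_on k a S" "Ck_on k f S" "flat k f" shows "flat k (\<lambda>s. a s * f s)"
  using assms(3-)
proof (induction k arbitrary: a f)
  case 0 then show ?case by (simp add: flat_def)
next
  case (Suc k)
  have a: "Ck_on k a S" "Ck_on k (deriv a) S" and f: "Ck_on k f S" "Ck_on k (deriv f) S"
    using Suc.prems Ck_on_SucD Ck_deriv(1)[OF assms(1)] by blast+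
  have ff: "flat k f" using Suc.prems(3) by (simp add: flat_def)
  have fd: "flat k (deriv f)" "f 0 = 0" using Suc.prems(3) by (auto simp: flat_Suc)
  have "flat k (\<lambda>s. deriv a s * f s + a s * deriv f s)"
    by (intro flat_add[OF assms(1,2)] Ck_on_mult assms(1) a f Suc.IH ff fd)
  then have "flat k (deriv (\<lambda>s. a s * f s))"
  proof (rule flat_cong[OF assms(1,2), rotated])
    fix s assume s: "s \<in> S"
    have "((\<lambda>s. a s * f s) has_real_derivative deriv a s * f s + a s * deriv f s) (at s)"
      by (auto intro!: derivative_eq_intros Ck_deriv(2)[OF assms(1) Suc.prems(1) s] Ck_deriv(2)[OF assms(1) Suc.prems(2) s])
    then show "deriv a s * f s + a s * deriv f s = deriv (\<lambda>s. a s * f s) s" by (rule DERIV_imp_deriv[symmetric])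
  qed
  then show ?case using fd(2) by (simp add: flat_Suc)
qed

lemma nth_vector_derivative_entry:
  fixes A :: "real \<Rightarrow> real^'n^'m"
  assumes "open S" "s \<in> S" "Ck_on j A S"
  shows "nth_vector_derivative j A s $ p $ q = (deriv ^^ j) (\<lambda>s. A s $ p $ q) s"
  using assms(2,3)
proof (induction j arbitrary: A s)
  case 0 then show ?case by (simp add: nth_vector_derivative_def)
next
  case (Suc j)
  have vd: "(\<lambda>t. vector_derivative A (at t)) t = partial_deriv 1 A t" if "t \<in> S" for t
    by (rule Ck_on_real_deriv(2)[OF Suc.prems(2) assms(1) that])
  have C: "Ck_on j (\<lambda>t. vector_derivative A (at t)) S"
    by (rule Ck_on_cong[OF assms(1), of "partial_deriv 1 A"]) (use Suc.prems vd in auto)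
  have d: "deriv (\<lambda>s. A s $ p $ q) t = vector_derivative A (at t) $ p $ q" if "t \<in> S" for t
  proof -
    have "(A has_vector_derivative vector_derivative A (at t)) (at t)"
      using Ck_on_real_deriv[OF Suc.prems(2) assms(1) that] by simp
    then have "((\<lambda>s. A s $ p $ q) has_vector_derivative vector_derivative A (at t) $ p $ q) (at t)"
      by (intro bounded_linear.has_vector_derivative[OF bounded_linear_vec_nth])
    then show ?thesis by (intro DERIV_imp_deriv) (simp add: has_real_derivative_iff_has_vector_derivative)
  qed
  have "nth_vector_derivative (Suc j) A s $ p $ q = nth_vector_derivative j (\<lambda>t. vector_derivative A (at t)) s $ p $ q"
    by (simp add: nth_vector_derivative_def funpow_Suc_right del: funpow.simps)
  also have "\<dots> = (deriv ^^ j) (\<lambda>t. vector_derivative A (at t) $ p $ q) s" by (rule Suc.IH[OF Suc.prems(1) C])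
  also have "\<dots> = (deriv ^^ j) (deriv (\<lambda>s. A s $ p $ q)) s" by (rule derivs_cong[OF assms(1) Suc.prems(1)]) (simp add: d)
  finally show ?case by (simp add: funpow_Suc_right del: funpow.simps)
qed

text \<open>In lattice coordinates x the relations say that the jets of A^-1(s) B x of orders 1 to k
  vanish whenever r . x = 0. Put w = A^-1(0) B x. Then A(s) w = B x - A(s) (A^-1(s) B x - w) is a
  constant minus a product with a flat factor, so its jets of these orders vanish as well.\<close>

lemma kernel_of_inverse_jets:
  fixes A :: "real \<Rightarrow> real^'n^'n" and B :: "real^'n^'n" and r :: "real^'n"
  assumes S: "open S" "0 \<in> S" and A: "\<And>m. Ck_on m A S" and inv: "\<And>s. s \<in> S \<Longrightarrow> det (A s) \<noteq> 0" and B: "invertible B"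
    and jets: "\<And>q i j. 1 \<le> j \<Longrightarrow> j \<le> k \<Longrightarrow> (deriv ^^ j) (\<lambda>s. matrix_inv (A s) $ q \<bullet> (B *v axis i 1)) 0 =
       r $ i * (deriv ^^ j) (\<lambda>s. matrix_inv (A s) $ q \<bullet> (B *v axis l 1)) 0" and rl: "r $ l = 1"
  shows "\<exists>D' :: (real^'n) set. subspace D' \<and> dim D' + 1 = CARD('n) \<and> (\<forall>w\<in>D'. \<forall>j. 1 \<le> j \<and> j \<le> k \<longrightarrow> nth_vector_derivative j A 0 *v w = 0)"
proof -
  let ?W = "\<lambda>s. matrix_inv (A s)"
  define T where "T x = ?W 0 *v (B *v x)" for x
  define D' where "D' = T ` {x. r \<bullet> x = 0}"
  have invA: "A s ** ?W s = mat 1" "?W s ** A s = mat 1" if "s \<in> S" for s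
    using inv[OF that] matrix_inv_inverse by (auto simp: invertible_det_nz)
  have linT: "linear T" unfolding T_def[abs_def] by (rule linearI) (simp_all add: matrix_vector_right_distrib matrix_vector_mult_scaleR)
  have injT: "inj T"
  proof (rule injI)
    fix x y assume "T x = T y"
    then have "A 0 *v T x = A 0 *v T y" by simp
    then have "B *v x = B *v y" by (simp add: T_def matrix_vector_mul_assoc invA(1)[OF S(2)] matrix_mul_assoc)
    then have "matrix_inv B *v (B *v x) = matrix_inv B *v (B *v y)" by simp
    then show "x = y" by (simp add: matrix_vector_mul_assoc matrix_inv_inverse[OF B])
  qed
  have r0: "r \<noteq> 0" using rl by auto
  have "dim D' = dim {x. r \<bullet> x = 0}" unfolding D'_def by (rule dim_image_eq[OF linT]) (use injT inj_on_subset in blast)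
  also have "\<dots> = CARD('n) - 1" using dim_hyperplane[OF r0] by simp
  finally have dim: "dim D' + 1 = CARD('n)" by simp
  have sub: "subspace D'" unfolding D'_def by (rule linear_subspace_image[OF linT subspace_hyperplane])
  have WC: "Ck_on m (\<lambda>s. ?W s $ q $ p) S" for m q p
    by (rule Ck_on_matrix_inv[OF S(1) _ inv]) (intro Ck_on_nth[OF S(1)] A)
  have ker: "nth_vector_derivative j A 0 *v w = 0" if w: "w \<in> D'" and j: "1 \<le> j" "j \<le> k" for w j
  proof -
    obtain x where x: "r \<bullet> x = 0" "w = T x" using w by (auto simp: D'_def)
    define g where "g q s = (?W s *v (B *v x)) $ q" for q s
    have g_sum: "g q s = (\<Sum>i\<in>UNIV. x $ i * (?W s $ q \<bullet> (B *v axis i 1)))" for q s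
      unfolding g_def matrix_vector_mul_component mult_axis_sum[of B x] by (simp add: inner_sum_right)
    have WiC: "Ck_on m (\<lambda>s. ?W s $ q \<bullet> v) S" for m q v
      unfolding inner_vec_def by (intro Ck_on_sum S(1)) (simp, intro Ck_on_mult S(1) WC Ck_on_const)
    have gC: "Ck_on m (g q) S" for m q unfolding g_sum[abs_def] by (intro Ck_on_sum Ck_on_mult Ck_on_const WiC S(1))
    have gd: "(deriv ^^ i) (g q) 0 = 0" if "1 \<le> i" "i \<le> k" for i q
    proof -
      have "(deriv ^^ i) (g q) 0 = (\<Sum>p\<in>UNIV. x $ p * (deriv ^^ i) (\<lambda>s. ?W s $ q \<bullet> (B *v axis p 1)) 0)"
        unfolding g_sum[abs_def] by (rule derivs_sum[OF S _ WiC]) simp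
      also have "\<dots> = (\<Sum>p\<in>UNIV. x $ p * r $ p) * (deriv ^^ i) (\<lambda>s. ?W s $ q \<bullet> (B *v axis l 1)) 0"
        unfolding sum_distrib_right
      proof (rule sum.cong[OF refl])
        fix p show "x $ p * (deriv ^^ i) (\<lambda>s. ?W s $ q \<bullet> (B *v axis p 1)) 0 = x $ p * r $ p * (deriv ^^ i) (\<lambda>s. ?W s $ q \<bullet> (B *v axis l 1)) 0"
          using jets[OF that, of q p] by (simp only: mult.assoc)
      qed
      also have "(\<Sum>p\<in>UNIV. x $ p * r $ p) = 0" using x(1) by (simp add: inner_vec_def mult.commute)
      finally show ?thesis by simp
    qed
    have gf: "flat k (\<lambda>s. g q s - g q 0)" for q
      unfolding flat_def
    proof (intro allI impI)
      fix i assume i: "i \<le> k"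
      show "(deriv ^^ i) (\<lambda>s. g q s - g q 0) 0 = 0"
      proof (cases i)
        case (Suc i')
        have "(deriv ^^ i) (\<lambda>s. 1 * g q s + (-1) * g q 0) 0 = 1 * (deriv ^^ i) (g q) 0 + (-1) * (deriv ^^ i) (\<lambda>s. g q 0) 0"
          by (rule derivs_linear[OF S gC Ck_on_const[OF S(1)]])
        then show ?thesis using gd[of i q] i Suc by (simp add: derivs_const del: funpow.simps)
      qed simp
    qed
    have "(nth_vector_derivative j A 0 *v w) $ p = 0" for p
    proof -
      have AC: "Ck_on m (\<lambda>s. A s $ p $ q) S" for m q by (intro Ck_on_nth[OF S(1)] A)
      have fl: "flat k (\<lambda>s. A s $ p $ q * (g q s - g q 0))" for q
        by (rule flat_mult[OF S AC _ gf]) (intro Ck_on_diff S(1) gC Ck_on_const)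
      have gC': "Ck_on m (\<lambda>s. A s $ p $ q * (g q s - g q 0)) S" for m q
        by (intro Ck_on_mult Ck_on_diff S(1) gC Ck_on_const AC)
      have fs: "(deriv ^^ j) (\<lambda>s. \<Sum>q\<in>UNIV. 1 * (A s $ p $ q * (g q s - g q 0))) 0 = 0"
        using derivs_sum[OF S finite_class.finite_UNIV gC', of j "\<lambda>_. 1"] fl j(2) by (simp add: flat_def)
      have eq: "(\<Sum>q\<in>UNIV. g q 0 * A s $ p $ q) = 1 * (B *v x) $ p + (-1) * (\<Sum>q\<in>UNIV. 1 * (A s $ p $ q * (g q s - g q 0)))" if "s \<in> S" for s
      proof -
        have "(\<Sum>q\<in>UNIV. A s $ p $ q * g q s) = (A s *v (?W s *v (B *v x))) $ p" by (simp add: g_def matrix_vector_mult_def)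
        also have "\<dots> = (B *v x) $ p" by (simp add: matrix_vector_mul_assoc matrix_mul_assoc invA(1)[OF that])
        finally show ?thesis by (simp add: algebra_simps sum_subtractf)
      qed
      have "(nth_vector_derivative j A 0 *v w) $ p = (\<Sum>q\<in>UNIV. g q 0 * (deriv ^^ j) (\<lambda>s. A s $ p $ q) 0)"
        by (simp add: matrix_vector_mult_def nth_vector_derivative_entry[OF S A] x(2) T_def g_def mult.commute)
      also have "\<dots> = (deriv ^^ j) (\<lambda>s. \<Sum>q\<in>UNIV. g q 0 * A s $ p $ q) 0"
        by (rule derivs_sum[OF S finite_class.finite_UNIV AC, symmetric])
      also have "\<dots> = (deriv ^^ j) (\<lambda>s. 1 * (B *v x) $ p + (-1) * (\<Sum>q\<in>UNIV. 1 * (A s $ p $ q * (g q s - g q 0)))) 0"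
        by (rule derivs_cong[OF S]) (rule eq)
      also have "\<dots> = 1 * (deriv ^^ j) (\<lambda>s. (B *v x) $ p) 0 + (-1) * (deriv ^^ j) (\<lambda>s. \<Sum>q\<in>UNIV. 1 * (A s $ p $ q * (g q s - g q 0))) 0"
        by (rule derivs_linear[OF S Ck_on_const[OF S(1)]]) (intro Ck_on_sum Ck_on_mult Ck_on_const S(1) Ck_on_diff gC AC)
      also have "\<dots> = 0" using fs j(1) by (cases j) (simp_all add: derivs_const del: funpow.simps)
      finally show ?thesis .
    qed
    then show ?thesis by (simp add: vec_eq_iff)
  qed
  show ?thesis using sub dim ker by blast
qed

section \<open>Noncompact orbits force flatness\<close>

text \<open>Division by the entry of largest modulus bounds all ratios by 1. Its index is constant
  on a subsequence by the pigeonhole principle, and compactness makes the vector of ratios converge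
  on a further one.\<close>

lemma diagonal_ratio_subsequence:
  fixes f :: "nat \<Rightarrow> 'n::finite \<Rightarrow> real"
  assumes "\<And>m. \<exists>i. f m i \<noteq> 0"
  shows "\<exists>l \<tau> r. strict_mono (\<tau> :: nat \<Rightarrow> nat) \<and> (\<forall>n. f (\<tau> n) l \<noteq> 0) \<and> (\<forall>i. (\<lambda>n. f (\<tau> n) i / f (\<tau> n) l) \<longlonglongrightarrow> r i)"
proof -
  have "\<exists>l. \<forall>i. \<bar>f m i\<bar> \<le> \<bar>f m l\<bar>" for m
  proof -
    have "Max (range (\<lambda>i. \<bar>f m i\<bar>)) \<in> range (\<lambda>i. \<bar>f m i\<bar>)" by (rule Max_in) auto
    then obtain l where "Max (range (\<lambda>i. \<bar>f m i\<bar>)) = \<bar>f m l\<bar>" by blast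
    moreover have "\<bar>f m i\<bar> \<le> Max (range (\<lambda>i. \<bar>f m i\<bar>))" for i by (rule Max_ge) auto
    ultimately show ?thesis by metis
  qed
  then obtain g where g: "\<And>m i. \<bar>f m i\<bar> \<le> \<bar>f m (g m)\<bar>" by metis
  obtain m0 where "infinite {m \<in> UNIV. g m = g m0}"
    using pigeonhole_infinite[of "UNIV :: nat set" g] by auto
  then have "infinite {m. g m = g m0}" by simp
  from infinite_enumerate[OF this] obtain \<tau>1 :: "nat \<Rightarrow> nat" where \<tau>1: "strict_mono \<tau>1" "\<And>n. g (\<tau>1 n) = g m0" by auto
  define l where "l = g m0"
  have nz: "f (\<tau>1 n) l \<noteq> 0" for n using assms[of "\<tau>1 n"] g[of "\<tau>1 n"] \<tau>1(2)[of n] unfolding l_def by (metis abs_le_zero_iff abs_zero)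
  define v :: "nat \<Rightarrow> real^'n" where "v n = (\<chi> i. f (\<tau>1 n) i / f (\<tau>1 n) l)" for n
  have "norm (v n) \<le> real CARD('n)" for n
  proof -
    have "norm (v n) \<le> (\<Sum>i\<in>UNIV. \<bar>v n $ i\<bar>)" by (rule norm_le_l1_cart)
    also have "\<dots> \<le> (\<Sum>i\<in>(UNIV::'n set). 1)"
    proof (rule sum_mono)
      fix i show "\<bar>v n $ i\<bar> \<le> 1"
        using g[of "\<tau>1 n" i] \<tau>1(2)[of n] nz[of n] by (simp add: v_def l_def abs_divide divide_le_eq)
    qed
    finally show ?thesis by simp
  qed
  then have "bounded (range v)" by (auto simp: bounded_iff)
  then obtain r \<tau>2 where \<tau>2: "strict_mono (\<tau>2 :: nat \<Rightarrow> nat)" "(v \<circ> \<tau>2) \<longlonglongrightarrow> r"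
    using bounded_imp_convergent_subsequence by blast
  have "(\<lambda>n. f (\<tau>1 (\<tau>2 n)) i / f (\<tau>1 (\<tau>2 n)) l) \<longlonglongrightarrow> r $ i" for i
    using tendsto_vec_nth[OF \<tau>2(2), of i] by (simp add: v_def comp_def)
  then show ?thesis
    by (intro exI[of _ l] exI[of _ "\<tau>1 \<circ> \<tau>2"] exI[of _ "\<lambda>i. r $ i"]) (simp add: strict_mono_o \<tau>1(1) \<tau>2(1) nz)
qed

theorem noncompact_imp_flat:
  fixes k :: nat and \<epsilon> :: real and L :: "(real^'n) set" and A :: "real \<Rightarrow> real^'n^'n"
  assumes k: "k \<ge> 1" and \<epsilon>: "\<epsilon> > 0" and L: "lattice_in L"
    and A: "smooth_on A {-\<epsilon><..<\<epsilon>}"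
    and inv: "\<And>z. z \<in> {-\<epsilon><..<\<epsilon>} \<Longrightarrow> invertible (A z)"
    and hyp: "\<forall>\<delta>>0. \<exists>X'. close_commuting_family L \<epsilon> k (horizontal_family A) \<delta> X' \<and>
             (\<exists>p \<in> torus L \<times> {0}. \<not> compactin (M_topology L \<epsilon>) (orbit L \<epsilon> X' p))"
  shows "\<exists>D' :: (real^'n) set. subspace D' \<and> dim D' + 1 = CARD('n) \<and>
             (\<forall>w\<in>D'. \<forall>j. 1 \<le> j \<and> j \<le> k \<longrightarrow> nth_vector_derivative j A 0 *v w = 0)"
proof -
  let ?S = "{-\<epsilon><..<\<epsilon>}"
  \<comment> \<open>Half the width, so that [-c, c] is a compact part of the interval on which A and
    its inverse are bounded with their derivatives.\<close>
  define c where "c = \<epsilon> / 2"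
  have c: "0 < c" "c < \<epsilon>" using \<epsilon> by (auto simp: c_def)
  let ?I = "{-c<..<c}"
  have IS: "{-c..c} \<subseteq> ?S" using c by auto
  obtain B :: "real^'n^'n" where B: "invertible B" "L = (\<lambda>m. B *v m) ` {m. \<forall>i. m $ i \<in> \<int>}" using L by (auto simp: lattice_in_def)
  let ?e = "\<lambda>i. B *v axis i 1 :: real^'n"
  have eL: "?e i \<in> L" for i unfolding B by (auto simp: axis_def)
  define D where "D = (\<Sum>i\<in>UNIV. norm (?e i))"
  have D0: "D \<ge> 0" unfolding D_def by (rule sum_nonneg) simp
  have ACk: "Ck_on m A ?S" for m using A by (simp add: smooth_on_def)
  have AeCk: "Ck_on m (\<lambda>s. A s $ i $ j) ?S" for m i j by (intro Ck_on_nth ACk) auto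
  have det0: "det (A s) \<noteq> 0" if "s \<in> ?S" for s using inv[OF that] by (simp add: invertible_det_nz)
  have WCk: "Ck_on m (\<lambda>s. matrix_inv (A s) $ q $ i) ?S" for m q i by (rule Ck_on_matrix_inv[OF _ AeCk det0]) auto
  \<comment> \<open>Half the minimum of |det A| on the compact interval: determinants of frames
    within e of the limit stay above e.\<close>
  obtain e where e: "e > 0" "\<And>s. s \<in> ?I \<Longrightarrow> 2 * e \<le> \<bar>det (A s)\<bar>"
  proof -
    have "continuous_on ?S (\<lambda>s. det (A s))" using Ck_on_det[of ?S 0 A] AeCk[of 0] by auto
    then have "continuous_on {-c..c} (\<lambda>s. \<bar>det (A s)\<bar>)" by (intro continuous_intros continuous_on_subset[OF _ IS])
    then obtain s0 where s0: "s0 \<in> {-c..c}" "\<And>s. s \<in> {-c..c} \<Longrightarrow> \<bar>det (A s0)\<bar> \<le> \<bar>det (A s)\<bar>"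
      using continuous_attains_inf[of "{-c..c}" "\<lambda>s. \<bar>det (A s)\<bar>"] c by auto
    have "det (A s0) \<noteq> 0" using det0 s0(1) IS by blast
    then show thesis using s0(2) by (intro that[of "\<bar>det (A s0)\<bar> / 2"]) auto
  qed
  have "\<forall>n. \<exists>X y. close_commuting_family L \<epsilon> k (horizontal_family A) (1 / (real n + 1)) X \<and>
      \<not> compactin (M_topology L \<epsilon>) (orbit L \<epsilon> X (torus_proj L y, 0))"
  proof
    fix n :: nat
    have "1 / (real n + 1) > 0" by simp
    then obtain X p where X: "close_commuting_family L \<epsilon> k (horizontal_family A) (1 / (real n + 1)) X" "p \<in> torus L \<times> {0}"
      "\<not> compactin (M_topology L \<epsilon>) (orbit L \<epsilon> X p)" using hyp by blast
    obtain u where u: "p = (u, 0)" "u \<in> range (torus_proj L)" using X(2) unfolding torus_proj_image by auto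
    then obtain y where "p = (torus_proj L y, 0)" by auto
    then show "\<exists>X y. close_commuting_family L \<epsilon> k (horizontal_family A) (1 / (real n + 1)) X \<and>
      \<not> compactin (M_topology L \<epsilon>) (orbit L \<epsilon> X (torus_proj L y, 0))" using X by blast
  qed
  then obtain X0 y0 where X0: "\<And>n. close_commuting_family L \<epsilon> k (horizontal_family A) (1 / (real n + 1)) (X0 n)"
     "\<And>n. \<not> compactin (M_topology L \<epsilon>) (orbit L \<epsilon> (X0 n) (torus_proj L (y0 n), 0))" by metis
  have lim0: "(\<lambda>n. 1 / (real n + 1)) \<longlonglongrightarrow> 0" using LIMSEQ_inverse_real_of_nat by (simp add: inverse_eq_divide add.commute)
  have "approx_class c k (\<lambda>n y s. det (frame_matrix L (X0 n) (y, s))) (\<lambda>s. det (A s))"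
    by (rule approx_class_det[OF entries_close(1)[OF A c X0(1) lim0]])
  from param_class_unif[OF approx_class_D(1)[OF this] c(1) e(1)] obtain N where N: "\<And>n y s. n \<ge> N \<Longrightarrow> s \<in> ?I \<Longrightarrow> \<bar>det (frame_matrix L (X0 n) (y, s)) - det (A s)\<bar> < e"
    unfolding eventually_sequentially by blast
  have dete: "e \<le> \<bar>det (frame_matrix L (X0 n) (y, s))\<bar>" if "n \<ge> N" "s \<in> ?I" for n y s
    using N[OF that, of y] e(2)[OF that(2)] by linarith
  have detA: "e \<le> \<bar>det (A s)\<bar>" if "s \<in> ?I" for s using e(2)[OF that] e(1) by linarith
  \<comment> \<open>Dropping the first N families makes the bound on the determinant hold for every
    n, as \<open>frame_close\<close> requires.\<close>
  define X1 where "X1 n = X0 (n + N)" for n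
  have X1: "close_commuting_family L \<epsilon> k (horizontal_family A) (1 / (real (n + N) + 1)) (X1 n)" for n
    unfolding X1_def by (rule X0(1))
  have lim1: "(\<lambda>n. 1 / (real (n + N) + 1)) \<longlonglongrightarrow> 0" using LIMSEQ_ignore_initial_segment[OF lim0, of N] by simp
  have det1: "e \<le> \<bar>det (frame_matrix L (X1 n) (y, s))\<bar>" if "s \<in> ?I" for n y s unfolding X1_def using dete that by simp
  have det1': "det (frame_matrix L (X1 n) (y, s)) \<noteq> 0" if "s \<in> ?I" for n y s using det1[OF that, of n y] e(1) by auto
  note fc = frame_close[OF A c X1 lim1 e(1) detA det1]
  have sm: "smooth_vfield L \<epsilon> (X1 n j)" "vfields_commute L \<epsilon> (X1 n i) (X1 n j)" for n i j
    using X1[of n] by (auto simp: close_commuting_family_def)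
  have sd: "slope L (X1 n) differentiable (at (y, s))" if "s \<in> ?I" for n y s
    using Ck_on_derivD[OF slope_Ck[OF sm(1) c(2) det1', where m="Suc 0"], of "(y, s)" n] that unfolding differentiable_def by auto
  define P where "P = matrix_inv (A 0)"
  have A0: "P ** A 0 = mat 1" "A 0 ** P = mat 1" using matrix_inv_inverse[OF inv[of 0]] \<epsilon> by (auto simp: P_def)
  have bA: "bounded_linear (\<lambda>v. A 0 *v v)" by (rule matrix_vector_mul_bounded_linear)
  \<comment> \<open>The tolerance for \<open>perturbed_linear_inverse\<close>, applied with P =
    A(0)^-1 and P' = A(0): half the reciprocal of the norm of A(0), with 1 added to avoid division
    by 0.\<close>
  define \<kappa> where "\<kappa> = 1 / (2 * (onorm (\<lambda>v. A 0 *v v) + 1))"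
  have on0: "onorm (\<lambda>v. A 0 *v v) + 1 > 0" using onorm_pos_le[OF bA] by linarith
  have \<kappa>: "\<kappa> > 0" using on0 by (simp add: \<kappa>_def)
  have \<kappa>A: "\<kappa> * norm (A 0 *v v) \<le> norm v / 2" for v
  proof -
    have "norm (A 0 *v v) \<le> (onorm (\<lambda>v. A 0 *v v) + 1) * norm v"
      using onorm[OF bA, of v] by (simp add: distrib_right add_increasing2)
    then have "\<kappa> * norm (A 0 *v v) \<le> \<kappa> * ((onorm (\<lambda>v. A 0 *v v) + 1) * norm v)" using \<kappa> by (intro mult_left_mono) auto
    also have "\<dots> = norm v / 2" using on0 by (simp add: \<kappa>_def field_simps)
    finally show ?thesis .
  qed
  define N2 where "N2 = real CARD('n) * real CARD('n)"
  have N2: "N2 > 0" by (simp add: N2_def)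
  \<comment> \<open>Entrywise tolerance that gives \<open>\<kappa>\<close> for the operator by
    \<open>matrix_norm_bound\<close>. One half is spent on the perturbation of the coframe, the
    other on the variation of A^-1 with the height.\<close>
  define \<mu> where "\<mu> = \<kappa> / N2"
  have \<mu>: "\<mu> > 0" using \<kappa> N2 by (simp add: \<mu>_def)
  have "\<exists>\<eta>>0. \<forall>s. \<bar>s\<bar> \<le> \<eta> \<longrightarrow> (\<forall>q i. \<bar>matrix_inv (A s) $ q $ i - P $ q $ i\<bar> \<le> \<mu> / 2)"
  proof -
    have "\<forall>\<^sub>F s in nhds 0. dist (matrix_inv (A s) $ q $ i) (P $ q $ i) < \<mu> / 2" for q i
    proof -
      have "continuous_on ?S (\<lambda>s. matrix_inv (A s) $ q $ i)" using WCk[of 0] by simp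
      then have "isCont (\<lambda>s. matrix_inv (A s) $ q $ i) 0" using \<epsilon> by (simp add: continuous_on_eq_continuous_at)
      then have "((\<lambda>s. matrix_inv (A s) $ q $ i) \<longlongrightarrow> P $ q $ i) (nhds 0)"
        unfolding P_def isCont_def using tendsto_at_iff_tendsto_nhds[of "\<lambda>s. matrix_inv (A s) $ q $ i" 0] by blast
      from tendstoD[OF this, of "\<mu> / 2"] show ?thesis using \<mu> by simp
    qed
    then have "\<forall>\<^sub>F s in nhds 0. \<forall>q i. dist (matrix_inv (A s) $ q $ i) (P $ q $ i) < \<mu> / 2" by (intro eventually_all_finite)
    then obtain \<eta> where "\<eta> > 0" "\<And>s. dist s 0 < \<eta> \<Longrightarrow> \<forall>q i. dist (matrix_inv (A s) $ q $ i) (P $ q $ i) < \<mu> / 2"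
      unfolding eventually_nhds_metric by blast
    then show ?thesis by (intro exI[of _ "\<eta> / 2"]) (auto simp: dist_real_def less_imp_le)
  qed
  then obtain \<eta> where \<eta>: "\<eta> > 0" "\<And>s q i. \<bar>s\<bar> \<le> \<eta> \<Longrightarrow> \<bar>matrix_inv (A s) $ q $ i - P $ q $ i\<bar> \<le> \<mu> / 2" by blast
  \<comment> \<open>The radii exceed the 4 D needed by \<open>periodic_extension\<close> and tend to
    infinity.\<close>
  define R where "R m = 4 * D + 1 + real m" for m
  have R: "4 * D < R m" "R m > 0" for m using D0 by (auto simp: R_def)
  define q0 where "q0 = min (c / 2) (min (1 / 2) \<eta>)"
  have q0: "q0 > 0" "q0 \<le> c / 2" "q0 \<le> 1 / 2" "q0 \<le> \<eta>" using c \<eta> by (auto simp: q0_def)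
  \<comment> \<open>Chosen so that \<open>d m * R m\<close> = q0 / (m + 1): the leaves live on
    growing balls while their heights tend to 0.\<close>
  define d where "d m = q0 / ((real m + 1) * R m)" for m
  have d: "d m > 0" for m unfolding d_def using q0(1) R(2)[of m] by (intro divide_pos_pos mult_pos_pos) auto
  have dR: "d m * R m = q0 / (real m + 1)" for m using R(2)[of m] by (simp add: d_def)
  have dR': "d m * R m \<le> q0" for m unfolding dR using q0(1) by (simp add: divide_le_eq)
  define P0 where "P0 n y F \<Phi> m \<longleftrightarrow> F 0 = 0 \<and> (\<forall>x\<in>ball 0 (R m). (F has_derivative (\<lambda>h. slope L (X1 n) (y + x, F x) \<bullet> h)) (at x) \<and> \<bar>F x\<bar> \<le> d m * R m \<and> F x \<in> ?I \<and>
     (\<forall>k. (\<Phi> k has_derivative (\<lambda>h. coframe L (X1 n) k (y + x, F x) \<bullet> h)) (at x))) \<and> (\<exists>i. F (?e i) \<noteq> 0)" for n y F and \<Phi> :: "'n \<Rightarrow> real^'n \<Rightarrow> real" and m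
  \<comment> \<open>For the radius \<open>R m\<close> a sufficiently close family is taken from the
    sequence; n >= m ensures that the closeness still tends to 0 after reindexing.\<close>
  have "\<forall>m. \<exists>n y F \<Phi>. n \<ge> m \<and> P0 n y F \<Phi> m"
  proof
    fix m
    have \<mu>2: "\<mu> / 2 > 0" using \<mu> by simp
    have "\<forall>\<^sub>F n in sequentially. \<forall>q i. \<forall>y. \<forall>s\<in>?I. \<bar>coframe L (X1 n) q (y, s) $ i - matrix_inv (A s) $ q $ i\<bar> < \<mu> / 2"
      by (intro eventually_all_finite param_class_unif[OF approx_class_D(1)[OF fc(1)] c(1) \<mu>2])
    then have "\<forall>\<^sub>F n in sequentially. n \<ge> m \<and> (\<forall>y. \<forall>s\<in>?I. norm (slope L (X1 n) (y, s)) \<le> d m \<and> norm (partial_deriv (0, 1) (slope L (X1 n)) (y, s)) \<le> d m)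
       \<and> (\<forall>q i. \<forall>y. \<forall>s\<in>?I. \<bar>coframe L (X1 n) q (y, s) $ i - matrix_inv (A s) $ q $ i\<bar> < \<mu> / 2)"
      by (intro eventually_conj eventually_ge_at_top slope_bounds[OF fc(2) k c(1) d sd]) auto
    then have "\<exists>n. n \<ge> m \<and> (\<forall>y. \<forall>s\<in>?I. norm (slope L (X1 n) (y, s)) \<le> d m \<and> norm (partial_deriv (0, 1) (slope L (X1 n)) (y, s)) \<le> d m)
       \<and> (\<forall>q i. \<forall>y. \<forall>s\<in>?I. \<bar>coframe L (X1 n) q (y, s) $ i - matrix_inv (A s) $ q $ i\<bar> < \<mu> / 2)"
      by (rule eventually_happens'[OF sequentially_bot])
    then obtain n where n': "n \<ge> m" "\<forall>y. \<forall>s\<in>?I. norm (slope L (X1 n) (y, s)) \<le> d m \<and> norm (partial_deriv (0, 1) (slope L (X1 n)) (y, s)) \<le> d m"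
       "\<forall>q i. \<forall>y. \<forall>s\<in>?I. \<bar>coframe L (X1 n) q (y, s) $ i - matrix_inv (A s) $ q $ i\<bar> < \<mu> / 2"
      by (elim exE conjE) (rule that; assumption)
    have n: "n \<ge> m" "\<And>y s. s \<in> ?I \<Longrightarrow> norm (slope L (X1 n) (y, s)) \<le> d m" "\<And>y s. s \<in> ?I \<Longrightarrow> norm (partial_deriv (0, 1) (slope L (X1 n)) (y, s)) \<le> d m"
       "\<And>q i y s. s \<in> ?I \<Longrightarrow> \<bar>coframe L (X1 n) q (y, s) $ i - matrix_inv (A s) $ q $ i\<bar> < \<mu> / 2"
      using n'(1) n'(2)[rule_format, THEN conjunct1] n'(2)[rule_format, THEN conjunct2] n'(3)[rule_format] by blast+
    have "\<exists>F \<Phi>. F 0 = 0 \<and> (\<forall>x\<in>ball 0 (R m). (F has_derivative (\<lambda>h. slope L (X1 n) (y0 (n + N) + x, F x) \<bullet> h)) (at x) \<and> \<bar>F x\<bar> \<le> d m * R m \<and> F x \<in> ?I \<and>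
     (\<forall>k. (\<Phi> k has_derivative (\<lambda>h. coframe L (X1 n) k (y0 (n + N) + x, F x) \<bullet> h)) (at x))) \<and> (\<exists>i. F (?e i) \<noteq> 0)"
    proof (rule one_step[OF B c sm det1' R(1)[of m, unfolded D_def] n(2,3) _ _ _ _ A0 \<kappa>A])
      show "d m * R m \<le> c / 2" "d m * R m \<le> 1 / 2" "d m * R m \<le> \<eta>" using dR'[of m] q0 by linarith+
      show "norm ((\<chi> k. coframe L (X1 n) k (y, s) \<bullet> v) - P *v v) \<le> \<kappa> * norm v" if s: "s \<in> ?I" "\<bar>s\<bar> \<le> \<eta>" for y s v
      proof -
        define M where "M = (\<chi> k. coframe L (X1 n) k (y, s)) - P"
        have "\<bar>M $ q $ i\<bar> \<le> \<mu>" for q i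
          using n(4)[OF s(1), of q y i] \<eta>(2)[OF s(2), of q i] unfolding M_def vector_minus_component vec_lambda_beta by linarith
        from matrix_norm_bound[of M, OF this, of v] have "norm (M *v v) \<le> \<kappa> * norm v"
          using N2 by (simp add: \<mu>_def N2_def[symmetric])
        moreover have "(\<chi> k. coframe L (X1 n) k (y, s) \<bullet> v) = (\<chi> k. coframe L (X1 n) k (y, s)) *v v" by (simp add: vec_eq_iff matrix_vector_mul_component)
        ultimately show ?thesis by (simp add: M_def matrix_vector_mult_diff_rdistrib)
      qed
      show "\<kappa> \<ge> 0" using \<kappa> by simp
      show "\<not> compactin (M_topology L \<epsilon>) (orbit L \<epsilon> (X1 n) (torus_proj L (y0 (n + N)), 0))" unfolding X1_def by (rule X0(2))
    qed
    then show "\<exists>n y F \<Phi>. n \<ge> m \<and> P0 n y F \<Phi> m" using n(1) unfolding P0_def by blast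
  qed
  then obtain \<sigma> y1 F1 \<Phi>1 where P1: "\<And>m. \<sigma> m \<ge> m" "\<And>m. P0 (\<sigma> m) (y1 m) (F1 m) (\<Phi>1 m) m" by metis
  have "\<And>m. \<exists>i. F1 m (?e i) \<noteq> 0" using P1(2) by (simp add: P0_def)
  from diagonal_ratio_subsequence[of "\<lambda>m i. F1 m (?e i)", OF this]
  obtain l \<tau> r where \<tau>: "strict_mono (\<tau> :: nat \<Rightarrow> nat)" "\<And>n. F1 (\<tau> n) (?e l) \<noteq> 0" "\<And>i. (\<lambda>n. F1 (\<tau> n) (?e i) / F1 (\<tau> n) (?e l)) \<longlonglongrightarrow> r i" by blast
  define X where "X n = X1 (\<sigma> (\<tau> n))" for n
  define y where "y n = y1 (\<tau> n)" for n
  define F where "F n = F1 (\<tau> n)" for n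
  define \<Phi> where "\<Phi> n = \<Phi>1 (\<tau> n)" for n
  have P2: "F n 0 = 0" "\<And>x. x \<in> ball 0 (R (\<tau> n)) \<Longrightarrow> (F n has_derivative (\<lambda>h. slope L (X n) (y n + x, F n x) \<bullet> h)) (at x)"
    "\<And>x. x \<in> ball 0 (R (\<tau> n)) \<Longrightarrow> \<bar>F n x\<bar> \<le> d (\<tau> n) * R (\<tau> n)"
    "\<And>x k. x \<in> ball 0 (R (\<tau> n)) \<Longrightarrow> (\<Phi> n k has_derivative (\<lambda>h. coframe L (X n) k (y n + x, F n x) \<bullet> h)) (at x)" for n
    using P1(2)[of "\<tau> n"] unfolding P0_def F_def X_def y_def \<Phi>_def by blast+
  have \<tau>n: "n \<le> \<tau> n" for n using \<tau>(1) by (rule strict_mono_imp_increasing)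
  have ball: "x \<in> ball 0 (R (\<tau> n))" if "x \<in> ball 0 \<rho>" "\<rho> \<le> real n" for x n \<rho>
    using that \<tau>n[of n] D0 by (auto simp: R_def)
  have evn: "\<forall>\<^sub>F n in sequentially. \<rho> \<le> real n" for \<rho>
    by (rule eventually_mono[OF eventually_ge_at_top[of "nat \<lceil>\<rho>\<rceil>"]]) linarith
  define \<delta> where "\<delta> n = 1 / (real (\<sigma> (\<tau> n) + N) + 1)" for n
  have X: "close_commuting_family L \<epsilon> k (horizontal_family A) (\<delta> n) (X n)" for n unfolding X_def \<delta>_def by (rule X1)
  have lim: "\<delta> \<longlonglongrightarrow> 0"
  proof (rule tendsto_sandwich[OF _ _ tendsto_const lim0])
    show "\<forall>\<^sub>F n in sequentially. 0 \<le> \<delta> n" by (simp add: \<delta>_def)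
    have "\<delta> n \<le> 1 / (real n + 1)" for n
    proof -
      have "n \<le> \<sigma> (\<tau> n) + N" using \<tau>n[of n] P1(1)[of "\<tau> n"] by linarith
      then show ?thesis unfolding \<delta>_def by (intro divide_left_mono mult_pos_pos) auto
    qed
    then show "\<forall>\<^sub>F n in sequentially. \<delta> n \<le> 1 / (real n + 1)" by simp
  qed
  have detX: "e \<le> \<bar>det (frame_matrix L (X n) (y, s))\<bar>" if "s \<in> ?I" for n y s unfolding X_def by (rule det1[OF that])
  note fcX = frame_close[OF A c X lim e(1) detA detX]
  have perM: "M_proj L (x + p, s) = M_proj L (x, s)" if "p \<in> L" for x p s
    using torus_proj_eq(1)[OF L, of "x + p" x] torus_proj_eq(3)[OF L that] by (simp add: M_proj_def)
  have pers: "slope L (X n) (x + p, s) = slope L (X n) (x, s)" "coframe L (X n) q (x + p, s) = coframe L (X n) q (x, s)" if "p \<in> L" for n x p s q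
    using perM[OF that] by (simp_all add: slope_def coframe_def frame_matrix_def)
  \<comment> \<open>The subsequence, the index l and the ratios are already fixed, so the locale can
    be interpreted for each basis vector i and each row q with the same F.\<close>
  have key: "(deriv ^^ j) (\<lambda>s. matrix_inv (A s) $ q \<bullet> ?e i) 0 = r i * (deriv ^^ j) (\<lambda>s. matrix_inv (A s) $ q \<bullet> ?e l) 0" if j: "1 \<le> j" "j \<le> k" for q i j
  proof -
    interpret leaf_seq_form "?e l" "?e i" c k F "\<lambda>n x s. slope L (X n) (y n + x, s)" "r i" "\<lambda>n x s. coframe L (X n) q (y n + x, s)" "\<lambda>s. matrix_inv (A s) $ q" "\<lambda>n. \<Phi> n q"
    proof
      show "0 < c" "1 \<le> k" by (fact c k)+
      show "\<forall>\<^sub>F n in sequentially. \<forall>x\<in>ball 0 \<rho>. (F n has_derivative (\<lambda>h. slope L (X n) (y n + x, F n x) \<bullet> h)) (at x)" for \<rho>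
        using evn[of \<rho>] by eventually_elim (use P2(2) ball in blast)
      show "\<forall>\<^sub>F n in sequentially. \<forall>x\<in>ball 0 \<rho>. (\<Phi> n q has_derivative (\<lambda>h. coframe L (X n) q (y n + x, F n x) \<bullet> h)) (at x)" for \<rho>
        using evn[of \<rho>] by eventually_elim (use P2(4) ball in blast)
      show "\<forall>\<^sub>F n in sequentially. \<forall>x\<in>ball 0 \<rho>. \<bar>F n x\<bar> < e'" if e': "e' > 0" for e' \<rho> :: real
        using evn[of \<rho>] evn[of "q0 / e'"]
      proof eventually_elim
        case (elim n)
        have "d (\<tau> n) * R (\<tau> n) = q0 / (real (\<tau> n) + 1)" by (rule dR)
        also have "\<dots> \<le> q0 / (real n + 1)" using \<tau>n[of n] q0(1) by (intro divide_left_mono mult_pos_pos) auto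
        also have "\<dots> < e'"
        proof -
          have "q0 \<le> real n * e'" using elim(2) e' by (simp add: divide_le_eq)
          then have "q0 < (real n + 1) * e'" using e' by (simp add: distrib_right)
          then show ?thesis by (simp add: divide_less_eq mult.commute)
        qed
        finally show ?case using P2(3)[of _ n] ball elim(1) by (meson le_less_trans)
      qed
      show "F n 0 = 0" "F n (?e l) \<noteq> 0" for n using P2(1) \<tau>(2) by (auto simp: F_def)
      show "param_class c True k (\<lambda>n x s. slope L (X n) (y n + x, s) \<bullet> v n)" if "Bseq v" for v
        by (rule param_class_inner[OF param_class_shift[OF fcX(2)] that])
      show "slope L (X n) (y n + (x + ?e l), s) = slope L (X n) (y n + x, s)" "slope L (X n) (y n + (x + ?e i), s) = slope L (X n) (y n + x, s)" for n x s
        using pers(1)[OF eL] by (simp_all add: add.assoc[symmetric])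
      show "coframe L (X n) q (y n + (x + ?e l), s) = coframe L (X n) q (y n + x, s)" "coframe L (X n) q (y n + (x + ?e i), s) = coframe L (X n) q (y n + x, s)" for n x s
        using pers(2)[OF eL] by (simp_all add: add.assoc[symmetric])
      show "(\<lambda>n. F n (?e i) / F n (?e l)) \<longlonglongrightarrow> r i" using \<tau>(3) by (simp add: F_def)
      show "param_class c True k (\<lambda>n x s. (coframe L (X n) q (y n + x, s) - matrix_inv (A s) $ q) \<bullet> v)" for v
      proof -
        have "param_class c True k (\<lambda>n x s. (\<lambda>x s. (coframe L (X n) q (x, s) - matrix_inv (A s) $ q)) (y n + x) s $ i)" for i
          using param_class_shift[OF approx_class_D(1)[OF fcX(1)[of q i]], of y] by simp
        from param_class_inner[OF this, of "\<lambda>_. v"] show ?thesis by simp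
      qed
      show "param_class c False k (\<lambda>n (x::real^'n) s. matrix_inv (A s) $ q \<bullet> v)" for v
        using param_class_inner[of c False k "\<lambda>n (x::real^'n) s. matrix_inv (A s) $ q" "\<lambda>_. v", OF approx_class_D(2)[OF fcX(1)]] by simp
    qed
    show ?thesis by (rule flat_ratio[OF j])
  qed
  have "r l = 1"
  proof -
    have "(\<lambda>n. F1 (\<tau> n) (?e l) / F1 (\<tau> n) (?e l)) = (\<lambda>n. 1)" using \<tau>(2) by simp
    then have "(\<lambda>n. 1) \<longlonglongrightarrow> r l" using \<tau>(3)[of l] by simp
    then show ?thesis using LIMSEQ_unique tendsto_const by blast
  qed
  then have rl: "(\<chi> i. r i) $ l = 1" by simp
  have "(deriv ^^ j) (\<lambda>s. matrix_inv (A s) $ q \<bullet> (B *v axis i 1)) 0 = (\<chi> i. r i) $ i * (deriv ^^ j) (\<lambda>s. matrix_inv (A s) $ q \<bullet> (B *v axis l 1)) 0"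
    if "1 \<le> j" "j \<le> k" for q i j unfolding vec_lambda_beta by (rule key[OF that])
  from kernel_of_inverse_jets[OF _ _ ACk det0 B(1) this rl] show ?thesis using \<epsilon> by auto
qed

section \<open>Cutoff functions\<close>

text \<open>The factor x^-n makes the family closed under differentiation up to linear combinations
  (\<open>flat_exp_deriv\<close>); n = 0 is the standard flat function exp(-1/x).\<close>

definition flat_exp :: "nat \<Rightarrow> real \<Rightarrow> real" where
  "flat_exp n x = (if x \<le> 0 then 0 else inverse x ^ n * exp (- inverse x))"

lemma flat_exp_lim: "flat_exp n \<midarrow>0\<rightarrow> 0"
proof -
  have "((\<lambda>t::real. t ^ n / exp t) \<longlongrightarrow> 0) at_top" by (rule tendsto_power_div_exp_0)
  from filterlim_compose[OF this filterlim_inverse_at_top_right]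
  have "((\<lambda>x::real. inverse x ^ n / exp (inverse x)) \<longlongrightarrow> 0) (at_right 0)" .
  moreover have "\<forall>\<^sub>F x in at_right (0::real). inverse x ^ n / exp (inverse x) = flat_exp n x"
    by (rule eventually_at_rightI[of 0 1]) (auto simp: flat_exp_def exp_minus divide_inverse)
  ultimately have r: "(flat_exp n \<longlongrightarrow> 0) (at_right 0)" by (rule Lim_transform_eventually)
  have "\<forall>\<^sub>F x in at_left (0::real). 0 = flat_exp n x"
    by (rule eventually_at_leftI[of "-1"]) (auto simp: flat_exp_def)
  then have "(flat_exp n \<longlongrightarrow> 0) (at_left 0)" by (rule Lim_transform_eventually[OF tendsto_const])
  then show ?thesis using r by (simp add: filterlim_split_at)
qed

lemma flat_exp_deriv: "(flat_exp n has_real_derivative flat_exp (n + 2) x - real n * flat_exp (n + 1) x) (at x)"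
proof -
  consider "x < 0" | "x = 0" | "x > 0" by linarith
  then show ?thesis
  proof cases
    case 1
    have "((\<lambda>x. 0::real) has_real_derivative 0) (at x)" by simp
    then have "(flat_exp n has_real_derivative 0) (at x)"
      by (rule has_field_derivative_transform_within_open[where S="{..<0}"]) (use 1 in \<open>auto simp: flat_exp_def\<close>)
    then show ?thesis using 1 by (simp add: flat_exp_def)
  next
    case 2
    have "(flat_exp n h - flat_exp n 0) / h = flat_exp (n + 1) h" for h
      by (simp add: flat_exp_def divide_inverse mult_ac)
    then have "(flat_exp n has_real_derivative 0) (at 0)"
      unfolding has_field_derivative_iff using flat_exp_lim[of "n + 1"] by simp
    then show ?thesis using 2 by (simp add: flat_exp_def)
  next
    case 3
    have "((\<lambda>x. inverse x ^ n * exp (- inverse x)) has_real_derivative flat_exp (n + 2) x - real n * flat_exp (n + 1) x) (at x)"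
    proof -
      have "((\<lambda>x. inverse x ^ n * exp (- inverse x)) has_real_derivative
          real n * inverse x ^ (n - 1) * (- (inverse x ^ 2)) * exp (- inverse x) + inverse x ^ n * (exp (- inverse x) * inverse x ^ 2)) (at x)"
        using 3 by (auto intro!: derivative_eq_intros simp: power2_eq_square divide_inverse algebra_simps)
      moreover have "real n * inverse x ^ (n - 1) * (- (inverse x ^ 2)) * exp (- inverse x) + inverse x ^ n * (exp (- inverse x) * inverse x ^ 2)
          = flat_exp (n + 2) x - real n * flat_exp (n + 1) x"
        using 3 by (cases n) (auto simp: flat_exp_def power2_eq_square algebra_simps)
      ultimately show ?thesis by (simp only:)
    qed
    then show ?thesis
      by (rule has_field_derivative_transform_within_open[where S="{0<..}"]) (use 3 in \<open>auto simp: flat_exp_def\<close>)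
  qed
qed

lemma flat_exp_Ck: "Ck_on m (flat_exp n) UNIV"
proof (induction m arbitrary: n)
  case 0
  have "isCont (flat_exp n) x" for x by (rule DERIV_isCont[OF flat_exp_deriv])
  then show ?case by (simp add: continuous_at_imp_continuous_on)
next
  case (Suc m)
  show ?case
    by (rule Ck_on_realI[where D="\<lambda>x. flat_exp (n + 2) x - real n * flat_exp (n + 1) x"])
      (use flat_exp_deriv Suc in \<open>auto simp: has_real_derivative_iff_has_vector_derivative[symmetric] intro!: Ck_on_diff Ck_on_mult Ck_on_const\<close>)
qed

text \<open>The last bound follows from exp(1/x) >= 1/x. It is a Lipschitz estimate at 0, which
  later prevents curves from reaching the level where the vertical speed vanishes.\<close>

lemma flat_exp_0: "flat_exp 0 x > 0 \<longleftrightarrow> x > 0" "flat_exp 0 x \<ge> 0" "x \<le> 0 \<Longrightarrow> flat_exp 0 x = 0" "\<bar>flat_exp 0 x\<bar> \<le> \<bar>x\<bar>"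
proof -
  show "flat_exp 0 x > 0 \<longleftrightarrow> x > 0" "flat_exp 0 x \<ge> 0" "x \<le> 0 \<Longrightarrow> flat_exp 0 x = 0" by (auto simp: flat_exp_def)
  show "\<bar>flat_exp 0 x\<bar> \<le> \<bar>x\<bar>"
  proof (cases "x \<le> 0")
    case False
    then have "inverse x \<le> exp (inverse x)" using exp_ge_add_one_self[of "inverse x"] by linarith
    then have "exp (- inverse x) \<le> x" using False le_imp_inverse_le[of "inverse x" "exp (inverse x)"] by (simp add: exp_minus)
    then show ?thesis using False by (simp add: flat_exp_def)
  qed (simp add: flat_exp_def)
qed

text \<open>With u = 4/3 (1 - x^2), one has u >= 1 exactly for |x| <= 1/2 and u <= 0 exactly for |x|
  >= 1; the quotient is the usual smooth step from 0 to 1 in u.\<close>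

definition plateau :: "real \<Rightarrow> real" where
  "plateau x = (let u = 4 / 3 * (1 - x * x) in flat_exp 0 u * inverse (flat_exp 0 u + flat_exp 0 (1 - u)))"

lemma plateau_1: assumes "\<bar>x\<bar> \<le> 1 / 2" shows "plateau x = 1"
proof -
  have "x * x \<le> (1/2) * (1/2)" using assms by (metis abs_ge_zero abs_mult_self_eq mult_mono' )
  then have "1 - 4 / 3 * (1 - x * x) \<le> 0" "4 / 3 * (1 - x * x) > 0" by auto
  then show ?thesis using flat_exp_0(1)[of "4 / 3 * (1 - x * x)"] by (simp add: plateau_def Let_def flat_exp_0(3))
qed

lemma plateau_0: assumes "\<bar>x\<bar> \<ge> 1" shows "plateau x = 0"
proof -
  have "x * x \<ge> 1" using assms by (metis abs_mult_self_eq mult_mono' mult_1 zero_le_one)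
  then show ?thesis by (simp add: plateau_def Let_def flat_exp_0(3))
qed

lemma plateau_Ck: "Ck_on m plateau UNIV"
proof -
  have q: "Ck_on m (\<lambda>x::real. 4 / 3 * (1 - x * x)) UNIV"
    by (intro Ck_on_mult Ck_on_diff Ck_on_const Ck_on_linear[OF _ bounded_linear_ident]) auto
  have q': "Ck_on m (\<lambda>x::real. 1 - 4 / 3 * (1 - x * x)) UNIV" by (intro Ck_on_diff Ck_on_const q open_UNIV)
  have c: "Ck_on m (\<lambda>x. flat_exp 0 (4 / 3 * (1 - x * x))) UNIV" "Ck_on m (\<lambda>x. flat_exp 0 (1 - 4 / 3 * (1 - x * x))) UNIV"
    by (rule Ck_on_compose[OF open_UNIV subset_UNIV flat_exp_Ck q], rule Ck_on_compose[OF open_UNIV subset_UNIV flat_exp_Ck q'])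
  have "flat_exp 0 u + flat_exp 0 (1 - u) \<noteq> 0" for u
    using flat_exp_0(1)[of u] flat_exp_0(1)[of "1 - u"] flat_exp_0(2)[of u] flat_exp_0(2)[of "1 - u"] by (cases "u > 0") auto
  then show ?thesis unfolding plateau_def[abs_def] Let_def
    by (intro Ck_on_mult Ck_on_inverse Ck_on_add c) auto
qed

text \<open>
  Functions rescaled by \<open>r\<close>: each derivative loses one power of \<open>r\<close>.
\<close>

definition small_order :: "real \<Rightarrow> nat \<Rightarrow> real \<Rightarrow> (real \<Rightarrow> real \<Rightarrow> real) \<Rightarrow> bool" where
  "small_order r\<^sub>0 k p G \<longleftrightarrow> (\<forall>i\<le>k. \<exists>C. \<forall>r z. 0 < r \<and> r \<le> r\<^sub>0 \<and> \<bar>z\<bar> \<le> r \<longrightarrow> \<bar>(deriv ^^ i) (G r) z\<bar> \<le> C * r powr (p - real i))"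

lemma small_order_Suc:
  "small_order r\<^sub>0 (Suc k) p G \<longleftrightarrow> (\<exists>C. \<forall>r z. 0 < r \<and> r \<le> r\<^sub>0 \<and> \<bar>z\<bar> \<le> r \<longrightarrow> \<bar>G r z\<bar> \<le> C * r powr p) \<and> small_order r\<^sub>0 k (p - 1) (\<lambda>r. deriv (G r))"
proof -
  have "(\<forall>i\<le>Suc k. Q i) \<longleftrightarrow> Q 0 \<and> (\<forall>i\<le>k. Q (Suc i))" for Q by (metis Suc_le_mono le0 not0_implies_Suc)
  then show ?thesis unfolding small_order_def
    by (simp add: funpow_Suc_right algebra_simps del: funpow.simps(2))
qed

lemma small_order_0:
  "small_order r\<^sub>0 0 p G \<longleftrightarrow> (\<exists>C. \<forall>r z. 0 < r \<and> r \<le> r\<^sub>0 \<and> \<bar>z\<bar> \<le> r \<longrightarrow> \<bar>G r z\<bar> \<le> C * r powr p)"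
  by (simp add: small_order_def)

lemma small_order_mono: "small_order r\<^sub>0 k p G \<Longrightarrow> i \<le> k \<Longrightarrow> small_order r\<^sub>0 i p G" by (simp add: small_order_def)

lemma small_order_cong:
  assumes "open S" "{-r\<^sub>0..r\<^sub>0} \<subseteq> S" "\<And>r z. z \<in> S \<Longrightarrow> 0 < r \<Longrightarrow> r \<le> r\<^sub>0 \<Longrightarrow> F r z = G r z" "small_order r\<^sub>0 k p F"
  shows "small_order r\<^sub>0 k p G"
proof -
  have "(deriv ^^ i) (F r) z = (deriv ^^ i) (G r) z" if "0 < r \<and> r \<le> r\<^sub>0 \<and> \<bar>z\<bar> \<le> r" for i r z
    by (rule derivs_cong[OF assms(1) subsetD[OF assms(2)]]) (use assms(3) that in \<open>auto simp: abs_le_iff\<close>)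
  then show ?thesis using assms(4) unfolding small_order_def by fastforce
qed

lemma small_order_add:
  assumes S: "open S" "{-r\<^sub>0..r\<^sub>0} \<subseteq> S" and F: "\<And>r. Ck_on k (F r) S" "small_order r\<^sub>0 k p F" and G: "\<And>r. Ck_on k (G r) S" "small_order r\<^sub>0 k p G"
  shows "small_order r\<^sub>0 k p (\<lambda>r z. F r z + G r z)"
  unfolding small_order_def
proof (intro allI impI)
  fix i assume i: "i \<le> k"
  obtain C where C: "\<And>r z. 0 < r \<and> r \<le> r\<^sub>0 \<and> \<bar>z\<bar> \<le> r \<Longrightarrow> \<bar>(deriv ^^ i) (F r) z\<bar> \<le> C * r powr (p - real i)" using F(2) i unfolding small_order_def by blast
  obtain C' where C': "\<And>r z. 0 < r \<and> r \<le> r\<^sub>0 \<and> \<bar>z\<bar> \<le> r \<Longrightarrow> \<bar>(deriv ^^ i) (G r) z\<bar> \<le> C' * r powr (p - real i)" using G(2) i unfolding small_order_def by blast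
  have "\<bar>(deriv ^^ i) (\<lambda>z. F r z + G r z) z\<bar> \<le> (C + C') * r powr (p - real i)" if h: "0 < r \<and> r \<le> r\<^sub>0 \<and> \<bar>z\<bar> \<le> r" for r z
  proof -
    have "z \<in> S" using h subsetD[OF S(2), of z] by (simp add: abs_le_iff)
    from derivs_linear[OF S(1) this Ck_on_mono[OF F(1) i] Ck_on_mono[OF G(1) i], of 1 r 1 r]
    have "(deriv ^^ i) (\<lambda>z. F r z + G r z) z = (deriv ^^ i) (F r) z + (deriv ^^ i) (G r) z" by simp
    then show ?thesis using C[OF h] C'[OF h] by (simp add: distrib_right)
  qed
  then show "\<exists>C. \<forall>r z. 0 < r \<and> r \<le> r\<^sub>0 \<and> \<bar>z\<bar> \<le> r \<longrightarrow> \<bar>(deriv ^^ i) (\<lambda>z. F r z + G r z) z\<bar> \<le> C * r powr (p - real i)" by blast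
qed

lemma small_order_mult:
  assumes S: "open S" "{-r\<^sub>0..r\<^sub>0} \<subseteq> S" and "\<And>r. Ck_on k (F r) S" "small_order r\<^sub>0 k p F" "\<And>r. Ck_on k (G r) S" "small_order r\<^sub>0 k q G"
  shows "small_order r\<^sub>0 k (p + q) (\<lambda>r z. F r z * G r z)"
  using assms(3-)
proof (induction k arbitrary: F G p q)
  have base: "\<exists>C. \<forall>r z. 0 < r \<and> r \<le> r\<^sub>0 \<and> \<bar>z\<bar> \<le> r \<longrightarrow> \<bar>F r z * G r z\<bar> \<le> C * r powr (p + q)"
    if h: "small_order r\<^sub>0 0 p F" "small_order r\<^sub>0 0 q G" for F G p q
  proof -
    obtain C where C: "\<And>r z. 0 < r \<and> r \<le> r\<^sub>0 \<and> \<bar>z\<bar> \<le> r \<Longrightarrow> \<bar>F r z\<bar> \<le> C * r powr p" using h(1) unfolding small_order_0 by blast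
    obtain C' where C': "\<And>r z. 0 < r \<and> r \<le> r\<^sub>0 \<and> \<bar>z\<bar> \<le> r \<Longrightarrow> \<bar>G r z\<bar> \<le> C' * r powr q" using h(2) unfolding small_order_0 by blast
    have "\<bar>F r z * G r z\<bar> \<le> (C * C') * r powr (p + q)" if "0 < r \<and> r \<le> r\<^sub>0 \<and> \<bar>z\<bar> \<le> r" for r z
    proof -
      have "\<bar>F r z * G r z\<bar> \<le> (C * r powr p) * (C' * r powr q)" unfolding abs_mult
        using order_trans[OF abs_ge_zero C[OF that]] by (intro mult_mono C C' that) auto
      then show ?thesis by (simp add: powr_add algebra_simps)
    qed
    then show ?thesis by blast
  qed
  {
    case 0 then show ?case using base unfolding small_order_0 by blast
  next
    case (Suc k)
    have F: "Ck_on k (F r) S" "Ck_on k (deriv (F r)) S" and G: "Ck_on k (G r) S" "Ck_on k (deriv (G r)) S" for r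
      using Ck_on_SucD Ck_deriv(1)[OF S(1)] Suc.prems(1,3) by blast+
    have oF: "small_order r\<^sub>0 k p F" "small_order r\<^sub>0 k (p - 1) (\<lambda>r. deriv (F r))" "small_order r\<^sub>0 0 p F"
      and oG: "small_order r\<^sub>0 k q G" "small_order r\<^sub>0 k (q - 1) (\<lambda>r. deriv (G r))" "small_order r\<^sub>0 0 q G"
      using Suc.prems(2,4) small_order_mono[of r\<^sub>0 "Suc k"] unfolding small_order_Suc[of r\<^sub>0 k] by auto
    have "small_order r\<^sub>0 k ((p - 1) + q) (\<lambda>r z. deriv (F r) z * G r z)" by (rule Suc.IH[OF F(2) oF(2) G(1) oG(1)])
    moreover have "small_order r\<^sub>0 k (p + (q - 1)) (\<lambda>r z. F r z * deriv (G r) z)" by (rule Suc.IH[OF F(1) oF(1) G(2) oG(2)])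
    moreover have "(p - 1) + q = p + q - 1" "p + (q - 1) = p + q - 1" by auto
    ultimately have "small_order r\<^sub>0 k (p + q - 1) (\<lambda>r z. deriv (F r) z * G r z + F r z * deriv (G r) z)"
      by (intro small_order_add[OF S] Ck_on_mult S F G) auto
    then have "small_order r\<^sub>0 k (p + q - 1) (\<lambda>r. deriv (\<lambda>z. F r z * G r z))"
    proof (rule small_order_cong[OF S, rotated])
      fix r z assume z: "z \<in> S"
      have "((\<lambda>z. F r z * G r z) has_real_derivative deriv (F r) z * G r z + F r z * deriv (G r) z) (at z)"
        by (auto intro!: derivative_eq_intros Ck_deriv(2)[OF S(1) Suc.prems(1) z] Ck_deriv(2)[OF S(1) Suc.prems(3) z])
      then show "deriv (F r) z * G r z + F r z * deriv (G r) z = deriv (\<lambda>z. F r z * G r z) z" by (rule DERIV_imp_deriv[symmetric])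
    qed
    then show ?case unfolding small_order_Suc using base[OF oF(3) oG(3)] by blast
  }
qed

text \<open>The prefactor makes the statement stable under differentiation, which replaces p by p -
  1 and f by its derivative.\<close>

lemma small_order_scaled:
  assumes "\<And>m. Ck_on m f UNIV" shows "small_order r\<^sub>0 k p (\<lambda>r z. r powr p * f (z / r))"
  using assms
proof (induction k arbitrary: p f)
  have base: "\<exists>C. \<forall>r z. 0 < r \<and> r \<le> r\<^sub>0 \<and> \<bar>z\<bar> \<le> r \<longrightarrow> \<bar>r powr p * f (z / r)\<bar> \<le> C * r powr p" if "\<And>m. Ck_on m f UNIV" for p and f :: "real \<Rightarrow> real"
  proof -
    have "continuous_on {-1..1} f" using that[of 0] continuous_on_subset by auto
    then have "bounded (f ` {-1..1})" by (intro compact_imp_bounded compact_continuous_image) auto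
    then obtain C where C: "\<And>x. x \<in> {-1..1} \<Longrightarrow> \<bar>f x\<bar> \<le> C" unfolding bounded_iff by (metis image_eqI real_norm_def)
    have "\<bar>r powr p * f (z / r)\<bar> \<le> C * r powr p" if "0 < r \<and> r \<le> r\<^sub>0 \<and> \<bar>z\<bar> \<le> r" for r z
    proof -
      have "z / r \<in> {-1..1}" using that by (auto simp: divide_le_eq le_divide_eq)
      from mult_left_mono[OF C[OF this], of "r powr p"] show ?thesis by (simp add: abs_mult mult.commute)
    qed
    then show ?thesis by blast
  qed
  {
    case 0 then show ?case using base unfolding small_order_0 by blast
  next
    case (Suc k)
    have "small_order r\<^sub>0 k (p - 1) (\<lambda>r z. r powr (p - 1) * deriv f (z / r))"
      by (rule Suc.IH) (rule Ck_deriv(1)[OF open_UNIV Suc.prems])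
    then have "small_order r\<^sub>0 k (p - 1) (\<lambda>r. deriv (\<lambda>z. r powr p * f (z / r)))"
    proof (rule small_order_cong[OF open_UNIV subset_UNIV, rotated])
      fix r z :: real assume r: "0 < r"
      have d: "(f has_real_derivative deriv f (z / r)) (at (z / r))" by (rule Ck_deriv(2)[OF open_UNIV Suc.prems]) simp
      have "((\<lambda>z. f (z / r)) has_real_derivative deriv f (z / r) * (1 / r)) (at z)"
        by (rule DERIV_chain2[where f=f and g="\<lambda>z. z / r", OF d]) (use r in \<open>auto intro!: derivative_eq_intros\<close>)
      from DERIV_cmult[OF this, of "r powr p"]
      have "((\<lambda>z. r powr p * f (z / r)) has_real_derivative r powr (p - 1) * deriv f (z / r)) (at z)"
        using r by (simp add: powr_diff)
      then show "r powr (p - 1) * deriv f (z / r) = deriv (\<lambda>z. r powr p * f (z / r)) z" by (rule DERIV_imp_deriv[symmetric])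
    qed
    then show ?case unfolding small_order_Suc using base[OF Suc.prems] by blast
  }
qed

text \<open>A function with vanishing k-jet is O(r^(k+1)) on [-r, r]: the mean value theorem applied
  to the bound for the derivative raises the exponent by one at each step.\<close>

lemma small_order_flat:
  assumes S: "open S" "{-r\<^sub>0..r\<^sub>0} \<subseteq> S" "r\<^sub>0 > 0" and B: "\<And>m. Ck_on m B S" "flat k B"
  shows "small_order r\<^sub>0 k (real k + 1) (\<lambda>r. B)"
  using B
proof (induction k arbitrary: B)
  have mvt: "\<bar>B z\<bar> \<le> C * \<bar>z\<bar>" if B: "\<And>m. Ck_on m B S" "B 0 = 0" and r: "0 < r" "r \<le> r\<^sub>0" "\<bar>z\<bar> \<le> r" and C: "\<And>x. \<bar>x\<bar> \<le> r \<Longrightarrow> \<bar>deriv B x\<bar> \<le> C" for B z r C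
  proof -
    have "norm (B z - B 0) \<le> C * norm (z - 0)"
    proof (rule field_differentiable_bound[of "{-r..r}" B "deriv B"])
      show "(B has_real_derivative deriv B x) (at x within {-r..r})" if "x \<in> {-r..r}" for x
        by (rule has_field_derivative_at_within[OF Ck_deriv(2)[OF S(1) B(1)]]) (use that r S(2) in auto)
    qed (use r C in auto)
    then show ?thesis using B(2) by simp
  qed
  {
    case 0
    have B0: "B 0 = 0" using 0(2) by (simp add: flat_def)
    have "continuous_on {-r\<^sub>0..r\<^sub>0} (deriv B)" using Ck_deriv(1)[OF S(1) 0(1)[of "Suc 0"]] S(2) continuous_on_subset by auto
    then have "bounded (deriv B ` {-r\<^sub>0..r\<^sub>0})" by (intro compact_imp_bounded compact_continuous_image) auto
    then obtain C where C: "\<And>x. x \<in> {-r\<^sub>0..r\<^sub>0} \<Longrightarrow> \<bar>deriv B x\<bar> \<le> C" unfolding bounded_iff by (metis image_eqI real_norm_def)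
    have C0: "C \<ge> 0" using C[of 0] S(3) by auto
    have "\<bar>B z\<bar> \<le> C * r powr 1" if "0 < r \<and> r \<le> r\<^sub>0 \<and> \<bar>z\<bar> \<le> r" for r z
    proof -
      have "\<bar>B z\<bar> \<le> C * \<bar>z\<bar>" by (rule mvt[OF 0(1) B0, of r]) (use that C in \<open>auto simp: abs_le_iff\<close>)
      also have "\<dots> \<le> C * r" using that C0 by (intro mult_left_mono) auto
      finally show ?thesis using that by simp
    qed
    then show ?case unfolding small_order_0 by auto
  next
    case (Suc k)
    have fl: "B 0 = 0" "flat k (deriv B)" using Suc.prems(2) by (auto simp: flat_Suc)
    have so: "small_order r\<^sub>0 k (real k + 1) (\<lambda>r. deriv B)"
      by (rule Suc.IH[OF _ fl(2)]) (rule Ck_deriv(1)[OF S(1) Suc.prems(1)])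
    then obtain C where C: "\<And>r z. 0 < r \<and> r \<le> r\<^sub>0 \<and> \<bar>z\<bar> \<le> r \<Longrightarrow> \<bar>deriv B z\<bar> \<le> C * r powr (real k + 1)"
      using small_order_mono[of r\<^sub>0 k _ _ 0] unfolding small_order_0 by blast
    have "\<bar>B z\<bar> \<le> C * r powr (real k + 2)" if h: "0 < r \<and> r \<le> r\<^sub>0 \<and> \<bar>z\<bar> \<le> r" for r z
    proof -
      have C0: "C * r powr (real k + 1) \<ge> 0" using C[OF h] by linarith
      have "\<bar>B z\<bar> \<le> (C * r powr (real k + 1)) * \<bar>z\<bar>" by (rule mvt[OF Suc.prems(1) fl(1), of r]) (use h C in auto)
      also have "\<dots> \<le> (C * r powr (real k + 1)) * r" using h C0 by (intro mult_left_mono) auto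
      also have "\<dots> = C * (r powr (real k + 1) * r powr 1)" using h by simp
      also have "\<dots> = C * r powr (real k + 2)" by (simp only: powr_add[symmetric] add.assoc one_add_one)
      finally show ?thesis .
    qed
    then show ?case unfolding small_order_Suc using so by (auto simp: algebra_simps)
  }
qed

section \<open>Homogeneous perturbations\<close>

text \<open>A horizontal derivative kills a function of z alone, so only lists of pure z-derivatives
  contribute.\<close>

lemma iter_partial_snd:
  fixes \<phi> :: "real \<Rightarrow> real"
  assumes \<phi>: "\<And>m. Ck_on m \<phi> {-\<epsilon><..<\<epsilon>}" and bs: "set bs \<subseteq> Basis" and p: "p \<in> (M_cover \<epsilon> :: ((real^'n) \<times> real) set)"
  shows "iter_partial bs (\<lambda>q. \<phi> (snd q)) p = (if set bs \<subseteq> {(0, 1)} then (deriv ^^ length bs) \<phi> (snd p) else 0)"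
  using bs p
proof (induction bs arbitrary: p)
  case (Cons b bs)
  have o: "open (M_cover \<epsilon> :: ((real^'n) \<times> real) set)" by (simp add: M_cover_def open_Times)
  have p: "snd p \<in> {-\<epsilon><..<\<epsilon>}" using Cons.prems(2) by (auto simp: M_cover_def)
  have D: "Ck_on m ((deriv ^^ i) \<phi>) {-\<epsilon><..<\<epsilon>}" for m i
  proof (induction i arbitrary: m)
    case (Suc i) show ?case using Ck_deriv(1)[OF open_greaterThanLessThan Suc[of "Suc m"]] by simp
  qed (simp add: \<phi>)
  have b: "b = (0, 1) \<or> snd b = 0" using Cons.prems(1) by (auto simp: Basis_prod_def)
  show ?case
  proof (cases "set bs \<subseteq> {(0, 1)}")
    case True
    let ?g = "(deriv ^^ length bs) \<phi>"
    have "(?g has_derivative (*) (deriv ?g (snd p))) (at (snd p))"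
      using Ck_deriv(2)[OF open_greaterThanLessThan D p] by (simp add: has_field_derivative_def)
    from has_derivative_compose[OF bounded_linear_imp_has_derivative[OF bounded_linear_snd] this]
    have d: "((\<lambda>q. ?g (snd q)) has_derivative (\<lambda>h. deriv ?g (snd p) * snd h)) (at p)" by simp
    have "iter_partial (b # bs) (\<lambda>q. \<phi> (snd q)) p = partial_deriv b (\<lambda>q. ?g (snd q)) p"
      unfolding iter_partial.simps
      by (rule partial_deriv_cong[OF o Cons.prems(2), symmetric])
        (use Cons.IH Cons.prems(1) True differentiableI[OF d] in auto)
    also have "\<dots> = deriv ?g (snd p) * snd b" by (rule partial_deriv_eq[OF d])
    finally show ?thesis using True b by auto
  next
    case False
    have "iter_partial (b # bs) (\<lambda>q. \<phi> (snd q)) p = partial_deriv b (\<lambda>q. 0) p"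
      unfolding iter_partial.simps
      by (rule partial_deriv_cong[OF o Cons.prems(2), symmetric])
        (use Cons.IH Cons.prems(1) False in auto)
    also have "\<dots> = 0" by (rule partial_deriv_eq) simp
    finally show ?thesis using False by auto
  qed
qed simp

lemma Ck_norm_le:
  fixes a :: "real \<Rightarrow> (real^'n) \<times> real"
  assumes a: "\<And>m b. b \<in> Basis \<Longrightarrow> Ck_on m (\<lambda>z. a z \<bullet> b) {-\<epsilon><..<\<epsilon>}"
    and e: "e \<ge> 0" "\<And>b i z. b \<in> Basis \<Longrightarrow> i \<le> k \<Longrightarrow> z \<in> {-\<epsilon><..<\<epsilon>} \<Longrightarrow> \<bar>(deriv ^^ i) (\<lambda>z. a z \<bullet> b) z\<bar> \<le> e"
  shows "Ck_norm L \<epsilon> k (\<lambda>p. a (snd p)) \<le> ereal e"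
  unfolding Ck_norm_def
proof (rule Sup_least, clarify)
  fix bs and c p :: "(real^'n) \<times> real"
  assume h: "length bs \<le> k" "set bs \<subseteq> (Basis :: ((real^'n) \<times> real) set)" "c \<in> Basis" "p \<in> M_cover \<epsilon>"
  have "snd p \<in> {-\<epsilon><..<\<epsilon>}" using h(4) by (auto simp: M_cover_def)
  moreover have "(\<lambda>q. a (snd (M_proj L q)) \<bullet> c) = (\<lambda>q. a (snd q) \<bullet> c)" by (auto simp: M_proj_def)
  ultimately show "ereal \<bar>iter_partial bs (\<lambda>q. a (snd (M_proj L q)) \<bullet> c) p\<bar> \<le> ereal e"
    using iter_partial_snd[of "\<lambda>z. a z \<bullet> c", OF a[OF h(3)] h(2,4)] e(2)[OF h(3,1)] e(1) by simp
qed

text \<open>The cutoff at scale r has order 0 and B has order k + 1, so the i-th derivative of the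
  product is O(r^(k+1-i)), with exponent at least 1 for i <= k. For |z| > r the product vanishes
  near z.\<close>

lemma cutoff_small:
  assumes \<epsilon>: "\<epsilon> > 0" and B: "\<And>m. Ck_on m B {-\<epsilon><..<\<epsilon>}" "flat k B" and e: "e > 0"
  shows "\<forall>\<^sub>F r in at_right 0. \<forall>i\<in>{..k}. \<forall>z\<in>{-\<epsilon><..<\<epsilon>}. \<bar>(deriv ^^ i) (\<lambda>z. plateau (z / r) * B z) z\<bar> \<le> e"
proof (rule eventually_ball_finite, simp, rule ballI)
  let ?S = "{-\<epsilon><..<\<epsilon>}"
  fix i assume i: "i \<in> {..k}"
  \<comment> \<open>The bound 1 allows the exponent to be lowered to 1; half of
    \<open>\<epsilon>\<close> keeps the scale inside the domain.\<close>
  define r0 where "r0 = min 1 (\<epsilon> / 2)"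
  have r0: "r0 > 0" "r0 \<le> 1" "r0 < \<epsilon>" using \<epsilon> by (auto simp: r0_def)
  have S: "open ?S" "{-r0..r0} \<subseteq> ?S" using r0 by auto
  have sc: "Ck_on m (\<lambda>z. r powr 0 * plateau (z / r)) ?S" for m r
    by (intro Ck_on_mult Ck_on_const S Ck_on_compose[OF S(1) subset_UNIV plateau_Ck] Ck_on_linear bounded_linear_divide)
  have "small_order r0 k (0 + (real k + 1)) (\<lambda>r z. (r powr 0 * plateau (z / r)) * B z)"
    by (rule small_order_mult[OF S sc small_order_scaled[OF plateau_Ck] B(1) small_order_flat[OF S r0(1) B]])
  then obtain C where C: "\<And>r z. 0 < r \<and> r \<le> r0 \<and> \<bar>z\<bar> \<le> r \<Longrightarrow> \<bar>(deriv ^^ i) (\<lambda>z. (r powr 0 * plateau (z / r)) * B z) z\<bar> \<le> C * r powr (0 + (real k + 1) - real i)"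
    using i unfolding small_order_def atMost_iff by blast
  define R where "R = min r0 (e / (\<bar>C\<bar> + 1))"
  have R: "R > 0" using r0 e by (auto simp: R_def)
  have "\<bar>(deriv ^^ i) (\<lambda>z. plateau (z / r) * B z) z\<bar> \<le> e" if r: "0 < r" "r < R" and z: "z \<in> ?S" for r z
  proof (cases "\<bar>z\<bar> \<le> r")
    case True
    have "\<bar>(deriv ^^ i) (\<lambda>z. (r powr 0 * plateau (z / r)) * B z) z\<bar> \<le> C * r powr (0 + (real k + 1) - real i)"
      by (rule C) (use True r in \<open>auto simp: R_def\<close>)
    also have "\<dots> \<le> \<bar>C\<bar> * r powr 1"
    proof (intro mult_mono)
      show "r powr (0 + (real k + 1) - real i) \<le> r powr 1"
        by (rule powr_mono') (use i r r0 in \<open>auto simp: R_def\<close>)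
    qed auto
    also have "\<dots> \<le> (\<bar>C\<bar> + 1) * r" using r by (simp add: distrib_right)
    also have "\<dots> \<le> e" proof -
      have "r \<le> e / (\<bar>C\<bar> + 1)" "\<bar>C\<bar> + 1 > 0" using r by (auto simp: R_def)
      then show ?thesis by (simp add: pos_le_divide_eq mult.commute)
    qed
    finally show ?thesis using r by simp
  next
    case False
    let ?V = "?S \<inter> {z. r < \<bar>z\<bar>}"
    have "open ?V" by (intro open_Int S open_Collect_less continuous_intros)
    then have "(deriv ^^ i) (\<lambda>z. plateau (z / r) * B z) z = (deriv ^^ i) (\<lambda>z. 0) z"
      by (rule derivs_cong) (use False z r in \<open>auto intro!: plateau_0 simp: le_divide_eq\<close>)
    also have "\<dots> = 0" using derivs_const[of _ 0] by (cases i) (auto simp del: funpow.simps(2))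
    finally show ?thesis using e by simp
  qed
  then show "\<forall>\<^sub>F r in at_right 0. \<forall>z\<in>?S. \<bar>(deriv ^^ i) (\<lambda>z. plateau (z / r) * B z) z\<bar> \<le> e"
    using R by (intro eventually_at_rightI[of 0 R]) auto
qed

text \<open>One \<open>\<eta>\<close> must serve all coefficients of modulus at most 1, because the
  fields share a common vertical profile.\<close>

lemma multiple_small:
  assumes h: "\<And>m. Ck_on m h (UNIV :: real set)" and e: "e > 0"
  shows "\<exists>\<eta>>0. \<forall>i\<le>k. \<forall>c. \<bar>c\<bar> \<le> 1 \<longrightarrow> (\<forall>z\<in>{-\<epsilon><..<\<epsilon>}. \<bar>(deriv ^^ i) (\<lambda>z. (\<eta> * c) * h z) z\<bar> \<le> e)"
proof -
  have D: "Ck_on m ((deriv ^^ i) h) UNIV" for m i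
  proof (induction i arbitrary: m)
    case (Suc i) show ?case using Ck_deriv(1)[OF open_UNIV Suc[of "Suc m"]] by simp
  qed (simp add: h)
  have "\<exists>K. \<forall>z\<in>{-\<epsilon>..\<epsilon>}. \<bar>(deriv ^^ i) h z\<bar> \<le> K" for i
  proof -
    have "continuous_on {-\<epsilon>..\<epsilon>} ((deriv ^^ i) h)" using D[of 0 i] continuous_on_subset by auto
    then have "bounded ((deriv ^^ i) h ` {-\<epsilon>..\<epsilon>})" by (intro compact_imp_bounded compact_continuous_image) auto
    then show ?thesis unfolding bounded_iff by (metis image_eqI real_norm_def)
  qed
  then obtain K where K: "\<And>i z. z \<in> {-\<epsilon>..\<epsilon>} \<Longrightarrow> \<bar>(deriv ^^ i) h z\<bar> \<le> K i" by metis
  define K' where "K' = (\<Sum>i\<le>k. \<bar>K i\<bar>) + 1"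
  have K'0: "K' > 0" by (simp add: K'_def sum_nonneg add_nonneg_pos)
  have K': "\<bar>(deriv ^^ i) h z\<bar> \<le> K'" if "i \<le> k" "z \<in> {-\<epsilon><..<\<epsilon>}" for i z
  proof -
    have "\<bar>(deriv ^^ i) h z\<bar> \<le> K i" by (rule K) (use that in auto)
    also have "\<dots> \<le> \<bar>K i\<bar>" by simp
    also have "\<dots> \<le> (\<Sum>i\<le>k. \<bar>K i\<bar>)" by (rule member_le_sum) (use that in auto)
    finally show ?thesis by (simp add: K'_def)
  qed
  have "\<bar>(deriv ^^ i) (\<lambda>z. (e / K' * c) * h z) z\<bar> \<le> e" if "i \<le> k" "\<bar>c\<bar> \<le> 1" "z \<in> {-\<epsilon><..<\<epsilon>}" for i c z
  proof -
    have "(deriv ^^ i) (\<lambda>z. (e / K' * c) * h z) z = (e / K' * c) * (deriv ^^ i) h z"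
      using derivs_linear[OF open_UNIV UNIV_I h h, where a="e / K' * c" and b=0] by simp
    also have "\<bar>\<dots>\<bar> = (e / K') * (\<bar>c\<bar> * \<bar>(deriv ^^ i) h z\<bar>)" using e K'0 by (simp add: abs_mult)
    also have "\<dots> \<le> (e / K') * (1 * K')" using e K'0 that K'[OF that(1,3)] by (intro mult_left_mono mult_mono) auto
    finally show ?thesis using K'0 by simp
  qed
  then show ?thesis using e K'0 by (intro exI[of _ "e / K'"]) auto
qed

section \<open>Orbits that climb towards a fixed height\<close>

locale escaping =
  fixes L :: "(real^'n) set" and \<epsilon> \<rho> :: real and G :: "'n \<Rightarrow> real \<Rightarrow> (real^'n) \<times> real" and \<kappa> :: "'n \<Rightarrow> real" and X :: "'n \<Rightarrow> 'n vfield"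
  assumes \<rho>: "0 < \<rho>" "\<rho> < \<epsilon>"
    and X: "X j p = G j (snd p)"
    and sndG: "snd (G j z) = \<kappa> j * flat_exp 0 (\<rho>\<^sup>2 - z\<^sup>2)"
    and contG: "continuous_on {-\<epsilon><..<\<epsilon>} (\<lambda>z. fst (G j z))"
begin

text \<open>Along the curve w = \<rho>^2 - z^2 satisfies |w'| <= C |w|, by the last bound of
  \<open>flat_exp_0\<close>. If w reached 0, it would vanish at time 0 as well.\<close>

lemma trapped_step:
  assumes "integral_curve_step L \<epsilon> (X j) q s" "\<bar>snd q\<bar> < \<rho>" shows "\<bar>snd s\<bar> < \<rho>"
proof (rule ccontr)
  assume n: "\<not> \<bar>snd s\<bar> < \<rho>"
  obtain T c where c: "\<And>t. t \<in> closed_segment 0 T \<Longrightarrow> c t \<in> M_cover \<epsilon>"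
    "\<And>t. t \<in> closed_segment 0 T \<Longrightarrow> (c has_vector_derivative X j (M_proj L (c t))) (at t within closed_segment 0 T)"
    "M_proj L (c 0) = q" "M_proj L (c T) = s"
    using assms(1) unfolding integral_curve_step_def by blast
  have sn: "snd (M_proj L p) = snd p" for p by (simp add: M_proj_def case_prod_beta)
  define w where "w t = \<rho>\<^sup>2 - (snd (c t))\<^sup>2" for t
  have wd: "(w has_real_derivative - (2 * snd (c t) * (\<kappa> j * flat_exp 0 (w t)))) (at t within closed_segment 0 T)" if "t \<in> closed_segment 0 T" for t
  proof -
    have "((\<lambda>t. snd (c t)) has_real_derivative \<kappa> j * flat_exp 0 (w t)) (at t within closed_segment 0 T)"
      using bounded_linear.has_vector_derivative[OF bounded_linear_snd c(2)[OF that]]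
      by (simp add: X sndG sn w_def has_real_derivative_iff_has_vector_derivative)
    then show ?thesis unfolding w_def[abs_def] by (auto intro!: derivative_eq_intros simp: w_def)
  qed
  have bd: "\<bar>- (2 * snd (c t) * (\<kappa> j * flat_exp 0 (w t)))\<bar> \<le> (2 * \<epsilon> * \<bar>\<kappa> j\<bar>) * \<bar>w t\<bar>" if "t \<in> closed_segment 0 T" for t
  proof -
    have "\<bar>snd (c t)\<bar> \<le> \<epsilon>" using c(1)[OF that] by (auto simp: M_cover_def mem_Times_iff abs_le_iff)
    then have "(2 * \<bar>snd (c t)\<bar>) * (\<bar>\<kappa> j\<bar> * \<bar>flat_exp 0 (w t)\<bar>) \<le> (2 * \<epsilon>) * (\<bar>\<kappa> j\<bar> * \<bar>w t\<bar>)"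
      using flat_exp_0(4) by (intro mult_mono) auto
    then show ?thesis by (simp add: abs_mult mult.assoc)
  qed
  have gw: "w t = 0" if "t0 \<in> closed_segment 0 T" "w t0 = 0" "t \<in> closed_segment 0 T" for t0 t
    by (rule gronwall_zero[where g=w and T=T and C="2 * \<epsilon> * \<bar>\<kappa> j\<bar>"]) (fact wd bd that)+
  have w0: "w 0 > 0" using power_strict_mono[OF assms(2), of 2] by (simp add: w_def c(3)[symmetric] sn)
  have wT: "w T \<le> 0" using power_mono[of \<rho> "\<bar>snd s\<bar>" 2] n \<rho>(1) by (simp add: w_def c(4)[symmetric] sn)
  have "continuous_on (closed_segment 0 T) w" using wd by (rule DERIV_continuous_on)
  then have "connected (w ` closed_segment 0 T)" by (intro connected_continuous_image) auto
  then have "{w T..w 0} \<subseteq> w ` closed_segment 0 T" by (intro connected_contains_Icc) auto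
  then obtain t0 where "t0 \<in> closed_segment 0 T" "w t0 = 0" using w0 wT by force
  from gw[OF this, of 0] w0 show False by simp
qed

lemma trapped: assumes "q \<in> orbit L \<epsilon> X p" "\<bar>snd p\<bar> < \<rho>" shows "\<bar>snd q\<bar> < \<rho>"
proof -
  have "(\<lambda>r s. \<exists>j. integral_curve_step L \<epsilon> (X j) r s)\<^sup>*\<^sup>* p q" using assms(1) by (simp add: orbit_def)
  then show ?thesis by induction (use assms(2) trapped_step in auto)
qed

text \<open>Separation of variables: F is the time needed to reach a height, obtained by integrating
  the reciprocal speed f; its inverse Z is the height as a function of time, and Y integrates the
  horizontal velocity with respect to height. For negative \<open>\<kappa> j\<close> the time T is
  negative, which a step permits.\<close>

lemma climb:
  assumes k: "\<kappa> j \<noteq> 0" and m: "\<bar>m\<bar> < \<rho>" "\<bar>m'\<bar> < \<rho>" "m \<le> m'"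
  shows "\<exists>v. integral_curve_step L \<epsilon> (X j) (torus_proj L y, m) (v, m')"
proof -
  obtain b where b: "b < \<rho>" "\<bar>m\<bar> < b" "\<bar>m'\<bar> < b" using dense[of "max \<bar>m\<bar> \<bar>m'\<bar>" \<rho>] m by auto
  then have b: "b < \<rho>" "-b < m" "m' < b" "-b < b" by linarith+
  define f where "f z = inverse (\<kappa> j * flat_exp 0 (\<rho>\<^sup>2 - z\<^sup>2))" for z
  have pos: "\<kappa> j * flat_exp 0 (\<rho>\<^sup>2 - z\<^sup>2) \<noteq> 0" if "z \<in> {-b..b}" for z
  proof -
    have "z\<^sup>2 < \<rho>\<^sup>2" using that b power_strict_mono[of "\<bar>z\<bar>" \<rho> 2] by auto
    then show ?thesis using k flat_exp_0(1)[of "\<rho>\<^sup>2 - z\<^sup>2"] by simp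
  qed
  have cf: "continuous_on {-b..b} f" unfolding f_def
  proof (intro continuous_on_inverse continuous_on_mult continuous_on_const ballI pos)
    show "continuous_on {-b..b} (\<lambda>z. flat_exp 0 (\<rho>\<^sup>2 - z\<^sup>2))"
      by (rule continuous_on_compose2[OF flat_exp_Ck[of 0 0, unfolded Ck_on.simps] _ subset_UNIV]) (intro continuous_intros)
  qed
  define F where "F z = integral {-b..z} f" for z
  define Y where "Y z = integral {-b..z} (\<lambda>z. f z *\<^sub>R fst (G j z))" for z
  have F: "(F has_real_derivative f z) (at z)" if "z \<in> {-b<..<b}" for z
    unfolding F_def using integral_has_real_derivative[OF cf, of z] that
    by (simp add: at_within_Icc_at)
  have cG: "continuous_on {-b..b} (\<lambda>z. fst (G j z))" by (rule continuous_on_subset[OF contG]) (use b \<rho> in auto)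
  have Y: "(Y has_vector_derivative f z *\<^sub>R fst (G j z)) (at z)" if "z \<in> {-b<..<b}" for z
    unfolding Y_def using integral_has_vector_derivative[OF continuous_on_scaleR[OF cf cG], of z] that
    by (simp add: at_within_Icc_at)
  have fnz: "f z \<noteq> 0" if "z \<in> {-b<..<b}" for z using pos[of z] that by (simp add: f_def)
  have inj: "inj_on F {-b<..<b}"
  proof (rule linorder_inj_onI')
    fix x y assume h: "x \<in> {-b<..<b}" "y \<in> {-b<..<b}" "x < y"
    obtain z where "x < z" "z < y" "F y - F x = (y - x) * f z" using MVT2[OF h(3), of F f] F h by auto
    then show "F x \<noteq> F y" using fnz[of z] h by auto
  qed
  define Z where "Z = inv_into {-b<..<b} F"
  have ZF: "Z (F z) = z" if "z \<in> {-b<..<b}" for z unfolding Z_def by (rule inv_into_f_f[OF inj that])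
  have cF: "continuous_on {-b<..<b} F" using F by (intro continuous_at_imp_continuous_on) (blast intro: DERIV_isCont)
  have Z: "(Z has_real_derivative inverse (f z)) (at (F z))" if "z \<in> {-b<..<b}" for z
    using fnz[OF that] unfolding has_field_derivative_def
    by (intro has_derivative_inverse_strong[OF open_greaterThanLessThan that cF ZF F[OF that, unfolded has_field_derivative_def]]) auto
  define T where "T = F m' - F m"
  have seg: "\<exists>z\<in>{-b<..<b}. t + F m = F z" if t: "t \<in> closed_segment 0 T" for t
  proof -
    have "convex (F ` {-b<..<b})" using connected_continuous_image[OF cF] by (simp add: is_interval_connected_1[symmetric] is_interval_convex_1)
    moreover have "F m \<in> F ` {-b<..<b}" "F m' \<in> F ` {-b<..<b}" using b m(3) by auto
    ultimately have "closed_segment (F m) (F m') \<subseteq> F ` {-b<..<b}" by (intro closed_segment_subset) auto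
    moreover have "t + F m \<in> closed_segment (F m) (F m')"
      using t by (auto simp: T_def closed_segment_eq_real_ivl split: if_splits)
    ultimately show ?thesis by auto
  qed
  define c where "c t = (y + (Y (Z (t + F m)) - Y m), Z (t + F m))" for t
  have mI: "m \<in> {-b<..<b}" "m' \<in> {-b<..<b}" using b m(3) by auto
  show ?thesis
    unfolding integral_curve_step_def
  proof (intro exI[of _ "torus_proj L (fst (c T))"] exI[of _ T] exI[of _ c] conjI ballI)
    fix t assume "t \<in> closed_segment 0 T"
    then obtain z where z: "z \<in> {-b<..<b}" "t + F m = F z" using seg by blast
    show "c t \<in> M_cover \<epsilon>" using z ZF[OF z(1)] b \<rho> by (auto simp: c_def M_cover_def)
    have dF: "((\<lambda>t. t + F m) has_real_derivative 1) (at t)" by (auto intro!: derivative_eq_intros)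
    have dZ: "((\<lambda>t. Z (t + F m)) has_real_derivative inverse (f z)) (at t)"
      using DERIV_chain2[where f=Z and g="\<lambda>t. t + F m" and x=t, OF _ dF] Z[OF z(1)] z(2) by simp
    have Yz: "(Y has_vector_derivative f z *\<^sub>R fst (G j z)) (at (Z (t + F m)))" using Y[OF z(1)] by (simp add: z(2) ZF[OF z(1)])
    have "((\<lambda>t. Y (Z (t + F m))) has_vector_derivative inverse (f z) *\<^sub>R (f z *\<^sub>R fst (G j z))) (at t)"
      using vector_diff_chain_at[OF dZ[unfolded has_real_derivative_iff_has_vector_derivative] Yz] by (simp add: comp_def)
    then have dY: "((\<lambda>t. y + (Y (Z (t + F m)) - Y m)) has_vector_derivative fst (G j z)) (at t)"
      using fnz[OF z(1)] by (auto intro!: derivative_eq_intros)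
    have "inverse (f z) = snd (G j z)" by (simp add: f_def sndG)
    then have "(c has_vector_derivative (fst (G j z), snd (G j z))) (at t)"
      unfolding c_def[abs_def] using dY dZ by (intro has_vector_derivative_Pair) (auto simp: has_real_derivative_iff_has_vector_derivative)
    then show "(c has_vector_derivative X j (M_proj L (c t))) (at t within closed_segment 0 T)"
      using ZF[OF z(1)] by (simp add: X M_proj_def c_def z(2) has_vector_derivative_at_within)
  next
    show "M_proj L (c 0) = (torus_proj L y, m)" using ZF[OF mI(1)] by (simp add: c_def M_proj_def)
    show "M_proj L (c T) = (torus_proj L (fst (c T)), m')" using ZF[OF mI(2)] by (simp add: c_def M_proj_def T_def)
  qed
qed

text \<open>A compact orbit would contain a point of maximal height. That height is below
  \<open>\<rho>\<close>, so the j-th field carries the point strictly higher within the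
  orbit.\<close>

lemma noncompact_orbit:
  assumes k: "\<kappa> j \<noteq> 0" and p: "p \<in> torus L \<times> {0}"
  shows "\<not> compactin (M_topology L \<epsilon>) (orbit L \<epsilon> X p)"
proof
  let ?O = "orbit L \<epsilon> X p"
  assume C: "compactin (M_topology L \<epsilon>) ?O"
  have "compactin (top_of_set {-\<epsilon><..<\<epsilon>}) (snd ` ?O)"
    using image_compactin[OF C[unfolded M_topology_def] continuous_map_snd] .
  then have "compact (snd ` ?O)" by (simp add: compactin_subtopology)
  moreover have pO: "p \<in> ?O" by (simp add: orbit_def)
  ultimately obtain q where q: "q \<in> ?O" "\<And>s. s \<in> ?O \<Longrightarrow> snd s \<le> snd q"
    using compact_attains_sup[of "snd ` ?O"] by (metis (no_types, lifting) empty_iff image_iff imageI)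
  have qr: "\<bar>snd q\<bar> < \<rho>" by (rule trapped[OF q(1)]) (use p \<rho> in auto)
  have "q \<in> topspace (M_topology L \<epsilon>)" using compactin_subset_topspace[OF C] q(1) by blast
  then have "fst q \<in> range (torus_proj L)"
    by (auto simp: M_topology_def topspace_torus_topology torus_proj_image)
  then obtain y where y: "q = (torus_proj L y, snd q)" by (metis imageE prod.collapse)
  define m' where "m' = (snd q + \<rho>) / 2"
  have m': "snd q < m'" "\<bar>m'\<bar> < \<rho>" using qr by (auto simp: m'_def)
  obtain v where "integral_curve_step L \<epsilon> (X j) q (v, m')" using climb[OF k qr m'(2), of y] y m'(1) by auto
  then have "(v, m') \<in> ?O" using q(1) unfolding orbit_def by (auto intro: rtranclp.rtrancl_into_rtrancl)
  from q(2)[OF this] m'(1) show False by simp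
qed

end

section \<open>Construction of the perturbation\<close>

lemma hyperplane_normal:
  fixes D :: "(real^'n) set"
  assumes "subspace D" "dim D + 1 = CARD('n)"
  shows "\<exists>u. norm u = 1 \<and> D = {w. u \<bullet> w = 0}"
proof -
  have "dim D < DIM(real^'n)" using assms(2) by simp
  then obtain a where a: "a \<noteq> 0" "span D \<subseteq> {w. a \<bullet> w = 0}" using lowdim_subset_hyperplane by blast
  have "dim {w. a \<bullet> w = 0} = dim D" using dim_hyperplane[OF a(1)] assms(2) by simp
  then have "D = {w. a \<bullet> w = 0}"
    by (intro subspace_dim_equal assms(1) subspace_hyperplane) (use a(2) span_superset in auto)
  then have "norm (a /\<^sub>R norm a) = 1 \<and> D = {w. (a /\<^sub>R norm a) \<bullet> w = 0}" using a(1) by simp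
  then show ?thesis by blast
qed

theorem flat_imp_homogeneous:
  fixes k :: nat and \<epsilon> :: real and L :: "(real^'n) set" and A :: "real \<Rightarrow> real^'n^'n" and D' :: "(real^'n) set"
  assumes \<epsilon>: "\<epsilon> > 0" and A: "smooth_on A {-\<epsilon><..<\<epsilon>}"
    and D': "subspace D'" "dim D' + 1 = CARD('n)" "\<And>w j. w \<in> D' \<Longrightarrow> 1 \<le> j \<Longrightarrow> j \<le> k \<Longrightarrow> nth_vector_derivative j A 0 *v w = 0"
    and \<delta>: "0 < \<delta>" "\<delta> < \<epsilon> / 2"
  shows "\<exists>X'. close_commuting_family L \<epsilon> k (horizontal_family A) \<delta> X' \<and> homogeneous_family L \<epsilon> X' \<and>
            (\<forall>j. \<forall>p \<in> M_set L \<epsilon> - torus L \<times> {-\<delta><..<\<delta>}. X' j p = horizontal_family A j p) \<and>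
            (\<forall>p \<in> torus L \<times> {0}. \<not> compactin (M_topology L \<epsilon>) (orbit L \<epsilon> X' p))"
proof -
  let ?S = "{-\<epsilon><..<\<epsilon>}"
  have S: "open ?S" "0 \<in> ?S" using \<epsilon> by auto
  obtain u where u: "norm u = 1" "D' = {w. u \<bullet> w = 0}" using hyperplane_normal[OF D'(1,2)] by blast
  have u1: "\<bar>u $ j\<bar> \<le> 1" for j using component_le_norm_cart[of u j] u(1) by simp
  have "u \<noteq> 0" using u(1) by auto
  then obtain j0 where j0: "u $ j0 \<noteq> 0" by (auto simp: vec_eq_iff)
  have ACk: "Ck_on m A ?S" for m using A by (simp add: smooth_on_def)
  have entry: "Ck_on m (\<lambda>s. A s $ i $ j) ?S" for m i j by (intro Ck_on_nth S ACk)
  \<comment> \<open>The j-th column of the orthogonal projection onto D'.\<close>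
  define v where "v j = axis j 1 - u $ j *\<^sub>R u" for j
  have vD: "v j \<in> D'" for j
    using u(1) by (simp add: v_def u(2) inner_diff_right inner_axis power2_norm_eq_inner[symmetric])
  \<comment> \<open>Subtracting the value at 0 supplies flatness of order 0, as the hypothesis on D'
    begins with the first derivative.\<close>
  define B where "B i j z = (A z *v v j) $ i - (A 0 *v v j) $ i" for i j z
  have Bsum: "(A z *v v j) $ i = (\<Sum>q\<in>UNIV. v j $ q * A z $ i $ q)" for i j z
    by (simp add: matrix_vector_mult_def mult.commute)
  have BCk: "Ck_on m (B i j) ?S" for m i j
    unfolding B_def[abs_def] Bsum by (intro Ck_on_diff Ck_on_sum Ck_on_mult Ck_on_const entry S)
  have Bflat: "flat k (B i j)" for i j
    unfolding flat_def
  proof (intro allI impI)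
    fix m assume m: "m \<le> k"
    show "(deriv ^^ m) (B i j) 0 = 0"
    proof (cases "m = 0")
      case False
      have "(deriv ^^ m) (B i j) 0 = (deriv ^^ m) (\<lambda>z. \<Sum>q\<in>UNIV. v j $ q * A z $ i $ q) 0 - (deriv ^^ m) (\<lambda>z. (A 0 *v v j) $ i) 0"
        using derivs_linear[OF S Ck_on_sum[OF S(1) Ck_on_mult[OF S(1) Ck_on_const[OF S(1)] entry]] Ck_on_const[OF S(1)], where a=1 and b="-1"]
        unfolding B_def[abs_def] Bsum by simp
      also have "(deriv ^^ m) (\<lambda>z. (A 0 *v v j) $ i) 0 = 0" using False derivs_const by (cases m) (auto simp del: funpow.simps)
      also have "(deriv ^^ m) (\<lambda>z. \<Sum>q\<in>UNIV. v j $ q * A z $ i $ q) 0 = (\<Sum>q\<in>UNIV. v j $ q * (deriv ^^ m) (\<lambda>z. A z $ i $ q) 0)"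
        by (rule derivs_sum[OF S finite entry])
      also have "\<dots> = (nth_vector_derivative m A 0 *v v j) $ i"
        by (simp add: matrix_vector_mult_def nth_vector_derivative_entry[OF S ACk] mult.commute)
      also have "\<dots> = 0" using D'(3)[OF vD, of m j] False m by simp
      finally show ?thesis by simp
    qed (simp add: B_def)
  qed
  have decomp: "A z $ i $ j - B i j z = (A 0 *v v j) $ i + u $ j * (A z *v u) $ i" for i j z
    by (simp add: B_def v_def matrix_vector_mult_diff_distrib matrix_vector_mult_scaleR matrix_vector_mult_basis column_def)
  \<comment> \<open>The norm is a supremum, so the pointwise bounds must stay strictly below
    \<open>\<delta>\<close>. The horizontal and vertical corrections occupy different components,
    hence e is spent on each and not shared.\<close>
  define e where "e = \<delta> / 2"
  have e: "e > 0" "e < \<delta>" using \<delta> by (auto simp: e_def)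
  have "\<forall>\<^sub>F r in at_right 0. \<forall>i j. \<forall>m\<in>{..k}. \<forall>z\<in>?S. \<bar>(deriv ^^ m) (\<lambda>z. plateau (z / r) * B i j z) z\<bar> \<le> e"
    by (intro eventually_all_finite cutoff_small \<epsilon> BCk Bflat e)
  moreover have "\<forall>\<^sub>F r in at_right 0. r < \<delta>" using eventually_at_right_real[OF \<delta>(1)] by (rule eventually_mono) auto
  moreover have "\<forall>\<^sub>F r in at_right (0::real). 0 < r" by (rule eventually_at_right_less)
  ultimately have "\<forall>\<^sub>F r in at_right 0. 0 < r \<and> r < \<delta> \<and> (\<forall>i j. \<forall>m\<in>{..k}. \<forall>z\<in>?S. \<bar>(deriv ^^ m) (\<lambda>z. plateau (z / r) * B i j z) z\<bar> \<le> e)"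
    by (intro eventually_conj)
  then obtain r where "0 < r \<and> r < \<delta> \<and> (\<forall>i j. \<forall>m\<in>{..k}. \<forall>z\<in>?S. \<bar>(deriv ^^ m) (\<lambda>z. plateau (z / r) * B i j z) z\<bar> \<le> e)"
    using eventually_happens'[OF trivial_limit_at_right_real] by blast
  then have r: "0 < r" "r < \<delta>" and rB: "\<And>i j m z. m \<le> k \<Longrightarrow> z \<in> ?S \<Longrightarrow> \<bar>(deriv ^^ m) (\<lambda>z. plateau (z / r) * B i j z) z\<bar> \<le> e"
    by blast+
  \<comment> \<open>Supported where the cutoff equals 1, so that vertical motion occurs only where
    all fields have the same varying part up to the factors \<open>u $ j\<close>.\<close>
  define h where "h z = flat_exp 0 ((r / 2)\<^sup>2 - z\<^sup>2)" for z
  have qCk: "Ck_on m (\<lambda>z::real. (r / 2)\<^sup>2 - z\<^sup>2) UNIV" for m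
    unfolding power2_eq_square by (intro Ck_on_diff Ck_on_const Ck_on_mult Ck_on_linear bounded_linear_ident open_UNIV)
  have hCk: "Ck_on m h UNIV" for m
    unfolding h_def[abs_def] by (rule Ck_on_compose[OF open_UNIV subset_UNIV flat_exp_Ck qCk])
  obtain \<eta> where \<eta>: "\<eta> > 0" "\<And>m c z. m \<le> k \<Longrightarrow> \<bar>c\<bar> \<le> 1 \<Longrightarrow> z \<in> ?S \<Longrightarrow> \<bar>(deriv ^^ m) (\<lambda>z. (\<eta> * c) * h z) z\<bar> \<le> e"
    using multiple_small[OF hCk e(1), of k \<epsilon>] by blast
  define N where "N j z = ((\<chi> i. - (plateau (z / r) * B i j z)) :: real^'n, (\<eta> * u $ j) * h z)" for j z
  define G where "G j z = (\<chi> i. A z $ i $ j, 0) + N j z" for j z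
  define X where "X j p = G j (snd p)" for j and p :: "(real^'n) set \<times> real"
  have pCk: "Ck_on m (\<lambda>z. plateau (z / r)) ?S" for m
    by (rule Ck_on_compose[OF S(1) subset_UNIV plateau_Ck Ck_on_linear[OF S(1) bounded_linear_divide]])
  have hS: "Ck_on m h ?S" for m by (rule Ck_on_subset[OF hCk subset_UNIV])
  have pBCk: "Ck_on m (\<lambda>z. plateau (z / r) * B i j z) ?S" for m i j by (intro Ck_on_mult S pCk BCk)
  have ehCk: "Ck_on m (\<lambda>z. (\<eta> * u $ j) * h z) ?S" for m j by (intro Ck_on_mult S Ck_on_const hS)
  have basis: "(\<exists>i. b = (axis i 1, 0)) \<or> b = (0, 1)" if "b \<in> Basis" for b :: "(real^'n) \<times> real"
    using that by (auto simp: Basis_prod_def Basis_vec_def)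
  have Ninner: "(\<exists>i. (\<lambda>z. N j z \<bullet> b) = (\<lambda>z. - (plateau (z / r) * B i j z))) \<or> (\<lambda>z. N j z \<bullet> b) = (\<lambda>z. (\<eta> * u $ j) * h z)" if "b \<in> Basis" for b j
    using basis[OF that] by (auto simp: N_def inner_axis)
  have NCk: "Ck_on m (\<lambda>z. N j z \<bullet> b) ?S" if "b \<in> Basis" for m j b
    using Ninner[OF that, of j] Ck_on_uminus[OF S(1) pBCk] ehCk by auto
  have bound: "\<bar>(deriv ^^ m) (\<lambda>z. N j z \<bullet> b) z\<bar> \<le> e" if "b \<in> Basis" "m \<le> k" "z \<in> ?S" for m j b z
    using Ninner[OF that(1), of j]
  proof (elim disjE exE)
    fix i assume eq: "(\<lambda>z. N j z \<bullet> b) = (\<lambda>z. - (plateau (z / r) * B i j z))"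
    have "(deriv ^^ m) (\<lambda>z. - (plateau (z / r) * B i j z)) z = - (deriv ^^ m) (\<lambda>z. plateau (z / r) * B i j z) z"
      using derivs_linear[OF S(1) that(3) pBCk pBCk, where a="-1" and b=0] by simp
    then show ?thesis unfolding eq using rB[OF that(2,3), of i j] by simp
  next
    assume eq: "(\<lambda>z. N j z \<bullet> b) = (\<lambda>z. (\<eta> * u $ j) * h z)"
    show ?thesis unfolding eq by (rule \<eta>(2)[OF that(2) u1 that(3)])
  qed
  have GCk: "Ck_on m (G j) ?S" for m j
  proof (rule Ck_on_components[OF S(1)])
    fix b :: "(real^'n) \<times> real" assume b: "b \<in> Basis"
    have "Ck_on m (\<lambda>z. ((\<chi> i. A z $ i $ j, 0) :: (real^'n) \<times> real) \<bullet> b) ?S"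
      using basis[OF b] entry Ck_on_const[OF S(1)] by (auto simp: inner_axis)
    from Ck_on_add[OF S(1) this NCk[OF b]] show "Ck_on m (\<lambda>z. G j z \<bullet> b) ?S" by (simp add: G_def inner_add_left)
  qed
  have XM: "X j \<circ> M_proj L = (\<lambda>q. G j (snd q))" for j by (auto simp: X_def M_proj_def)
  have sndG: "snd (G j z) = (\<eta> * u $ j) * h z" for j z by (simp add: G_def N_def)
  have "close_commuting_family L \<epsilon> k (horizontal_family A) \<delta> X"
    unfolding close_commuting_family_def
  proof (intro conjI allI)
    show "smooth_vfield L \<epsilon> (X j)" for j unfolding smooth_vfield_def smooth_on_def XM using snd_Ck[OF GCk] by blast
    have "(\<lambda>p. X j p - horizontal_family A j p) = (\<lambda>p. N j (snd p))" for j by (auto simp: X_def G_def horizontal_family_def)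
    then show "Ck_norm L \<epsilon> k (\<lambda>p. X j p - horizontal_family A j p) < ereal \<delta>" for j
      using Ck_norm_le[of "N j" \<epsilon> e k L, OF NCk _ bound] e by (auto intro: order.strict_trans1)
    show "vfields_commute L \<epsilon> (X i) (X j)" for i j
      unfolding vfields_commute_def XM
    proof
      fix p :: "(real^'n) \<times> real" assume "p \<in> M_cover \<epsilon>"
      then have p: "snd p \<in> ?S" by (auto simp: M_cover_def)
      define g where "g j = vector_derivative (G j) (at (snd p))" for j
      have gd: "(G j has_vector_derivative g j) (at (snd p))" for j
        unfolding g_def using Ck_on_real_deriv[OF GCk S(1) p] by simp
      have d: "((\<lambda>q. G j (snd q)) has_derivative (\<lambda>h. snd h *\<^sub>R g j)) (at p)" for j
        using has_derivative_compose[OF bounded_linear_imp_has_derivative[OF bounded_linear_snd] gd[of j, unfolded has_vector_derivative_def]] by simp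
      \<comment> \<open>For fields depending on z alone, only the vertical component of one field
        differentiates the other.\<close>
      have "lie_bracket (\<lambda>q. G i (snd q)) (\<lambda>q. G j (snd q)) p = snd (G i (snd p)) *\<^sub>R g j - snd (G j (snd p)) *\<^sub>R g i"
        unfolding lie_bracket_def frechet_derivative_at[OF d, symmetric] ..
      also have "\<dots> = 0"
      proof (cases "\<bar>snd p\<bar> < r / 2")
        case True
        \<comment> \<open>Where the cutoff is 1, each G j is a constant plus \<open>u $ j\<close>
          times K. Both terms of the bracket then equal \<open>\<eta> * u $ i * u $ j * h\<close>
          times the derivative of K.\<close>
        define K where "K z = (A z *v u, \<eta> * h z)" for z
        have KCk: "Ck_on m K ?S" for m
        proof (rule Ck_on_components[OF S(1)])
          fix b :: "(real^'n) \<times> real" assume b: "b \<in> Basis"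
          have 1: "Ck_on m (\<lambda>z. (A z *v u) $ i) ?S" for i
            unfolding matrix_vector_mult_def vec_lambda_beta by (intro Ck_on_sum Ck_on_mult S entry Ck_on_const)
          have 2: "Ck_on m (\<lambda>z. \<eta> * h z) ?S" by (intro Ck_on_mult Ck_on_const S hS)
          show "Ck_on m (\<lambda>z. K z \<bullet> b) ?S" using basis[OF b] 1 2 by (auto simp: K_def inner_axis)
        qed
        have gK: "g j = u $ j *\<^sub>R vector_derivative K (at (snd p))" for j
        proof -
          have "(K has_vector_derivative vector_derivative K (at (snd p))) (at (snd p))"
            using Ck_on_real_deriv[OF KCk S(1) p] by simp
          then have "((\<lambda>z. (A 0 *v v j, 0) + u $ j *\<^sub>R K z) has_vector_derivative u $ j *\<^sub>R vector_derivative K (at (snd p))) (at (snd p))"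
            by (auto intro!: derivative_eq_intros)
          then have "(G j has_vector_derivative u $ j *\<^sub>R vector_derivative K (at (snd p))) (at (snd p))"
          proof (rule has_vector_derivative_transform_within_open[where S="{-(r/2)<..<r/2}"])
            fix z assume z: "z \<in> {-(r/2)<..<r/2}"
            have "\<bar>z\<bar> \<le> r / 2" using z by auto
            then have "plateau (z / r) = 1" using r by (intro plateau_1) (simp add: divide_le_eq)
            then show "(A 0 *v v j, 0) + u $ j *\<^sub>R K z = G j z"
              using decomp[of z _ j] by (simp add: G_def N_def K_def vec_eq_iff)
          qed (use True in \<open>auto simp: abs_less_iff\<close>)
          then show ?thesis unfolding g_def by (rule vector_derivative_at)
        qed
        show ?thesis unfolding gK sndG by (simp add: mult_ac)
      next
        case False
        then have "(r / 2)\<^sup>2 \<le> (snd p)\<^sup>2" using r power_mono[of "r / 2" "\<bar>snd p\<bar>" 2] by simp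
        then have "h (snd p) = 0" unfolding h_def by (intro flat_exp_0) simp
        then show ?thesis by (simp add: sndG)
      qed
      finally show "lie_bracket (\<lambda>q. G i (snd q)) (\<lambda>q. G j (snd q)) p = 0" .
    qed
  qed
  moreover have "homogeneous_family L \<epsilon> X" unfolding homogeneous_family_def by (auto simp: X_def)
  moreover have "X j p = horizontal_family A j p" if "p \<in> M_set L \<epsilon> - torus L \<times> {-\<delta><..<\<delta>}" for j p
  proof -
    have "\<bar>snd p\<bar> \<ge> \<delta>" using that by (cases p) (auto simp: M_set_def)
    then have p: "\<bar>snd p\<bar> \<ge> r" "\<bar>snd p\<bar> \<ge> r / 2" using r by auto
    then have "(r / 2)\<^sup>2 \<le> (snd p)\<^sup>2" using r power_mono[of "r / 2" "\<bar>snd p\<bar>" 2] by simp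
    then have "h (snd p) = 0" unfolding h_def by (intro flat_exp_0) simp
    moreover have "plateau (snd p / r) = 0" using p r by (intro plateau_0) (simp add: le_divide_eq)
    ultimately show ?thesis by (simp add: X_def G_def N_def horizontal_family_def case_prod_beta vec_eq_iff prod_eq_iff)
  qed
  moreover have "\<not> compactin (M_topology L \<epsilon>) (orbit L \<epsilon> X p)" if "p \<in> torus L \<times> {0}" for p
  proof -
    interpret escaping L \<epsilon> "r / 2" G "\<lambda>j. \<eta> * u $ j" X
    proof
      show "continuous_on ?S (\<lambda>z. fst (G j z))" for j using GCk[of 0] by (intro continuous_on_fst) simp
    qed (use r \<delta> X_def sndG h_def in auto)
    show ?thesis by (rule noncompact_orbit[OF _ that]) (use j0 \<eta> in simp)
  qed
  ultimately show ?thesis by blast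
qed

lemma close_commuting_family_mono:
  "close_commuting_family L \<epsilon> k X \<delta> X' \<Longrightarrow> \<delta> \<le> \<delta>' \<Longrightarrow> close_commuting_family L \<epsilon> k X \<delta>' X'"
  unfolding close_commuting_family_def by (meson ereal_less_eq(3) order_less_le_trans)

theorem theorem1:
  fixes k :: nat and \<epsilon> :: real and L :: "(real^'n) set" and A :: "real \<Rightarrow> real^'n^'n"
  assumes "k \<ge> 1" and "\<epsilon> > 0" and "lattice_in L"
    and "smooth_on A {-\<epsilon><..<\<epsilon>}"
    and "\<And>z. z \<in> {-\<epsilon><..<\<epsilon>} \<Longrightarrow> invertible (A z)"
  shows "((\<exists>D' :: (real^'n) set. subspace D' \<and> dim D' + 1 = CARD('n) \<and>
             (\<forall>w\<in>D'. \<forall>j. 1 \<le> j \<and> j \<le> k \<longrightarrow> nth_vector_derivative j A 0 *v w = 0))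
          \<longleftrightarrow>
          (\<forall>\<delta>>0. \<exists>X'. close_commuting_family L \<epsilon> k (horizontal_family A) \<delta> X' \<and>
             (\<exists>p \<in> torus L \<times> {0}. \<not> compactin (M_topology L \<epsilon>) (orbit L \<epsilon> X' p))))
         \<and>
         ((\<forall>\<delta>>0. \<exists>X'. close_commuting_family L \<epsilon> k (horizontal_family A) \<delta> X' \<and>
             (\<exists>p \<in> torus L \<times> {0}. \<not> compactin (M_topology L \<epsilon>) (orbit L \<epsilon> X' p)))
          \<longleftrightarrow>
          (\<forall>\<delta>. 0 < \<delta> \<and> \<delta> < \<epsilon> / 2 \<longrightarrow>
             (\<exists>X'. close_commuting_family L \<epsilon> k (horizontal_family A) \<delta> X' \<and>
                homogeneous_family L \<epsilon> X' \<and>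
                (\<forall>j. \<forall>p \<in> M_set L \<epsilon> - torus L \<times> {-\<delta><..<\<delta>}.
                   X' j p = horizontal_family A j p) \<and>
                (\<forall>p \<in> torus L \<times> {0}. \<not> compactin (M_topology L \<epsilon>) (orbit L \<epsilon> X' p)))))"
    (is "(?flat \<longleftrightarrow> ?nc) \<and> (?nc \<longleftrightarrow> ?hom)")
proof -
  have 1: ?hom if ?flat
    using that flat_imp_homogeneous[OF assms(2,4), of _ k _ L] by (elim exE) auto
  have 2: ?nc if hom: ?hom
  proof (intro allI impI)
    fix \<delta> :: real assume \<delta>: "\<delta> > 0"
    \<comment> \<open>A third of \<open>\<epsilon>\<close> is a value strictly below the half up to
      which the third condition applies; closeness within a smaller tolerance implies the required
      one.\<close>
    define \<delta>' where "\<delta>' = min \<delta> (\<epsilon> / 3)"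
    have \<delta>': "0 < \<delta>'" "\<delta>' < \<epsilon> / 2" "\<delta>' \<le> \<delta>" using \<delta> assms(2) by (auto simp: \<delta>'_def)
    obtain X' where X': "close_commuting_family L \<epsilon> k (horizontal_family A) \<delta>' X'"
      "\<And>p. p \<in> torus L \<times> {0} \<Longrightarrow> \<not> compactin (M_topology L \<epsilon>) (orbit L \<epsilon> X' p)"
      using hom[rule_format, OF conjI[OF \<delta>'(1,2)]] by blast
    have "(torus_proj L 0, 0) \<in> torus L \<times> {0}" using torus_proj_image by blast
    then show "\<exists>X'. close_commuting_family L \<epsilon> k (horizontal_family A) \<delta> X' \<and>
             (\<exists>p \<in> torus L \<times> {0}. \<not> compactin (M_topology L \<epsilon>) (orbit L \<epsilon> X' p))"
      using X' close_commuting_family_mono[OF _ \<delta>'(3)] by blast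
  qed
  have 3: ?flat if ?nc by (rule noncompact_imp_flat[OF assms that])
  show ?thesis using 1 2 3 by argo
qed

end
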